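(* Let $\widetilde\theta(s)$ be the coefficient of $\epsilon$ in the series expansion of the Laplace transform $\widetilde w_\epsilon(s)$ of the queueing delay in the mixture model (the explicit expression is given in the context). Its Laplace inversion $\Theta(t)=\mathcal L^{-1}\{\widetilde\theta(s)\}$ (in tail form: $\widetilde\theta$ is the Laplace–Stieltjes transform of a signed measure on $[0,\infty)$ giving mass $\Theta(t)$ to $(t,\infty)$, $t\ge0$) equals $$\Theta(t)=\frac1{\mathbf u\boldsymbol\omega}\big(\Theta_1(t)+\Theta_2(t)\big),$$ where $$\begin{aligned} \Theta_1(t)=&\Big(\mathbf z\boldsymbol\omega-\sum_{k=2}^N\frac{\alpha_k}{s_k}\Big)\mathbb P(W>t)+\Big(\beta-\sum_{k=2}^N\frac{\beta_k}{s_k}\Big)\Big(\mu_p\mathbb P(W+B^e>t)-\mu_h\mathbb P(W+C^e>t)\Big)\\ &-\Big(\gamma-\sum_{k=2}^N\frac{\gamma_k}{s_k}\Big)\Big(\mu_p\mathbb P(W+W'+B^e>t)-\mu_h\mathbb P(W+W'+C^e>t)\Big)\\ &-\sum_{j=1}^{\sigma}\sum_{l=1}^{r_j}\Big[\gamma''_{j,l}\Big(\mu_p\mathbb P\big(W+W'+B^e+E_{r_j-l+1}(y_j)>t\big)-\mu_h\mathbb P\big(W+W'+C^e+E_{r_j-l+1}(y_j)>t\big)\Big)\\ &\qquad-\beta''_{j,l}\Big(\mu_p\mathbb P\big(W+B^e+E_{r_j-l+1}(y_j)>t\big)-\mu_h\mathbb P\big(W+C^e+E_{r_j-l+1}(y_j)>t\big)\Big)-\alpha''_{j,l}\mathbb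 P\big(W+E_{r_j-l+1}(y_j)>t\big)\Big],\\ \Theta_2(t)=&-\sum_{k=2}^N\frac1{s_k}\Big[\gamma_k\Big(\mu_p\mathbb P\big(t<W+W'+B^e<t+E(s_k)\big)-\mu_h\mathbb P\big(t<W+W'+C^e<t+E(s_k)\big)\Big)\\ &\qquad-\beta_k\Big(\mu_p\mathbb P\big(t<W+B^e<t+E(s_k)\big)-\mu_h\mathbb P\big(t<W+C^e<t+E(s_k)\big)\Big)-\alpha_k\mathbb P\big(t<W<t+E(s_k)\big)\Big], \end{aligned}$$ and $W'$ is independent of, and has the same distribution as, $W$.
   Context: Random variables. $W$ is the queueing delay in the replace base model (Laplace transform $\widetilde w(s)$); $B^e,C^e$ are generic stationary-excess phase-type and heavy-tailed service times (LSTs $\widetilde F_p^e,\widetilde F_h^e$); $E_k(\lambda)$ is an Erlang variable with $k$ phases and rate $\lambda$, $E(\lambda)=E_1(\lambda)$. All random variables appearing together are independent. All $s_k$ ($k\ge2$) and $y_j$ below are assumed real. Arrivals. Single-server FIFO queue with arrivals governed by a Markov process on $\mathcal N=\{1,\dots,N\}$ with intensity matrix $\mathbf D=\mathbf D^{(1)}+\mathbf D^{(2)}$. Entries $d^{(2)}_{ij}\ge0$ are rates of transitions accompanied by a real customer; off-diagonal entries $d^{(1)}_{ij}\ge0$ are rates of transitions without a real customer (a "dummy" customer with zero service time is said to arrive); $d^{(1)}_{ii}=-\sum_{k\ne i}d^{(1)}_{ik}-\sum_kd^{(2)}_{ik}$. Put $\lambda_i=\sum_{k\neq i}d^{(1)}_{ik}+\sum_{k}d^{(2)}_{ik}$,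 $p_{ij}=\big(d^{(1)}_{ij}(1-\delta_{ij})+d^{(2)}_{ij}\big)/\lambda_i$ ($\delta_{ij}$ Kronecker), and, if $p_{ij}>0$, $q^{(1)}_{ij}=d^{(1)}_{ij}(1-\delta_{ij})/(\lambda_ip_{ij})$, $q^{(2)}_{ij}=d^{(2)}_{ij}/(\lambda_ip_{ij})$ (both $0$ if $p_{ij}=0$). $\mathbf P=[p_{ij}]$ (transition matrix of the Markov chain embedded at arrivals of real and dummy customers) is irreducible with stationary row vector $\boldsymbol\pi$; $\mathbf\Lambda=\mathrm{diag}(\lambda_1,\dots,\lambda_N)$, $\mathbf Q^{(i)}=[q^{(i)}_{kl}]$; $\circ$ is the Hadamard product, and $\mathbf Q\circ\mathbf P\mathbf\Lambda$ means $\mathbf Q\circ(\mathbf P\mathbf\Lambda)$; $\mathbf e$ is the all-ones column vector, $\mathbf I$ the identity. An arriving customer at a transition from $i$ to $j$ is tagged $i$. Service times of real customers are i.i.d., independent of the arrival process. Replace base model: phase-type distribution $F_p$ with mean $\mu_p$ and LST $\widetilde F_p=q/p$, with $q,p$ polynomials without common roots, $p$ monic of degree $M$, $\deg q\le M-1$. Mixture model: $G_\epsilon=(1-\epsilon)F_p+\epsilon F_h$, with $F_h$ heavy-tailed of finite mean $\mu_h$ and LST $\widetilde F_h$. Stationary-excess LSTs: $\widetilde F^e_p(s)=(1-\widetilde F_p(s))/(\mu_ps)$, $\widetilde F^e_h(s)=(1-\widetilde F_h(s))/(\mu_hs)$. Both models are assumed stable: $\boldsymbol\pi(\mathbf\Lambda^{-1}-\mathbf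 M)\mathbf e>0$ with $\mathbf M=\mu_p\mathbf Q^{(2)}\circ\mathbf P$, and $\boldsymbol\pi(\mathbf\Lambda^{-1}-\mathbf M_\epsilon)\mathbf e>0$ with $\mathbf M_\epsilon=\mathbf M+\epsilon(\mu_h-\mu_p)\mathbf Q^{(2)}\circ\mathbf P$. Delay. In each model, let $V$ be the steady-state workload just before an arrival (real or dummy), $Z$ the steady-state tag, $\widetilde\phi_i(s)=\mathbb E(e^{-sV};Z=i)$, $\widetilde{\mathbf\Phi}=[\widetilde\phi_1,\dots,\widetilde\phi_N]$. The Laplace transform of the queueing delay of real customers is $\widetilde{\mathbf\Phi}(s)\boldsymbol\omega$, where $\boldsymbol\omega=\mathbf\Lambda^{-1}\mathbf D^{(2)}\mathbf e/(\boldsymbol\pi\mathbf\Lambda^{-1}\mathbf D^{(2)}\mathbf e)$; it is denoted $\widetilde w(s)$ in the base model and $\widetilde w_\epsilon(s)$ in the mixture model. Base-model quantities. $\mathbf E(s,g)=(\mathbf Q^{(1)}+g\mathbf Q^{(2)})\circ\mathbf P\mathbf\Lambda+s\mathbf I-\mathbf\Lambda$, $\mathbf E(s)=\mathbf E(s,\widetilde F_p(s))$, $\mathrm{adj}$ is the adjugate. $\det\mathbf E(s)=0$ has exactly $N$ solutions with non-negative real part, $s_1=0$ and $s_2,\dots,s_N$ with $\Re s_i>0$, assumed simple. For $i\ge2$ choose $m=m_i$ such that the $m$-th column of $\mathrm{adj}\,\mathbf E(s_i)$ is nonzero; $\mathbf a_i$ is that column and $\mathbf a_i^{(1)}$ is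 the derivative at $s=s_i$ of the $m$-th column of $\mathrm{adj}\,\mathbf E(s)$. The row vector $\mathbf u$ is the unique solution of $\mathbf u\mathbf\Lambda^{-1}\mathbf e=\boldsymbol\pi(\mathbf\Lambda^{-1}-\mathbf M)\mathbf e$, $\mathbf u\mathbf a_i=0$ ($i=2,\dots,N$); one has $\widetilde w(s)=s\mathbf u\,\mathrm{adj}(\mathbf E(s))\boldsymbol\omega/\det\mathbf E(s)$. Here $r$ is the highest power of $p$ occurring in the denominators of $\det\mathbf E(s)$ and the entries of $\mathrm{adj}\,\mathbf E(s)$, and $x_j,y_j$ ($\Re x_j,\Re y_j>0$, $j=1,\dots,rM$) are defined by $p^r\det\mathbf E(s)=s\prod_{k=2}^N(s-s_k)\prod_{j=1}^{rM}(s+x_j)$ and $p^rs\mathbf u\,\mathrm{adj}(\mathbf E(s))\boldsymbol\omega=\mathbf u\boldsymbol\omega\,s\prod_{k=2}^N(s-s_k)\prod_{j=1}^{rM}(s+y_j)$. The distinct numbers among the $-y_j$ are denoted $-y_1,\dots,-y_\sigma$, with multiplicities $r_1,\dots,r_\sigma$, $\sum_jr_j=rM$. The vector $\mathbf z$. $\mathbf K(s)=s(\mu_p\widetilde F_p^e(s)-\mu_h\widetilde F_h^e(s))\mathbf Q^{(2)}\circ\mathbf P\mathbf\Lambda$. Write $\mathbf X_{\bullet j}$ for the $j$-th column of $\mathbf X$, and $\mathbf X^{W}_{U}$ for the submatrix with rows $U$, columns $W$. For $i=2,\dots,N$, $$\delta_i=\frac{\sum_{j=1}^N\det(\mathbf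 E(s_i)_{\bullet1},\dots,\mathbf K(s_i)_{\bullet j},\dots,\mathbf E(s_i)_{\bullet N})}{\sum_{j=1}^N\det(\mathbf E(s_i)_{\bullet1},\dots,\mathbf E^{(1)}(s_i)_{\bullet j},\dots,\mathbf E(s_i)_{\bullet N})},\quad \mathbf E^{(1)}=\tfrac{d}{ds}\mathbf E,$$ and $\mathbf k_i$ is the column vector with entries $k_{i,j}=(-1)^{m+j}\sum_{k=1}^{N-1}\det\big((\mathbf E(s_i)^{\mathcal N\setminus\{j\}}_{\mathcal N\setminus\{m\}})_{\bullet1},\dots,(\mathbf K(s_i)^{\mathcal N\setminus\{j\}}_{\mathcal N\setminus\{m\}})_{\bullet k},\dots,(\mathbf E(s_i)^{\mathcal N\setminus\{j\}}_{\mathcal N\setminus\{m\}})_{\bullet N-1}\big)$. With $\mathbf A=(\mathbf\Lambda^{-1}\mathbf e,\mathbf a_2,\dots,\mathbf a_N)$, $\mathbf c=(\boldsymbol\pi(\mathbf\Lambda^{-1}-\mathbf M)\mathbf e,0,\dots,0)$, $\mathbf B=(\mathbf0,\delta_2\mathbf a_2^{(1)}-\mathbf k_2,\dots,\delta_N\mathbf a_N^{(1)}-\mathbf k_N)$, $\mathbf d=((\mu_p-\mu_h)\boldsymbol\pi(\mathbf Q^{(2)}\circ\mathbf P)\mathbf e,0,\dots,0)$, put $\mathbf z=(\mathbf c\mathbf A^{-1}\mathbf B+\mathbf d)\mathbf A^{-1}$. Coefficients. Let $\Delta(s)=\prod_{k=2}^N(s-s_k)\prod_{j=1}^\sigma(s+y_j)^{r_j}$,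 $X_A(s)=p(s)^r\,\mathbf z\,\mathrm{adj}(\mathbf E(s))\boldsymbol\omega$, $X_B(s)=s\,p(s)^r\,\partial_g[\mathbf u\,\mathrm{adj}(\mathbf E(s,g))\boldsymbol\omega]_{g=\widetilde F_p(s)}$, $X_C(s)=p(s)^r\,\partial_g[\det\mathbf E(s,g)]_{g=\widetilde F_p(s)}$. The coefficients are those of the partial fraction decompositions $\frac{X_A}{\Delta}=\mathbf z\boldsymbol\omega+\sum_{k}\frac{\alpha_k}{s-s_k}+\sum_{j,l}\frac{\alpha''_{j,l}y_j^{r_j-l+1}}{(s+y_j)^{r_j-l+1}}$, $\frac{X_B}{\Delta}=\beta+\sum_{k}\frac{\beta_k}{s-s_k}+\sum_{j,l}\frac{\beta''_{j,l}y_j^{r_j-l+1}}{(s+y_j)^{r_j-l+1}}$, $\frac{X_C}{\Delta}=\gamma+\sum_{k}\frac{\gamma_k}{s-s_k}+\sum_{j,l}\frac{\gamma''_{j,l}y_j^{r_j-l+1}}{(s+y_j)^{r_j-l+1}}$, with $k=2,\dots,N$, $j=1,\dots,\sigma$, $l=1,\dots,r_j$. One has $\widetilde w_\epsilon(s)=\widetilde w(s)+\epsilon\widetilde\theta(s)+O(\epsilon^2)$ with $$\widetilde\theta(s)=\frac{\widetilde w(s)}{\mathbf u\boldsymbol\omega}\Big[\frac{X_A(s)}{\Delta(s)}+\big(\mu_p\widetilde F^e_p(s)-\mu_h\widetilde F^e_h(s)\big)\frac{X_B(s)}{\Delta(s)}-\big(\mu_p\widetilde F^e_p(s)-\mu_h\widetilde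 F^e_h(s)\big)\widetilde w(s)\frac{X_C(s)}{\Delta(s)}\Big].$$ *)

theory Defs
  imports
    "HOL-Probability.Probability"
    "HOL-Complex_Analysis.Complex_Analysis"
    "HOL-Library.Landau_Symbols"
    "Jordan_Normal_Form.Determinant"
    "Jordan_Normal_Form.Gauss_Jordan_Elimination"
begin

unbundle no inner_syntax and no vec_syntax
hide_const (open) Determinants.det Finite_Cartesian_Product.mat Finite_Cartesian_Product.vec
  Finite_Cartesian_Product.row Finite_Cartesian_Product.column

text \<open>
  States, matrix rows and matrix columns are numbered from \<open>0\<close>, following
  \<^theory>\<open>Jordan_Normal_Form.Matrix\<close>: the state set is \<open>{0..<N}\<close>, the root \<open>s\<^sub>1 = 0\<close>
  gets index \<open>0\<close>, and \<open>s\<^sub>2, \<dots>, s\<^sub>N\<close> get the indices \<open>1, \<dots>, N - 1\<close>.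
  The sign \<open>(-1)\<^bsup>m + j\<^esup>\<close> of a cofactor is not affected by this shift.
\<close>

section \<open>Matrices and vectors\<close>

abbreviation cmat :: "real mat \<Rightarrow> complex mat" where
  "cmat \<equiv> map_mat complex_of_real"

definition hadamard :: "'a::times mat \<Rightarrow> 'a mat \<Rightarrow> 'a mat" where
  "hadamard A B = mat (dim_row A) (dim_col A) (\<lambda>ij. A $$ ij * B $$ ij)"

definition ones :: "nat \<Rightarrow> 'a::one vec" where
  "ones n = vec n (\<lambda>_. 1)"

text \<open>Row vector times matrix; row vectors are represented by plain vectors.\<close>

definition vec_mult_mat :: "'a::semiring_0 vec \<Rightarrow> 'a mat \<Rightarrow> 'a vec" (infixl \<open>\<^sub>v*\<close> 70) where
  "v \<^sub>v* A = transpose_mat A *\<^sub>v v"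

definition inv_mat :: "'a::field mat \<Rightarrow> 'a mat" where
  "inv_mat A = the (mat_inverse A)"

text \<open>
  \<open>\<Sum>\<^sub>j det(X\<^sub>\<bullet>\<^sub>1, \<dots>, Y\<^sub>\<bullet>\<^sub>j, \<dots>, X\<^sub>\<bullet>\<^sub>n)\<close>, the columns of \<open>X\<close> being replaced by those of \<open>Y\<close>
  one at a time.
\<close>

definition col_replace_sum :: "complex mat \<Rightarrow> complex mat \<Rightarrow> complex" where
  "col_replace_sum X Y = (\<Sum>j<dim_col X. det (replace_col X (col Y j) j))"

section \<open>Distributions on the nonnegative half-line\<close>

definition nonneg_dist :: "real measure \<Rightarrow> bool" where
  "nonneg_dist F \<longleftrightarrow> real_distribution F \<and> measure F {..<0} = 0"

definition mean :: "real measure \<Rightarrow> real" where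
  "mean F = (\<integral>x. x \<partial>F)"

definition lst :: "real measure \<Rightarrow> complex \<Rightarrow> complex" where
  "lst F \<zeta> = (\<integral>x. exp (- \<zeta> * complex_of_real x) \<partial>F)"

text \<open>Stationary-excess distribution, with density \<open>(1 - F(x)) / mean F\<close> on \<open>[0, \<infinity>)\<close>.\<close>

definition excess :: "real measure \<Rightarrow> real measure" where
  "excess F = density lborel
     (\<lambda>x. ennreal (if 0 \<le> x then measure F {x<..} / mean F else 0))"

definition mixture :: "real \<Rightarrow> real measure \<Rightarrow> real measure \<Rightarrow> real measure" where
  "mixture \<epsilon> F G = measure_of UNIV (sets borel)
     (\<lambda>A. ennreal (1 - \<epsilon>) * emeasure F A + ennreal \<epsilon> * emeasure G A)"

text \<open>
  Phase-type: the absorption time of a Markov chain on \<open>d\<close> transient phases with initial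
  law \<open>a\<close> and subintensity matrix \<open>T\<close>, i.e. \<open>F((x, \<infinity>)) = a exp(x T) e\<close>; the matrix
  exponential is written as its power series.
\<close>

definition phase_type :: "real measure \<Rightarrow> bool" where
  "phase_type F \<longleftrightarrow> nonneg_dist F \<and>
     (\<exists>d (a::real vec) (T::real mat).
        a \<in> carrier_vec d \<and> T \<in> carrier_mat d d \<and>
        (\<forall>i<d. 0 \<le> a $ i) \<and> (\<Sum>i<d. a $ i) = 1 \<and>
        (\<forall>i<d. \<forall>j<d. i \<noteq> j \<longrightarrow> 0 \<le> T $$ (i, j)) \<and>
        (\<forall>i<d. (\<Sum>j<d. T $$ (i, j)) \<le> 0) \<and>
        (\<forall>x\<ge>0. (\<lambda>n. x ^ n / fact n * (a \<bullet> ((T ^\<^sub>m n) *\<^sub>v ones d))) sums measure F {x<..}))"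

definition heavy_tailed :: "real measure \<Rightarrow> bool" where
  "heavy_tailed F \<longleftrightarrow> nonneg_dist F \<and>
     (\<forall>\<eta>>0. (\<integral>\<^sup>+ x. ennreal (exp (\<eta> * x)) \<partial>F) = \<infinity>)"

section \<open>Arrivals\<close>

text \<open>\<open>D1\<close>, \<open>D2\<close> are the intensities without and with a real customer.\<close>

definition arrival_rates :: "nat \<Rightarrow> real mat \<Rightarrow> real mat \<Rightarrow> bool" where
  "arrival_rates N D1 D2 \<longleftrightarrow> 0 < N \<and> D1 \<in> carrier_mat N N \<and> D2 \<in> carrier_mat N N \<and>
     (\<forall>i<N. \<forall>j<N. 0 \<le> D2 $$ (i, j) \<and> (i \<noteq> j \<longrightarrow> 0 \<le> D1 $$ (i, j))) \<and>
     (\<forall>i<N. D1 $$ (i, i) = - (\<Sum>k\<in>{..<N} - {i}. D1 $$ (i, k)) - (\<Sum>k<N. D2 $$ (i, k)))"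

definition rate :: "real mat \<Rightarrow> real mat \<Rightarrow> nat \<Rightarrow> real" where
  "rate D1 D2 i = (\<Sum>k\<in>{..<dim_row D1} - {i}. D1 $$ (i, k)) + (\<Sum>k<dim_row D1. D2 $$ (i, k))"

definition Lam :: "real mat \<Rightarrow> real mat \<Rightarrow> real mat" where
  "Lam D1 D2 = mat (dim_row D1) (dim_row D1) (\<lambda>(i, j). if i = j then rate D1 D2 i else 0)"

definition Lam_inv :: "real mat \<Rightarrow> real mat \<Rightarrow> real mat" where
  "Lam_inv D1 D2 = mat (dim_row D1) (dim_row D1) (\<lambda>(i, j). if i = j then 1 / rate D1 D2 i else 0)"

definition P_mat :: "real mat \<Rightarrow> real mat \<Rightarrow> real mat" where
  "P_mat D1 D2 = mat (dim_row D1) (dim_row D1)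
     (\<lambda>(i, j). ((if i = j then 0 else D1 $$ (i, j)) + D2 $$ (i, j)) / rate D1 D2 i)"

definition Q1 :: "real mat \<Rightarrow> real mat \<Rightarrow> real mat" where
  "Q1 D1 D2 = mat (dim_row D1) (dim_row D1)
     (\<lambda>(i, j). if 0 < P_mat D1 D2 $$ (i, j)
        then (if i = j then 0 else D1 $$ (i, j)) / (rate D1 D2 i * P_mat D1 D2 $$ (i, j)) else 0)"

definition Q2 :: "real mat \<Rightarrow> real mat \<Rightarrow> real mat" where
  "Q2 D1 D2 = mat (dim_row D1) (dim_row D1)
     (\<lambda>(i, j). if 0 < P_mat D1 D2 $$ (i, j)
        then D2 $$ (i, j) / (rate D1 D2 i * P_mat D1 D2 $$ (i, j)) else 0)"

definition irreducible_mat :: "real mat \<Rightarrow> bool" where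
  "irreducible_mat A \<longleftrightarrow>
     (\<forall>i<dim_row A. \<forall>j<dim_row A. \<exists>n. 0 < (A ^\<^sub>m n) $$ (i, j))"

definition stationary_vec :: "real mat \<Rightarrow> real vec \<Rightarrow> bool" where
  "stationary_vec A \<pi> \<longleftrightarrow> \<pi> \<in> carrier_vec (dim_row A) \<and> (\<forall>i<dim_row A. 0 \<le> \<pi> $ i) \<and>
     \<pi> \<bullet> ones (dim_row A) = 1 \<and> \<pi> \<^sub>v* A = \<pi>"

text \<open>\<open>\<pi> (\<Lambda>\<^sup>-\<^sup>1 - \<mu> Q\<^sup>(\<^sup>2\<^sup>) \<circ> P) e\<close>; the queue with mean service time \<open>\<mu>\<close> is stable iff this is positive.\<close>

definition drift :: "real mat \<Rightarrow> real mat \<Rightarrow> real vec \<Rightarrow> real \<Rightarrow> real" where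
  "drift D1 D2 \<pi> \<mu> =
     \<pi> \<bullet> ((Lam_inv D1 D2 - \<mu> \<cdot>\<^sub>m hadamard (Q2 D1 D2) (P_mat D1 D2)) *\<^sub>v ones (dim_row D1))"

section \<open>Workload and delay\<close>

text \<open>
  The pair (workload just before an arrival, tag) is a Markov chain. From \<open>(v, i)\<close> the state
  jumps to \<open>j\<close> with probability \<open>p\<^sub>i\<^sub>j\<close>; the arriving customer is dummy (no work) with probability
  \<open>q\<^sup>(\<^sup>1\<^sup>)\<^sub>i\<^sub>j\<close> and real (an independent service time \<open>b\<close> with law \<open>G\<close>) with probability \<open>q\<^sup>(\<^sup>2\<^sup>)\<^sub>i\<^sub>j\<close>;
  the next arrival, tagged \<open>j\<close>, comes after an exponential time \<open>t\<close> with rate \<open>\<lambda>\<^sub>j\<close>, during which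
  the server works at unit speed. \<open>step_prob\<close> is the probability of moving from \<open>(v, i)\<close> into
  \<open>A \<times> {j}\<close>, and a steady-state law is an invariant probability law of this chain.
\<close>

definition step_prob ::
    "real mat \<Rightarrow> real mat \<Rightarrow> real measure \<Rightarrow> real \<Rightarrow> nat \<Rightarrow> real set \<Rightarrow> nat \<Rightarrow> ennreal" where
  "step_prob D1 D2 G v i A j =
     (let T = density lborel (exponential_density (rate D1 D2 j)) in
      ennreal (P_mat D1 D2 $$ (i, j)) *
        (ennreal (Q1 D1 D2 $$ (i, j)) * emeasure T {t. max 0 (v - t) \<in> A} +
         ennreal (Q2 D1 D2 $$ (i, j)) * emeasure (G \<Otimes>\<^sub>M T) {(b, t). max 0 (v + b - t) \<in> A}))"

definition steady_state ::
    "real mat \<Rightarrow> real mat \<Rightarrow> real measure \<Rightarrow> (real \<times> nat) measure \<Rightarrow> bool" where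
  "steady_state D1 D2 G \<nu> \<longleftrightarrow> prob_space \<nu> \<and>
     sets \<nu> = sets (borel \<Otimes>\<^sub>M count_space {..<dim_row D1}) \<and>
     (AE vi in \<nu>. 0 \<le> fst vi) \<and>
     (\<forall>A\<in>sets borel. \<forall>j<dim_row D1.
        emeasure \<nu> (A \<times> {j}) = (\<integral>\<^sup>+ vi. step_prob D1 D2 G (fst vi) (snd vi) A j \<partial>\<nu>))"

definition Phi :: "nat \<Rightarrow> (real \<times> nat) measure \<Rightarrow> complex \<Rightarrow> complex vec" where
  "Phi N \<nu> \<zeta> = vec N (\<lambda>i.
     \<integral>vi. (if snd vi = i then exp (- \<zeta> * complex_of_real (fst vi)) else 0) \<partial>\<nu>)"

definition omega :: "real mat \<Rightarrow> real mat \<Rightarrow> real vec \<Rightarrow> complex vec" where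
  "omega D1 D2 \<pi> = (let h = Lam_inv D1 D2 *\<^sub>v (D2 *\<^sub>v ones (dim_row D1))
     in map_vec complex_of_real ((1 / (\<pi> \<bullet> h)) \<cdot>\<^sub>v h))"

text \<open>Laplace transform of the queueing delay of real customers.\<close>

definition delay_transform ::
    "real mat \<Rightarrow> real mat \<Rightarrow> real vec \<Rightarrow> (real \<times> nat) measure \<Rightarrow> complex \<Rightarrow> complex" where
  "delay_transform D1 D2 \<pi> \<nu> \<zeta> = Phi (dim_row D1) \<nu> \<zeta> \<bullet> omega D1 D2 \<pi>"

section \<open>Base-model quantities\<close>

definition QP2Lam :: "real mat \<Rightarrow> real mat \<Rightarrow> complex mat" where
  "QP2Lam D1 D2 = cmat (hadamard (Q2 D1 D2) (P_mat D1 D2 * Lam D1 D2))"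

definition E_mat2 :: "real mat \<Rightarrow> real mat \<Rightarrow> complex \<Rightarrow> complex \<Rightarrow> complex mat" where
  "E_mat2 D1 D2 \<zeta> g =
     hadamard (cmat (Q1 D1 D2) + g \<cdot>\<^sub>m cmat (Q2 D1 D2)) (cmat (P_mat D1 D2 * Lam D1 D2))
       + \<zeta> \<cdot>\<^sub>m 1\<^sub>m (dim_row D1) - cmat (Lam D1 D2)"

text \<open>
  \<open>E(\<zeta>) = E(\<zeta>, F\<^sub>p(\<zeta>))\<close>, with the transform \<open>q / p\<close> of \<open>F\<^sub>p\<close> so that it is meaningful on the
  whole plane apart from the zeros of \<open>p\<close>.
\<close>

definition E_mat ::
    "real mat \<Rightarrow> real mat \<Rightarrow> complex poly \<Rightarrow> complex poly \<Rightarrow> complex \<Rightarrow> complex mat" where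
  "E_mat D1 D2 q p \<zeta> = E_mat2 D1 D2 \<zeta> (poly q \<zeta> / poly p \<zeta>)"

definition mat_deriv :: "(complex \<Rightarrow> complex mat) \<Rightarrow> complex \<Rightarrow> complex mat" where
  "mat_deriv X \<zeta> = mat (dim_row (X \<zeta>)) (dim_col (X \<zeta>)) (\<lambda>ij. deriv (\<lambda>w. X w $$ ij) \<zeta>)"

text \<open>
  The highest power \<open>r\<close> of \<open>p\<close> in the denominators of \<open>det E(\<zeta>)\<close> and of the entries of
  \<open>adj E(\<zeta>)\<close>. These are polynomials in \<open>g\<close> evaluated at \<open>g = q(\<zeta>) / p(\<zeta>)\<close>, where \<open>p\<close> and \<open>q\<close>
  have no common root, so a denominator \<open>p\<^sup>k\<close> comes from a term with \<open>g\<^sup>k\<close>; hence \<open>r\<close> is the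
  largest degree in \<open>g\<close> of \<open>det E(\<zeta>, g)\<close> and of the entries of \<open>adj E(\<zeta>, g)\<close>.
\<close>

definition degree_le :: "(complex \<Rightarrow> complex) \<Rightarrow> nat \<Rightarrow> bool" where
  "degree_le f k \<longleftrightarrow> (\<exists>c. degree c \<le> k \<and> (\<forall>g. f g = poly c g))"

definition p_power :: "real mat \<Rightarrow> real mat \<Rightarrow> nat" where
  "p_power D1 D2 = (LEAST k. \<forall>\<zeta>. degree_le (\<lambda>g. det (E_mat2 D1 D2 \<zeta> g)) k \<and>
     (\<forall>i<dim_row D1. \<forall>j<dim_row D1. degree_le (\<lambda>g. adj_mat (E_mat2 D1 D2 \<zeta> g) $$ (i, j)) k))"

section \<open>The vectors \<open>a\<^sub>i\<close> and \<open>z\<close>\<close>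

text \<open>\<open>\<mu>\<^sub>p F\<^sub>p\<^sup>e(\<zeta>) - \<mu>\<^sub>h F\<^sub>h\<^sup>e(\<zeta>)\<close>\<close>

definition excess_diff :: "real measure \<Rightarrow> real measure \<Rightarrow> complex \<Rightarrow> complex" where
  "excess_diff Fp Fh \<zeta> = mean Fp * lst (excess Fp) \<zeta> - mean Fh * lst (excess Fh) \<zeta>"

definition K_mat ::
    "real mat \<Rightarrow> real mat \<Rightarrow> real measure \<Rightarrow> real measure \<Rightarrow> complex \<Rightarrow> complex mat" where
  "K_mat D1 D2 Fp Fh \<zeta> = (\<zeta> * excess_diff Fp Fh \<zeta>) \<cdot>\<^sub>m QP2Lam D1 D2"

text \<open>
  In the following definitions \<open>E\<close> and \<open>K\<close> are matrix functions, \<open>s\<close> is a root of \<open>det E\<close> and \<open>m\<close>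
  is the column chosen for it.
\<close>

definition a_col :: "(complex \<Rightarrow> complex mat) \<Rightarrow> complex \<Rightarrow> nat \<Rightarrow> complex vec" where
  "a_col E s m = col (adj_mat (E s)) m"

definition a_col_deriv :: "(complex \<Rightarrow> complex mat) \<Rightarrow> complex \<Rightarrow> nat \<Rightarrow> complex vec" where
  "a_col_deriv E s m = col (mat_deriv (\<lambda>\<zeta>. adj_mat (E \<zeta>)) s) m"

definition delta :: "(complex \<Rightarrow> complex mat) \<Rightarrow> (complex \<Rightarrow> complex mat) \<Rightarrow> complex \<Rightarrow> complex" where
  "delta E K s = col_replace_sum (E s) (K s) / col_replace_sum (E s) (mat_deriv E s)"

definition k_col ::
    "(complex \<Rightarrow> complex mat) \<Rightarrow> (complex \<Rightarrow> complex mat) \<Rightarrow> complex \<Rightarrow> nat \<Rightarrow> complex vec" where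
  "k_col E K s m = vec (dim_row (E s)) (\<lambda>j.
     (- 1) ^ (m + j) * col_replace_sum (mat_delete (E s) m j) (mat_delete (K s) m j))"

definition A_mat ::
    "real mat \<Rightarrow> real mat \<Rightarrow> (complex \<Rightarrow> complex mat) \<Rightarrow> (nat \<Rightarrow> real) \<Rightarrow> (nat \<Rightarrow> nat) \<Rightarrow> complex mat"
  where
  "A_mat D1 D2 E s m = mat_of_cols (dim_row D1)
     (map_vec complex_of_real (Lam_inv D1 D2 *\<^sub>v ones (dim_row D1)) #
      map (\<lambda>i. a_col E (s i) (m i)) [1..<dim_row D1])"

definition B_mat ::
    "nat \<Rightarrow> (complex \<Rightarrow> complex mat) \<Rightarrow> (complex \<Rightarrow> complex mat) \<Rightarrow> (nat \<Rightarrow> real) \<Rightarrow> (nat \<Rightarrow> nat)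
      \<Rightarrow> complex mat"
  where
  "B_mat N E K s m = mat_of_cols N
     (0\<^sub>v N #
      map (\<lambda>i. delta E K (s i) \<cdot>\<^sub>v a_col_deriv E (s i) (m i) - k_col E K (s i) (m i)) [1..<N])"

definition c_vec :: "real mat \<Rightarrow> real mat \<Rightarrow> real vec \<Rightarrow> real measure \<Rightarrow> complex vec" where
  "c_vec D1 D2 \<pi> Fp =
     vec (dim_row D1) (\<lambda>i. if i = 0 then complex_of_real (drift D1 D2 \<pi> (mean Fp)) else 0)"

definition d_vec ::
    "real mat \<Rightarrow> real mat \<Rightarrow> real vec \<Rightarrow> real measure \<Rightarrow> real measure \<Rightarrow> complex vec" where
  "d_vec D1 D2 \<pi> Fp Fh = vec (dim_row D1) (\<lambda>i. if i = 0
     then complex_of_real ((mean Fp - mean Fh) *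
       (\<pi> \<bullet> (hadamard (Q2 D1 D2) (P_mat D1 D2) *\<^sub>v ones (dim_row D1))))
     else 0)"

section \<open>Laplace inversion and random variables\<close>

text \<open>
  \<open>\<theta>\<close> is (on the closed right half-plane) the Laplace--Stieltjes transform of a signed measure on
  \<open>[0, \<infinity>)\<close> with tail \<open>\<Theta>\<close>; the signed measure is a difference of two finite measures.
\<close>

definition laplace_inversion_tail :: "(complex \<Rightarrow> complex) \<Rightarrow> (real \<Rightarrow> complex) \<Rightarrow> bool" where
  "laplace_inversion_tail \<theta> \<Theta> \<longleftrightarrow> (\<exists>\<mu> \<nu> :: real measure.
     finite_measure \<mu> \<and> finite_measure \<nu> \<and> sets \<mu> = sets borel \<and> sets \<nu> = sets borel \<and>
     measure \<mu> {..<0} = 0 \<and> measure \<nu> {..<0} = 0 \<and>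
     (\<forall>\<zeta>. 0 \<le> Re \<zeta> \<longrightarrow> \<theta> \<zeta> = lst \<mu> \<zeta> - lst \<nu> \<zeta>) \<and>
     (\<forall>t\<ge>0. \<Theta> t = complex_of_real (measure \<mu> {t<..} - measure \<nu> {t<..})))"

text \<open>Index type for the jointly independent family; the variables \<open>Erl j l\<close> and \<open>Expo k\<close> are
  the Erlang and exponential ones.\<close>

datatype rv = Delay | Delay' | ExcessP | ExcessH | Erl nat nat | Expo nat

end

theory Submission
  imports Defs
begin

text \<open>
Write \<open>\<Phi>(\<zeta>)\<close> for the row vector of transforms of the workload seen by an arrival, split by tags.
Conditioning on one step of the chain and integrating out the exponential interarrival time turns
invariance into the linear system \<open>\<Phi>(\<zeta>) E(\<zeta>) = \<zeta> u\<close> (\<open>balance\<close>), where the vector \<open>u\<close> does not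
depend on \<open>\<zeta>\<close>. The limit \<open>\<zeta> \<rightarrow> 0\<close> fixes the scalar \<open>u \<Lambda>\<^sup>-\<^sup>1 e\<close> (\<open>normalization\<close>), and Cramer's rule at a
root of \<open>det E\<close> gives \<open>u a\<^sub>k = 0\<close>; these conditions characterize \<open>u\<close>. For the mixture the same
holds with the matrix \<open>E + \<epsilon> K\<close> and a vector \<open>u\<^sub>\<epsilon>\<close>.

\<^emph>\<open>The expansion.\<close> Cramer's rule expresses \<open>det E \<cdot> (\<Phi>\<^sub>\<epsilon> - \<Phi>)\<close> through \<open>u\<^sub>\<epsilon> - u\<close> and \<open>\<epsilon> \<Phi>\<^sub>\<epsilon> K\<close>. Since \<open>\<Phi>\<^sub>\<epsilon>\<close> is
bounded, first \<open>u\<^sub>\<epsilon> - u = O(\<epsilon>)\<close>, then \<open>\<Phi>\<^sub>\<epsilon> - \<Phi> = O(\<epsilon>)\<close> uniformly on compact sets without roots of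
\<open>det E\<close>. The maximum modulus principle on small circles extends this to the roots \<open>s\<^sub>k\<close>; inserting it
into the equations for \<open>u\<^sub>\<epsilon>\<close> gives \<open>u\<^sub>\<epsilon> = u + \<epsilon> z + O(\<epsilon>\<^sup>2)\<close>, where the vector \<open>z\<close> of the theorem appears because
differentiating Cramer's rule at a simple root evaluates \<open>\<Phi>(s\<^sub>k) K(s\<^sub>k) a\<^sub>k\<close> (\<open>first_order_at_root\<close>).
One more application of Cramer's rule yields the first-order term \<open>\<Psi>\<close> of \<open>\<Phi>\<^sub>\<epsilon>\<close>, away from the roots.
Its product with \<open>\<omega>\<close> is the bracket of the theorem (\<open>\<psi>_eq\<close>), by the product rule for
\<open>E(\<zeta>, g) adj E(\<zeta>, g) = det E(\<zeta>, g) I\<close> with respect to \<open>g\<close>.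

\<^emph>\<open>The inversion.\<close> The candidate \<open>\<theta>\<close> is the transform of the right-hand side, summand by summand.
The powers of \<open>y / (\<zeta> + y)\<close> are transforms of Erlang laws. The factor \<open>1 / (\<zeta> - s)\<close> with \<open>s > 0\<close> is not a
transform, but if \<open>A\<close> is the transform of \<open>X\<close> and \<open>T\<close> is exponential with rate \<open>s\<close>, then
\<open>t \<mapsto> P(t < X < t + T)\<close> is the tail of a signed measure with transform \<open>\<zeta> (A(\<zeta>) - A(s)) / (\<zeta> - s)\<close>
(\<open>overshoot_transform\<close>). Thus a summand \<open>\<alpha> A(\<zeta>) / (\<zeta> - s)\<close> is \<open>\<alpha> / s\<close> times this transform minus
\<open>\<alpha> A(\<zeta>) / s\<close>, up to the contribution of \<open>A(s)\<close>. The contributions of the three partial fraction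
expansions at \<open>s\<^sub>k\<close> cancel, because the first-order term stays bounded near \<open>s\<^sub>k\<close>, being a limit of
the quotients \<open>(\<Phi>\<^sub>\<epsilon> - \<Phi>) / \<epsilon>\<close>. So \<open>\<theta>\<close> agrees with the bracket off the roots; being
holomorphic it also gives the expansion at the roots, again by the maximum modulus principle, and
\<open>\<zeta> = 0\<close> is settled by a direct computation (\<open>first_order_tail\<close>).

Since the coefficients may be complex, this construction yields a complex measure a priori. But
\<open>\<theta>\<close> is a limit of quotients of transforms of real measures, hence commutes with conjugation, and
by the uniqueness of characteristic functions its imaginary part vanishes (\<open>complex_tail_hermitian\<close>).
\<close>

unbundle no fps_syntax

section \<open>Laplace transforms on the right half-plane\<close>

definition laplace :: "'a measure \<Rightarrow> ('a \<Rightarrow> complex) \<Rightarrow> ('a \<Rightarrow> real) \<Rightarrow> complex \<Rightarrow> complex" where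
  "laplace M g X \<zeta> = (\<integral>x. g x * exp (- \<zeta> * complex_of_real (X x)) \<partial>M)"

lemma lst_eq_laplace: "lst F = laplace F (\<lambda>_. 1) (\<lambda>x. x)"
  by (simp add: lst_def laplace_def fun_eq_iff)

lemma norm_laplace_kernel_le:
  assumes "0 \<le> Re \<zeta>" "0 \<le> x" "norm c \<le> (1::real)"
  shows "norm (c * exp (- \<zeta> * complex_of_real x)) \<le> 1"
proof -
  have "norm (exp (- \<zeta> * complex_of_real x)) \<le> 1"
    using assms by (simp add: norm_exp_eq_Re)
  then show ?thesis using assms(3) by (simp add: norm_mult mult_le_one)
qed

text \<open>The weight \<open>g\<close> will be the indicator of a tag, or constant for the transform of a single law.\<close>

locale bounded_laplace = finite_measure M for M :: "'a measure" +
  fixes g :: "'a \<Rightarrow> complex" and X :: "'a \<Rightarrow> real"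
  assumes g [measurable]: "g \<in> borel_measurable M"
    and X [measurable]: "X \<in> borel_measurable M"
    and g_le: "\<And>x. norm (g x) \<le> 1"
    and X_ge: "AE x in M. 0 \<le> X x"
begin

lemma laplace_integrable:
  assumes "0 \<le> Re \<zeta>"
  shows "integrable M (\<lambda>x. g x * exp (- \<zeta> * complex_of_real (X x)))"
proof (rule integrable_const_bound[where B = 1])
  show "AE x in M. norm (g x * exp (- \<zeta> * complex_of_real (X x))) \<le> 1"
    using X_ge by eventually_elim (rule norm_laplace_kernel_le[OF assms _ g_le])
qed simp

lemma norm_laplace_le:
  assumes "0 \<le> Re \<zeta>"
  shows "norm (laplace M g X \<zeta>) \<le> measure M (space M)"
proof -
  have "norm (laplace M g X \<zeta>) \<le> (\<integral>x. norm (g x * exp (- \<zeta> * complex_of_real (X x))) \<partial>M)"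
    unfolding laplace_def by (rule integral_norm_bound)
  also have "\<dots> \<le> (\<integral>x. 1 \<partial>M)"
  proof (rule integral_mono_AE)
    show "integrable M (\<lambda>x. norm (g x * exp (- \<zeta> * complex_of_real (X x))))"
      using laplace_integrable[OF assms] by (rule integrable_norm)
    show "AE x in M. norm (g x * exp (- \<zeta> * complex_of_real (X x))) \<le> 1"
      using X_ge by eventually_elim (rule norm_laplace_kernel_le[OF assms _ g_le])
  qed simp
  finally show ?thesis by simp
qed

lemma laplace_continuous: "continuous_on {\<zeta>. 0 \<le> Re \<zeta>} (laplace M g X)"
proof (rule continuous_on_sequentiallyI)
  fix v :: "nat \<Rightarrow> complex" and c
  assume v: "\<forall>n. v n \<in> {\<zeta>. 0 \<le> Re \<zeta>}" "c \<in> {\<zeta>. 0 \<le> Re \<zeta>}" "v \<longlonglongrightarrow> c"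
  show "(\<lambda>n. laplace M g X (v n)) \<longlonglongrightarrow> laplace M g X c"
    unfolding laplace_def
  proof (rule integral_dominated_convergence[where w = "\<lambda>_. 1"])
    show "AE x in M. (\<lambda>i. g x * exp (- v i * complex_of_real (X x)))
        \<longlonglongrightarrow> g x * exp (- c * complex_of_real (X x))"
      by (intro AE_I2 tendsto_intros v)
    show "AE x in M. norm (g x * exp (- v i * complex_of_real (X x))) \<le> 1" for i
      using X_ge by eventually_elim (rule norm_laplace_kernel_le[OF _ _ g_le], use v in auto)
  qed simp_all
qed

text \<open>Difference quotients at \<open>c\<close> with increments of norm at most \<open>d = Re c / 2\<close> are dominated by the
  constant \<open>1 / d\<close>, since half of the decay of \<open>exp (- c x)\<close> absorbs the growth of the increment.\<close>

lemma laplace_holomorphic: "laplace M g X holomorphic_on {\<zeta>. 0 < Re \<zeta>}"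
proof (rule holomorphic_onI)
  fix c :: complex assume "c \<in> {\<zeta>. 0 < Re \<zeta>}"
  then have c: "0 < Re c" by simp
  define d where "d = Re c / 2"
  have d: "0 < d" "Re c = 2 * d" using c by (auto simp: d_def)
  define D where "D = (\<integral>x. - complex_of_real (X x) * (g x * exp (- c * complex_of_real (X x))) \<partial>M)"
  have "((\<lambda>h. (laplace M g X (c + h) - laplace M g X c) / h) \<longlongrightarrow> D) (at 0 within ball 0 d)"
    unfolding tendsto_at_iff_sequentially
  proof (intro allI impI)
    fix h :: "nat \<Rightarrow> complex"
    assume h: "\<forall>i. h i \<in> ball 0 d - {0}" "h \<longlonglongrightarrow> 0"
    have hd: "norm (h i) \<le> d" "h i \<noteq> 0" for i using h(1) by (auto simp: less_imp_le)
    have Re_ge: "0 \<le> Re (c + h i)" for i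
      using abs_Re_le_cmod[of "h i"] hd(1)[of i] d by simp
    let ?f = "\<lambda>i x. (g x * exp (- (c + h i) * complex_of_real (X x))
                 - g x * exp (- c * complex_of_real (X x))) / h i"
    have "(\<lambda>i. \<integral>x. ?f i x \<partial>M) \<longlonglongrightarrow> D"
      unfolding D_def
    proof (rule integral_dominated_convergence[where w = "\<lambda>_. 1 / d"])
      show "AE x in M. (\<lambda>i. ?f i x) \<longlonglongrightarrow>
          - complex_of_real (X x) * (g x * exp (- c * complex_of_real (X x)))"
      proof (rule AE_I2)
        fix x
        have "((\<lambda>w. g x * exp (- w * complex_of_real (X x))) has_field_derivative
            - complex_of_real (X x) * (g x * exp (- c * complex_of_real (X x)))) (at c)"
          by (auto intro!: derivative_eq_intros)
        then have "((\<lambda>h. (g x * exp (- (c + h) * complex_of_real (X x))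
                 - g x * exp (- c * complex_of_real (X x))) / h) \<longlongrightarrow>
            - complex_of_real (X x) * (g x * exp (- c * complex_of_real (X x)))) (at 0)"
          unfolding DERIV_def .
        then show "(\<lambda>i. ?f i x) \<longlonglongrightarrow>
            - complex_of_real (X x) * (g x * exp (- c * complex_of_real (X x)))"
          unfolding tendsto_at_iff_sequentially using h hd(2) by (auto simp: o_def)
      qed
      show "AE x in M. norm (?f i x) \<le> 1 / d" for i
        using X_ge
      proof eventually_elim
        fix x assume x: "0 \<le> X x"
        let ?e = "exp (- (h i * complex_of_real (X x))) - 1"
        have "norm ?e \<le> exp \<bar>Re (- (h i * complex_of_real (X x)))\<bar>
            * norm (- (h i * complex_of_real (X x)))"
          using Taylor_exp[of "- (h i * complex_of_real (X x))" 0] by simp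
        also have "\<dots> \<le> exp (d * X x) * (norm (h i) * X x)"
        proof (intro mult_mono)
          have "\<bar>Re (h i)\<bar> \<le> d" using abs_Re_le_cmod[of "h i"] hd(1)[of i] by linarith
          then show "exp \<bar>Re (- (h i * complex_of_real (X x)))\<bar> \<le> exp (d * X x)"
            using x by (auto simp: abs_mult intro!: mult_right_mono)
        qed (use x in \<open>auto simp: norm_mult\<close>)
        finally have 1: "norm ?e \<le> exp (d * X x) * (norm (h i) * X x)" .
        have "?f i x = g x * exp (- c * complex_of_real (X x)) * ?e / h i"
          by (simp add: algebra_simps exp_add exp_diff exp_minus field_simps)
        then have "norm (?f i x) = norm (g x * exp (- c * complex_of_real (X x)) * ?e / h i)"
          by (rule arg_cong)
        also have "\<dots> = norm (g x) * exp (- (2 * d * X x)) * norm ?e / norm (h i)"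
          unfolding norm_mult norm_divide norm_exp_eq_Re using d by simp
        also have "\<dots> \<le> 1 * exp (- (2 * d * X x)) * (exp (d * X x) * (norm (h i) * X x)) / norm (h i)"
          by (intro divide_right_mono mult_mono 1 g_le) auto
        also have "\<dots> = X x * exp (- (d * X x))"
          using hd(2)[of i] by (simp add: field_simps flip: exp_add)
        also have "\<dots> \<le> 1 / d"
        proof -
          have "d * X x \<le> exp (d * X x)" using exp_ge_add_one_self[of "d * X x"] by linarith
          then show ?thesis using d by (simp add: field_simps exp_minus)
        qed
        finally show "norm (?f i x) \<le> 1 / d" .
      qed
    qed simp_all
    moreover have "(\<integral>x. ?f i x \<partial>M) = (laplace M g X (c + h i) - laplace M g X c) / h i" for i
      unfolding laplace_def integral_divide_zero
      by (subst Bochner_Integration.integral_diff)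
        (use laplace_integrable[OF Re_ge[of i]] laplace_integrable[of c] c in auto)
    ultimately show "((\<lambda>h. (laplace M g X (c + h) - laplace M g X c) / h) \<circ> h) \<longlonglongrightarrow> D"
      by (simp only: o_def)
  qed
  then have "(laplace M g X has_field_derivative D) (at c)"
    unfolding DERIV_def using at_within_open[of "0::complex" "ball 0 d"] d by simp
  then show "laplace M g X field_differentiable (at c within {\<zeta>. 0 < Re \<zeta>})"
    unfolding field_differentiable_def by (blast intro: has_field_derivative_at_within)
qed

end

lemma laplace_cnj: "laplace M (\<lambda>x. complex_of_real (g x)) X (cnj \<zeta>) = cnj (laplace M (\<lambda>x. complex_of_real (g x)) X \<zeta>)"
proof -
  have "laplace M (\<lambda>x. complex_of_real (g x)) X (cnj \<zeta>) =
      (\<integral>x. cnj (complex_of_real (g x) * exp (- \<zeta> * complex_of_real (X x))) \<partial>M)"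
    unfolding laplace_def by (intro Bochner_Integration.integral_cong) (simp_all add: exp_cnj)
  also have "\<dots> = cnj (laplace M (\<lambda>x. complex_of_real (g x)) X \<zeta>)"
    unfolding laplace_def by (rule Bochner_Integration.integral_cnj)
  finally show ?thesis .
qed

locale nonneg_finite_measure =
  fixes F :: "real measure"
  assumes fin: "finite_measure F" and sets_F: "sets F = sets borel"
    and null_neg: "measure F {..<0} = 0"
begin

lemma AE_nonneg: "AE x in F. 0 \<le> x"
proof -
  interpret finite_measure F by (rule fin)
  have "emeasure F {..<0} = 0" using null_neg by (simp add: emeasure_eq_measure)
  then have "{..<0} \<in> null_sets F" using sets_F by (auto simp: null_sets_def)
  then show ?thesis by (rule AE_I'[of _ _]) auto
qed

lemma measurable_F: "f \<in> borel_measurable borel \<Longrightarrow> f \<in> borel_measurable F"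
  using sets_F measurable_cong_sets by blast

sublocale lap: bounded_laplace F "\<lambda>_. 1" "\<lambda>x. x"
  unfolding bounded_laplace_def bounded_laplace_axioms_def
  by (auto intro: measurable_F AE_nonneg fin)

lemma lst_integrable: "0 \<le> Re \<zeta> \<Longrightarrow> integrable F (\<lambda>x. exp (- \<zeta> * complex_of_real x))"
  using lap.laplace_integrable by simp

lemma lst_continuous: "continuous_on {\<zeta>. 0 \<le> Re \<zeta>} (lst F)"
  unfolding lst_eq_laplace by (rule lap.laplace_continuous)

lemma lst_holomorphic: "lst F holomorphic_on {\<zeta>. 0 < Re \<zeta>}"
  unfolding lst_eq_laplace by (rule lap.laplace_holomorphic)

lemma lst_cnj: "lst F (cnj \<zeta>) = cnj (lst F \<zeta>)"
  unfolding lst_eq_laplace using laplace_cnj[of F "\<lambda>_. 1"] by simp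

end

lemma nonneg_finite_measureI_dist: "nonneg_dist F \<Longrightarrow> nonneg_finite_measure F"
  unfolding nonneg_dist_def nonneg_finite_measure_def
  using prob_space.finite_measure real_distribution.axioms(1) real_distribution.events_eq_borel by blast

section \<open>Sums of measures\<close>

definition msum :: "real \<Rightarrow> real measure \<Rightarrow> real \<Rightarrow> real measure \<Rightarrow> real measure" where
  "msum a F b G = measure_of UNIV (sets borel)
     (\<lambda>A. ennreal a * emeasure F A + ennreal b * emeasure G A)"

lemma sets_msum [simp, measurable_cong]: "sets (msum a F b G) = sets borel"
  unfolding msum_def
  by (subst sets_measure_of) (use sets.sigma_sets_eq[of borel] in auto)

lemma space_msum [simp]: "space (msum a F b G) = UNIV"
  unfolding msum_def by (simp add: space_measure_of_conv)

lemma emeasure_msum: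
  assumes "sets F = sets borel" "sets G = sets borel" "A \<in> sets borel"
  shows "emeasure (msum a F b G) A = ennreal a * emeasure F A + ennreal b * emeasure G A"
  unfolding msum_def
proof (rule emeasure_measure_of_sigma[OF _ _ _ assms(3)])
  show "sigma_algebra UNIV (sets borel)" using sets.sigma_algebra_axioms[of borel] by simp
  show "positive (sets borel) (\<lambda>A. ennreal a * emeasure F A + ennreal b * emeasure G A)"
    by (simp add: positive_def)
  show "countably_additive (sets borel) (\<lambda>A. ennreal a * emeasure F A + ennreal b * emeasure G A)"
  proof (rule countably_additiveI)
    fix A :: "nat \<Rightarrow> real set" assume A: "range A \<subseteq> sets borel" "disjoint_family A"
    have "(\<Sum>i. ennreal a * emeasure F (A i) + ennreal b * emeasure G (A i)) =
        (\<Sum>i. ennreal a * emeasure F (A i)) + (\<Sum>i. ennreal b * emeasure G (A i))"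
      by (rule suminf_add[symmetric]) auto
    then show "(\<Sum>i. ennreal a * emeasure F (A i) + ennreal b * emeasure G (A i)) =
        ennreal a * emeasure F (\<Union> (range A)) + ennreal b * emeasure G (\<Union> (range A))"
      using suminf_emeasure[of A F] suminf_emeasure[of A G] A assms by simp
  qed
qed

lemma nn_integral_msum:
  assumes F: "sets F = sets borel" and G: "sets G = sets borel" and f: "f \<in> borel_measurable borel"
  shows "(\<integral>\<^sup>+x. f x \<partial>msum a F b G) = ennreal a * (\<integral>\<^sup>+x. f x \<partial>F) + ennreal b * (\<integral>\<^sup>+x. f x \<partial>G)"
  using f
proof (induction rule: borel_measurable_induct)
  case (cong f g)
  then show ?case by (simp cong: nn_integral_cong)
next
  case (set A)
  then show ?case using F G by (simp add: emeasure_msum)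
next
  case (mult u c)
  have [measurable]: "u \<in> borel_measurable F" "u \<in> borel_measurable G" "u \<in> borel_measurable borel"
    using mult(2) F G by (auto cong: measurable_cong_sets)
  show ?case by (simp add: nn_integral_cmult mult distrib_left ac_simps)
next
  case (add u v)
  have [measurable]: "u \<in> borel_measurable F" "u \<in> borel_measurable G" "u \<in> borel_measurable borel"
    "v \<in> borel_measurable F" "v \<in> borel_measurable G" "v \<in> borel_measurable borel"
    using add F G by (auto cong: measurable_cong_sets)
  show ?case by (simp add: nn_integral_add add distrib_left ac_simps)
next
  case (seq U)
  have [measurable]: "U i \<in> borel_measurable F" "U i \<in> borel_measurable G" "U i \<in> borel_measurable borel" for i
    using seq(1) F G by (auto cong: measurable_cong_sets)
  have inc: "incseq (\<lambda>i. ennreal c * \<integral>\<^sup>+ x. U i x \<partial>H)" for c H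
    using seq(3) by (auto simp: incseq_def le_fun_def intro!: mult_left_mono nn_integral_mono)
  have sup: "(SUP i. U i) x = (SUP i. U i x)" for x by (simp add: image_comp)
  have "(\<integral>\<^sup>+x. (SUP i. U i) x \<partial>msum a F b G) = (SUP i. ennreal a * (\<integral>\<^sup>+x. U i x \<partial>F) + ennreal b * (\<integral>\<^sup>+x. U i x \<partial>G))"
    unfolding sup using seq by (simp add: nn_integral_monotone_convergence_SUP)
  also have "\<dots> = (SUP i. ennreal a * (\<integral>\<^sup>+x. U i x \<partial>F)) + (SUP i. ennreal b * (\<integral>\<^sup>+x. U i x \<partial>G))"
    by (rule ennreal_SUP_add[OF inc inc])
  also have "\<dots> = ennreal a * (\<integral>\<^sup>+x. (SUP i. U i) x \<partial>F) + ennreal b * (\<integral>\<^sup>+x. (SUP i. U i) x \<partial>G)"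
    unfolding sup using seq by (simp add: nn_integral_monotone_convergence_SUP SUP_mult_left_ennreal)
  finally show ?case .
qed

lemma integral_msum:
  fixes f :: "real \<Rightarrow> complex"
  assumes sets: "sets F = sets borel" "sets G = sets borel" and ab: "0 \<le> a" "0 \<le> b"
    and int: "integrable F f" "integrable G f"
  shows "(\<integral>x. f x \<partial>msum a F b G) = a * (\<integral>x. f x \<partial>F) + b * (\<integral>x. f x \<partial>G)"
    and "integrable (msum a F b G) f"
proof -
  have real: "integrable (msum a F b G) h \<and> (\<integral>x. h x \<partial>msum a F b G) = a * (\<integral>x. h x \<partial>F) + b * (\<integral>x. h x \<partial>G)"
    if h: "integrable F h" "integrable G h" for h :: "real \<Rightarrow> real"
  proof -
    have hb [measurable]: "h \<in> borel_measurable borel"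
      using h(1) sets(1) by (metis borel_measurable_integrable measurable_cong_sets)
    have fin: "(\<integral>\<^sup>+x. ennreal (h' x) \<partial>H) < \<infinity>"
      if "h' = h \<or> h' = (\<lambda>x. - h x)" "H = F \<or> H = G" for h' H
    proof -
      have "integrable H h'" using that h by auto
      then have "(\<integral>\<^sup>+x. ennreal (norm (h' x)) \<partial>H) < \<infinity>" by (simp add: integrable_iff_bounded)
      moreover have "(\<integral>\<^sup>+x. ennreal (h' x) \<partial>H) \<le> (\<integral>\<^sup>+x. ennreal (norm (h' x)) \<partial>H)"
        by (intro nn_integral_mono ennreal_leI) auto
      ultimately show ?thesis by (rule le_less_trans[rotated])
    qed
    have norm_fin: "(\<integral>\<^sup>+x. ennreal (norm (h x)) \<partial>H) < \<infinity>" if "H = F \<or> H = G" for H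
      using that h by (auto simp: integrable_iff_bounded)
    have int_m: "integrable (msum a F b G) h"
      unfolding integrable_iff_bounded
    proof
      show "(\<integral>\<^sup>+x. ennreal (norm (h x)) \<partial>msum a F b G) < \<infinity>"
        using norm_fin[of F] norm_fin[of G] by (subst nn_integral_msum[OF sets]) (auto simp: ennreal_mult_less_top)
    qed (use hb in measurable)
    have split: "enn2real (\<integral>\<^sup>+x. ennreal (h' x) \<partial>msum a F b G) =
        a * enn2real (\<integral>\<^sup>+x. ennreal (h' x) \<partial>F) + b * enn2real (\<integral>\<^sup>+x. ennreal (h' x) \<partial>G)"
      if "h' = h \<or> h' = (\<lambda>x. - h x)" for h'
    proof -
      have m: "(\<lambda>x. ennreal (h' x)) \<in> borel_measurable borel" using that by auto
      show ?thesis
        using fin[OF that, of F] fin[OF that, of G] ab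
        by (subst nn_integral_msum[OF sets m]) (simp add: enn2real_plus ennreal_mult_less_top enn2real_mult)
    qed
    show ?thesis
      using int_m split[of h] split[of "\<lambda>x. - h x"]
      by (simp add: real_lebesgue_integral_def h algebra_simps)
  qed
  have Re: "integrable F (\<lambda>x. Re (f x))" "integrable G (\<lambda>x. Re (f x))"
    and Im: "integrable F (\<lambda>x. Im (f x))" "integrable G (\<lambda>x. Im (f x))"
    using int by auto
  have i: "integrable (msum a F b G) (\<lambda>x. Re (f x))" "integrable (msum a F b G) (\<lambda>x. Im (f x))"
    using real[OF Re] real[OF Im] by auto
  then have "integrable (msum a F b G) (\<lambda>x. complex_of_real (Re (f x)) + \<i> * complex_of_real (Im (f x)))"
    by (intro Bochner_Integration.integrable_add integrable_mult_right integrable_of_real)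
  then show f: "integrable (msum a F b G) f" by (simp flip: complex_eq)
  show "(\<integral>x. f x \<partial>msum a F b G) = a * (\<integral>x. f x \<partial>F) + b * (\<integral>x. f x \<partial>G)"
    using real[OF Re] real[OF Im] f int
    by (simp add: complex_eq_iff flip: integral_Re integral_Im)
qed

lemma nonneg_finite_measure_msum:
  assumes "nonneg_finite_measure F" "nonneg_finite_measure G" "0 \<le> a" "0 \<le> b"
  shows "nonneg_finite_measure (msum a F b G)"
    and "\<And>A. A \<in> sets borel \<Longrightarrow> measure (msum a F b G) A = a * measure F A + b * measure G A"
    and "\<And>\<zeta>. 0 \<le> Re \<zeta> \<Longrightarrow> lst (msum a F b G) \<zeta> = a * lst F \<zeta> + b * lst G \<zeta>"
proof -
  interpret F: nonneg_finite_measure F by fact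
  interpret G: nonneg_finite_measure G by fact
  have em: "emeasure (msum a F b G) A = ennreal (a * measure F A + b * measure G A)" if "A \<in> sets borel" for A
    using assms(3,4) that
    by (simp add: emeasure_msum F.sets_F G.sets_F F.lap.emeasure_eq_measure G.lap.emeasure_eq_measure
        flip: ennreal_mult ennreal_plus)
  show m: "measure (msum a F b G) A = a * measure F A + b * measure G A" if "A \<in> sets borel" for A
  proof -
    have "0 \<le> a * measure F A + b * measure G A" using assms(3,4) by simp
    then show ?thesis unfolding measure_def[of "msum a F b G"] em[OF that] by (rule enn2real_ennreal)
  qed
  show "nonneg_finite_measure (msum a F b G)"
  proof (rule nonneg_finite_measure.intro)
    show "finite_measure (msum a F b G)"
      by (rule finite_measureI) (simp add: em)
    show "measure (msum a F b G) {..<0} = 0" by (simp add: m F.null_neg G.null_neg)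
  qed simp
  show "lst (msum a F b G) \<zeta> = a * lst F \<zeta> + b * lst G \<zeta>" if "0 \<le> Re \<zeta>" for \<zeta>
    unfolding lst_def using integral_msum(1)[OF F.sets_F G.sets_F assms(3,4)]
      F.lst_integrable[OF that] G.lst_integrable[OF that] by simp
qed

section \<open>Exponential, Erlang and stationary-excess transforms\<close>

lemma integral_exp_Icc:
  assumes "0 \<le> x"
  shows "c * (\<integral>t. indicator {0..x} t *\<^sub>R exp (- c * complex_of_real t) \<partial>lborel) = 1 - exp (- c * complex_of_real x)"
proof -
  have "(\<integral>t. indicator {0..x} t *\<^sub>R (c * exp (- c * complex_of_real t)) \<partial>lborel)
      = - exp (- c * complex_of_real x) - (- exp (- c * complex_of_real 0))"
    by (rule integral_FTC_Icc[OF assms])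
      (auto intro!: has_vector_derivative_real_field derivative_eq_intros continuous_intros)
  moreover have "(\<integral>t. indicator {0..x} t *\<^sub>R (c * exp (- c * complex_of_real t)) \<partial>lborel)
     = c * (\<integral>t. indicator {0..x} t *\<^sub>R exp (- c * complex_of_real t) \<partial>lborel)"
    by (simp flip: integral_mult_right_zero add: ac_simps)
  ultimately show ?thesis by simp
qed

lemma integrable_exp_Icc:
  "integrable lborel (\<lambda>t. indicator {0..x::real} t *\<^sub>R exp (- c * complex_of_real t))"
  by (rule borel_integrable_compact) (auto intro!: continuous_intros)

lemma emeasure_exponential_Ioi:
  assumes "0 < l" "0 \<le> x"
  shows "measure (density lborel (exponential_density l)) {x<..} = exp (- l * x)"
proof -
  interpret T: prob_space "density lborel (exponential_density l)"
    using assms by (intro prob_space_exponential_density)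
  have "T.prob {..x} = 1 - exp (- l * x)"
    using assms by (simp add: measure_def emeasure_erlang_density erlang_CDF_0)
  moreover have "T.prob {x<..} = 1 - T.prob {..x}"
    by (subst T.prob_compl[symmetric]) (auto simp: Compl_eq_Diff_UNIV[symmetric] intro!: arg_cong[where f = T.prob])
  ultimately show ?thesis by simp
qed

text \<open>The computation behind both the balance equations and the overshoot formula: the first summand
  on the right is the transform of \<open>x - t\<close>, the second corrects for the reflection at \<open>0\<close>. Multiplying by
  \<open>l - \<zeta>\<close> instead of dividing keeps the identity valid at \<open>\<zeta> = l\<close>.\<close>

lemma exponential_reflected_transform:
  assumes l: "0 < l" and x: "0 \<le> x"
  shows "(complex_of_real l - \<zeta>) *
      (\<integral>t. exp (- \<zeta> * complex_of_real (max 0 (x - t))) \<partial>density lborel (exponential_density l))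
    = complex_of_real l * exp (- \<zeta> * complex_of_real x) - \<zeta> * exp (- complex_of_real l * complex_of_real x)"
proof -
  let ?T = "density lborel (exponential_density l)"
  interpret T: prob_space ?T using l by (intro prob_space_exponential_density)
  let ?c = "complex_of_real l - \<zeta>"
  let ?g = "\<lambda>t. indicator {0..x} t *\<^sub>R exp (- ?c * complex_of_real t)"
  have nn: "AE t in lborel. 0 \<le> exponential_density l t" using l by (simp add: exponential_density_nonneg)
  have Ioi: "(\<integral>t. exponential_density l t *\<^sub>R complex_of_real (indicator {x<..} t) \<partial>lborel) = exp (- l * x)"
    (is "?I = _")
    and int: "integrable lborel (\<lambda>t. exponential_density l t *\<^sub>R complex_of_real (indicator {x<..} t))"
  proof -
    have "?I = (\<integral>t. complex_of_real (indicator {x<..} t) \<partial>?T)"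
      using nn by (subst integral_density) auto
    also have "\<dots> = exp (- l * x)"
      using emeasure_exponential_Ioi[OF assms] by simp
    finally show "?I = exp (- l * x)" .
    have "integrable ?T (\<lambda>t. complex_of_real (indicator {x<..} t))"
      by (rule T.integrable_const_bound[where B = 1]) (auto simp: indicator_def)
    then show "integrable lborel (\<lambda>t. exponential_density l t *\<^sub>R complex_of_real (indicator {x<..} t))"
      using nn by (subst (asm) integrable_density) auto
  qed
  have "(\<integral>t. exp (- \<zeta> * complex_of_real (max 0 (x - t))) \<partial>?T)
      = (\<integral>t. exponential_density l t *\<^sub>R exp (- \<zeta> * complex_of_real (max 0 (x - t))) \<partial>lborel)"
    using nn by (subst integral_density) auto
  also have "\<dots> = (\<integral>t. complex_of_real l * exp (- \<zeta> * complex_of_real x) * ?g t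
       + exponential_density l t *\<^sub>R complex_of_real (indicator {x<..} t) \<partial>lborel)"
  proof (intro Bochner_Integration.integral_cong refl)
    fix t :: real
    show "exponential_density l t *\<^sub>R exp (- \<zeta> * complex_of_real (max 0 (x - t))) =
      complex_of_real l * exp (- \<zeta> * complex_of_real x) * ?g t
       + exponential_density l t *\<^sub>R complex_of_real (indicator {x<..} t)"
    proof (cases "t \<in> {0..x}")
      case True
      have "exp (- \<zeta> * complex_of_real x) * exp (- ?c * complex_of_real t)
          = complex_of_real (exp (- t * l)) * exp (- \<zeta> * complex_of_real (x - t))"
        unfolding exp_of_real[symmetric] mult_exp_exp by (simp add: algebra_simps)
      then show ?thesis using True
        by (simp add: exponential_density_def scaleR_conv_of_real max_def)
    next
      case False
      then show ?thesis using x by (auto simp: exponential_density_def max_def)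
    qed
  qed
  also have "\<dots> = complex_of_real l * exp (- \<zeta> * complex_of_real x) * (\<integral>t. ?g t \<partial>lborel) + exp (- l * x)"
    by (subst Bochner_Integration.integral_add[OF integrable_mult_right[OF integrable_exp_Icc] int])
      (simp only: Ioi integral_mult_right_zero)
  finally have "?c * (\<integral>t. exp (- \<zeta> * complex_of_real (max 0 (x - t))) \<partial>?T) =
     complex_of_real l * exp (- \<zeta> * complex_of_real x) * (?c * (\<integral>t. ?g t \<partial>lborel)) + ?c * exp (- l * x)"
    by (simp add: algebra_simps)
  also have "\<dots> = complex_of_real l * exp (- \<zeta> * complex_of_real x) * (1 - exp (- ?c * complex_of_real x)) + ?c * exp (- l * x)"
    by (subst integral_exp_Icc[OF x]) simp
  also have "\<dots> = complex_of_real l * exp (- \<zeta> * complex_of_real x) - \<zeta> * exp (- complex_of_real l * complex_of_real x)"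
  proof -
    have "exp (- \<zeta> * complex_of_real x) * exp (- ?c * complex_of_real x) = exp (- complex_of_real l * complex_of_real x)"
      unfolding mult_exp_exp by (simp add: algebra_simps)
    moreover have "complex_of_real (exp (- l * x)) = exp (- complex_of_real l * complex_of_real x)"
      unfolding exp_of_real[symmetric] by simp
    ultimately show ?thesis by (simp add: algebra_simps)
  qed
  finally show ?thesis .
qed

lemma excess_density_measurable:
  assumes F: "nonneg_dist F"
  shows "(\<lambda>x. if 0 \<le> x then measure F {x<..} / mean F else 0) \<in> borel_measurable borel"
proof -
  interpret real_distribution F using F by (simp add: nonneg_dist_def)
  define G where "G = (\<lambda>x. measure F {x<..})"
  have "G = (\<lambda>x. 1 - cdf F x)"
    unfolding G_def
  proof
    fix x
    have "space F - {..x} = {x<..}" by auto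
    then show "measure F {x<..} = 1 - cdf F x"
      using prob_compl[of "{..x}"] by (simp add: cdf_def)
  qed
  moreover have "mono (cdf F)" by (auto intro!: monoI cdf_nondecreasing)
  then have "(\<lambda>x. 1 - cdf F x) \<in> borel_measurable borel"
    by (intro borel_measurable_diff borel_measurable_const borel_measurable_mono)
  ultimately have "G \<in> borel_measurable borel" by (simp only:)
  then have "(\<lambda>x. indicator {0..} x * (G x / mean F)) \<in> borel_measurable borel"
    by (intro borel_measurable_times borel_measurable_divide borel_measurable_const borel_measurable_indicator)
      simp
  moreover have "(\<lambda>x. indicator {0..} x * (G x / mean F)) = (\<lambda>x. if 0 \<le> x then measure F {x<..} / mean F else 0)"
    by (auto simp: indicator_def G_def)
  ultimately show ?thesis by (simp only:)
qed

text \<open>Integrating \<open>exp (- \<zeta> x)\<close> over \<open>0 \<le> x < b\<close> and then over the law of \<open>b\<close>, in either order.\<close>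

lemma lst_excess:
  assumes F: "nonneg_dist F" and int: "integrable F (\<lambda>t. t)" and mean: "mean F \<noteq> 0"
    and \<zeta>: "0 \<le> Re \<zeta>"
  shows "\<zeta> * (mean F * lst (excess F) \<zeta>) = 1 - lst F \<zeta>"
proof -
  interpret F: nonneg_finite_measure F using F by (rule nonneg_finite_measureI_dist)
  interpret real_distribution F using F by (simp add: nonneg_dist_def)
  interpret pair_sigma_finite lborel F ..
  note [measurable_cong] = F.sets_F
  let ?e = "\<lambda>x. exp (- \<zeta> * complex_of_real x)"
  \<comment> \<open>\<open>?f\<close> and \<open>?h\<close> differ only for \<open>x = b\<close>: the strict inequality matches the tail \<open>F((x, \<infinity>))\<close>,
      the closed interval the integral over \<open>{0..b}\<close>.\<close>
  let ?f = "\<lambda>x b. indicator {0..b} x *\<^sub>R ?e x"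
  let ?h = "\<lambda>x b. indicator {(x, b). 0 \<le> x \<and> x < b} (x, b) *\<^sub>R ?e x"
  have mean_pos: "0 < mean F"
    using mean integral_nonneg_AE[OF F.AE_nonneg] by (simp add: mean_def)
  have meas [measurable]: "(\<lambda>(x, b). ?h x b) \<in> borel_measurable (lborel \<Otimes>\<^sub>M F)"
  proof -
    have "{p \<in> space (borel \<Otimes>\<^sub>M borel). 0 \<le> fst p \<and> fst p < (snd p :: real)} \<in> sets (borel \<Otimes>\<^sub>M borel)"
      by measurable
    then have [measurable]: "{p :: real \<times> real. 0 \<le> fst p \<and> fst p < snd p} \<in> sets (borel \<Otimes>\<^sub>M borel)"
      by (simp add: space_pair_measure)
    then have "{p. 0 \<le> fst p \<and> fst p < snd p} \<in> sets (lborel \<Otimes>\<^sub>M F)"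
      unfolding sets_pair_measure_cong[OF sets_lborel F.sets_F] .
    then have "(\<lambda>p. indicator {p. 0 \<le> fst p \<and> fst p < snd p} p *\<^sub>R ?e (fst p)) \<in> borel_measurable (lborel \<Otimes>\<^sub>M F)"
      by (intro borel_measurable_scaleR borel_measurable_indicator) measurable
    then show ?thesis by (simp only: split_beta' fst_conv snd_conv prod.collapse)
  qed
  have intg: "integrable (lborel \<Otimes>\<^sub>M F) (\<lambda>(x, b). ?h x b)"
  proof (rule integrableI_bounded)
    have "(\<integral>\<^sup>+p. norm (case p of (x, b) \<Rightarrow> ?h x b) \<partial>(lborel \<Otimes>\<^sub>M F))
        = (\<integral>\<^sup>+b. \<integral>\<^sup>+x. norm (?h x b) \<partial>lborel \<partial>F)"
      by (rule nn_integral_snd[of "\<lambda>p. ennreal (norm (case p of (x, b) \<Rightarrow> ?h x b))", simplified prod.case, symmetric])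
        (use meas in measurable)
    also have "\<dots> \<le> (\<integral>\<^sup>+b. \<integral>\<^sup>+x. indicator {0..b} x \<partial>lborel \<partial>F)"
      by (intro nn_integral_mono) (use \<zeta> in \<open>auto simp: indicator_def norm_exp_eq_Re\<close>)
    also have "\<dots> = (\<integral>\<^sup>+b. ennreal b \<partial>F)"
    proof (rule nn_integral_cong_AE)
      show "AE b in F. (\<integral>\<^sup>+x. indicator {0..b} x \<partial>lborel) = ennreal b"
        using F.AE_nonneg by eventually_elim simp
    qed
    also have "\<dots> < \<infinity>"
    proof -
      have "(\<integral>\<^sup>+b. ennreal (norm b) \<partial>F) < \<infinity>" using int by (simp add: integrable_iff_bounded)
      moreover have "(\<integral>\<^sup>+b. ennreal b \<partial>F) \<le> (\<integral>\<^sup>+b. ennreal (norm b) \<partial>F)"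
        by (intro nn_integral_mono ennreal_leI) auto
      ultimately show ?thesis by (rule le_less_trans[rotated])
    qed
    finally show "(\<integral>\<^sup>+p. norm (case p of (x, b) \<Rightarrow> ?h x b) \<partial>(lborel \<Otimes>\<^sub>M F)) < \<infinity>" .
  qed (rule meas)
  have "mean F * lst (excess F) \<zeta> = mean F * (\<integral>x. (if 0 \<le> x then measure F {x<..} / mean F else 0) *\<^sub>R ?e x \<partial>lborel)"
  proof -
    have "(\<integral>x. ?e x \<partial>excess F) = (\<integral>x. (if 0 \<le> x then measure F {x<..} / mean F else 0) *\<^sub>R ?e x \<partial>lborel)"
      unfolding excess_def
    proof (rule integral_density)
      show "AE x in lborel. 0 \<le> (if 0 \<le> x then measure F {x<..} / mean F else 0)"
        by (rule AE_I2) (use mean_pos in \<open>simp add: less_imp_le\<close>)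
      show "?e \<in> borel_measurable lborel" by measurable
      show "(\<lambda>x. if 0 \<le> x then measure F {x<..} / mean F else 0) \<in> borel_measurable lborel"
        using excess_density_measurable[OF F] by (simp only: measurable_lborel2)
    qed
    then show ?thesis by (simp only: lst_def)
  qed
  also have "\<dots> = (\<integral>x. complex_of_real (mean F) * ((if 0 \<le> x then measure F {x<..} / mean F else 0) *\<^sub>R ?e x) \<partial>lborel)"
    by (rule integral_mult_right_zero[symmetric])
  also have "\<dots> = (\<integral>x. \<integral>b. ?h x b \<partial>F \<partial>lborel)"
  proof (intro Bochner_Integration.integral_cong refl)
    fix x :: real
    have "(\<integral>b. ?h x b \<partial>F) = (\<integral>b. (if 0 \<le> x then ?e x else 0) * complex_of_real (indicator {x<..} b) \<partial>F)"
      by (intro Bochner_Integration.integral_cong) (auto simp: indicator_def)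
    also have "\<dots> = (if 0 \<le> x then ?e x else 0) * complex_of_real (measure F {x<..})"
      by (simp add: F.sets_F)
    finally show "complex_of_real (mean F) * ((if 0 \<le> x then measure F {x<..} / mean F else 0) *\<^sub>R ?e x) = (\<integral>b. ?h x b \<partial>F)"
      using mean by (simp add: scaleR_conv_of_real)
  qed
  also have "\<dots> = (\<integral>b. \<integral>x. ?h x b \<partial>lborel \<partial>F)"
    using Fubini_integral[OF intg] by simp
  also have "\<dots> = (\<integral>b. \<integral>x. ?f x b \<partial>lborel \<partial>F)"
  proof (rule Bochner_Integration.integral_cong[OF refl])
    fix b :: real
    show "(\<integral>x. ?h x b \<partial>lborel) = (\<integral>x. ?f x b \<partial>lborel)"
    proof (rule integral_cong_AE)
      have "AE x in lborel. x \<noteq> b" by (rule AE_lborel_singleton)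
      then show "AE x in lborel. ?h x b = ?f x b" by eventually_elim (auto simp: indicator_def)
      have "(\<lambda>x. ?h x b) = (\<lambda>x. indicator {0..<b} x *\<^sub>R ?e x)" by (auto simp: indicator_def)
      then show "(\<lambda>x. ?h x b) \<in> borel_measurable lborel" by simp
    qed simp
  qed
  finally have "\<zeta> * (mean F * lst (excess F) \<zeta>) = \<zeta> * (\<integral>b. \<integral>x. ?f x b \<partial>lborel \<partial>F)" by (rule arg_cong)
  also have "\<dots> = (\<integral>b. \<zeta> * (\<integral>x. ?f x b \<partial>lborel) \<partial>F)" by simp
  also have "\<dots> = (\<integral>b. 1 - ?e b \<partial>F)"
  proof (rule integral_cong_AE)
    show "AE b in F. \<zeta> * (\<integral>x. ?f x b \<partial>lborel) = 1 - ?e b"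
      using F.AE_nonneg by eventually_elim (rule integral_exp_Icc)
    show "(\<lambda>b. \<zeta> * (\<integral>x. ?f x b \<partial>lborel)) \<in> borel_measurable F"
    proof -
      have "{p \<in> space (borel \<Otimes>\<^sub>M borel). 0 \<le> snd p \<and> snd p \<le> (fst p :: real)} \<in> sets (borel \<Otimes>\<^sub>M borel)"
        by measurable
      then have [measurable]: "{p :: real \<times> real. 0 \<le> snd p \<and> snd p \<le> fst p} \<in> sets (borel \<Otimes>\<^sub>M borel)"
        by (simp add: space_pair_measure)
      then have "{p. 0 \<le> snd p \<and> snd p \<le> fst p} \<in> sets (F \<Otimes>\<^sub>M lborel)"
        unfolding sets_pair_measure_cong[OF F.sets_F sets_lborel] .
      then have "(\<lambda>p. indicator {p. 0 \<le> snd p \<and> snd p \<le> fst p} p *\<^sub>R ?e (snd p)) \<in> borel_measurable (F \<Otimes>\<^sub>M lborel)"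
        by (intro borel_measurable_scaleR borel_measurable_indicator) measurable
      then have "(\<lambda>(b, x). indicator {p :: real \<times> real. 0 \<le> snd p \<and> snd p \<le> fst p} (b, x) *\<^sub>R ?e x)
          \<in> borel_measurable (F \<Otimes>\<^sub>M lborel)"
        by (simp only: split_beta' prod.collapse)
      from lborel.borel_measurable_lebesgue_integral[OF this]
      have "(\<lambda>b. \<integral>x. indicator {p. 0 \<le> snd p \<and> snd p \<le> fst p} (b, x) *\<^sub>R ?e x \<partial>lborel) \<in> borel_measurable F"
        by simp
      moreover have "(\<lambda>b. \<integral>x. indicator {p. 0 \<le> snd p \<and> snd p \<le> fst p} (b, x) *\<^sub>R ?e x \<partial>lborel)
         = (\<lambda>b. \<integral>x. ?f x b \<partial>lborel)"
        by (intro ext Bochner_Integration.integral_cong) (auto simp: indicator_def)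
      ultimately show ?thesis by (simp only: borel_measurable_const borel_measurable_times)
    qed
    show "(\<lambda>b. 1 - ?e b) \<in> borel_measurable F" by measurable
  qed
  also have "\<dots> = (\<integral>b. 1 \<partial>F) - (\<integral>b. ?e b \<partial>F)"
    by (rule Bochner_Integration.integral_diff[OF _ F.lst_integrable[OF \<zeta>]]) simp
  also have "(\<integral>b. 1 \<partial>F) = (1 :: complex)"
    using prob_space by simp
  also have "1 - (\<integral>b. ?e b \<partial>F) = 1 - lst F \<zeta>"
    unfolding lst_def ..
  finally show ?thesis .
qed

lemma nonneg_finite_measure_erlang:
  assumes l: "0 < l"
  shows "nonneg_finite_measure (density lborel (erlang_density k l))"
proof -
  let ?F = "density lborel (erlang_density k l)"
  interpret P: prob_space ?F using l by (rule prob_space_erlang_density)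
  have "emeasure ?F {..<0} \<le> emeasure ?F {..0}" by (intro emeasure_mono) auto
  also have "\<dots> = 0" using l by (simp add: emeasure_erlang_density erlang_CDF_at0)
  finally have "P.prob {..<0} = 0" by (simp add: P.emeasure_eq_measure)
  then show ?thesis by (intro nonneg_finite_measure.intro P.finite_measure_axioms) simp_all
qed

text \<open>For real \<open>\<zeta>\<close> the integrand is a multiple of an Erlang density with rate \<open>l + \<zeta>\<close>; analytic
  continuation reaches the open right half-plane and continuity its boundary.\<close>

lemma lst_erlang:
  assumes l: "0 < l" and \<zeta>: "0 \<le> Re \<zeta>"
  shows "lst (density lborel (erlang_density k l)) \<zeta> =
    complex_of_real l ^ (k + 1) / (\<zeta> + complex_of_real l) ^ (k + 1)"
proof -
  let ?F = "density lborel (erlang_density k l)"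
  interpret F: nonneg_finite_measure ?F using l by (rule nonneg_finite_measure_erlang)
  let ?h = "\<lambda>\<zeta>. complex_of_real l ^ (k + 1) / (\<zeta> + complex_of_real l) ^ (k + 1)"
  have nz: "\<zeta> + complex_of_real l \<noteq> 0" if "0 \<le> Re \<zeta>" for \<zeta>
    using that l by (auto simp: complex_eq_iff)
  have real: "lst ?F (complex_of_real x) = ?h (complex_of_real x)" if x: "0 < x" for x
  proof -
    have nn: "AE t in lborel. 0 \<le> erlang_density k l t" using l by simp
    have "lst ?F (complex_of_real x) = (\<integral>t. erlang_density k l t *\<^sub>R exp (- complex_of_real x * complex_of_real t) \<partial>lborel)"
      unfolding lst_def using nn by (subst integral_density) auto
    also have "\<dots> = (\<integral>t. complex_of_real ((l / (l + x)) ^ (k + 1) * erlang_density k (l + x) t) \<partial>lborel)"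
    proof (intro Bochner_Integration.integral_cong refl)
      fix t :: real
      have "erlang_density k l t * exp (- x * t) = (l / (l + x)) ^ (k + 1) * erlang_density k (l + x) t"
      proof (cases "t < 0")
        case False
        have "exp (- l * t) * exp (- x * t) = exp (- (l + x) * t)"
          unfolding mult_exp_exp by (simp add: algebra_simps)
        then have "erlang_density k l t * exp (- x * t) = l ^ (k + 1) * t ^ k * exp (- (l + x) * t) / fact k"
          using False by (simp add: erlang_density_def)
        also have "\<dots> = (l / (l + x)) ^ (k + 1) * erlang_density k (l + x) t"
        proof -
          have "(l / (l + x)) ^ (k + 1) * (l + x) ^ (k + 1) = l ^ (k + 1)"
            using l x by (simp add: power_mult_distrib[symmetric] del: power_Suc)
          then show ?thesis using False by (simp add: erlang_density_def mult.assoc[symmetric])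
        qed
        finally show ?thesis .
      qed (simp add: erlang_density_def)
      then show "erlang_density k l t *\<^sub>R exp (- complex_of_real x * complex_of_real t) =
         complex_of_real ((l / (l + x)) ^ (k + 1) * erlang_density k (l + x) t)"
        by (metis of_real_minus of_real_mult exp_of_real scaleR_conv_of_real)
    qed
    also have "\<dots> = complex_of_real ((l / (l + x)) ^ (k + 1) * (\<integral>t. erlang_density k (l + x) t \<partial>lborel))"
      by simp
    also have "(\<integral>t. erlang_density k (l + x) t \<partial>lborel) = 1"
    proof -
      interpret Q: prob_space "density lborel (erlang_density k (l + x))"
        using l x by (intro prob_space_erlang_density) simp
      have "(\<integral>t. erlang_density k (l + x) t *\<^sub>R (1::real) \<partial>lborel) = (\<integral>t. 1 \<partial>density lborel (erlang_density k (l + x)))"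
        by (subst integral_density) (use l x in auto)
      then show ?thesis using Q.prob_space by simp
    qed
    finally show ?thesis by (simp add: power_divide add.commute)
  qed
  have pos: "lst ?F \<zeta> = ?h \<zeta>" if "0 < Re \<zeta>" for \<zeta>
  proof -
    have "lst ?F \<zeta> - ?h \<zeta> = 0"
    proof (rule analytic_continuation[where f = "\<lambda>\<zeta>. lst ?F \<zeta> - ?h \<zeta>" and w = \<zeta> and S = "{\<zeta>. 0 < Re \<zeta>}" and U = "complex_of_real ` {0<..}" and \<xi> = 1])
      show "(\<lambda>\<zeta>. lst ?F \<zeta> - ?h \<zeta>) holomorphic_on {\<zeta>. 0 < Re \<zeta>}"
        by (intro holomorphic_intros F.lst_holomorphic) (use nz in \<open>auto simp: less_imp_le\<close>)
      show "connected {\<zeta>. 0 < Re \<zeta>}"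
        by (intro convex_connected convex_halfspace_Re_gt)
      show "1 islimpt complex_of_real ` {0<..}"
        unfolding islimpt_approachable
      proof (intro allI impI)
        fix e :: real assume "0 < e"
        then show "\<exists>x'\<in>complex_of_real ` {0<..}. x' \<noteq> 1 \<and> dist x' 1 < e"
          by (intro bexI[of _ "complex_of_real (1 + e / 2)"] conjI image_eqI[OF refl]) (auto simp: dist_norm)
      qed
    qed (use real that in \<open>auto simp: open_halfspace_Re_gt\<close>)
    then show ?thesis by simp
  qed
  define e where "e n = complex_of_real (inverse (real (Suc n)))" for n
  have e0: "e \<longlonglongrightarrow> 0"
    unfolding e_def using tendsto_of_real[OF LIMSEQ_inverse_real_of_nat] unfolding of_real_0 .
  have eRe: "0 < Re (\<zeta> + e n)" for n
    using \<zeta> by (simp add: e_def add_nonneg_pos)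
  have lim: "(\<lambda>n. \<zeta> + e n) \<longlonglongrightarrow> \<zeta>"
    using tendsto_add[OF tendsto_const e0, of \<zeta>] by simp
  have "(\<lambda>n. lst ?F (\<zeta> + e n)) \<longlonglongrightarrow> lst ?F \<zeta>"
    by (rule continuous_on_tendsto_compose[OF F.lst_continuous lim])
      (use \<zeta> eRe in \<open>auto intro!: always_eventually less_imp_le\<close>)
  moreover have "(\<lambda>n. lst ?F (\<zeta> + e n)) \<longlonglongrightarrow> ?h \<zeta>"
    unfolding pos[OF eRe] by (intro tendsto_intros lim) (use nz[OF \<zeta>] in auto)
  ultimately show ?thesis by (rule LIMSEQ_unique)
qed

section \<open>Signed measures and their tails\<close>

lemma laplace_inversion_tail_iff:
  "laplace_inversion_tail \<theta> T \<longleftrightarrow> (\<exists>\<mu> \<nu>. nonneg_finite_measure \<mu> \<and> nonneg_finite_measure \<nu> \<and>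
     (\<forall>\<zeta>. 0 \<le> Re \<zeta> \<longrightarrow> \<theta> \<zeta> = lst \<mu> \<zeta> - lst \<nu> \<zeta>) \<and>
     (\<forall>t\<ge>0. T t = complex_of_real (measure \<mu> {t<..} - measure \<nu> {t<..})))"
  unfolding laplace_inversion_tail_def nonneg_finite_measure_def by blast

text \<open>Only real multiples of a signed measure are again signed measures; a negative factor exchanges
  the two parts of the difference.\<close>

lemma laplace_inversion_tail_scale:
  assumes "laplace_inversion_tail \<theta> T"
  shows "laplace_inversion_tail (\<lambda>\<zeta>. complex_of_real a * \<theta> \<zeta>) (\<lambda>t. complex_of_real a * T t)"
proof -
  obtain \<mu> \<nu> where m: "nonneg_finite_measure \<mu>" "nonneg_finite_measure \<nu>"
    and \<theta>: "\<And>\<zeta>. 0 \<le> Re \<zeta> \<Longrightarrow> \<theta> \<zeta> = lst \<mu> \<zeta> - lst \<nu> \<zeta>"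
    and T: "\<And>t. 0 \<le> t \<Longrightarrow> T t = complex_of_real (measure \<mu> {t<..} - measure \<nu> {t<..})"
    using assms unfolding laplace_inversion_tail_iff by blast
  have a: "0 \<le> max a 0" "0 \<le> max (- a) 0" and split: "max a 0 - max (- a) 0 = a" by auto
  have split': "complex_of_real (max a 0) = complex_of_real a + complex_of_real (max (- a) 0)"
    using split by (simp flip: of_real_add)
  note P = nonneg_finite_measure_msum[OF m a] and N = nonneg_finite_measure_msum[OF m a(2,1)]
  show ?thesis
    unfolding laplace_inversion_tail_iff
    by (rule exI[of _ "msum (max a 0) \<mu> (max (- a) 0) \<nu>"], rule exI[of _ "msum (max (- a) 0) \<mu> (max a 0) \<nu>"])
      (simp add: P(1) N(1) P(2,3) N(2,3) \<theta> T split' algebra_simps)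
qed

lemma laplace_inversion_tail_add:
  assumes "laplace_inversion_tail \<theta> T" "laplace_inversion_tail \<theta>' T'"
  shows "laplace_inversion_tail (\<lambda>\<zeta>. \<theta> \<zeta> + \<theta>' \<zeta>) (\<lambda>t. T t + T' t)"
proof -
  obtain \<mu> \<nu> where m: "nonneg_finite_measure \<mu>" "nonneg_finite_measure \<nu>"
    and \<theta>: "\<And>\<zeta>. 0 \<le> Re \<zeta> \<Longrightarrow> \<theta> \<zeta> = lst \<mu> \<zeta> - lst \<nu> \<zeta>"
    and T: "\<And>t. 0 \<le> t \<Longrightarrow> T t = complex_of_real (measure \<mu> {t<..} - measure \<nu> {t<..})"
    using assms(1) unfolding laplace_inversion_tail_iff by blast
  obtain \<mu>' \<nu>' where m': "nonneg_finite_measure \<mu>'" "nonneg_finite_measure \<nu>'"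
    and \<theta>': "\<And>\<zeta>. 0 \<le> Re \<zeta> \<Longrightarrow> \<theta>' \<zeta> = lst \<mu>' \<zeta> - lst \<nu>' \<zeta>"
    and T': "\<And>t. 0 \<le> t \<Longrightarrow> T' t = complex_of_real (measure \<mu>' {t<..} - measure \<nu>' {t<..})"
    using assms(2) unfolding laplace_inversion_tail_iff by blast
  have one: "(0::real) \<le> 1" by simp
  note P = nonneg_finite_measure_msum[OF m(1) m'(1) one one] and N = nonneg_finite_measure_msum[OF m(2) m'(2) one one]
  show ?thesis
    unfolding laplace_inversion_tail_iff
    by (rule exI[of _ "msum 1 \<mu> 1 \<mu>'"], rule exI[of _ "msum 1 \<nu> 1 \<nu>'"])
      (simp add: P(1) N(1) P(2,3) N(2,3) \<theta> \<theta>' T T')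
qed

lemma laplace_inversion_tail_measure:
  assumes "nonneg_finite_measure \<mu>"
  shows "laplace_inversion_tail (lst \<mu>) (\<lambda>t. complex_of_real (measure \<mu> {t<..}))"
proof -
  have zero: "(0::real) \<le> 0" by simp
  note Z = nonneg_finite_measure_msum[OF assms assms zero zero]
  show ?thesis
    unfolding laplace_inversion_tail_iff
    by (rule exI[of _ \<mu>], rule exI[of _ "msum 0 \<mu> 0 \<mu>"]) (simp add: assms Z(1) Z(2,3))
qed

text \<open>The partial fraction coefficients may be complex, so the tails are combined over the complex numbers
  first; the imaginary part is shown to vanish only at the end.\<close>

definition complex_tail :: "(complex \<Rightarrow> complex) \<Rightarrow> (real \<Rightarrow> complex) \<Rightarrow> bool" where
  "complex_tail \<theta> T \<longleftrightarrow> (\<exists>\<theta>1 T1 \<theta>2 T2. laplace_inversion_tail \<theta>1 T1 \<and> laplace_inversion_tail \<theta>2 T2 \<and>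
     (\<forall>\<zeta>. 0 \<le> Re \<zeta> \<longrightarrow> \<theta> \<zeta> = \<theta>1 \<zeta> + \<i> * \<theta>2 \<zeta>) \<and> (\<forall>t\<ge>0. T t = T1 t + \<i> * T2 t))"

lemma complex_tail_cong:
  assumes "complex_tail \<theta> T" "\<And>\<zeta>. 0 \<le> Re \<zeta> \<Longrightarrow> \<theta>' \<zeta> = \<theta> \<zeta>" "\<And>t. 0 \<le> t \<Longrightarrow> T' t = T t"
  shows "complex_tail \<theta>' T'"
proof -
  obtain \<theta>1 T1 \<theta>2 T2 where "laplace_inversion_tail \<theta>1 T1" "laplace_inversion_tail \<theta>2 T2"
    "\<And>\<zeta>. 0 \<le> Re \<zeta> \<Longrightarrow> \<theta> \<zeta> = \<theta>1 \<zeta> + \<i> * \<theta>2 \<zeta>" "\<And>t. 0 \<le> t \<Longrightarrow> T t = T1 t + \<i> * T2 t"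
    using assms(1) unfolding complex_tail_def by blast
  then show ?thesis
    unfolding complex_tail_def
    by (intro exI[of _ \<theta>1] exI[of _ T1] exI[of _ \<theta>2] exI[of _ T2]) (simp add: assms(2,3))
qed

lemma complex_tail_add:
  assumes "complex_tail \<theta> T" "complex_tail \<theta>' T'"
  shows "complex_tail (\<lambda>\<zeta>. \<theta> \<zeta> + \<theta>' \<zeta>) (\<lambda>t. T t + T' t)"
proof -
  obtain \<theta>1 T1 \<theta>2 T2 where 1: "laplace_inversion_tail \<theta>1 T1" "laplace_inversion_tail \<theta>2 T2"
    "\<And>\<zeta>. 0 \<le> Re \<zeta> \<Longrightarrow> \<theta> \<zeta> = \<theta>1 \<zeta> + \<i> * \<theta>2 \<zeta>" "\<And>t. 0 \<le> t \<Longrightarrow> T t = T1 t + \<i> * T2 t"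
    using assms(1) unfolding complex_tail_def by blast
  obtain \<theta>1' T1' \<theta>2' T2' where 2: "laplace_inversion_tail \<theta>1' T1'" "laplace_inversion_tail \<theta>2' T2'"
    "\<And>\<zeta>. 0 \<le> Re \<zeta> \<Longrightarrow> \<theta>' \<zeta> = \<theta>1' \<zeta> + \<i> * \<theta>2' \<zeta>" "\<And>t. 0 \<le> t \<Longrightarrow> T' t = T1' t + \<i> * T2' t"
    using assms(2) unfolding complex_tail_def by blast
  show ?thesis
    unfolding complex_tail_def
    by (rule exI, rule exI, rule exI, rule exI, rule conjI[OF laplace_inversion_tail_add[OF 1(1) 2(1)]],
        rule conjI[OF laplace_inversion_tail_add[OF 1(2) 2(2)]])
      (simp add: 1(3,4) 2(3,4) algebra_simps)
qed

lemma complex_tail_scale: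
  assumes "complex_tail \<theta> T"
  shows "complex_tail (\<lambda>\<zeta>. c * \<theta> \<zeta>) (\<lambda>t. c * T t)"
proof -
  obtain \<theta>1 T1 \<theta>2 T2 where 1: "laplace_inversion_tail \<theta>1 T1" "laplace_inversion_tail \<theta>2 T2"
    "\<And>\<zeta>. 0 \<le> Re \<zeta> \<Longrightarrow> \<theta> \<zeta> = \<theta>1 \<zeta> + \<i> * \<theta>2 \<zeta>" "\<And>t. 0 \<le> t \<Longrightarrow> T t = T1 t + \<i> * T2 t"
    using assms(1) unfolding complex_tail_def by blast
  have c: "c * (x + \<i> * y) = (complex_of_real (Re c) * x + complex_of_real (- Im c) * y)
     + \<i> * (complex_of_real (Im c) * x + complex_of_real (Re c) * y)" for x y
    by (subst complex_eq[of c]) (simp add: algebra_simps)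
  note s = laplace_inversion_tail_scale
  show ?thesis
    unfolding complex_tail_def
    by (rule exI, rule exI, rule exI, rule exI,
        rule conjI[OF laplace_inversion_tail_add[OF s[OF 1(1), of "Re c"] s[OF 1(2), of "- Im c"]]],
        rule conjI[OF laplace_inversion_tail_add[OF s[OF 1(1), of "Im c"] s[OF 1(2), of "Re c"]]])
      (intro conjI allI impI; simp only: 1(3,4) c)
qed

lemma complex_tail_diff:
  assumes "complex_tail \<theta> T" "complex_tail \<theta>' T'"
  shows "complex_tail (\<lambda>\<zeta>. \<theta> \<zeta> - \<theta>' \<zeta>) (\<lambda>t. T t - T' t)"
  using complex_tail_add[OF assms(1) complex_tail_scale[OF assms(2), of "- 1"]] by simp

lemma complex_tail_uminus: "complex_tail \<theta> T \<Longrightarrow> complex_tail (\<lambda>\<zeta>. - \<theta> \<zeta>) (\<lambda>t. - T t)"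
  using complex_tail_scale[of \<theta> T "- 1"] by simp

lemma complex_tail_real:
  assumes "laplace_inversion_tail \<theta> T"
  shows "complex_tail \<theta> T"
  unfolding complex_tail_def
  by (rule exI[of _ \<theta>], rule exI[of _ T], rule exI, rule exI, rule conjI[OF assms],
      rule conjI[OF laplace_inversion_tail_scale[OF assms, of 0]]) simp

lemma complex_tail_sum:
  assumes "finite I" "complex_tail \<theta>0 T0" "\<And>i. i \<in> I \<Longrightarrow> complex_tail (\<theta> i) (T i)"
  shows "complex_tail (\<lambda>\<zeta>. \<Sum>i\<in>I. \<theta> i \<zeta>) (\<lambda>t. \<Sum>i\<in>I. T i t)"
  using assms(1,3)
proof (induction I rule: finite_induct)
  case empty
  show ?case using complex_tail_scale[OF assms(2), of 0] by simp
next
  case (insert i I)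
  then show ?case using complex_tail_add[of "\<theta> i" "T i"] by simp
qed

lemma complex_tail_holomorphic:
  assumes "complex_tail \<theta> T"
  shows "\<theta> holomorphic_on {\<zeta>. 0 < Re \<zeta>}"
proof -
  have hol: "\<theta>' holomorphic_on {\<zeta>. 0 < Re \<zeta>}" if t: "laplace_inversion_tail \<theta>' T'" for \<theta>' T'
  proof -
    obtain \<mu> \<nu> where m: "nonneg_finite_measure \<mu>" "nonneg_finite_measure \<nu>"
      and \<theta>: "\<And>\<zeta>. 0 \<le> Re \<zeta> \<Longrightarrow> \<theta>' \<zeta> = lst \<mu> \<zeta> - lst \<nu> \<zeta>"
      using t unfolding laplace_inversion_tail_iff by blast
    have "(\<lambda>\<zeta>. lst \<mu> \<zeta> - lst \<nu> \<zeta>) holomorphic_on {\<zeta>. 0 < Re \<zeta>}"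
      by (intro holomorphic_intros nonneg_finite_measure.lst_holomorphic m)
    then show ?thesis by (rule holomorphic_transform) (simp add: \<theta>)
  qed
  obtain \<theta>1 T1 \<theta>2 T2 where 1: "laplace_inversion_tail \<theta>1 T1" "laplace_inversion_tail \<theta>2 T2"
    "\<And>\<zeta>. 0 \<le> Re \<zeta> \<Longrightarrow> \<theta> \<zeta> = \<theta>1 \<zeta> + \<i> * \<theta>2 \<zeta>"
    using assms(1) unfolding complex_tail_def by blast
  have "(\<lambda>\<zeta>. \<theta>1 \<zeta> + \<i> * \<theta>2 \<zeta>) holomorphic_on {\<zeta>. 0 < Re \<zeta>}"
    by (intro holomorphic_intros hol[OF 1(1)] hol[OF 1(2)])
  then show ?thesis by (rule holomorphic_transform) (simp add: 1(3))
qed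

text \<open>Up to normalization, the transform on the imaginary axis is a characteristic function.\<close>

lemma lst_unique:
  assumes "nonneg_finite_measure \<mu>" "nonneg_finite_measure \<nu>"
    and eq: "\<And>\<zeta>. 0 \<le> Re \<zeta> \<Longrightarrow> lst \<mu> \<zeta> = lst \<nu> \<zeta>" and A: "A \<in> sets borel"
  shows "measure \<mu> A = measure \<nu> A"
proof -
  interpret \<mu>: nonneg_finite_measure \<mu> by fact
  interpret \<nu>: nonneg_finite_measure \<nu> by fact
  have sp: "space \<mu> = UNIV" "space \<nu> = UNIV"
    using sets_eq_imp_space_eq[OF \<mu>.sets_F] sets_eq_imp_space_eq[OF \<nu>.sets_F] by (simp_all only: space_borel)
  define c where "c = measure \<mu> UNIV"
  have c': "measure \<nu> UNIV = c"
  proof -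
    have "lst \<mu> 0 = complex_of_real (measure \<mu> UNIV)" "lst \<nu> 0 = complex_of_real (measure \<nu> UNIV)"
      unfolding lst_def using sp by (simp_all add: scaleR_conv_of_real)
    then show ?thesis using eq[of 0] by (simp add: c_def)
  qed
  show ?thesis
  proof (cases "c = 0")
    case True
    have "measure \<mu> A \<le> measure \<mu> (space \<mu>)" "measure \<nu> A \<le> measure \<nu> (space \<nu>)"
      using \<mu>.lap.bounded_measure \<nu>.lap.bounded_measure by auto
    then show ?thesis using True c' unfolding sp c_def
      by (metis antisym measure_nonneg)
  next
    case False
    then have c: "0 < c" using measure_nonneg[of \<mu> UNIV] by (simp add: c_def less_le)
    have c0: "0 \<le> 1 / c" "(0::real) \<le> 0" using c by auto
    note m1 = nonneg_finite_measure_msum[OF assms(1,1) c0] and m2 = nonneg_finite_measure_msum[OF assms(2,2) c0]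
    have rd: "real_distribution (msum (1 / c) \<rho> 0 \<rho>)"
      if r: "nonneg_finite_measure \<rho>" "measure \<rho> UNIV = c" for \<rho>
    proof -
      note m = nonneg_finite_measure_msum[OF r(1,1) c0]
      have "measure (msum (1 / c) \<rho> 0 \<rho>) UNIV = 1" using m(2)[of UNIV] r(2) c by simp
      moreover have "finite_measure (msum (1 / c) \<rho> 0 \<rho>)" using m(1) by (rule nonneg_finite_measure.fin)
      ultimately have "prob_space (msum (1 / c) \<rho> 0 \<rho>)"
        by (intro prob_spaceI) (simp add: finite_measure.emeasure_eq_measure)
      then show ?thesis
        unfolding real_distribution_def real_distribution_axioms_def by simp
    qed
    have "msum (1 / c) \<mu> 0 \<mu> = msum (1 / c) \<nu> 0 \<nu>"
    proof (rule Levy_uniqueness)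
      show "real_distribution (msum (1 / c) \<mu> 0 \<mu>)" by (rule rd[OF assms(1)]) (simp add: c_def)
      show "real_distribution (msum (1 / c) \<nu> 0 \<nu>)" by (rule rd[OF assms(2) c'])
      show "char (msum (1 / c) \<mu> 0 \<mu>) = char (msum (1 / c) \<nu> 0 \<nu>)"
      proof
        fix t
        have ch: "char \<rho> t = lst \<rho> (- (\<i> * complex_of_real t))" for \<rho>
          unfolding char_def lst_def by (simp add: mult.assoc)
        have re: "0 \<le> Re (- (\<i> * complex_of_real t))" by simp
        show "char (msum (1 / c) \<mu> 0 \<mu>) t = char (msum (1 / c) \<nu> 0 \<nu>) t"
          unfolding ch m1(3)[OF re] m2(3)[OF re] eq[OF re] ..
      qed
    qed
    then have "1 / c * measure \<mu> A + 0 * measure \<mu> A = 1 / c * measure \<nu> A + 0 * measure \<nu> A"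
      using m1(2)[OF A] m2(2)[OF A] by metis
    then show ?thesis using c by simp
  qed
qed

text \<open>A transform that commutes with conjugation belongs to a real signed measure: the transform of the
  imaginary part vanishes, hence so does the imaginary part.\<close>

lemma complex_tail_hermitian:
  assumes "complex_tail \<theta> T" and herm: "\<And>\<zeta>. 0 \<le> Re \<zeta> \<Longrightarrow> \<theta> (cnj \<zeta>) = cnj (\<theta> \<zeta>)"
  shows "laplace_inversion_tail \<theta> T"
proof -
  obtain \<theta>1 T1 \<theta>2 T2 where 1: "laplace_inversion_tail \<theta>1 T1" "laplace_inversion_tail \<theta>2 T2"
    "\<And>\<zeta>. 0 \<le> Re \<zeta> \<Longrightarrow> \<theta> \<zeta> = \<theta>1 \<zeta> + \<i> * \<theta>2 \<zeta>" "\<And>t. 0 \<le> t \<Longrightarrow> T t = T1 t + \<i> * T2 t"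
    using assms(1) unfolding complex_tail_def by blast
  have cnj: "\<theta>' (cnj \<zeta>) = cnj (\<theta>' \<zeta>)" if t: "laplace_inversion_tail \<theta>' T'" and z: "0 \<le> Re \<zeta>" for \<theta>' T' \<zeta>
  proof -
    obtain \<mu> \<nu> where m: "nonneg_finite_measure \<mu>" "nonneg_finite_measure \<nu>"
      and \<theta>: "\<And>\<zeta>. 0 \<le> Re \<zeta> \<Longrightarrow> \<theta>' \<zeta> = lst \<mu> \<zeta> - lst \<nu> \<zeta>"
      using t unfolding laplace_inversion_tail_iff by blast
    show ?thesis
      using z by (simp add: \<theta> nonneg_finite_measure.lst_cnj[OF m(1)] nonneg_finite_measure.lst_cnj[OF m(2)])
  qed
  have zero: "\<theta>2 \<zeta> = 0" if z: "0 \<le> Re \<zeta>" for \<zeta>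
  proof -
    have "\<theta>1 (cnj \<zeta>) + \<i> * \<theta>2 (cnj \<zeta>) = cnj (\<theta>1 \<zeta> + \<i> * \<theta>2 \<zeta>)"
      using herm[OF z] 1(3)[of \<zeta>] 1(3)[of "cnj \<zeta>"] z by simp
    then show ?thesis using cnj[OF 1(1) z] cnj[OF 1(2) z] by (simp add: complex_eq_iff)
  qed
  obtain \<mu> \<nu> where m: "nonneg_finite_measure \<mu>" "nonneg_finite_measure \<nu>"
    and \<theta>: "\<And>\<zeta>. 0 \<le> Re \<zeta> \<Longrightarrow> \<theta>2 \<zeta> = lst \<mu> \<zeta> - lst \<nu> \<zeta>"
    and T2: "\<And>t. 0 \<le> t \<Longrightarrow> T2 t = complex_of_real (measure \<mu> {t<..} - measure \<nu> {t<..})"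
    using 1(2) unfolding laplace_inversion_tail_iff by blast
  have "measure \<mu> {t<..} = measure \<nu> {t<..}" for t
    by (rule lst_unique[OF m]) (use \<theta> zero in auto)
  then have T: "T t = T1 t" if "0 \<le> t" for t using that by (simp add: 1(4) T2)
  show ?thesis
    using 1(1) unfolding laplace_inversion_tail_iff by (simp add: 1(3) zero T)
qed

section \<open>Sums and overshoots of independent random variables\<close>

context prob_space begin

definition LT :: "('a \<Rightarrow> real) \<Rightarrow> complex \<Rightarrow> complex" where
  "LT X = lst (distr M borel X)"

lemma nonneg_distr:
  assumes "random_variable borel X" "AE x in M. 0 \<le> X x"
  shows "nonneg_finite_measure (distr M borel X)"
proof (rule nonneg_finite_measure.intro)
  interpret D: prob_space "distr M borel X" using assms(1) by (rule prob_space_distr)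
  show "finite_measure (distr M borel X)" by (rule D.finite_measure_axioms)
  have ev: "X -` {..<0} \<inter> space M \<in> events" using assms(1) by (rule measurable_sets) simp
  have "AE x in M. x \<notin> X -` {..<0} \<inter> space M" using assms(2) by eventually_elim auto
  then have "prob (X -` {..<0} \<inter> space M) = 0" using prob_eq_0[OF ev] by blast
  then show "measure (distr M borel X) {..<0} = 0" using assms(1) by (subst measure_distr) auto
qed simp

lemma LT_eq: "random_variable borel X \<Longrightarrow> LT X \<zeta> = (\<integral>x. exp (- \<zeta> * complex_of_real (X x)) \<partial>M)"
  unfolding LT_def lst_def by (rule integral_distr) auto

lemma tail_random_variable:
  assumes "random_variable borel X" "AE x in M. 0 \<le> X x"
  shows "laplace_inversion_tail (LT X) (\<lambda>t. complex_of_real (\<P>(x in M. X x > t)))"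
proof -
  have "measure (distr M borel X) {t<..} = \<P>(x in M. X x > t)" for t
    using assms(1) by (subst measure_distr) (auto intro!: arg_cong[where f = prob])
  then show ?thesis
    using laplace_inversion_tail_measure[OF nonneg_distr[OF assms]] by (simp add: LT_def)
qed

lemma LT_sum:
  assumes ind: "indep_vars (\<lambda>_. borel) Z J" and J: "finite J" "J \<noteq> {}"
    and nn: "\<And>j. j \<in> J \<Longrightarrow> AE x in M. 0 \<le> Z j x" and \<zeta>: "0 \<le> Re \<zeta>"
  shows "LT (\<lambda>x. \<Sum>j\<in>J. Z j x) \<zeta> = (\<Prod>j\<in>J. LT (Z j) \<zeta>)"
proof -
  have rv: "random_variable borel (Z j)" if "j \<in> J" for j
    using ind that by (simp add: indep_vars_def)
  have ind': "indep_vars (\<lambda>_. borel) (\<lambda>j x. exp (- \<zeta> * complex_of_real (Z j x))) J"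
    by (rule indep_vars_compose2[OF ind]) measurable
  have "LT (\<lambda>x. \<Sum>j\<in>J. Z j x) \<zeta> = (\<integral>x. (\<Prod>j\<in>J. exp (- \<zeta> * complex_of_real (Z j x))) \<partial>M)"
    by (subst LT_eq, intro borel_measurable_sum rv, assumption)
      (simp add: exp_sum[OF J(1), symmetric] sum_distrib_left)
  also have "\<dots> = (\<Prod>j\<in>J. \<integral>x. exp (- \<zeta> * complex_of_real (Z j x)) \<partial>M)"
  proof (rule indep_vars_lebesgue_integral[OF J(1) ind'])
    fix j assume j: "j \<in> J"
    show "integrable M (\<lambda>x. exp (- \<zeta> * complex_of_real (Z j x)))"
    proof (rule integrable_const_bound[where B = 1])
      show "AE x in M. norm (exp (- \<zeta> * complex_of_real (Z j x))) \<le> 1"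
        using nn[OF j] by eventually_elim (use norm_laplace_kernel_le[OF \<zeta>, of _ 1] in simp)
      show "(\<lambda>x. exp (- \<zeta> * complex_of_real (Z j x))) \<in> borel_measurable M"
        using rv[OF j] by measurable
    qed
  qed
  also have "\<dots> = (\<Prod>j\<in>J. LT (Z j) \<zeta>)"
    by (intro prod.cong refl) (simp add: LT_eq rv)
  finally show ?thesis .
qed

text \<open>\<open>P(t < X < t + T) = P(X > t) - P(X - T > t)\<close> up to null events, so this tail belongs to the difference
  of the laws of \<open>X\<close> and of the positive part of \<open>X - T\<close>.\<close>

definition overshoot :: "('a \<Rightarrow> real) \<Rightarrow> ('a \<Rightarrow> real) \<Rightarrow> complex \<Rightarrow> complex" where
  "overshoot X T \<zeta> = LT X \<zeta> - LT (\<lambda>x. max 0 (X x - T x)) \<zeta>"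

lemma overshoot_transform:
  assumes ind: "indep_var borel T borel X" and X: "AE x in M. 0 \<le> X x" and l: "0 < l"
    and T: "distributed M lborel T (exponential_density l)" and \<zeta>: "0 \<le> Re \<zeta>"
  shows "(\<zeta> - complex_of_real l) * overshoot X T \<zeta> = \<zeta> * (LT X \<zeta> - LT X (complex_of_real l))"
proof -
  have rv: "random_variable borel T" "random_variable borel X"
    and joint: "distr M borel T \<Otimes>\<^sub>M distr M borel X = distr M (borel \<Otimes>\<^sub>M borel) (\<lambda>x. (T x, X x))"
    using ind unfolding indep_var_distribution_eq by auto
  have dT: "distr M borel T = density lborel (exponential_density l)"
    using distributed_distr_eq_density[OF T] distr_cong[of M M lborel borel T T] by simp
  interpret DX: nonneg_finite_measure "distr M borel X" by (rule nonneg_distr[OF rv(2) X])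
  interpret PX: prob_space "distr M borel X" using rv(2) by (rule prob_space_distr)
  interpret PT: prob_space "density lborel (exponential_density l)" using l by (rule prob_space_exponential_density)
  interpret PP: pair_prob_space "density lborel (exponential_density l)" "distr M borel X" ..
  let ?f = "\<lambda>p. exp (- \<zeta> * complex_of_real (max 0 (snd p - fst p)))"
  have f: "?f \<in> borel_measurable (borel \<Otimes>\<^sub>M borel)" by measurable
  have s: "sets (density lborel (exponential_density l) \<Otimes>\<^sub>M distr M borel X) = sets (borel \<Otimes>\<^sub>M borel)"
    by (intro sets_pair_measure_cong) simp_all
  have f': "?f \<in> borel_measurable (density lborel (exponential_density l) \<Otimes>\<^sub>M distr M borel X)"
    using f unfolding measurable_cong_sets[OF s refl] .
  have int: "integrable (density lborel (exponential_density l) \<Otimes>\<^sub>M distr M borel X) (\<lambda>(t, x). ?f (t, x))"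
  proof (rule PP.integrable_const_bound[where B = 1])
    show "AE p in density lborel (exponential_density l) \<Otimes>\<^sub>M distr M borel X. norm (case p of (t, x) \<Rightarrow> ?f (t, x)) \<le> 1"
      using \<zeta> by (intro AE_I2) (simp add: norm_exp_eq_Re split_beta')
    show "(\<lambda>(t, x). ?f (t, x)) \<in> borel_measurable (density lborel (exponential_density l) \<Otimes>\<^sub>M distr M borel X)"
      using f' by (simp only: split_beta' prod.collapse)
  qed
  have m: "random_variable borel (\<lambda>x. max 0 (X x - T x))" using rv by measurable
  have "LT (\<lambda>x. max 0 (X x - T x)) \<zeta> = (\<integral>x. ?f (T x, X x) \<partial>M)"
    unfolding LT_eq[OF m] by (simp only: fst_conv snd_conv)
  also have "\<dots> = (\<integral>p. ?f p \<partial>distr M (borel \<Otimes>\<^sub>M borel) (\<lambda>x. (T x, X x)))"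
    by (rule integral_distr[symmetric, OF _ f]) (use rv in measurable)
  also have "\<dots> = (\<integral>p. ?f p \<partial>(density lborel (exponential_density l) \<Otimes>\<^sub>M distr M borel X))"
    unfolding joint[symmetric] dT ..
  also have "\<dots> = (\<integral>x. \<integral>t. ?f (t, x) \<partial>density lborel (exponential_density l) \<partial>distr M borel X)"
    using PP.integral_snd[OF int] by (simp only: split_beta' prod.collapse)
  finally have "(complex_of_real l - \<zeta>) * LT (\<lambda>x. max 0 (X x - T x)) \<zeta> =
     (\<integral>x. (complex_of_real l - \<zeta>) * (\<integral>t. exp (- \<zeta> * complex_of_real (max 0 (x - t))) \<partial>density lborel (exponential_density l)) \<partial>distr M borel X)"
    by (simp only: fst_conv snd_conv integral_mult_right_zero)
  also have "\<dots> = (\<integral>x. complex_of_real l * exp (- \<zeta> * complex_of_real x) - \<zeta> * exp (- complex_of_real l * complex_of_real x) \<partial>distr M borel X)"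
  proof (rule integral_cong_AE)
    show "AE x in distr M borel X. (complex_of_real l - \<zeta>) * (\<integral>t. exp (- \<zeta> * complex_of_real (max 0 (x - t))) \<partial>density lborel (exponential_density l))
       = complex_of_real l * exp (- \<zeta> * complex_of_real x) - \<zeta> * exp (- complex_of_real l * complex_of_real x)"
      using DX.AE_nonneg by eventually_elim (rule exponential_reflected_transform[OF l])
    show "(\<lambda>x. (complex_of_real l - \<zeta>) * (\<integral>t. exp (- \<zeta> * complex_of_real (max 0 (x - t))) \<partial>density lborel (exponential_density l))) \<in> borel_measurable (distr M borel X)"
      using borel_measurable_integrable[OF PP.integrable_snd[OF int]]
      by (intro borel_measurable_times borel_measurable_const) (simp only: fst_conv snd_conv)
    show "(\<lambda>x. complex_of_real l * exp (- \<zeta> * complex_of_real x) - \<zeta> * exp (- complex_of_real l * complex_of_real x)) \<in> borel_measurable (distr M borel X)"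
      by (rule DX.measurable_F) measurable
  qed
  also have "\<dots> = complex_of_real l * LT X \<zeta> - \<zeta> * LT X (complex_of_real l)"
    unfolding LT_def lst_def integral_mult_right_zero[symmetric]
    by (intro Bochner_Integration.integral_diff integrable_mult_right DX.lst_integrable) (use \<zeta> l in auto)
  finally show ?thesis unfolding overshoot_def by (simp add: algebra_simps)
qed

text \<open>The event \<open>X = t + T\<close> separates the two sides of the decomposition; it is null since \<open>T\<close> has a density.\<close>

lemma overshoot_tail:
  assumes ind: "indep_var borel T borel X" and X: "AE x in M. 0 \<le> X x" and l: "0 < l"
    and T: "distributed M lborel T (exponential_density l)"
  shows "complex_tail (overshoot X T) (\<lambda>t. complex_of_real (\<P>(x in M. t < X x \<and> X x < t + T x)))"
proof -
  have rv [measurable]: "random_variable borel T" "random_variable borel X"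
    and joint: "distr M borel T \<Otimes>\<^sub>M distr M borel X = distr M (borel \<Otimes>\<^sub>M borel) (\<lambda>x. (T x, X x))"
    using ind unfolding indep_var_distribution_eq by auto
  have dT: "distr M borel T = density lborel (exponential_density l)"
    using distributed_distr_eq_density[OF T] distr_cong[of M M lborel borel T T] by simp
  interpret PX: prob_space "distr M borel X" using rv(2) by (rule prob_space_distr)
  interpret PT: prob_space "distr M borel T" using rv(1) by (rule prob_space_distr)
  interpret PP: pair_prob_space "distr M borel T" "distr M borel X" ..
  have Tnn: "AE x in M. 0 \<le> T x"
  proof -
    have "prob {x \<in> space M. T x \<le> 0} = 0"
      using exponential_distributedD_le[OF T, of 0] l by simp
    then have "AE x in M. \<not> T x \<le> 0"
      by (subst (asm) prob_eq_0) auto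
    then show ?thesis by eventually_elim simp
  qed
  have null: "prob {x \<in> space M. X x = t + T x} = 0" for t
  proof -
    let ?A = "{p :: real \<times> real. snd p = t + fst p}"
    have A: "?A \<in> sets (borel \<Otimes>\<^sub>M borel)"
    proof -
      have "{p \<in> space (borel \<Otimes>\<^sub>M borel). snd p = t + fst p} \<in> sets (borel \<Otimes>\<^sub>M (borel :: real measure))" by measurable
      then show ?thesis by (simp only: space_pair_measure space_borel UNIV_Times_UNIV UNIV_I simp_thms)
    qed
    have A': "?A \<in> sets (distr M borel T \<Otimes>\<^sub>M distr M borel X)"
      using A sets_pair_measure_cong[OF sets_distr sets_distr, of M borel T M borel X] by (simp only:)
    have "emeasure M {x \<in> space M. X x = t + T x} = emeasure M ((\<lambda>x. (T x, X x)) -` ?A \<inter> space M)"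
      by (intro arg_cong[where f = "emeasure M"]) auto
    also have "\<dots> = emeasure (distr M (borel \<Otimes>\<^sub>M borel) (\<lambda>x. (T x, X x))) ?A"
      using A by (intro emeasure_distr[symmetric]) measurable
    also have "\<dots> = (\<integral>\<^sup>+x. emeasure (distr M borel T) ((\<lambda>e. (e, x)) -` ?A) \<partial>distr M borel X)"
      unfolding joint[symmetric] by (rule PP.emeasure_pair_measure_alt2[OF A'])
    also have "\<dots> = (\<integral>\<^sup>+x. 0 \<partial>distr M borel X)"
    proof (intro nn_integral_cong)
      fix x :: real
      have "(\<lambda>e. (e, x)) -` ?A = {x - t}" by auto
      moreover have "emeasure (density lborel (exponential_density l)) {x - t} = 0"
      proof -
        have "{x - t} \<in> null_sets lborel" by (simp add: null_sets_def)
        then have "{x - t} \<in> null_sets (density lborel (exponential_density l))"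
          using absolutely_continuousI_density[of "\<lambda>x. ennreal (exponential_density l x)" lborel]
          unfolding absolutely_continuous_def by auto
        then show ?thesis by (simp only: null_sets_def mem_Collect_eq)
      qed
      ultimately show "emeasure (distr M borel T) ((\<lambda>e. (e, x)) -` ?A) = 0" by (simp add: dT)
    qed
    finally show ?thesis by (simp add: measure_def)
  qed
  have m: "random_variable borel (\<lambda>x. max 0 (X x - T x))" by measurable
  have "complex_tail (overshoot X T) (\<lambda>t. complex_of_real (\<P>(x in M. X x > t)) - complex_of_real (\<P>(x in M. max 0 (X x - T x) > t)))"
    unfolding overshoot_def
    by (intro complex_tail_diff complex_tail_real tail_random_variable rv X m) simp
  then show ?thesis
  proof (rule complex_tail_cong)
    fix t :: real assume t: "0 \<le> t"
    have "\<P>(x in M. X x > t) = prob ({x \<in> space M. t < X x \<and> X x < t + T x} \<union> {x \<in> space M. max 0 (X x - T x) > t})"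
    proof (rule finite_measure_eq_AE)
      have "AE x in M. X x \<noteq> t + T x"
        using null[of t] by (subst (asm) prob_eq_0) auto
      then show "AE x in M. (x \<in> {x \<in> space M. X x > t}) = (x \<in> {x \<in> space M. t < X x \<and> X x < t + T x} \<union> {x \<in> space M. max 0 (X x - T x) > t})"
        using Tnn by eventually_elim (use t in auto)
    qed measurable
    also have "\<dots> = \<P>(x in M. t < X x \<and> X x < t + T x) + \<P>(x in M. max 0 (X x - T x) > t)"
      by (rule finite_measure_Union) (measurable, use t in auto)
    finally show "complex_of_real (\<P>(x in M. t < X x \<and> X x < t + T x)) =
      complex_of_real (\<P>(x in M. X x > t)) - complex_of_real (\<P>(x in M. max 0 (X x - T x) > t))" by simp
  qed simp
qed

end

section \<open>The arrival process\<close>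

locale arrivals =
  fixes N :: nat and D1 D2 :: "real mat" and \<pi> :: "real vec"
  assumes arr: "arrival_rates N D1 D2" and rate_pos: "\<And>i. i < N \<Longrightarrow> 0 < rate D1 D2 i"
    and irr: "irreducible_mat (P_mat D1 D2)" and stat: "stationary_vec (P_mat D1 D2) \<pi>"
begin

abbreviation p where "p i j \<equiv> P_mat D1 D2 $$ (i, j)"
abbreviation q1 where "q1 i j \<equiv> Q1 D1 D2 $$ (i, j)"
abbreviation q2 where "q2 i j \<equiv> Q2 D1 D2 $$ (i, j)"
abbreviation lam where "lam \<equiv> rate D1 D2"

lemma dim [simp]: "dim_row D1 = N" "dim_col D1 = N" "dim_row D2 = N" "dim_col D2 = N" "0 < N"
  using arr by (auto simp: arrival_rates_def)

lemma D_nonneg: "i < N \<Longrightarrow> j < N \<Longrightarrow> 0 \<le> D2 $$ (i, j)" "i < N \<Longrightarrow> j < N \<Longrightarrow> i \<noteq> j \<Longrightarrow> 0 \<le> D1 $$ (i, j)"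
  using arr by (auto simp: arrival_rates_def)

lemma p_eq: "i < N \<Longrightarrow> j < N \<Longrightarrow> p i j = ((if i = j then 0 else D1 $$ (i, j)) + D2 $$ (i, j)) / lam i"
  by (simp add: P_mat_def)

lemma p_nonneg: "i < N \<Longrightarrow> j < N \<Longrightarrow> 0 \<le> p i j"
  using D_nonneg rate_pos[of i] by (simp add: p_eq)

lemma q_nonneg: "i < N \<Longrightarrow> j < N \<Longrightarrow> 0 \<le> q1 i j" "i < N \<Longrightarrow> j < N \<Longrightarrow> 0 \<le> q2 i j"
  using D_nonneg[of i j] rate_pos[of i] by (auto simp: Q1_def Q2_def intro!: divide_nonneg_pos)

lemma q_sum: "i < N \<Longrightarrow> j < N \<Longrightarrow> (q1 i j + q2 i j) * p i j = p i j"
proof -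
  assume ij: "i < N" "j < N"
  show ?thesis
  proof (cases "0 < p i j")
    case True
    have "q1 i j + q2 i j = ((if i = j then 0 else D1 $$ (i, j)) + D2 $$ (i, j)) / (lam i * p i j)"
      using ij True by (simp add: Q1_def Q2_def add_divide_distrib)
    also have "\<dots> = 1" using ij True rate_pos[OF ij(1)] p_eq[OF ij] by (simp add: field_simps)
    finally show ?thesis by simp
  qed (use p_nonneg[OF ij] in simp)
qed

lemma p_row_sum: "i < N \<Longrightarrow> (\<Sum>j<N. p i j) = 1"
proof -
  assume i: "i < N"
  have "(\<Sum>j<N. p i j) = (\<Sum>j<N. (if i = j then 0 else D1 $$ (i, j)) + D2 $$ (i, j)) / lam i"
    using i by (simp add: p_eq sum_divide_distrib)
  also have "(\<Sum>j<N. (if i = j then 0 else D1 $$ (i, j)) + D2 $$ (i, j)) = lam i"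
  proof -
    have "(\<Sum>j<N. if i = j then 0 else D1 $$ (i, j)) = (\<Sum>j\<in>{..<N} - {i}. D1 $$ (i, j))"
      using i by (subst sum.remove[of "{..<N}" i]) (auto intro!: sum.cong)
    then show ?thesis by (simp add: rate_def sum.distrib)
  qed
  finally show ?thesis using rate_pos[OF i] by simp
qed

lemma P_carrier: "P_mat D1 D2 \<in> carrier_mat N N"
  by (simp add: P_mat_def)

lemma pi_sum: "(\<Sum>i<N. \<pi> $ i) = 1" and pi_stationary: "j < N \<Longrightarrow> (\<Sum>i<N. \<pi> $ i * p i j) = \<pi> $ j"
proof -
  have P: "dim_row (P_mat D1 D2) = N" "dim_col (P_mat D1 D2) = N" using P_carrier by auto
  have c: "\<pi> \<in> carrier_vec N" using stat P by (simp add: stationary_vec_def)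
  show "(\<Sum>i<N. \<pi> $ i) = 1"
    using stat c P by (simp add: stationary_vec_def scalar_prod_def ones_def lessThan_atLeast0)
  show "(\<Sum>i<N. \<pi> $ i * p i j) = \<pi> $ j" if "j < N"
  proof -
    have "(\<pi> \<^sub>v* P_mat D1 D2) $ j = \<pi> $ j" using stat by (simp add: stationary_vec_def)
    then show ?thesis
      using that c P by (simp add: vec_mult_mat_def scalar_prod_def lessThan_atLeast0 mult.commute)
  qed
qed

lemma pow_entries:
  "(P_mat D1 D2 ^\<^sub>m n) \<in> carrier_mat N N"
  "i < N \<Longrightarrow> j < N \<Longrightarrow> 0 \<le> (P_mat D1 D2 ^\<^sub>m n) $$ (i, j)"
  "(\<And>i. i < N \<Longrightarrow> (\<Sum>j<N. p i j * f j) = f i) \<Longrightarrow> i < N \<Longrightarrow> (\<Sum>j<N. (P_mat D1 D2 ^\<^sub>m n) $$ (i, j) * f j) = f i"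
proof -
  show c: "(P_mat D1 D2 ^\<^sub>m n) \<in> carrier_mat N N" for n by (rule pow_carrier_mat[OF P_carrier])
  have S: "(P_mat D1 D2 ^\<^sub>m Suc n) $$ (i, j) = (\<Sum>k<N. (P_mat D1 D2 ^\<^sub>m n) $$ (i, k) * p k j)" if "i < N" "j < N" for i j n
    using that c[of n] P_carrier by (simp add: scalar_prod_def lessThan_atLeast0)
  have "dim_row (P_mat D1 D2) = N" using P_carrier by auto
  then have one: "(P_mat D1 D2 ^\<^sub>m 0) $$ (i, j) = (if i = j then 1 else 0)" if "i < N" "j < N" for i j
    using that by simp
  show "i < N \<Longrightarrow> j < N \<Longrightarrow> 0 \<le> (P_mat D1 D2 ^\<^sub>m n) $$ (i, j)" for i j
  proof (induction n arbitrary: i j)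
    case (Suc n)
    then show ?case unfolding S[OF Suc.prems] by (intro sum_nonneg mult_nonneg_nonneg p_nonneg) auto
  qed (simp only: one, simp)
  show "i < N \<Longrightarrow> (\<Sum>j<N. (P_mat D1 D2 ^\<^sub>m n) $$ (i, j) * f j) = f i"
    if h: "\<And>i. i < N \<Longrightarrow> (\<Sum>j<N. p i j * f j) = f i" for i
  proof (induction n arbitrary: i)
    case 0
    then have "(\<Sum>j<N. (P_mat D1 D2 ^\<^sub>m 0) $$ (i, j) * f j) = (\<Sum>j<N. if i = j then f i else 0)"
      by (intro sum.cong) (auto simp only: one lessThan_iff, auto)
    then show ?case using 0 by simp
  next
    case (Suc n)
    have "(\<Sum>j<N. (P_mat D1 D2 ^\<^sub>m Suc n) $$ (i, j) * f j) = (\<Sum>j<N. \<Sum>k<N. (P_mat D1 D2 ^\<^sub>m n) $$ (i, k) * p k j * f j)"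
      using Suc.prems by (intro sum.cong) (auto simp only: S lessThan_iff sum_distrib_right)
    also have "\<dots> = (\<Sum>k<N. (P_mat D1 D2 ^\<^sub>m n) $$ (i, k) * (\<Sum>j<N. p k j * f j))"
      by (subst sum.swap) (simp only: sum_distrib_left mult.assoc)
    also have "\<dots> = (\<Sum>k<N. (P_mat D1 D2 ^\<^sub>m n) $$ (i, k) * f k)"
      by (intro sum.cong) (auto simp only: h lessThan_iff)
    finally show ?case using Suc by simp
  qed
qed

text \<open>Maximum principle: a harmonic function attains its maximum at some state, and then also at every
  state that is reachable from it.\<close>

lemma harmonic_const:
  fixes f :: "nat \<Rightarrow> real"
  assumes h: "\<And>i. i < N \<Longrightarrow> (\<Sum>j<N. p i j * f j) = f i" and ij: "i < N" "j < N"
  shows "f i = f j"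
proof -
  have ne: "f ` {..<N} \<noteq> {}" using ij by auto
  obtain a where a: "a < N" "f a = Max (f ` {..<N})"
    using Max_in[OF _ ne] by auto
  have le: "f k \<le> f a" if "k < N" for k using that a by simp
  have "f k = f a" if k: "k < N" for k
  proof -
    have "\<exists>n. 0 < (P_mat D1 D2 ^\<^sub>m n) $$ (a, k)"
      using irr a(1) k P_carrier by (auto simp: irreducible_mat_def)
    then obtain n where n: "0 < (P_mat D1 D2 ^\<^sub>m n) $$ (a, k)" ..
    have one: "(\<Sum>j<N. (P_mat D1 D2 ^\<^sub>m n) $$ (a, j) * 1) = 1"
      by (rule pow_entries(3)[where f = "\<lambda>_. 1"]) (use p_row_sum a in auto)
    have two: "(\<Sum>j<N. (P_mat D1 D2 ^\<^sub>m n) $$ (a, j) * f j) = f a"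
      by (rule pow_entries(3)[where f = f]) (use h a in auto)
    have "(\<Sum>j<N. (P_mat D1 D2 ^\<^sub>m n) $$ (a, j) * (f a - f j)) = f a * (\<Sum>j<N. (P_mat D1 D2 ^\<^sub>m n) $$ (a, j) * 1) - (\<Sum>j<N. (P_mat D1 D2 ^\<^sub>m n) $$ (a, j) * f j)"
      by (simp add: algebra_simps sum_subtractf sum_distrib_left)
    also have "\<dots> = 0" unfolding one two by simp
    finally have "(\<Sum>j<N. (P_mat D1 D2 ^\<^sub>m n) $$ (a, j) * (f a - f j)) = 0" .
    then have "(P_mat D1 D2 ^\<^sub>m n) $$ (a, k) * (f a - f k) = 0"
      using sum_nonneg_0[of "{..<N}" "\<lambda>j. (P_mat D1 D2 ^\<^sub>m n) $$ (a, j) * (f a - f j)" k] k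
        pow_entries(2)[OF a(1)] le by auto
    then show ?thesis using n by simp
  qed
  then show ?thesis using ij by simp
qed

lemma harmonic_const_complex:
  fixes f :: "nat \<Rightarrow> complex"
  assumes h: "\<And>i. i < N \<Longrightarrow> (\<Sum>j<N. complex_of_real (p i j) * f j) = f i" and ij: "i < N" "j < N"
  shows "f i = f j"
proof (rule complex_eqI)
  show "Re (f i) = Re (f j)"
    by (rule harmonic_const[OF _ ij]) (use h in \<open>auto simp: complex_eq_iff\<close>)
  show "Im (f i) = Im (f j)"
    by (rule harmonic_const[OF _ ij]) (use h in \<open>auto simp: complex_eq_iff\<close>)
qed

lemma stationary_unique:
  fixes v :: "nat \<Rightarrow> real"
  assumes v: "\<And>j. j < N \<Longrightarrow> (\<Sum>i<N. v i * p i j) = v j" and sum: "(\<Sum>i<N. v i) = 1" and j: "j < N"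
  shows "v j = \<pi> $ j"
proof (rule ccontr)
  assume ne: "v j \<noteq> \<pi> $ j"
  \<comment> \<open>The matrix \<open>I - P + e \<pi>\<close> has trivial kernel, hence also trivial left kernel, which contains \<open>v - \<pi>\<close>.\<close>
  define A where "A = mat N N (\<lambda>(i, k). (if i = k then 1 else 0) - p i k + \<pi> $ k)"
  have A: "A \<in> carrier_mat N N" by (simp add: A_def)
  have "det A \<noteq> 0"
  proof
    assume "det A = 0"
    then obtain f where f: "f \<in> carrier_vec N" "f \<noteq> 0\<^sub>v N" "A *\<^sub>v f = 0\<^sub>v N"
      using det_0_iff_vec_prod_zero[OF A] by blast
    define c where "c = (\<Sum>k<N. \<pi> $ k * f $ k)"
    have row: "f $ i - (\<Sum>k<N. p i k * f $ k) + c = 0" if i: "i < N" for i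
    proof -
      have "0 = (A *\<^sub>v f) $ i" using f(3) i by simp
      also have "\<dots> = (\<Sum>k<N. ((if i = k then 1 else 0) - p i k + \<pi> $ k) * f $ k)"
        using i f(1) by (simp add: A_def scalar_prod_def lessThan_atLeast0)
      also have "\<dots> = (\<Sum>k<N. (if i = k then f $ k else 0)) - (\<Sum>k<N. p i k * f $ k) + c"
        by (simp add: c_def distrib_right left_diff_distrib sum.distrib sum_subtractf if_distrib[of "\<lambda>x. x * _"] cong: if_cong)
      finally show ?thesis using i by simp
    qed
    have "0 = (\<Sum>i<N. \<pi> $ i * (f $ i - (\<Sum>k<N. p i k * f $ k) + c))" using row by simp
    also have "\<dots> = (\<Sum>i<N. \<pi> $ i * f $ i) - (\<Sum>i<N. \<pi> $ i * (\<Sum>k<N. p i k * f $ k)) + (\<Sum>i<N. \<pi> $ i) * c"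
      unfolding sum_distrib_right by (simp add: right_diff_distrib distrib_left sum.distrib sum_subtractf)
    also have "\<dots> = c - (\<Sum>i<N. \<Sum>k<N. \<pi> $ i * p i k * f $ k) + (\<Sum>i<N. \<pi> $ i) * c"
      by (simp only: c_def[symmetric] sum_distrib_left mult.assoc)
    also have "(\<Sum>i<N. \<Sum>k<N. \<pi> $ i * p i k * f $ k) = (\<Sum>k<N. (\<Sum>i<N. \<pi> $ i * p i k) * f $ k)"
      by (subst sum.swap) (simp add: sum_distrib_right)
    also have "\<dots> = c" unfolding c_def by (intro sum.cong) (auto simp: pi_stationary)
    finally have c0: "c = 0" using pi_sum by simp
    have const: "f $ i = f $ j" if "i < N" for i
      using harmonic_const[of "\<lambda>i. f $ i" i j] row c0 that j by simp
    have "c = (\<Sum>k<N. \<pi> $ k * f $ j)" unfolding c_def by (intro sum.cong) (auto simp: const)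
    also have "\<dots> = (\<Sum>k<N. \<pi> $ k) * f $ j" by (rule sum_distrib_right[symmetric])
    finally have "f $ j = 0" using c0 pi_sum by simp
    then have "f = 0\<^sub>v N" using f(1) const by (intro eq_vecI) auto
    then show False using f(2) by contradiction
  qed
  then have "det (transpose_mat A) \<noteq> 0" using det_transpose[OF A] by simp
  moreover define w where "w = vec N (\<lambda>i. v i - \<pi> $ i)"
  have "transpose_mat A *\<^sub>v w = 0\<^sub>v N"
  proof (rule eq_vecI)
    fix k assume "k < dim_vec (0\<^sub>v N :: real vec)"
    then have k: "k < N" by simp
    have "(transpose_mat A *\<^sub>v w) $ k = (\<Sum>i<N. ((if i = k then 1 else 0) - p i k + \<pi> $ k) * (v i - \<pi> $ i))"
      using k by (simp add: A_def w_def scalar_prod_def lessThan_atLeast0)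
    also have "\<dots> = (\<Sum>i<N. (if i = k then v i - \<pi> $ i else 0)) - (\<Sum>i<N. v i * p i k) + (\<Sum>i<N. \<pi> $ i * p i k)
         + \<pi> $ k * ((\<Sum>i<N. v i) - (\<Sum>i<N. \<pi> $ i))"
      by (simp add: algebra_simps sum.distrib sum_subtractf sum_distrib_left if_distrib[of "(*) _"] cong: if_cong)
    also have "\<dots> = 0" using k by (simp add: v pi_stationary sum pi_sum)
    finally show "(transpose_mat A *\<^sub>v w) $ k = 0\<^sub>v N $ k" using k by simp
  qed (simp add: A_def)
  moreover have "w \<in> carrier_vec N" by (simp add: w_def)
  moreover have "w \<noteq> 0\<^sub>v N"
  proof
    assume "w = 0\<^sub>v N"
    then have "w $ j = 0" using j by simp
    then show False using ne j by (simp add: w_def)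
  qed
  ultimately show False using det_0_iff_vec_prod_zero[of "transpose_mat A" N] A by auto
qed

lemma P_Lam_entry:
  assumes "i < N" "j < N"
  shows "(P_mat D1 D2 * Lam D1 D2) $$ (i, j) = p i j * lam j"
proof -
  have "(P_mat D1 D2 * Lam D1 D2) $$ (i, j) = (\<Sum>k<N. p i k * (if k = j then lam k else 0))"
    using assms P_carrier by (simp add: Lam_def scalar_prod_def lessThan_atLeast0)
  also have "\<dots> = (\<Sum>k<N. if k = j then p i k * lam k else 0)" by (intro sum.cong) auto
  finally show ?thesis using assms by simp
qed

lemma E_mat2_entry:
  assumes "i < N" "j < N"
  shows "E_mat2 D1 D2 \<zeta> g $$ (i, j) =
    (complex_of_real (q1 i j) + g * complex_of_real (q2 i j)) * complex_of_real (p i j * lam j)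
      + (if i = j then \<zeta> - complex_of_real (lam i) else 0)"
proof -
  have dims: "dim_row (P_mat D1 D2) = N" "dim_col (P_mat D1 D2) = N" "dim_row (Lam D1 D2) = N" "dim_col (Lam D1 D2) = N"
    "dim_row (Q1 D1 D2) = N" "dim_col (Q1 D1 D2) = N" "dim_row (Q2 D1 D2) = N" "dim_col (Q2 D1 D2) = N"
    by (simp_all add: P_mat_def Lam_def Q1_def Q2_def)
  show ?thesis
    unfolding E_mat2_def hadamard_def using assms P_Lam_entry[OF assms] dims by (simp add: Lam_def)
qed

lemma E_mat2_carrier: "E_mat2 D1 D2 \<zeta> g \<in> carrier_mat N N"
  unfolding E_mat2_def by (intro minus_carrier_mat) (simp add: Lam_def)

lemma QP2Lam_entry:
  assumes "i < N" "j < N"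
  shows "QP2Lam D1 D2 $$ (i, j) = complex_of_real (q2 i j * (p i j * lam j))"
proof -
  have "dim_row (Q2 D1 D2) = N" "dim_col (Q2 D1 D2) = N" by (simp_all add: Q2_def)
  then show ?thesis unfolding QP2Lam_def hadamard_def using assms P_Lam_entry[OF assms] by simp
qed

lemma QP2Lam_carrier: "QP2Lam D1 D2 \<in> carrier_mat N N"
  by (simp add: QP2Lam_def hadamard_def Q2_def)

text \<open>\<open>E(\<zeta>, g)\<close> is affine in \<open>g\<close>, so mixing the service times perturbs \<open>E\<close> by exactly \<open>\<epsilon> K\<close>.\<close>

lemma E_mat2_line: "E_mat2 D1 D2 \<zeta> (g + h) = E_mat2 D1 D2 \<zeta> g + h \<cdot>\<^sub>m QP2Lam D1 D2"
proof (rule eq_matI)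
  fix i j assume "i < dim_row (E_mat2 D1 D2 \<zeta> g + h \<cdot>\<^sub>m QP2Lam D1 D2)" "j < dim_col (E_mat2 D1 D2 \<zeta> g + h \<cdot>\<^sub>m QP2Lam D1 D2)"
  then have ij: "i < N" "j < N" using E_mat2_carrier[of \<zeta> g] QP2Lam_carrier by auto
  then show "E_mat2 D1 D2 \<zeta> (g + h) $$ (i, j) = (E_mat2 D1 D2 \<zeta> g + h \<cdot>\<^sub>m QP2Lam D1 D2) $$ (i, j)"
    using QP2Lam_carrier E_mat2_carrier[of \<zeta> g] by (simp add: E_mat2_entry QP2Lam_entry algebra_simps)
qed (use E_mat2_carrier QP2Lam_carrier in auto)

lemma drift_eq: "drift D1 D2 \<pi> \<mu> = (\<Sum>i<N. \<pi> $ i * (1 / lam i - \<mu> * (\<Sum>j<N. q2 i j * p i j)))"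
proof -
  have d: "dim_row (Q2 D1 D2) = N" "dim_col (Q2 D1 D2) = N" by (simp_all add: Q2_def)
  have "((Lam_inv D1 D2 - \<mu> \<cdot>\<^sub>m hadamard (Q2 D1 D2) (P_mat D1 D2)) *\<^sub>v ones N) $ i =
     1 / lam i - \<mu> * (\<Sum>j<N. q2 i j * p i j)" if i: "i < N" for i
  proof -
    have "((Lam_inv D1 D2 - \<mu> \<cdot>\<^sub>m hadamard (Q2 D1 D2) (P_mat D1 D2)) *\<^sub>v ones N) $ i =
      (\<Sum>j<N. (if i = j then 1 / lam i else 0) - \<mu> * (q2 i j * p i j))"
      using i d by (simp add: hadamard_def Lam_inv_def ones_def scalar_prod_def lessThan_atLeast0)
    then show ?thesis using i by (simp add: sum_subtractf sum_distrib_left)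
  qed
  then show ?thesis
    unfolding drift_def using d by (simp add: scalar_prod_def lessThan_atLeast0 hadamard_def)
qed

lemma Lam_inv_ones: "i < N \<Longrightarrow> (Lam_inv D1 D2 *\<^sub>v ones N) $ i = 1 / lam i"
proof -
  assume i: "i < N"
  have "(Lam_inv D1 D2 *\<^sub>v ones N) $ i = (\<Sum>j<N. (if i = j then 1 / lam i else 0))"
    using i by (simp add: Lam_inv_def ones_def scalar_prod_def lessThan_atLeast0)
  then show ?thesis using i by simp
qed

text \<open>\<open>E(\<zeta>, g) \<Lambda>\<^sup>-\<^sup>1 e\<close> has the factor \<open>\<zeta>\<close> when \<open>g\<close> is a transform, as \<open>g - 1\<close> has one; dividing the
  balance equation by \<open>\<zeta>\<close> along this direction gives the normalization of \<open>u\<close>.\<close>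

lemma E_mat2_row:
  assumes "i < N"
  shows "(\<Sum>j<N. E_mat2 D1 D2 \<zeta> g $$ (i, j) * complex_of_real (1 / lam j)) =
     (g - 1) * (\<Sum>j<N. complex_of_real (q2 i j * p i j)) + \<zeta> * complex_of_real (1 / lam i)"
proof -
  have "(\<Sum>j<N. E_mat2 D1 D2 \<zeta> g $$ (i, j) * complex_of_real (1 / lam j)) =
    (\<Sum>j<N. complex_of_real (p i j) + (g - 1) * complex_of_real (q2 i j * p i j) + (if i = j then (\<zeta> - complex_of_real (lam i)) / complex_of_real (lam i) else 0))"
  proof (intro sum.cong refl)
    fix j assume "j \<in> {..<N}"
    then have j: "j < N" by simp
    have q: "complex_of_real (q1 i j) * complex_of_real (p i j) = complex_of_real (p i j) - complex_of_real (q2 i j) * complex_of_real (p i j)"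
      using arg_cong[OF q_sum[OF assms j], of complex_of_real] by (simp add: algebra_simps)
    have l: "complex_of_real (lam j) * complex_of_real (1 / lam j) = 1" using rate_pos[OF j] by simp
    have "E_mat2 D1 D2 \<zeta> g $$ (i, j) * complex_of_real (1 / lam j) =
       (complex_of_real (q1 i j) * complex_of_real (p i j) + g * (complex_of_real (q2 i j) * complex_of_real (p i j))) * (complex_of_real (lam j) * complex_of_real (1 / lam j))
        + (if i = j then (\<zeta> - complex_of_real (lam i)) / complex_of_real (lam i) else 0)"
      unfolding E_mat2_entry[OF assms j] by (auto simp: algebra_simps)
    also have "\<dots> = complex_of_real (p i j) + (g - 1) * complex_of_real (q2 i j * p i j) + (if i = j then (\<zeta> - complex_of_real (lam i)) / complex_of_real (lam i) else 0)"
      unfolding l q by (simp add: algebra_simps)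
    finally show "E_mat2 D1 D2 \<zeta> g $$ (i, j) * complex_of_real (1 / lam j) = \<dots>" .
  qed
  also have "\<dots> = complex_of_real (\<Sum>j<N. p i j) + (g - 1) * (\<Sum>j<N. complex_of_real (q2 i j * p i j)) + (\<zeta> - complex_of_real (lam i)) / complex_of_real (lam i)"
    using assms by (simp add: sum.distrib sum_distrib_left)
  also have "\<dots> = (g - 1) * (\<Sum>j<N. complex_of_real (q2 i j * p i j)) + \<zeta> * complex_of_real (1 / lam i)"
    using rate_pos[OF assms] by (simp add: p_row_sum[OF assms] field_simps)
  finally show ?thesis .
qed

end

section \<open>Derivatives of determinants and adjugates\<close>

text \<open>Leibniz expansion and the product rule; regrouping by the differentiated column gives the sum of
  determinants with one replaced column.\<close>

lemma det_has_field_derivative: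
  fixes X :: "complex \<Rightarrow> complex mat"
  assumes X: "\<And>w. X w \<in> carrier_mat n n" and Y: "Y \<in> carrier_mat n n"
    and deriv: "\<And>i j. i < n \<Longrightarrow> j < n \<Longrightarrow> ((\<lambda>w. X w $$ (i, j)) has_field_derivative Y $$ (i, j)) (at c)"
  shows "((\<lambda>w. det (X w)) has_field_derivative col_replace_sum (X c) Y) (at c)"
proof -
  let ?P = "{p. p permutes {0..<n}}"
  have fin: "finite ?P" by (simp add: finite_permutations)
  have perm: "p j < n" if "p \<in> ?P" "j < n" for p j
    using that permutes_in_image[of p "{0..<n}" j] by auto
  have det: "det (X w) = (\<Sum>p\<in>?P. signof p * (\<Prod>j\<in>{0..<n}. X w $$ (p j, j)))" for w
    using det_col[OF X[of w]] unfolding lessThan_atLeast0 .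
  have rep: "det (replace_col (X c) (col Y j) j) =
     (\<Sum>p\<in>?P. signof p * (Y $$ (p j, j) * (\<Prod>i\<in>{0..<n} - {j}. X c $$ (p i, i))))" if j: "j < n" for j
  proof -
    have car: "replace_col (X c) (col Y j) j \<in> carrier_mat n n"
      using X[of c] by (auto simp: replace_col_def)
    have "(\<Prod>i\<in>{0..<n}. replace_col (X c) (col Y j) j $$ (p i, i)) =
        Y $$ (p j, j) * (\<Prod>i\<in>{0..<n} - {j}. X c $$ (p i, i))" if p: "p \<in> ?P" for p
    proof -
      have e: "replace_col (X c) (col Y j) j $$ (p i, i) = (if i = j then Y $$ (p j, j) else X c $$ (p i, i))"
        if "i < n" for i
        using that j perm[OF p] X[of c] Y by (auto simp: replace_col_def)
      have "(\<Prod>i\<in>{0..<n}. replace_col (X c) (col Y j) j $$ (p i, i)) =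
        replace_col (X c) (col Y j) j $$ (p j, j) * (\<Prod>i\<in>{0..<n} - {j}. replace_col (X c) (col Y j) j $$ (p i, i))"
        using j by (intro prod.remove) auto
      also have "\<dots> = Y $$ (p j, j) * (\<Prod>i\<in>{0..<n} - {j}. X c $$ (p i, i))"
        using j by (intro arg_cong2[where f = "(*)"] prod.cong) (auto simp: e)
      finally show ?thesis .
    qed
    then show ?thesis unfolding det_col[OF car] lessThan_atLeast0 by (intro sum.cong) auto
  qed
  have "((\<lambda>w. \<Sum>p\<in>?P. signof p * (\<Prod>j\<in>{0..<n}. X w $$ (p j, j))) has_field_derivative
      (\<Sum>p\<in>?P. signof p * (\<Sum>j\<in>{0..<n}. Y $$ (p j, j) * (\<Prod>i\<in>{0..<n} - {j}. X c $$ (p i, i))))) (at c)"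
    by (intro DERIV_sum DERIV_cmult has_field_derivative_prod deriv) (auto intro: perm)
  also have "(\<Sum>p\<in>?P. signof p * (\<Sum>j\<in>{0..<n}. Y $$ (p j, j) * (\<Prod>i\<in>{0..<n} - {j}. X c $$ (p i, i))))
     = (\<Sum>j\<in>{0..<n}. \<Sum>p\<in>?P. signof p * (Y $$ (p j, j) * (\<Prod>i\<in>{0..<n} - {j}. X c $$ (p i, i))))"
    by (subst sum.swap) (simp add: sum_distrib_left)
  also have "\<dots> = (\<Sum>j\<in>{0..<n}. det (replace_col (X c) (col Y j) j))"
    by (intro sum.cong) (auto simp: rep)
  also have "\<dots> = col_replace_sum (X c) Y"
    using X[of c] by (simp add: col_replace_sum_def lessThan_atLeast0)
  finally show ?thesis unfolding det .
qed

text \<open>The directional derivative of the adjugate at \<open>X\<close> in direction \<open>Y\<close>. Its columns are the vectors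
  \<open>k\<^sub>i\<close> (for \<open>Y = K\<close>) and \<open>a\<^sub>i\<^sup>(\<^sup>1\<^sup>)\<close> (for \<open>Y = E\<^sup>(\<^sup>1\<^sup>)\<close>).\<close>

definition adj_derivative :: "complex mat \<Rightarrow> complex mat \<Rightarrow> complex mat" where
  "adj_derivative X Y = mat (dim_row X) (dim_col X)
     (\<lambda>(i, j). (- 1) ^ (j + i) * col_replace_sum (mat_delete X j i) (mat_delete Y j i))"

lemma adj_mat_has_field_derivative:
  fixes X :: "complex \<Rightarrow> complex mat"
  assumes X: "\<And>w. X w \<in> carrier_mat n n" and Y: "Y \<in> carrier_mat n n"
    and deriv: "\<And>i j. i < n \<Longrightarrow> j < n \<Longrightarrow> ((\<lambda>w. X w $$ (i, j)) has_field_derivative Y $$ (i, j)) (at c)"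
    and ij: "i < n" "j < n"
  shows "((\<lambda>w. adj_mat (X w) $$ (i, j)) has_field_derivative adj_derivative (X c) Y $$ (i, j)) (at c)"
proof -
  have "((\<lambda>w. det (mat_delete (X w) j i)) has_field_derivative
      col_replace_sum (mat_delete (X c) j i) (mat_delete Y j i)) (at c)"
  proof (rule det_has_field_derivative[where n = "n - 1"])
    show "mat_delete (X w) j i \<in> carrier_mat (n - 1) (n - 1)" for w by (rule mat_delete_carrier[OF X])
    show "mat_delete Y j i \<in> carrier_mat (n - 1) (n - 1)" by (rule mat_delete_carrier[OF Y])
    fix k l assume kl: "k < n - 1" "l < n - 1"
    let ?k = "if k < j then k else Suc k" and ?l = "if l < i then l else Suc l"
    have e: "mat_delete A j i $$ (k, l) = A $$ (?k, ?l)" if "A \<in> carrier_mat n n" for A :: "complex mat"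
      using that kl by (simp add: mat_delete_def)
    show "((\<lambda>w. mat_delete (X w) j i $$ (k, l)) has_field_derivative mat_delete Y j i $$ (k, l)) (at c)"
      unfolding e[OF X] e[OF Y] by (rule deriv) (use kl in auto)
  qed
  then have "((\<lambda>w. (- 1) ^ (j + i) * det (mat_delete (X w) j i)) has_field_derivative
      (- 1) ^ (j + i) * col_replace_sum (mat_delete (X c) j i) (mat_delete Y j i)) (at c)"
    by (rule DERIV_cmult)
  then show ?thesis
    using ij X[of c] carrier_matD[OF X] by (simp add: adj_mat_def cofactor_def adj_derivative_def)
qed

lemma mat_times_adj_entry:
  fixes X :: "'a :: comm_ring_1 mat"
  assumes "X \<in> carrier_mat n n" "i < n" "j < n"
  shows "(\<Sum>k<n. X $$ (i, k) * adj_mat X $$ (k, j)) = (if i = j then det X else 0)"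
    and "(\<Sum>k<n. adj_mat X $$ (i, k) * X $$ (k, j)) = (if i = j then det X else 0)"
proof -
  have "(X * adj_mat X) $$ (i, j) = (\<Sum>k<n. X $$ (i, k) * adj_mat X $$ (k, j))"
    using assms adj_mat(1)[OF assms(1)] by (simp add: scalar_prod_def lessThan_atLeast0)
  then show "(\<Sum>k<n. X $$ (i, k) * adj_mat X $$ (k, j)) = (if i = j then det X else 0)"
    using adj_mat(2)[OF assms(1)] assms by (auto split: if_splits)
  have "(adj_mat X * X) $$ (i, j) = (\<Sum>k<n. adj_mat X $$ (i, k) * X $$ (k, j))"
    using assms adj_mat(1)[OF assms(1)] by (simp add: scalar_prod_def lessThan_atLeast0)
  then show "(\<Sum>k<n. adj_mat X $$ (i, k) * X $$ (k, j)) = (if i = j then det X else 0)"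
    using adj_mat(3)[OF assms(1)] assms by (auto split: if_splits)
qed

text \<open>Differentiate \<open>X adj X = det X I\<close> along the line \<open>X + w Y\<close> at \<open>w = 0\<close>.\<close>

lemma adj_derivative_product_rule:
  assumes X: "X \<in> carrier_mat n n" and Y: "Y \<in> carrier_mat n n" and ij: "i < n" "j < n"
  shows "(\<Sum>k<n. Y $$ (i, k) * adj_mat X $$ (k, j)) + (\<Sum>k<n. X $$ (i, k) * adj_derivative X Y $$ (k, j))
     = (if i = j then col_replace_sum X Y else 0)"
proof -
  define Z where "Z w = X + w \<cdot>\<^sub>m Y" for w
  have Z: "Z w \<in> carrier_mat n n" for w using X Y by (simp add: Z_def)
  have Z0: "Z 0 = X" using X Y by (intro eq_matI) (auto simp: Z_def)
  have dZ: "((\<lambda>w. Z w $$ (k, l)) has_field_derivative Y $$ (k, l)) (at 0)" if "k < n" "l < n" for k l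
    using that X Y by (auto simp: Z_def intro!: derivative_eq_intros)
  have "((\<lambda>w. \<Sum>k<n. Z w $$ (i, k) * adj_mat (Z w) $$ (k, j)) has_field_derivative
      (\<Sum>k<n. Z 0 $$ (i, k) * adj_derivative (Z 0) Y $$ (k, j) + Y $$ (i, k) * adj_mat (Z 0) $$ (k, j))) (at 0)"
    by (intro DERIV_sum DERIV_mult' dZ adj_mat_has_field_derivative[OF Z Y]) (use ij in auto)
  moreover have "((\<lambda>w. if i = j then det (Z w) else 0) has_field_derivative
      (if i = j then col_replace_sum (Z 0) Y else 0)) (at 0)"
    using det_has_field_derivative[OF Z Y dZ] by simp
  ultimately show ?thesis
    unfolding mat_times_adj_entry(1)[OF Z ij] Z0
    by (auto dest: DERIV_unique simp: sum.distrib add.commute)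
qed

text \<open>The perturbation \<open>Y\<close> is left on the right-hand side together with the unknown \<open>f\<close>: a bound on \<open>f\<close>
  then controls its contribution.\<close>

lemma perturbed_cramer:
  fixes X :: "'a :: comm_ring_1 mat"
  assumes X: "X \<in> carrier_mat n n" and j: "j < n"
    and eq: "\<And>k. k < n \<Longrightarrow> (\<Sum>i<n. f i * (X $$ (i, k) + Y i k)) = v k"
  shows "det X * f j = (\<Sum>k<n. v k * adj_mat X $$ (k, j)) - (\<Sum>i<n. \<Sum>k<n. f i * Y i k * adj_mat X $$ (k, j))"
proof -
  have "(\<Sum>k<n. v k * adj_mat X $$ (k, j)) = (\<Sum>k<n. \<Sum>i<n. f i * (X $$ (i, k) + Y i k) * adj_mat X $$ (k, j))"
    by (intro sum.cong) (auto simp: eq[symmetric] sum_distrib_right)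
  also have "\<dots> = (\<Sum>i<n. \<Sum>k<n. f i * (X $$ (i, k) * adj_mat X $$ (k, j)) + f i * Y i k * adj_mat X $$ (k, j))"
    by (subst sum.swap) (simp add: algebra_simps)
  also have "\<dots> = (\<Sum>i<n. f i * (\<Sum>k<n. X $$ (i, k) * adj_mat X $$ (k, j))) + (\<Sum>i<n. \<Sum>k<n. f i * Y i k * adj_mat X $$ (k, j))"
    by (simp add: sum.distrib sum_distrib_left)
  also have "(\<Sum>i<n. f i * (\<Sum>k<n. X $$ (i, k) * adj_mat X $$ (k, j))) = (\<Sum>i<n. if i = j then f j * det X else 0)"
    by (intro sum.cong) (auto simp: mat_times_adj_entry(1)[OF X _ j])
  also have "\<dots> = f j * det X" using j by simp
  finally show ?thesis by (simp add: algebra_simps)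
qed

section \<open>Uniform expansions\<close>

text \<open>A bound in this filter holds for small \<open>\<epsilon>\<close>, uniformly in \<open>\<zeta> \<in> S\<close>.\<close>

definition unif :: "complex set \<Rightarrow> (real \<times> complex) filter" where
  "unif S = at_right 0 \<times>\<^sub>F principal S"

lemma eventually_unif:
  "eventually P (unif S) \<longleftrightarrow> (\<forall>\<^sub>F \<epsilon> in at_right 0. \<forall>\<zeta>\<in>S. P (\<epsilon>, \<zeta>))"
proof
  assume "eventually P (unif S)"
  then obtain A B where "eventually A (at_right 0)" "\<forall>\<zeta>\<in>S. B \<zeta>" "\<And>\<epsilon> \<zeta>. A \<epsilon> \<Longrightarrow> B \<zeta> \<Longrightarrow> P (\<epsilon>, \<zeta>)"
    unfolding unif_def eventually_prod_filter eventually_principal by blast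
  then show "\<forall>\<^sub>F \<epsilon> in at_right 0. \<forall>\<zeta>\<in>S. P (\<epsilon>, \<zeta>)" by (auto elim: eventually_mono)
next
  assume "\<forall>\<^sub>F \<epsilon> in at_right 0. \<forall>\<zeta>\<in>S. P (\<epsilon>, \<zeta>)"
  then show "eventually P (unif S)"
    unfolding unif_def eventually_prod_filter eventually_principal
    by (intro exI[of _ "\<lambda>\<epsilon>. \<forall>\<zeta>\<in>S. P (\<epsilon>, \<zeta>)"] exI[of _ "\<lambda>\<zeta>. \<zeta> \<in> S"]) auto
qed

lemma bigo_unif_iff:
  "f \<in> O[unif S](\<lambda>p. complex_of_real (fst p) ^ k) \<longleftrightarrow>
     (\<exists>C. \<forall>\<^sub>F \<epsilon> in at_right 0. \<forall>\<zeta>\<in>S. norm (f (\<epsilon>, \<zeta>)) \<le> C * \<epsilon> ^ k)"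
proof
  assume "f \<in> O[unif S](\<lambda>p. complex_of_real (fst p) ^ k)"
  then obtain C where "\<forall>\<^sub>F p in unif S. norm (f p) \<le> C * norm (complex_of_real (fst p) ^ k)"
    by (elim landau_o.bigE)
  then have "\<forall>\<^sub>F \<epsilon> in at_right 0. \<forall>\<zeta>\<in>S. norm (f (\<epsilon>, \<zeta>)) \<le> C * \<bar>\<epsilon>\<bar> ^ k"
    by (simp add: eventually_unif norm_power)
  moreover have "\<forall>\<^sub>F \<epsilon> in at_right (0::real). 0 < \<epsilon>" by (rule eventually_at_right_less)
  ultimately have "\<forall>\<^sub>F \<epsilon> in at_right 0. \<forall>\<zeta>\<in>S. norm (f (\<epsilon>, \<zeta>)) \<le> C * \<epsilon> ^ k"
    by eventually_elim simp
  then show "\<exists>C. \<forall>\<^sub>F \<epsilon> in at_right 0. \<forall>\<zeta>\<in>S. norm (f (\<epsilon>, \<zeta>)) \<le> C * \<epsilon> ^ k" ..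
next
  assume "\<exists>C. \<forall>\<^sub>F \<epsilon> in at_right 0. \<forall>\<zeta>\<in>S. norm (f (\<epsilon>, \<zeta>)) \<le> C * \<epsilon> ^ k"
  then obtain C where "\<forall>\<^sub>F \<epsilon> in at_right 0. \<forall>\<zeta>\<in>S. norm (f (\<epsilon>, \<zeta>)) \<le> C * \<epsilon> ^ k" ..
  moreover have "\<forall>\<^sub>F \<epsilon> in at_right (0::real). 0 < \<epsilon>" by (rule eventually_at_right_less)
  ultimately have "\<forall>\<^sub>F \<epsilon> in at_right 0. \<forall>\<zeta>\<in>S. norm (f (\<epsilon>, \<zeta>)) \<le> C * norm (complex_of_real \<epsilon> ^ k)"
    by eventually_elim (simp add: norm_power)
  then show "f \<in> O[unif S](\<lambda>p. complex_of_real (fst p) ^ k)"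
    by (intro bigoI[of _ C]) (simp add: eventually_unif)
qed

lemma bigo_unif_singleton:
  "f \<in> O[unif {\<zeta>}](\<lambda>p. complex_of_real (fst p) ^ k) \<longleftrightarrow>
    (\<lambda>\<epsilon>. f (\<epsilon>, \<zeta>)) \<in> O[at_right 0](\<lambda>\<epsilon>. complex_of_real \<epsilon> ^ k)"
  unfolding unif_def prod_filter_principal_singleton2 by (simp add: landau_o.big.in_filtermap_iff)

lemma bigo_unif_mono: "S \<subseteq> T \<Longrightarrow> f \<in> O[unif T](g) \<Longrightarrow> f \<in> O[unif S](g)"
  by (erule landau_o.big.filter_mono[rotated]) (simp add: unif_def prod_filter_mono)

lemma bigo_unif_param:
  assumes "f \<in> O[at_right 0](\<lambda>\<epsilon>. complex_of_real \<epsilon> ^ k)"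
  shows "(\<lambda>p. f (fst p)) \<in> O[unif S](\<lambda>p. complex_of_real (fst p) ^ k)"
  using assms unfolding unif_def by (rule landau_o.big.compose[OF _ filterlim_fst])

lemma bigo_unif_coeff:
  assumes "compact S" "continuous_on S h"
  shows "(\<lambda>p. h (snd p)) \<in> O[unif S](\<lambda>_. 1 :: complex)"
proof -
  have "bounded (h ` S)" using assms by (intro compact_imp_bounded compact_continuous_image)
  then obtain B where "\<And>\<zeta>. \<zeta> \<in> S \<Longrightarrow> norm (h \<zeta>) \<le> B" by (auto simp: bounded_iff)
  then show ?thesis by (intro bigoI[of _ B]) (simp add: eventually_unif)
qed

text \<open>The maximum modulus principle, used to carry estimates across the isolated zeros of \<open>det E\<close>.\<close>

lemma bigo_unif_disc:
  assumes hol: "\<forall>\<^sub>F \<epsilon> in at_right 0. g \<epsilon> holomorphic_on {\<zeta>. 0 < Re \<zeta>}"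
    and sub: "cball c \<rho> \<subseteq> {\<zeta>. 0 < Re \<zeta>}" and \<rho>: "0 < \<rho>"
    and bound: "(\<lambda>p. g (fst p) (snd p)) \<in> O[unif (sphere c \<rho>)](\<lambda>p. complex_of_real (fst p) ^ k)"
  shows "(\<lambda>p. g (fst p) (snd p)) \<in> O[unif (cball c \<rho>)](\<lambda>p. complex_of_real (fst p) ^ k)"
proof -
  obtain C where "\<forall>\<^sub>F \<epsilon> in at_right 0. \<forall>\<zeta>\<in>sphere c \<rho>. norm (g \<epsilon> \<zeta>) \<le> C * \<epsilon> ^ k"
    using bound unfolding bigo_unif_iff by auto
  with hol have "\<forall>\<^sub>F \<epsilon> in at_right 0. \<forall>\<zeta>\<in>cball c \<rho>. norm (g \<epsilon> \<zeta>) \<le> C * \<epsilon> ^ k"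
  proof eventually_elim
    case (elim \<epsilon>)
    have hol: "g \<epsilon> holomorphic_on cball c \<rho>" using elim(1) sub by (rule holomorphic_on_subset)
    show ?case
    proof
      fix \<zeta> assume \<zeta>: "\<zeta> \<in> cball c \<rho>"
      show "norm (g \<epsilon> \<zeta>) \<le> C * \<epsilon> ^ k"
      proof (rule maximum_modulus_frontier[of "g \<epsilon>" "cball c \<rho>"])
        show "g \<epsilon> holomorphic_on interior (cball c \<rho>)"
          using hol interior_subset by (rule holomorphic_on_subset)
        show "continuous_on (closure (cball c \<rho>)) (g \<epsilon>)"
          using holomorphic_on_imp_continuous_on[OF hol] by simp
        show "norm (g \<epsilon> \<xi>) \<le> C * \<epsilon> ^ k" if "\<xi> \<in> frontier (cball c \<rho>)" for \<xi>
          using elim(2) that \<rho> by simp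
      qed (use \<zeta> in simp_all)
    qed
  qed
  then show ?thesis unfolding bigo_unif_iff by auto
qed

lemma bigo_square_tendsto:
  assumes "(\<lambda>\<epsilon>. h \<epsilon> - complex_of_real \<epsilon> * c) \<in> O[at_right 0](\<lambda>\<epsilon>. complex_of_real \<epsilon> ^ 2)"
  shows "((\<lambda>\<epsilon>. h \<epsilon> / complex_of_real \<epsilon>) \<longlongrightarrow> c) (at_right 0)"
proof -
  obtain C where "\<forall>\<^sub>F \<epsilon> in at_right 0. norm (h \<epsilon> - complex_of_real \<epsilon> * c) \<le> C * norm (complex_of_real \<epsilon> ^ 2)"
    using assms by (elim landau_o.bigE)
  moreover have "\<forall>\<^sub>F \<epsilon> in at_right (0::real). 0 < \<epsilon>" by (rule eventually_at_right_less)
  ultimately have "\<forall>\<^sub>F \<epsilon> in at_right 0. norm (h \<epsilon> / complex_of_real \<epsilon> - c) \<le> C * \<epsilon>"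
  proof eventually_elim
    case (elim \<epsilon>)
    have "h \<epsilon> / complex_of_real \<epsilon> - c = (h \<epsilon> - complex_of_real \<epsilon> * c) / complex_of_real \<epsilon>"
      using elim(2) by (simp add: field_simps)
    then show ?case
      using elim by (simp add: norm_divide norm_power norm_mult power2_eq_square field_simps)
  qed
  moreover have "((\<lambda>\<epsilon>. C * \<epsilon>) \<longlongrightarrow> 0) (at_right 0)"
    by (intro tendsto_mult_right_zero tendsto_ident_at)
  ultimately have "((\<lambda>\<epsilon>. h \<epsilon> / complex_of_real \<epsilon> - c) \<longlongrightarrow> 0) (at_right 0)"
    by (rule Lim_null_comparison)
  then show ?thesis by (rule LIM_zero_cancel)
qed

section \<open>Perturbation of the balance equations\<close>

text \<open>An abstract form of the two models: \<open>f0\<close> and \<open>fe\<close> are the unperturbed and the perturbed transform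
  vectors, \<open>u0\<close> and \<open>ue\<close> the right-hand sides, \<open>l0\<close> is \<open>\<Lambda>\<^sup>-\<^sup>1 e\<close>, and \<open>G\<close> is the inverse of the matrix with
  columns \<open>l0, a\<^sub>2, \<dots>, a\<^sub>N\<close>, so that a vector is recovered from its products with these columns. The
  conditions on \<open>z\<close> are those that the first-order term of \<open>ue\<close> must satisfy.\<close>

locale perturbed_balance =
  fixes n :: nat and E K :: "complex \<Rightarrow> complex mat"
    and f0 :: "complex \<Rightarrow> nat \<Rightarrow> complex" and fe :: "real \<Rightarrow> complex \<Rightarrow> nat \<Rightarrow> complex"
    and u0 z :: "nat \<Rightarrow> complex" and ue :: "real \<Rightarrow> nat \<Rightarrow> complex"
    and s :: "nat \<Rightarrow> real" and m :: "nat \<Rightarrow> nat"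
    and l0 :: "nat \<Rightarrow> complex" and c0 c1 :: complex and G :: "nat \<Rightarrow> nat \<Rightarrow> complex"
  assumes E [simp]: "E \<zeta> \<in> carrier_mat n n"
    and E_cont: "i < n \<Longrightarrow> j < n \<Longrightarrow> continuous_on {\<zeta>. 0 \<le> Re \<zeta>} (\<lambda>\<zeta>. E \<zeta> $$ (i, j))"
    and K_cont: "i < n \<Longrightarrow> j < n \<Longrightarrow> continuous_on {\<zeta>. 0 \<le> Re \<zeta>} (\<lambda>\<zeta>. K \<zeta> $$ (i, j))"
    and f0_hol: "(\<lambda>\<zeta>. f0 \<zeta> i) holomorphic_on {\<zeta>. 0 < Re \<zeta>}"
    and fe_hol: "\<forall>\<^sub>F \<epsilon> in at_right 0. \<forall>i<n. (\<lambda>\<zeta>. fe \<epsilon> \<zeta> i) holomorphic_on {\<zeta>. 0 < Re \<zeta>}"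
    and fe_le: "\<forall>\<^sub>F \<epsilon> in at_right 0. \<forall>i<n. \<forall>\<zeta>. 0 \<le> Re \<zeta> \<longrightarrow> norm (fe \<epsilon> \<zeta> i) \<le> 1"
    and balance0: "0 \<le> Re \<zeta> \<Longrightarrow> j < n \<Longrightarrow> (\<Sum>i<n. f0 \<zeta> i * E \<zeta> $$ (i, j)) = \<zeta> * u0 j"
    and balance: "\<forall>\<^sub>F \<epsilon> in at_right 0. \<forall>\<zeta>. \<forall>j<n. 0 \<le> Re \<zeta> \<longrightarrow>
        (\<Sum>i<n. fe \<epsilon> \<zeta> i * (E \<zeta> $$ (i, j) + complex_of_real \<epsilon> * K \<zeta> $$ (i, j))) = \<zeta> * ue \<epsilon> j"
    and s_pos: "k \<in> {1..<n} \<Longrightarrow> 0 < s k" and m_less: "k \<in> {1..<n} \<Longrightarrow> m k < n"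
    and s_root: "k \<in> {1..<n} \<Longrightarrow> det (E (complex_of_real (s k))) = 0"
    and s_isolated: "k \<in> {1..<n} \<Longrightarrow> \<forall>\<^sub>F \<zeta> in at (complex_of_real (s k)). det (E \<zeta>) \<noteq> 0"
    and norm0: "(\<Sum>i<n. u0 i * l0 i) = c0"
    and norm: "\<forall>\<^sub>F \<epsilon> in at_right 0. (\<Sum>i<n. ue \<epsilon> i * l0 i) = c0 + complex_of_real \<epsilon> * c1"
    and z0: "(\<Sum>i<n. z i * l0 i) = c1"
    and z_root: "k \<in> {1..<n} \<Longrightarrow> complex_of_real (s k) * (\<Sum>i<n. z i * adj_mat (E (complex_of_real (s k))) $$ (i, m k))
       = (\<Sum>i<n. \<Sum>j<n. f0 (complex_of_real (s k)) i * K (complex_of_real (s k)) $$ (i, j) * adj_mat (E (complex_of_real (s k))) $$ (j, m k))"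
    and G: "j < n \<Longrightarrow> v j = (\<Sum>i<n. v i * l0 i) * G 0 j
       + (\<Sum>k\<in>{1..<n}. (\<Sum>i<n. v i * adj_mat (E (complex_of_real (s k))) $$ (i, m k)) * G k j)"
begin

abbreviation adjE :: "complex \<Rightarrow> nat \<Rightarrow> nat \<Rightarrow> complex" where
  "adjE \<zeta> i j \<equiv> adj_mat (E \<zeta>) $$ (i, j)"

text \<open>The derivative in \<open>\<epsilon>\<close> of the solution that Cramer's rule gives for the perturbed system.\<close>

definition \<Psi> :: "complex \<Rightarrow> nat \<Rightarrow> complex" where
  "\<Psi> \<zeta> j = (\<zeta> * (\<Sum>i<n. z i * adjE \<zeta> i j) - (\<Sum>i<n. \<Sum>k<n. f0 \<zeta> i * K \<zeta> $$ (i, k) * adjE \<zeta> k j)) / det (E \<zeta>)"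

definition admissible :: "complex set \<Rightarrow> bool" where
  "admissible S \<longleftrightarrow> compact S \<and> (\<forall>\<zeta>\<in>S. 0 \<le> Re \<zeta> \<and> det (E \<zeta>) \<noteq> 0)"

lemma det_cont: "continuous_on {\<zeta>. 0 \<le> Re \<zeta>} (\<lambda>\<zeta>. det (E \<zeta>))"
  unfolding det_def'[OF E]
proof (intro continuous_on_sum continuous_on_mult continuous_on_const continuous_on_prod)
  fix p i assume "p \<in> {p. p permutes {0..<n}}" "i \<in> {0..<n}"
  then show "continuous_on {\<zeta>. 0 \<le> Re \<zeta>} (\<lambda>\<zeta>. E \<zeta> $$ (i, p i))"
    using permutes_in_image[of p "{0..<n}" i] by (intro E_cont) auto
qed

lemma adj_cont:
  assumes "i < n" "j < n"
  shows "continuous_on {\<zeta>. 0 \<le> Re \<zeta>} (\<lambda>\<zeta>. adjE \<zeta> i j)"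
proof -
  have *: "mat_delete (E \<zeta>) j i \<in> carrier_mat (n - 1) (n - 1)" for \<zeta> by (rule mat_delete_carrier[OF E])
  have "continuous_on {\<zeta>. 0 \<le> Re \<zeta>} (\<lambda>\<zeta>. (- 1) ^ (j + i) * det (mat_delete (E \<zeta>) j i))"
    unfolding det_def'[OF *]
  proof (intro continuous_on_sum continuous_on_mult continuous_on_const continuous_on_prod)
    fix p k assume pk: "p \<in> {p. p permutes {0..<n - 1}}" "k \<in> {0..<n - 1}"
    then have pk': "p k < n - 1" using permutes_in_image[of p "{0..<n - 1}" k] by auto
    have "mat_delete (E \<zeta>) j i $$ (k, p k) =
        E \<zeta> $$ (if k < j then k else Suc k, if p k < i then p k else Suc (p k))" for \<zeta>
      using carrier_matD[OF E[of \<zeta>]] pk(2) pk' by (simp add: mat_delete_def)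
    then show "continuous_on {\<zeta>. 0 \<le> Re \<zeta>} (\<lambda>\<zeta>. mat_delete (E \<zeta>) j i $$ (k, p k))"
      using pk(2) pk' by (auto intro!: E_cont)
  qed
  then show ?thesis
    using assms carrier_matD[OF E] by (simp add: adj_mat_def cofactor_def)
qed

lemma cramer0:
  assumes "0 \<le> Re \<zeta>" "j < n"
  shows "det (E \<zeta>) * f0 \<zeta> j = \<zeta> * (\<Sum>k<n. u0 k * adjE \<zeta> k j)"
  using perturbed_cramer[OF E[of \<zeta>] assms(2), of "f0 \<zeta>" "\<lambda>_ _. 0" "\<lambda>k. \<zeta> * u0 k"] balance0[OF assms(1)]
  by (simp add: sum_distrib_left mult.assoc)

lemma cramer_perturbed:
  "\<forall>\<^sub>F \<epsilon> in at_right 0. \<forall>\<zeta>. \<forall>j<n. 0 \<le> Re \<zeta> \<longrightarrow> det (E \<zeta>) * fe \<epsilon> \<zeta> j =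
     \<zeta> * (\<Sum>k<n. ue \<epsilon> k * adjE \<zeta> k j)
     - complex_of_real \<epsilon> * (\<Sum>i<n. \<Sum>k<n. fe \<epsilon> \<zeta> i * K \<zeta> $$ (i, k) * adjE \<zeta> k j)"
  using balance
proof eventually_elim
  case (elim \<epsilon>)
  show ?case
  proof (intro allI impI)
    fix \<zeta> j assume j: "j < n" and \<zeta>: "0 \<le> Re \<zeta>"
    have "det (E \<zeta>) * fe \<epsilon> \<zeta> j = (\<Sum>k<n. \<zeta> * ue \<epsilon> k * adjE \<zeta> k j)
       - (\<Sum>i<n. \<Sum>k<n. fe \<epsilon> \<zeta> i * (complex_of_real \<epsilon> * K \<zeta> $$ (i, k)) * adjE \<zeta> k j)"
      by (rule perturbed_cramer[OF E j]) (use elim \<zeta> in auto)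
    then show "det (E \<zeta>) * fe \<epsilon> \<zeta> j = \<zeta> * (\<Sum>k<n. ue \<epsilon> k * adjE \<zeta> k j)
       - complex_of_real \<epsilon> * (\<Sum>i<n. \<Sum>k<n. fe \<epsilon> \<zeta> i * K \<zeta> $$ (i, k) * adjE \<zeta> k j)"
      by (simp add: sum_distrib_left ac_simps)
  qed
qed

lemma fe_bigo: "i < n \<Longrightarrow> S \<subseteq> {\<zeta>. 0 \<le> Re \<zeta>} \<Longrightarrow> (\<lambda>p. fe (fst p) (snd p) i) \<in> O[unif S](\<lambda>_. 1)"
  by (intro bigoI[of _ 1], unfold eventually_unif, use fe_le in eventually_elim) auto

lemma coeff_bigo:
  assumes S: "admissible S" and n: "i < n" "k < n" "j < n"
  shows "(\<lambda>p. snd p * adjE (snd p) k j / det (E (snd p))) \<in> O[unif S](\<lambda>_. 1)"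
    and "(\<lambda>p. K (snd p) $$ (i, k) * adjE (snd p) k j / det (E (snd p))) \<in> O[unif S](\<lambda>_. 1)"
proof -
  have S': "compact S" "S \<subseteq> {\<zeta>. 0 \<le> Re \<zeta>}" "\<And>\<zeta>. \<zeta> \<in> S \<Longrightarrow> det (E \<zeta>) \<noteq> 0"
    using S by (auto simp: admissible_def)
  note cont = continuous_on_subset[OF _ S'(2)]
  have "continuous_on S (\<lambda>\<zeta>. \<zeta> * adjE \<zeta> k j / det (E \<zeta>))"
    by (intro continuous_on_divide continuous_on_mult continuous_on_id cont[OF adj_cont] cont[OF det_cont] ballI S'(3) n)
  then show "(\<lambda>p. snd p * adjE (snd p) k j / det (E (snd p))) \<in> O[unif S](\<lambda>_. 1)"
    by (rule bigo_unif_coeff[OF S'(1)])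
  have "continuous_on S (\<lambda>\<zeta>. K \<zeta> $$ (i, k) * adjE \<zeta> k j / det (E \<zeta>))"
    by (intro continuous_on_divide continuous_on_mult cont[OF K_cont] cont[OF adj_cont] cont[OF det_cont] ballI S'(3) n)
  then show "(\<lambda>p. K (snd p) $$ (i, k) * adjE (snd p) k j / det (E (snd p))) \<in> O[unif S](\<lambda>_. 1)"
    by (rule bigo_unif_coeff[OF S'(1)])
qed

text \<open>It suffices that \<open>fe\<close> is bounded: on the right-hand side of Cramer's rule it carries a factor \<open>\<epsilon>\<close>.\<close>

lemma first_order:
  assumes S: "admissible S" and j: "j < n"
    and ue: "\<And>i. i < n \<Longrightarrow> (\<lambda>\<epsilon>. ue \<epsilon> i - u0 i) \<in> O[at_right 0](\<lambda>\<epsilon>. complex_of_real \<epsilon> ^ 1)"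
  shows "(\<lambda>p. fe (fst p) (snd p) j - f0 (snd p) j) \<in> O[unif S](\<lambda>p. complex_of_real (fst p) ^ 1)"
proof -
  have S': "compact S" "S \<subseteq> {\<zeta>. 0 \<le> Re \<zeta>}" "\<And>\<zeta>. \<zeta> \<in> S \<Longrightarrow> det (E \<zeta>) \<noteq> 0"
    using S by (auto simp: admissible_def)
  let ?a = "\<lambda>p. \<Sum>k<n. (ue (fst p) k - u0 k) * (snd p * adjE (snd p) k j / det (E (snd p)))"
  let ?b = "\<lambda>p. complex_of_real (fst p) ^ 1 * (\<Sum>i<n. \<Sum>k<n. fe (fst p) (snd p) i * (K (snd p) $$ (i, k) * adjE (snd p) k j / det (E (snd p))))"
  have "\<forall>\<^sub>F p in unif S. fe (fst p) (snd p) j - f0 (snd p) j = ?a p - ?b p"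
    unfolding eventually_unif using cramer_perturbed
  proof eventually_elim
    case (elim \<epsilon>)
    show ?case
    proof
      fix \<zeta> assume \<zeta>: "\<zeta> \<in> S"
      then have \<zeta>': "0 \<le> Re \<zeta>" using S'(2) by auto
      have "fe \<epsilon> \<zeta> j - f0 \<zeta> j = (det (E \<zeta>) * fe \<epsilon> \<zeta> j - det (E \<zeta>) * f0 \<zeta> j) / det (E \<zeta>)"
        using S'(3)[OF \<zeta>] by (simp add: field_simps)
      then show "fe (fst (\<epsilon>, \<zeta>)) (snd (\<epsilon>, \<zeta>)) j - f0 (snd (\<epsilon>, \<zeta>)) j = ?a (\<epsilon>, \<zeta>) - ?b (\<epsilon>, \<zeta>)"
        using elim \<zeta>' j
        by (simp add: cramer0 sum_distrib_left sum_divide_distrib diff_divide_distrib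
            sum_subtractf left_diff_distrib right_diff_distrib ac_simps)
    qed
  qed
  moreover have "(\<lambda>p. ?a p - ?b p) \<in> O[unif S](\<lambda>p. complex_of_real (fst p) ^ 1)"
  proof (intro sum_in_bigo big_sum_in_bigo)
    fix k assume k: "k \<in> {..<n}"
    have "(\<lambda>p. (ue (fst p) k - u0 k) * (snd p * adjE (snd p) k j / det (E (snd p))))
       \<in> O[unif S](\<lambda>p. complex_of_real (fst p) ^ 1 * 1)"
      using k by (intro landau_o.big.mult bigo_unif_param[where f = "\<lambda>\<epsilon>. ue \<epsilon> k - u0 k"] ue coeff_bigo(1)[OF S _ _ j]) auto
    then show "(\<lambda>p. (ue (fst p) k - u0 k) * (snd p * adjE (snd p) k j / det (E (snd p))))
       \<in> O[unif S](\<lambda>p. complex_of_real (fst p) ^ 1)" by (simp only: mult_1_right)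
  next
    have "(\<lambda>p. \<Sum>i<n. \<Sum>k<n. fe (fst p) (snd p) i * (K (snd p) $$ (i, k) * adjE (snd p) k j / det (E (snd p)))) \<in> O[unif S](\<lambda>_. 1 * 1)"
      by (intro big_sum_in_bigo landau_o.big.mult fe_bigo S'(2) coeff_bigo(2)[OF S _ _ j]) auto
    then have "?b \<in> O[unif S](\<lambda>p. complex_of_real (fst p) ^ 1 * (1 * 1))"
      by (intro landau_o.big.mult landau_o.big_refl)
    then show "?b \<in> O[unif S](\<lambda>p. complex_of_real (fst p) ^ 1)" by (simp only: mult_1_right)
  qed
  ultimately show ?thesis by (subst landau_o.big.in_cong)
qed

text \<open>Now the factor of \<open>\<epsilon>\<close> is known to first order by the previous lemma.\<close>

lemma second_order:
  assumes S: "admissible S" and j: "j < n"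
    and ue1: "\<And>i. i < n \<Longrightarrow> (\<lambda>\<epsilon>. ue \<epsilon> i - u0 i) \<in> O[at_right 0](\<lambda>\<epsilon>. complex_of_real \<epsilon> ^ 1)"
    and ue: "\<And>i. i < n \<Longrightarrow> (\<lambda>\<epsilon>. ue \<epsilon> i - u0 i - complex_of_real \<epsilon> * z i) \<in> O[at_right 0](\<lambda>\<epsilon>. complex_of_real \<epsilon> ^ 2)"
  shows "(\<lambda>p. fe (fst p) (snd p) j - f0 (snd p) j - complex_of_real (fst p) * \<Psi> (snd p) j)
     \<in> O[unif S](\<lambda>p. complex_of_real (fst p) ^ 2)"
proof -
  have S': "compact S" "S \<subseteq> {\<zeta>. 0 \<le> Re \<zeta>}" "\<And>\<zeta>. \<zeta> \<in> S \<Longrightarrow> det (E \<zeta>) \<noteq> 0"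
    using S by (auto simp: admissible_def)
  let ?a = "\<lambda>p. \<Sum>k<n. (ue (fst p) k - u0 k - complex_of_real (fst p) * z k) * (snd p * adjE (snd p) k j / det (E (snd p)))"
  let ?b = "\<lambda>p. complex_of_real (fst p) ^ 1 * (\<Sum>i<n. \<Sum>k<n. (fe (fst p) (snd p) i - f0 (snd p) i) * (K (snd p) $$ (i, k) * adjE (snd p) k j / det (E (snd p))))"
  have "\<forall>\<^sub>F p in unif S. fe (fst p) (snd p) j - f0 (snd p) j - complex_of_real (fst p) * \<Psi> (snd p) j = ?a p - ?b p"
    unfolding eventually_unif using cramer_perturbed
  proof eventually_elim
    case (elim \<epsilon>)
    show ?case
    proof
      fix \<zeta> assume \<zeta>: "\<zeta> \<in> S"
      then have \<zeta>': "0 \<le> Re \<zeta>" using S'(2) by auto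
      have "fe \<epsilon> \<zeta> j - f0 \<zeta> j = (det (E \<zeta>) * fe \<epsilon> \<zeta> j - det (E \<zeta>) * f0 \<zeta> j) / det (E \<zeta>)"
        using S'(3)[OF \<zeta>] by (simp add: field_simps)
      then show "fe (fst (\<epsilon>, \<zeta>)) (snd (\<epsilon>, \<zeta>)) j - f0 (snd (\<epsilon>, \<zeta>)) j - complex_of_real (fst (\<epsilon>, \<zeta>)) * \<Psi> (snd (\<epsilon>, \<zeta>)) j = ?a (\<epsilon>, \<zeta>) - ?b (\<epsilon>, \<zeta>)"
        using elim \<zeta>' j
        by (simp add: \<Psi>_def cramer0 sum_distrib_left sum_divide_distrib diff_divide_distrib
            sum_subtractf left_diff_distrib right_diff_distrib ac_simps)
    qed
  qed
  moreover have "(\<lambda>p. ?a p - ?b p) \<in> O[unif S](\<lambda>p. complex_of_real (fst p) ^ 2)"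
  proof (intro sum_in_bigo big_sum_in_bigo)
    fix k assume k: "k \<in> {..<n}"
    have "(\<lambda>p. (ue (fst p) k - u0 k - complex_of_real (fst p) * z k) * (snd p * adjE (snd p) k j / det (E (snd p))))
       \<in> O[unif S](\<lambda>p. complex_of_real (fst p) ^ 2 * 1)"
      using k by (intro landau_o.big.mult bigo_unif_param[where f = "\<lambda>\<epsilon>. ue \<epsilon> k - u0 k - complex_of_real \<epsilon> * z k"] ue coeff_bigo(1)[OF S _ _ j]) auto
    then show "(\<lambda>p. (ue (fst p) k - u0 k - complex_of_real (fst p) * z k) * (snd p * adjE (snd p) k j / det (E (snd p))))
       \<in> O[unif S](\<lambda>p. complex_of_real (fst p) ^ 2)" by (simp only: mult_1_right)
  next
    have "(\<lambda>p. \<Sum>i<n. \<Sum>k<n. (fe (fst p) (snd p) i - f0 (snd p) i) * (K (snd p) $$ (i, k) * adjE (snd p) k j / det (E (snd p)))) \<in> O[unif S](\<lambda>p. complex_of_real (fst p) ^ 1 * 1)"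
      by (intro big_sum_in_bigo landau_o.big.mult first_order[OF S] ue1 S'(2) coeff_bigo(2)[OF S _ _ j]) auto
    then have "?b \<in> O[unif S](\<lambda>p. complex_of_real (fst p) ^ 1 * (complex_of_real (fst p) ^ 1 * 1))"
      by (intro landau_o.big.mult landau_o.big_refl)
    then show "?b \<in> O[unif S](\<lambda>p. complex_of_real (fst p) ^ 2)"
      by (simp only: mult_1_right power2_eq_square power_one_right)
  qed
  ultimately show ?thesis by (subst landau_o.big.in_cong)
qed

lemma root_circle:
  assumes k: "k \<in> {1..<n}"
  obtains \<rho> where "0 < \<rho>" "cball (complex_of_real (s k)) \<rho> \<subseteq> {\<zeta>. 0 < Re \<zeta>}"
    "admissible (sphere (complex_of_real (s k)) \<rho>)"
    "\<And>\<zeta>. \<zeta> \<in> cball (complex_of_real (s k)) \<rho> \<Longrightarrow> \<zeta> \<noteq> complex_of_real (s k) \<Longrightarrow> det (E \<zeta>) \<noteq> 0"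
proof -
  let ?s = "complex_of_real (s k)"
  obtain d where d: "0 < d" "\<And>\<zeta>. \<zeta> \<noteq> ?s \<Longrightarrow> dist \<zeta> ?s < d \<Longrightarrow> det (E \<zeta>) \<noteq> 0"
    using s_isolated[OF k] by (auto simp: eventually_at)
  \<comment> \<open>Small enough to avoid the other roots and to stay in the open right half-plane.\<close>
  define \<rho> where "\<rho> = min d (s k) / 2"
  have \<rho>: "0 < \<rho>" "\<rho> < d" "\<rho> < s k" using d(1) s_pos[OF k] by (auto simp: \<rho>_def min_def)
  have Re: "0 < Re \<zeta>" if "\<zeta> \<in> cball ?s \<rho>" for \<zeta>
    using that abs_Re_le_cmod[of "?s - \<zeta>"] \<rho>(3) by (simp add: dist_norm)
  have nz: "det (E \<zeta>) \<noteq> 0" if "\<zeta> \<in> cball ?s \<rho>" "\<zeta> \<noteq> ?s" for \<zeta>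
    using that \<rho>(2) by (intro d(2)) (auto simp: dist_commute)
  have "admissible (sphere ?s \<rho>)"
    unfolding admissible_def
  proof (intro conjI ballI)
    fix \<zeta> assume z: "\<zeta> \<in> sphere ?s \<rho>"
    then have c: "\<zeta> \<in> cball ?s \<rho>" by simp
    show "0 \<le> Re \<zeta>" using Re[OF c] by simp
    show "det (E \<zeta>) \<noteq> 0" using z \<rho>(1) by (intro nz c) auto
  qed simp
  with \<rho>(1) Re nz show ?thesis by (intro that[of \<rho>]) auto
qed

lemma u0_root:
  assumes k: "k \<in> {1..<n}"
  shows "(\<Sum>i<n. u0 i * adjE (complex_of_real (s k)) i (m k)) = 0"
  using cramer0[of "complex_of_real (s k)" "m k"] s_root[OF k] s_pos[OF k] m_less[OF k] by simp

text \<open>At a root the left-hand side of Cramer's rule vanishes, which leaves an equation for \<open>ue\<close>.\<close>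

lemma ue_root:
  "\<forall>\<^sub>F \<epsilon> in at_right 0. \<forall>k\<in>{1..<n}. (\<Sum>i<n. ue \<epsilon> i * adjE (complex_of_real (s k)) i (m k))
     = complex_of_real \<epsilon> * ((1 / complex_of_real (s k)) *
       (\<Sum>i<n. \<Sum>j<n. fe \<epsilon> (complex_of_real (s k)) i * (K (complex_of_real (s k)) $$ (i, j) * adjE (complex_of_real (s k)) j (m k))))"
  using cramer_perturbed
proof eventually_elim
  case (elim \<epsilon>)
  show ?case
  proof
    fix k assume k: "k \<in> {1..<n}"
    have "0 = complex_of_real (s k) * (\<Sum>i<n. ue \<epsilon> i * adjE (complex_of_real (s k)) i (m k))
      - complex_of_real \<epsilon> * (\<Sum>i<n. \<Sum>j<n. fe \<epsilon> (complex_of_real (s k)) i * K (complex_of_real (s k)) $$ (i, j) * adjE (complex_of_real (s k)) j (m k))"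
      using elim[rule_format, OF m_less[OF k], of "complex_of_real (s k)"] s_root[OF k] s_pos[OF k] by simp
    then show "(\<Sum>i<n. ue \<epsilon> i * adjE (complex_of_real (s k)) i (m k))
     = complex_of_real \<epsilon> * ((1 / complex_of_real (s k)) *
       (\<Sum>i<n. \<Sum>j<n. fe \<epsilon> (complex_of_real (s k)) i * (K (complex_of_real (s k)) $$ (i, j) * adjE (complex_of_real (s k)) j (m k))))"
      using s_pos[OF k] by (simp add: field_simps)
  qed
qed

text \<open>The products of \<open>ue - u0\<close> with the columns \<open>l0, a\<^sub>2, \<dots>, a\<^sub>N\<close> are \<open>O(\<epsilon>)\<close>, since \<open>fe\<close> is bounded.\<close>

lemma ue_first:
  assumes j: "j < n"
  shows "(\<lambda>\<epsilon>. ue \<epsilon> j - u0 j) \<in> O[at_right 0](\<lambda>\<epsilon>. complex_of_real \<epsilon> ^ 1)"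
proof -
  let ?r = "\<lambda>\<epsilon> k. (1 / complex_of_real (s k)) *
       (\<Sum>i<n. \<Sum>j<n. fe \<epsilon> (complex_of_real (s k)) i * (K (complex_of_real (s k)) $$ (i, j) * adjE (complex_of_real (s k)) j (m k)))"
  have "\<forall>\<^sub>F \<epsilon> in at_right 0. ue \<epsilon> j - u0 j =
     complex_of_real \<epsilon> ^ 1 * (c1 * G 0 j + (\<Sum>k\<in>{1..<n}. ?r \<epsilon> k * G k j))"
    using ue_root norm
  proof eventually_elim
    case (elim \<epsilon>)
    have "ue \<epsilon> j - u0 j = (\<Sum>i<n. (ue \<epsilon> i - u0 i) * l0 i) * G 0 j
       + (\<Sum>k\<in>{1..<n}. (\<Sum>i<n. (ue \<epsilon> i - u0 i) * adjE (complex_of_real (s k)) i (m k)) * G k j)"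
      by (rule G[OF j])
    also have "(\<Sum>i<n. (ue \<epsilon> i - u0 i) * l0 i) = complex_of_real \<epsilon> * c1"
      using elim(2) norm0 by (simp add: left_diff_distrib sum_subtractf)
    also have "(\<Sum>k\<in>{1..<n}. (\<Sum>i<n. (ue \<epsilon> i - u0 i) * adjE (complex_of_real (s k)) i (m k)) * G k j)
        = (\<Sum>k\<in>{1..<n}. complex_of_real \<epsilon> * (?r \<epsilon> k * G k j))"
    proof (intro sum.cong refl)
      fix k assume k: "k \<in> {1..<n}"
      have "(\<Sum>i<n. (ue \<epsilon> i - u0 i) * adjE (complex_of_real (s k)) i (m k)) = complex_of_real \<epsilon> * ?r \<epsilon> k"
        unfolding elim(1)[rule_format, OF k, symmetric]
        using u0_root[OF k] by (simp add: left_diff_distrib sum_subtractf)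
      then show "(\<Sum>i<n. (ue \<epsilon> i - u0 i) * adjE (complex_of_real (s k)) i (m k)) * G k j = complex_of_real \<epsilon> * (?r \<epsilon> k * G k j)"
        by (simp only: mult.assoc)
    qed
    also have "complex_of_real \<epsilon> * c1 * G 0 j + (\<Sum>k\<in>{1..<n}. complex_of_real \<epsilon> * (?r \<epsilon> k * G k j))
       = complex_of_real \<epsilon> ^ 1 * (c1 * G 0 j + (\<Sum>k\<in>{1..<n}. ?r \<epsilon> k * G k j))"
      by (simp only: sum_distrib_left[symmetric] distrib_left mult.assoc power_one_right)
    finally show ?case .
  qed
  moreover have "(\<lambda>\<epsilon>. complex_of_real \<epsilon> ^ 1 * (c1 * G 0 j + (\<Sum>k\<in>{1..<n}. ?r \<epsilon> k * G k j)))
      \<in> O[at_right 0](\<lambda>\<epsilon>. complex_of_real \<epsilon> ^ 1 * 1)"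
  proof (intro landau_o.big.mult landau_o.big_refl sum_in_bigo big_sum_in_bigo)
    fix k assume k: "k \<in> {1..<n}"
    have "(\<lambda>\<epsilon>. ?r \<epsilon> k * G k j) \<in> O[at_right 0](\<lambda>_. 1 * (1 * 1) * 1)"
    proof (intro landau_o.big.mult big_sum_in_bigo)
      fix i assume i: "i \<in> {..<n}"
      show "(\<lambda>\<epsilon>. fe \<epsilon> (complex_of_real (s k)) i) \<in> O[at_right 0](\<lambda>_. 1)"
        by (intro bigoI[of _ 1], use fe_le in eventually_elim) (use i s_pos[OF k] in auto)
    qed simp_all
    then show "(\<lambda>\<epsilon>. ?r \<epsilon> k * G k j) \<in> O[at_right 0](\<lambda>_. 1)" by simp
  qed simp
  ultimately show ?thesis by (simp only: mult_1_right) (rule landau_o.big.in_cong[THEN iffD2])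
qed

lemma fe_first_disc:
  assumes k: "k \<in> {1..<n}" and i: "i < n"
    and \<rho>: "0 < \<rho>" "cball (complex_of_real (s k)) \<rho> \<subseteq> {\<zeta>. 0 < Re \<zeta>}" "admissible (sphere (complex_of_real (s k)) \<rho>)"
  shows "(\<lambda>p. fe (fst p) (snd p) i - f0 (snd p) i) \<in> O[unif (cball (complex_of_real (s k)) \<rho>)](\<lambda>p. complex_of_real (fst p) ^ 1)"
proof (rule bigo_unif_disc[where g = "\<lambda>\<epsilon> \<zeta>. fe \<epsilon> \<zeta> i - f0 \<zeta> i", OF _ \<rho>(2,1)])
  show "\<forall>\<^sub>F \<epsilon> in at_right 0. (\<lambda>\<zeta>. fe \<epsilon> \<zeta> i - f0 \<zeta> i) holomorphic_on {\<zeta>. 0 < Re \<zeta>}"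
    using fe_hol by eventually_elim (use i in \<open>auto intro!: holomorphic_intros f0_hol\<close>)
qed (rule first_order[OF \<rho>(3) i ue_first])

lemma fe_first_root:
  assumes k: "k \<in> {1..<n}" and i: "i < n"
  shows "(\<lambda>\<epsilon>. fe \<epsilon> (complex_of_real (s k)) i - f0 (complex_of_real (s k)) i) \<in> O[at_right 0](\<lambda>\<epsilon>. complex_of_real \<epsilon> ^ 1)"
proof -
  obtain \<rho> where \<rho>: "0 < \<rho>" "cball (complex_of_real (s k)) \<rho> \<subseteq> {\<zeta>. 0 < Re \<zeta>}" "admissible (sphere (complex_of_real (s k)) \<rho>)"
    using root_circle[OF k] by metis
  have "(\<lambda>p. fe (fst p) (snd p) i - f0 (snd p) i) \<in> O[unif {complex_of_real (s k)}](\<lambda>p. complex_of_real (fst p) ^ 1)"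
    by (rule bigo_unif_mono[OF _ fe_first_disc[OF k i \<rho>]]) (use \<rho>(1) in simp)
  then show ?thesis unfolding bigo_unif_singleton by simp
qed

text \<open>As before, but the products involve \<open>fe - f0\<close> at the roots, which is \<open>O(\<epsilon>)\<close> by the maximum modulus
  argument.\<close>

lemma ue_second:
  assumes j: "j < n"
  shows "(\<lambda>\<epsilon>. ue \<epsilon> j - u0 j - complex_of_real \<epsilon> * z j) \<in> O[at_right 0](\<lambda>\<epsilon>. complex_of_real \<epsilon> ^ 2)"
proof -
  let ?r = "\<lambda>\<epsilon> k. (1 / complex_of_real (s k)) *
       (\<Sum>i<n. \<Sum>j<n. (fe \<epsilon> (complex_of_real (s k)) i - f0 (complex_of_real (s k)) i) * (K (complex_of_real (s k)) $$ (i, j) * adjE (complex_of_real (s k)) j (m k)))"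
  have "\<forall>\<^sub>F \<epsilon> in at_right 0. ue \<epsilon> j - u0 j - complex_of_real \<epsilon> * z j =
     complex_of_real \<epsilon> ^ 1 * (\<Sum>k\<in>{1..<n}. ?r \<epsilon> k * G k j)"
    using ue_root norm
  proof eventually_elim
    case (elim \<epsilon>)
    have "ue \<epsilon> j - u0 j - complex_of_real \<epsilon> * z j = (\<Sum>i<n. (ue \<epsilon> i - u0 i - complex_of_real \<epsilon> * z i) * l0 i) * G 0 j
       + (\<Sum>k\<in>{1..<n}. (\<Sum>i<n. (ue \<epsilon> i - u0 i - complex_of_real \<epsilon> * z i) * adjE (complex_of_real (s k)) i (m k)) * G k j)"
      by (rule G[OF j])
    also have "(\<Sum>i<n. (ue \<epsilon> i - u0 i - complex_of_real \<epsilon> * z i) * l0 i) = 0"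
      using elim(2) norm0 z0 by (simp add: left_diff_distrib sum_subtractf mult.assoc sum_distrib_left[symmetric])
    also have "(\<Sum>k\<in>{1..<n}. (\<Sum>i<n. (ue \<epsilon> i - u0 i - complex_of_real \<epsilon> * z i) * adjE (complex_of_real (s k)) i (m k)) * G k j)
        = (\<Sum>k\<in>{1..<n}. complex_of_real \<epsilon> * (?r \<epsilon> k * G k j))"
    proof (intro sum.cong refl)
      fix k assume k: "k \<in> {1..<n}"
      have zr: "(\<Sum>i<n. z i * adjE (complex_of_real (s k)) i (m k)) = (1 / complex_of_real (s k)) *
        (\<Sum>i<n. \<Sum>j<n. f0 (complex_of_real (s k)) i * (K (complex_of_real (s k)) $$ (i, j) * adjE (complex_of_real (s k)) j (m k)))"
        using z_root[OF k] s_pos[OF k] by (simp add: field_simps)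
      have "(\<Sum>i<n. (ue \<epsilon> i - u0 i - complex_of_real \<epsilon> * z i) * adjE (complex_of_real (s k)) i (m k))
         = (\<Sum>i<n. ue \<epsilon> i * adjE (complex_of_real (s k)) i (m k)) - (\<Sum>i<n. u0 i * adjE (complex_of_real (s k)) i (m k))
           - complex_of_real \<epsilon> * (\<Sum>i<n. z i * adjE (complex_of_real (s k)) i (m k))"
        by (simp add: left_diff_distrib sum_subtractf mult.assoc sum_distrib_left)
      also have "\<dots> = complex_of_real \<epsilon> * ?r \<epsilon> k"
        unfolding zr elim(1)[rule_format, OF k] u0_root[OF k]
        by (simp add: left_diff_distrib right_diff_distrib sum_subtractf diff_divide_distrib)
      finally show "(\<Sum>i<n. (ue \<epsilon> i - u0 i - complex_of_real \<epsilon> * z i) * adjE (complex_of_real (s k)) i (m k)) * G k j = complex_of_real \<epsilon> * (?r \<epsilon> k * G k j)"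
        by (simp only: mult.assoc)
    qed
    finally show ?case by (simp only: sum_distrib_left[symmetric] power_one_right mult_zero_left add_0)
  qed
  moreover have "(\<lambda>\<epsilon>. complex_of_real \<epsilon> ^ 1 * (\<Sum>k\<in>{1..<n}. ?r \<epsilon> k * G k j))
      \<in> O[at_right 0](\<lambda>\<epsilon>. complex_of_real \<epsilon> ^ 1 * complex_of_real \<epsilon> ^ 1)"
  proof (intro landau_o.big.mult landau_o.big_refl big_sum_in_bigo)
    fix k assume k: "k \<in> {1..<n}"
    have "(\<lambda>\<epsilon>. ?r \<epsilon> k * G k j) \<in> O[at_right 0](\<lambda>\<epsilon>. 1 * (complex_of_real \<epsilon> ^ 1 * 1) * 1)"
      by (intro landau_o.big.mult big_sum_in_bigo fe_first_root[OF k]) simp_all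
    then show "(\<lambda>\<epsilon>. ?r \<epsilon> k * G k j) \<in> O[at_right 0](\<lambda>\<epsilon>. complex_of_real \<epsilon> ^ 1)"
      by (simp only: mult_1_right mult_1_left)
  qed
  ultimately show ?thesis
    by (simp only: power2_eq_square power_one_right) (rule landau_o.big.in_cong[THEN iffD2])
qed

lemma expansion_uniform:
  assumes "admissible S" "j < n"
  shows "(\<lambda>p. fe (fst p) (snd p) j - f0 (snd p) j - complex_of_real (fst p) * \<Psi> (snd p) j)
     \<in> O[unif S](\<lambda>p. complex_of_real (fst p) ^ 2)"
  by (rule second_order[OF assms ue_first ue_second])

lemma expansion_pointwise:
  assumes "0 \<le> Re \<zeta>" "det (E \<zeta>) \<noteq> 0" "j < n"
  shows "(\<lambda>\<epsilon>. fe \<epsilon> \<zeta> j - f0 \<zeta> j - complex_of_real \<epsilon> * \<Psi> \<zeta> j) \<in> O[at_right 0](\<lambda>\<epsilon>. complex_of_real \<epsilon> ^ 2)"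
proof -
  have "admissible {\<zeta>}" using assms by (simp add: admissible_def)
  from expansion_uniform[OF this assms(3)] show ?thesis unfolding bigo_unif_singleton by simp
qed

text \<open>A continuation \<open>\<theta>\<close> of the first-order term into a root is again the first-order term there: the
  error is holomorphic in \<open>\<zeta>\<close> and \<open>O(\<epsilon>\<^sup>2)\<close> on a circle around the root.\<close>

lemma expansion_at_root:
  assumes k: "k \<in> {1..<n}" and hol: "\<theta> holomorphic_on {\<zeta>. 0 < Re \<zeta>}"
    and \<theta>: "\<And>\<zeta>. 0 < Re \<zeta> \<Longrightarrow> det (E \<zeta>) \<noteq> 0 \<Longrightarrow> \<theta> \<zeta> = (\<Sum>j<n. \<Psi> \<zeta> j * w j)"
  shows "(\<lambda>\<epsilon>. (\<Sum>j<n. fe \<epsilon> (complex_of_real (s k)) j * w j) - (\<Sum>j<n. f0 (complex_of_real (s k)) j * w j)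
     - complex_of_real \<epsilon> * \<theta> (complex_of_real (s k))) \<in> O[at_right 0](\<lambda>\<epsilon>. complex_of_real \<epsilon> ^ 2)"
proof -
  let ?s = "complex_of_real (s k)"
  obtain \<rho> where \<rho>: "0 < \<rho>" "cball ?s \<rho> \<subseteq> {\<zeta>. 0 < Re \<zeta>}" "admissible (sphere ?s \<rho>)"
    using root_circle[OF k] by metis
  let ?g = "\<lambda>\<epsilon> \<zeta>. (\<Sum>j<n. fe \<epsilon> \<zeta> j * w j) - (\<Sum>j<n. f0 \<zeta> j * w j) - complex_of_real \<epsilon> * \<theta> \<zeta>"
  have "(\<lambda>p. ?g (fst p) (snd p)) \<in> O[unif (cball ?s \<rho>)](\<lambda>p. complex_of_real (fst p) ^ 2)"
  proof (rule bigo_unif_disc[where g = ?g, OF _ \<rho>(2,1)])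
    show "\<forall>\<^sub>F \<epsilon> in at_right 0. ?g \<epsilon> holomorphic_on {\<zeta>. 0 < Re \<zeta>}"
      using fe_hol by eventually_elim (auto intro!: holomorphic_intros f0_hol hol)
    have "(\<lambda>p. \<Sum>j<n. (fe (fst p) (snd p) j - f0 (snd p) j - complex_of_real (fst p) * \<Psi> (snd p) j) * w j)
        \<in> O[unif (sphere ?s \<rho>)](\<lambda>p. complex_of_real (fst p) ^ 2 * 1)"
      by (intro big_sum_in_bigo landau_o.big.mult expansion_uniform \<rho>) simp_all
    moreover have "\<forall>\<^sub>F p in unif (sphere ?s \<rho>). ?g (fst p) (snd p) =
        (\<Sum>j<n. (fe (fst p) (snd p) j - f0 (snd p) j - complex_of_real (fst p) * \<Psi> (snd p) j) * w j)"
      unfolding eventually_unif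
    proof (intro always_eventually allI ballI)
      fix \<epsilon> \<zeta> assume \<zeta>: "\<zeta> \<in> sphere ?s \<rho>"
      have "\<zeta> \<in> cball ?s \<rho>" using \<zeta> by simp
      then have "0 < Re \<zeta>" using \<rho>(2) by blast
      moreover have "det (E \<zeta>) \<noteq> 0" using \<rho>(3) \<zeta> by (simp add: admissible_def)
      ultimately have "\<theta> \<zeta> = (\<Sum>j<n. \<Psi> \<zeta> j * w j)" by (rule \<theta>)
      then show "?g (fst (\<epsilon>, \<zeta>)) (snd (\<epsilon>, \<zeta>)) =
          (\<Sum>j<n. (fe (fst (\<epsilon>, \<zeta>)) (snd (\<epsilon>, \<zeta>)) j - f0 (snd (\<epsilon>, \<zeta>)) j - complex_of_real (fst (\<epsilon>, \<zeta>)) * \<Psi> (snd (\<epsilon>, \<zeta>)) j) * w j)"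
        by (simp add: left_diff_distrib sum_subtractf mult.assoc sum_distrib_left)
    qed
    ultimately show "(\<lambda>p. ?g (fst p) (snd p)) \<in> O[unif (sphere ?s \<rho>)](\<lambda>p. complex_of_real (fst p) ^ 2)"
      by (simp only: mult_1_right) (rule landau_o.big.in_cong[THEN iffD2])
  qed
  from bigo_unif_mono[OF _ this, of "{?s}"] \<rho>(1) show ?thesis
    unfolding bigo_unif_singleton by simp
qed

text \<open>\<open>\<Psi>\<close> is the limit of \<open>(fe - f0) / \<epsilon>\<close>, which is bounded on a whole disc around the root. This is
  where the apparent pole of \<open>\<Psi>\<close> disappears.\<close>

lemma \<Psi>_bounded_near_root:
  assumes k: "k \<in> {1..<n}" and j: "j < n"
  shows "\<exists>B. \<forall>\<^sub>F \<zeta> in at (complex_of_real (s k)). norm (\<Psi> \<zeta> j) \<le> B"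
proof -
  let ?s = "complex_of_real (s k)"
  obtain \<rho> where \<rho>: "0 < \<rho>" "cball ?s \<rho> \<subseteq> {\<zeta>. 0 < Re \<zeta>}" "admissible (sphere ?s \<rho>)"
    and nz: "\<And>\<zeta>. \<zeta> \<in> cball ?s \<rho> \<Longrightarrow> \<zeta> \<noteq> ?s \<Longrightarrow> det (E \<zeta>) \<noteq> 0"
    using root_circle[OF k] by metis
  obtain C where C: "\<forall>\<^sub>F \<epsilon> in at_right 0. \<forall>\<zeta>\<in>cball ?s \<rho>. norm (fe \<epsilon> \<zeta> j - f0 \<zeta> j) \<le> C * \<epsilon> ^ 1"
    using fe_first_disc[OF k j \<rho>] unfolding bigo_unif_iff by auto
  have "norm (\<Psi> \<zeta> j) \<le> C" if \<zeta>: "\<zeta> \<in> cball ?s \<rho>" "\<zeta> \<noteq> ?s" for \<zeta>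
  proof -
    have "0 < Re \<zeta>" using \<zeta>(1) \<rho>(2) by blast
    then have "(\<lambda>\<epsilon>. fe \<epsilon> \<zeta> j - f0 \<zeta> j - complex_of_real \<epsilon> * \<Psi> \<zeta> j) \<in> O[at_right 0](\<lambda>\<epsilon>. complex_of_real \<epsilon> ^ 2)"
      by (intro expansion_pointwise nz \<zeta> j) simp
    then have "((\<lambda>\<epsilon>. (fe \<epsilon> \<zeta> j - f0 \<zeta> j) / complex_of_real \<epsilon>) \<longlongrightarrow> \<Psi> \<zeta> j) (at_right 0)"
      by (rule bigo_square_tendsto)
    then show ?thesis
    proof (rule tendsto_upperbound[OF tendsto_norm])
      have "\<forall>\<^sub>F \<epsilon> in at_right (0::real). 0 < \<epsilon>" by (rule eventually_at_right_less)
      with C show "\<forall>\<^sub>F \<epsilon> in at_right 0. norm ((fe \<epsilon> \<zeta> j - f0 \<zeta> j) / complex_of_real \<epsilon>) \<le> C"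
        by eventually_elim (use \<zeta>(1) in \<open>auto simp: norm_divide field_simps\<close>)
    qed simp
  qed
  moreover have "\<forall>\<^sub>F \<zeta> in at ?s. \<zeta> \<in> cball ?s \<rho> \<and> \<zeta> \<noteq> ?s"
    using \<rho>(1) by (auto simp: eventually_at dist_commute intro!: exI[of _ \<rho>])
  ultimately show ?thesis by (intro exI[of _ C]) (auto elim: eventually_mono)
qed

end

section \<open>The invariance equation of the workload chain\<close>

text \<open>The law of the workload after one step with increment \<open>m\<close> (reflected at \<open>0\<close>), restricted to the
  event that a transition of probability \<open>c\<close> occurs. Dummy and real customers differ only in \<open>m\<close> and \<open>c\<close>.\<close>

definition jump_law :: "(real \<times> nat) measure \<Rightarrow> 'b measure \<Rightarrow> ('b \<Rightarrow> real) \<Rightarrow> (nat \<Rightarrow> real) \<Rightarrow> real measure" where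
  "jump_law \<nu> S m c = distr (density (\<nu> \<Otimes>\<^sub>M S) (\<lambda>x. ennreal (c (snd (fst x))))) borel (\<lambda>x. max 0 (fst (fst x) + m (snd x)))"

locale jump = pair_prob_space \<nu> S
  for \<nu> :: "(real \<times> nat) measure" and S :: "'b measure" +
  fixes n :: nat and m :: "'b \<Rightarrow> real" and c :: "nat \<Rightarrow> real"
  assumes sets_nu: "sets \<nu> = sets (borel \<Otimes>\<^sub>M count_space {..<n})"
    and m: "m \<in> borel_measurable S"
    and c_nonneg: "\<And>i. i < n \<Longrightarrow> 0 \<le> c i"
begin

lemma space_nu: "space \<nu> = UNIV \<times> {..<n}"
  using sets_eq_imp_space_eq[OF sets_nu] by (simp only: space_pair_measure space_borel space_count_space)

lemma snd_less: "x \<in> space \<nu> \<Longrightarrow> snd x < n"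
  unfolding space_nu by (simp only: mem_Times_iff lessThan_iff)

lemmas [measurable_cong] = sets_nu
lemmas [measurable] = m

lemma c_measurable [measurable]: "(\<lambda>x. c (snd x)) \<in> borel_measurable \<nu>"
proof -
  have "c \<in> borel_measurable (count_space {..<n})" by simp
  moreover have "snd \<in> measurable \<nu> (count_space {..<n})" by measurable
  ultimately show ?thesis by (rule measurable_compose[rotated])
qed

lemma c_measurable_pair [measurable]: "(\<lambda>x. c (snd (fst x))) \<in> borel_measurable (\<nu> \<Otimes>\<^sub>M S)"
  by (rule measurable_compose[OF measurable_fst c_measurable])

lemma fst_measurable [measurable]: "fst \<in> borel_measurable \<nu>"
  by measurable

lemma step_measurable [measurable]: "(\<lambda>x. max 0 (fst (fst x) + m (snd x))) \<in> borel_measurable (\<nu> \<Otimes>\<^sub>M S)"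
  by measurable

lemma emeasure_jump_law:
  assumes A [measurable]: "A \<in> sets borel"
  shows "emeasure (jump_law \<nu> S m c) A =
    (\<integral>\<^sup>+x. ennreal (c (snd x)) * emeasure S {s \<in> space S. max 0 (fst x + m s) \<in> A} \<partial>\<nu>)"
proof -
  have "emeasure (jump_law \<nu> S m c) A = (\<integral>\<^sup>+y. indicator A y \<partial>jump_law \<nu> S m c)"
    using A by (simp add: jump_law_def)
  also have "\<dots> = (\<integral>\<^sup>+x. ennreal (c (snd (fst x))) * indicator A (max 0 (fst (fst x) + m (snd x))) \<partial>(\<nu> \<Otimes>\<^sub>M S))"
    unfolding jump_law_def by (simp add: nn_integral_distr nn_integral_density del: nn_integral_indicator)
  also have "\<dots> = (\<integral>\<^sup>+x. \<integral>\<^sup>+s. ennreal (c (snd x)) * indicator A (max 0 (fst x + m s)) \<partial>S \<partial>\<nu>)"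
    by (subst M2.nn_integral_fst[symmetric]) simp_all
  also have "\<dots> = (\<integral>\<^sup>+x. ennreal (c (snd x)) * emeasure S {s \<in> space S. max 0 (fst x + m s) \<in> A} \<partial>\<nu>)"
  proof (intro nn_integral_cong)
    fix x assume "x \<in> space \<nu>"
    have [measurable]: "{s \<in> space S. max 0 (fst x + m s) \<in> A} \<in> sets S" by measurable
    have "(\<integral>\<^sup>+s. ennreal (c (snd x)) * indicator A (max 0 (fst x + m s)) \<partial>S)
       = (\<integral>\<^sup>+s. ennreal (c (snd x)) * indicator {s \<in> space S. max 0 (fst x + m s) \<in> A} s \<partial>S)"
      by (intro nn_integral_cong) (auto simp: indicator_def)
    also have "\<dots> = ennreal (c (snd x)) * emeasure S {s \<in> space S. max 0 (fst x + m s) \<in> A}"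
      by (subst nn_integral_cmult) simp_all
    finally show "(\<integral>\<^sup>+s. ennreal (c (snd x)) * indicator A (max 0 (fst x + m s)) \<partial>S) = \<dots>" .
  qed
  finally show ?thesis .
qed

lemma c_bound: "x \<in> space \<nu> \<Longrightarrow> \<bar>c (snd x)\<bar> \<le> (\<Sum>i<n. \<bar>c i\<bar>)"
  using snd_less[of x] by (intro member_le_sum) auto

lemma integral_jump_law:
  fixes f :: "real \<Rightarrow> complex"
  assumes f [measurable]: "f \<in> borel_measurable borel" and bound: "\<And>v. 0 \<le> v \<Longrightarrow> norm (f v) \<le> 1"
  shows "integrable (jump_law \<nu> S m c) f"
    and "(\<integral>y. f y \<partial>jump_law \<nu> S m c) = (\<integral>x. complex_of_real (c (snd x)) * (\<integral>s. f (max 0 (fst x + m s)) \<partial>S) \<partial>\<nu>)"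
    and "integrable \<nu> (\<lambda>x. complex_of_real (c (snd x)) * (\<integral>s. f (max 0 (fst x + m s)) \<partial>S))"
proof -
  define B where "B = (\<Sum>i<n. \<bar>c i\<bar>)"
  have B: "\<And>x. x \<in> space \<nu> \<Longrightarrow> \<bar>c (snd x)\<bar> \<le> B" unfolding B_def by (rule c_bound)
  let ?h = "\<lambda>x. complex_of_real (c (snd (fst x))) * f (max 0 (fst (fst x) + m (snd x)))"
  have nn: "AE x in \<nu> \<Otimes>\<^sub>M S. 0 \<le> c (snd (fst x))"
    by (rule AE_I2) (auto simp: space_pair_measure intro!: c_nonneg snd_less)
  have int: "integrable (\<nu> \<Otimes>\<^sub>M S) ?h"
  proof (rule P.integrable_const_bound[where B = B])
    show "AE x in \<nu> \<Otimes>\<^sub>M S. norm (?h x) \<le> B"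
    proof (rule AE_I2)
      fix x assume "x \<in> space (\<nu> \<Otimes>\<^sub>M S)"
      then have "\<bar>c (snd (fst x))\<bar> \<le> B" using B by (auto simp: space_pair_measure)
      moreover have "norm (f (max 0 (fst (fst x) + m (snd x)))) \<le> 1" by (rule bound) simp
      ultimately have "\<bar>c (snd (fst x))\<bar> * norm (f (max 0 (fst (fst x) + m (snd x)))) \<le> B * 1"
        by (intro mult_mono) auto
      then show "norm (?h x) \<le> B" by (simp add: norm_mult)
    qed
  qed measurable
  have eq: "(\<lambda>x. c (snd (fst x)) *\<^sub>R f (max 0 (fst (fst x) + m (snd x)))) = ?h"
    by (simp add: scaleR_conv_of_real)
  show "integrable (jump_law \<nu> S m c) f"
    unfolding jump_law_def
    by (subst integrable_distr_eq) (measurable, subst integrable_density, use nn int in \<open>simp_all add: eq\<close>)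
  have F: "(\<lambda>x. ?h x) = (\<lambda>(x, s). complex_of_real (c (snd x)) * f (max 0 (fst x + m s)))"
    by (simp add: fun_eq_iff)
  have inner: "(\<integral>s. complex_of_real (c (snd x)) * f (max 0 (fst x + m s)) \<partial>S)
      = complex_of_real (c (snd x)) * (\<integral>s. f (max 0 (fst x + m s)) \<partial>S)" for x
    by simp
  have "(\<integral>y. f y \<partial>jump_law \<nu> S m c) = (\<integral>x. ?h x \<partial>(\<nu> \<Otimes>\<^sub>M S))"
    unfolding jump_law_def
    by (subst integral_distr) (measurable, subst integral_density, use nn in \<open>simp_all add: eq\<close>)
  also have "\<dots> = (\<integral>x. \<integral>s. complex_of_real (c (snd x)) * f (max 0 (fst x + m s)) \<partial>S \<partial>\<nu>)"
    unfolding F by (rule integral_fst[symmetric]) (use int in \<open>simp only: F\<close>)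
  finally show "(\<integral>y. f y \<partial>jump_law \<nu> S m c) = (\<integral>x. complex_of_real (c (snd x)) * (\<integral>s. f (max 0 (fst x + m s)) \<partial>S) \<partial>\<nu>)"
    unfolding inner .
  show "integrable \<nu> (\<lambda>x. complex_of_real (c (snd x)) * (\<integral>s. f (max 0 (fst x + m s)) \<partial>S))"
    using integrable_fst[of "\<lambda>x s. complex_of_real (c (snd x)) * f (max 0 (fst x + m s))"] int
    unfolding inner F by simp
qed

end

locale steady = arrivals N D1 D2 \<pi> for N D1 D2 \<pi> +
  fixes G :: "real measure" and \<nu> :: "(real \<times> nat) measure"
  assumes ss: "steady_state D1 D2 G \<nu>" and G: "nonneg_dist G"
begin

sublocale nu: prob_space \<nu> using ss by (simp add: steady_state_def)
sublocale G: nonneg_finite_measure G using G by (rule nonneg_finite_measureI_dist)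
sublocale GP: prob_space G using G by (simp add: nonneg_dist_def real_distribution_def)

lemma sets_nu [measurable_cong]: "sets \<nu> = sets (borel \<Otimes>\<^sub>M count_space {..<N})"
  using ss unfolding steady_state_def dim by blast

lemma space_nu: "space \<nu> = UNIV \<times> {..<N}"
  using sets_eq_imp_space_eq[OF sets_nu] by (simp only: space_pair_measure space_borel space_count_space)

lemma AE_fst: "AE x in \<nu>. 0 \<le> fst x"
  using ss by (simp add: steady_state_def)

abbreviation g where "g i \<equiv> (\<lambda>x :: real \<times> nat. if snd x = i then 1 else (0 :: complex))"

lemma g_measurable [measurable]: "g i \<in> borel_measurable \<nu>"
proof -
  have "(\<lambda>k. if k = i then 1 else (0 :: complex)) \<in> borel_measurable (count_space {..<N})" by simp
  moreover have "snd \<in> measurable \<nu> (count_space {..<N})" by measurable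
  ultimately show ?thesis by (rule measurable_compose[rotated])
qed

lemma fst_measurable [measurable]: "fst \<in> borel_measurable \<nu>"
  by measurable

sublocale L: bounded_laplace \<nu> "g i" fst for i
  by (intro bounded_laplace.intro bounded_laplace_axioms.intro g_measurable fst_measurable AE_fst
      nu.finite_measure_axioms) simp

definition \<phi> :: "complex \<Rightarrow> nat \<Rightarrow> complex" where "\<phi> \<zeta> i = laplace \<nu> (g i) fst \<zeta>"

text \<open>A function of the tag integrates against \<open>\<nu>\<close> as a linear combination of the tagged transforms.\<close>

lemma integral_weighted:
  assumes "0 \<le> Re \<zeta>"
  shows "(\<integral>x. complex_of_real (c (snd x)) * exp (- \<zeta> * complex_of_real (fst x)) \<partial>\<nu>) = (\<Sum>i<N. complex_of_real (c i) * \<phi> \<zeta> i)"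
    and "integrable \<nu> (\<lambda>x. complex_of_real (c (snd x)) * exp (- \<zeta> * complex_of_real (fst x)))"
proof -
  have eq: "complex_of_real (c (snd x)) * exp (- \<zeta> * complex_of_real (fst x)) =
     (\<Sum>i<N. complex_of_real (c i) * (g i x * exp (- \<zeta> * complex_of_real (fst x))))" if "x \<in> space \<nu>" for x
  proof -
    have "snd x < N" using that unfolding space_nu by auto
    moreover have "(\<Sum>i<N. complex_of_real (c i) * (g i x * exp (- \<zeta> * complex_of_real (fst x)))) =
       (\<Sum>i<N. if i = snd x then complex_of_real (c i) * exp (- \<zeta> * complex_of_real (fst x)) else 0)"
      by (intro sum.cong) auto
    ultimately show ?thesis by simp
  qed
  have "(\<integral>x. complex_of_real (c (snd x)) * exp (- \<zeta> * complex_of_real (fst x)) \<partial>\<nu>) =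
     (\<integral>x. (\<Sum>i<N. complex_of_real (c i) * (g i x * exp (- \<zeta> * complex_of_real (fst x)))) \<partial>\<nu>)"
    by (intro Bochner_Integration.integral_cong eq refl)
  also have "\<dots> = (\<Sum>i<N. complex_of_real (c i) * \<phi> \<zeta> i)"
    unfolding \<phi>_def laplace_def
    by (subst Bochner_Integration.integral_sum)
      (rule integrable_mult_right, rule L.laplace_integrable[OF assms], simp only: integral_mult_right_zero)
  finally show "(\<integral>x. complex_of_real (c (snd x)) * exp (- \<zeta> * complex_of_real (fst x)) \<partial>\<nu>) = (\<Sum>i<N. complex_of_real (c i) * \<phi> \<zeta> i)" .
  show "integrable \<nu> (\<lambda>x. complex_of_real (c (snd x)) * exp (- \<zeta> * complex_of_real (fst x)))"
    by (subst Bochner_Integration.integrable_cong[OF refl eq], assumption)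
      (intro Bochner_Integration.integrable_sum integrable_mult_right L.laplace_integrable[OF assms])
qed

abbreviation T where "T j \<equiv> density lborel (exponential_density (lam j))"

lemma prob_T: "j < N \<Longrightarrow> prob_space (T j)"
  using rate_pos by (intro prob_space_exponential_density)

text \<open>The hypothesis is the transform of the reflected increment from a fixed workload \<open>v\<close>. It is affine in
  \<open>exp (- \<zeta> v)\<close> and \<open>exp (- l v)\<close>, so integrating over the workload involves \<open>\<phi>\<close> at \<open>\<zeta>\<close> and at \<open>l\<close> only.\<close>

lemma jump_transform:
  fixes S :: "'b measure"
  assumes "jump \<nu> S N m c" and \<zeta>: "0 \<le> Re \<zeta>" and l: "0 < l"
    and H: "\<And>v. 0 \<le> v \<Longrightarrow> (complex_of_real l - \<zeta>) * (\<integral>s. exp (- \<zeta> * complex_of_real (max 0 (v + m s))) \<partial>S)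
       = complex_of_real l * g1 * exp (- \<zeta> * complex_of_real v) - \<zeta> * g2 * exp (- complex_of_real l * complex_of_real v)"
  shows "(complex_of_real l - \<zeta>) * lst (jump_law \<nu> S m c) \<zeta> =
    complex_of_real l * g1 * (\<Sum>i<N. complex_of_real (c i) * \<phi> \<zeta> i) - \<zeta> * g2 * (\<Sum>i<N. complex_of_real (c i) * \<phi> (complex_of_real l) i)"
proof -
  interpret J: jump \<nu> S N m c by fact
  let ?f = "\<lambda>v. exp (- \<zeta> * complex_of_real v)"
  have f: "?f \<in> borel_measurable borel" by measurable
  have b: "norm (?f v) \<le> 1" if "0 \<le> v" for v using norm_laplace_kernel_le[OF \<zeta> that, of 1] by simp
  note J = J.integral_jump_law
  have l': "0 \<le> Re (complex_of_real l)" using l by simp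
  have e: "lst (jump_law \<nu> S m c) \<zeta> = (\<integral>x. complex_of_real (c (snd x)) * (\<integral>s. ?f (max 0 (fst x + m s)) \<partial>S) \<partial>\<nu>)"
    unfolding lst_def by (rule J(2)[OF f b])
  have "(complex_of_real l - \<zeta>) * lst (jump_law \<nu> S m c) \<zeta> =
     (\<integral>x. (complex_of_real l - \<zeta>) * (complex_of_real (c (snd x)) * (\<integral>s. ?f (max 0 (fst x + m s)) \<partial>S)) \<partial>\<nu>)"
    unfolding e by (rule integral_mult_right_zero[symmetric])
  also have "\<dots> = (\<integral>x. complex_of_real l * g1 * (complex_of_real (c (snd x)) * exp (- \<zeta> * complex_of_real (fst x)))
      - \<zeta> * g2 * (complex_of_real (c (snd x)) * exp (- complex_of_real l * complex_of_real (fst x))) \<partial>\<nu>)"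
  proof (rule integral_cong_AE)
    show "(\<lambda>x. (complex_of_real l - \<zeta>) * (complex_of_real (c (snd x)) * (\<integral>s. ?f (max 0 (fst x + m s)) \<partial>S))) \<in> borel_measurable \<nu>"
      by (rule borel_measurable_times[OF borel_measurable_const borel_measurable_integrable[OF J(3)[OF f b]]])
    show "(\<lambda>x. complex_of_real l * g1 * (complex_of_real (c (snd x)) * exp (- \<zeta> * complex_of_real (fst x)))
      - \<zeta> * g2 * (complex_of_real (c (snd x)) * exp (- complex_of_real l * complex_of_real (fst x)))) \<in> borel_measurable \<nu>"
      by (intro borel_measurable_diff borel_measurable_times borel_measurable_const
        borel_measurable_integrable[OF integral_weighted(2)[OF \<zeta>]] borel_measurable_integrable[OF integral_weighted(2)[OF l']])
    show "AE x in \<nu>. (complex_of_real l - \<zeta>) * (complex_of_real (c (snd x)) * (\<integral>s. ?f (max 0 (fst x + m s)) \<partial>S)) =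
       complex_of_real l * g1 * (complex_of_real (c (snd x)) * exp (- \<zeta> * complex_of_real (fst x)))
      - \<zeta> * g2 * (complex_of_real (c (snd x)) * exp (- complex_of_real l * complex_of_real (fst x)))"
      using AE_fst
    proof eventually_elim
      case (elim x)
      have "(complex_of_real l - \<zeta>) * (complex_of_real (c (snd x)) * (\<integral>s. ?f (max 0 (fst x + m s)) \<partial>S))
         = complex_of_real (c (snd x)) * ((complex_of_real l - \<zeta>) * (\<integral>s. ?f (max 0 (fst x + m s)) \<partial>S))"
        by (simp only: ac_simps)
      then show ?case unfolding H[OF elim] by (simp only: right_diff_distrib ac_simps)
    qed
  qed
  also have "\<dots> = complex_of_real l * g1 * (\<Sum>i<N. complex_of_real (c i) * \<phi> \<zeta> i) - \<zeta> * g2 * (\<Sum>i<N. complex_of_real (c i) * \<phi> (complex_of_real l) i)"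
    unfolding integral_weighted(1)[OF \<zeta>, symmetric] integral_weighted(1)[OF l', symmetric]
    by (subst Bochner_Integration.integral_diff, (rule integrable_mult_right, rule integral_weighted(2), rule \<zeta>),
      (rule integrable_mult_right, rule integral_weighted(2), rule l'), simp only: integral_mult_right_zero)
  finally show ?thesis .
qed

text \<open>The part of one step that is due to idleness: up to the factor \<open>\<zeta>\<close> it collects the correction
  terms for the reflection at \<open>0\<close>.\<close>

definition u :: "nat \<Rightarrow> complex" where
  "u j = (\<Sum>i<N. complex_of_real (p i j * q1 i j) * \<phi> (complex_of_real (lam j)) i)
     + lst G (complex_of_real (lam j)) * (\<Sum>i<N. complex_of_real (p i j * q2 i j) * \<phi> (complex_of_real (lam j)) i)"

text \<open>The law of the next workload with tag \<open>j\<close> is the sum of the laws produced by dummy and by real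
  customers; this is invariance of \<open>\<nu>\<close>, read as an identity of measures and then of transforms.\<close>

lemma invariance:
  assumes j: "j < N" and \<zeta>: "0 \<le> Re \<zeta>"
  shows "\<phi> \<zeta> j = lst (jump_law \<nu> (T j) (\<lambda>t. - t) (\<lambda>i. p i j * q1 i j)) \<zeta>
     + lst (jump_law \<nu> (G \<Otimes>\<^sub>M T j) (\<lambda>(b, t). b - t) (\<lambda>i. p i j * q2 i j)) \<zeta>"
    and "jump \<nu> (T j) N (\<lambda>t. - t) (\<lambda>i. p i j * q1 i j)"
    and "jump \<nu> (G \<Otimes>\<^sub>M T j) N (\<lambda>(b, t). b - t) (\<lambda>i. p i j * q2 i j)"
proof -
  interpret T: prob_space "T j" by (rule prob_T[OF j])
  interpret GT: prob_space "G \<Otimes>\<^sub>M T j" by (rule prob_space_pair) unfold_locales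
  have GTm: "(\<lambda>(b, t). b - t) \<in> borel_measurable (G \<Otimes>\<^sub>M T j)"
  proof -
    have "(\<lambda>x :: real \<times> real. fst x - snd x) \<in> borel_measurable (borel \<Otimes>\<^sub>M borel)" by measurable
    moreover have s: "sets (G \<Otimes>\<^sub>M T j) = sets (borel \<Otimes>\<^sub>M borel)"
      by (intro sets_pair_measure_cong G.sets_F) simp
    ultimately show ?thesis unfolding split_beta' measurable_cong_sets[OF s refl] by blast
  qed
  have "pair_prob_space \<nu> (T j)" by unfold_locales
  then show J1: "jump \<nu> (T j) N (\<lambda>t. - t) (\<lambda>i. p i j * q1 i j)"
    by (intro jump.intro jump_axioms.intro sets_nu mult_nonneg_nonneg p_nonneg q_nonneg j) simp_all
  have "pair_prob_space \<nu> (G \<Otimes>\<^sub>M T j)" by unfold_locales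
  then show J2: "jump \<nu> (G \<Otimes>\<^sub>M T j) N (\<lambda>(b, t). b - t) (\<lambda>i. p i j * q2 i j)"
    by (intro jump.intro jump_axioms.intro sets_nu GTm mult_nonneg_nonneg p_nonneg q_nonneg j) simp_all
  interpret J1: jump \<nu> "T j" N "\<lambda>t. - t" "\<lambda>i. p i j * q1 i j" by (rule J1)
  interpret J2: jump \<nu> "G \<Otimes>\<^sub>M T j" N "\<lambda>(b, t). b - t" "\<lambda>i. p i j * q2 i j" by (rule J2)
  let ?L = "distr (density \<nu> (\<lambda>x. ennreal (if snd x = j then 1 else 0))) borel fst"
  let ?R1 = "jump_law \<nu> (T j) (\<lambda>t. - t) (\<lambda>i. p i j * q1 i j)"
  let ?R2 = "jump_law \<nu> (G \<Otimes>\<^sub>M T j) (\<lambda>(b, t). b - t) (\<lambda>i. p i j * q2 i j)"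
  have [measurable]: "(\<lambda>x. if snd x = j then 1 else 0 :: real) \<in> borel_measurable \<nu>"
  proof -
    have "(\<lambda>k. if k = j then 1 else (0 :: real)) \<in> borel_measurable (count_space {..<N})" by simp
    moreover have "snd \<in> measurable \<nu> (count_space {..<N})" by measurable
    ultimately show ?thesis by (rule measurable_compose[rotated])
  qed
  have spG: "space G = UNIV" using sets_eq_imp_space_eq[OF G.sets_F] by (simp only: space_borel)
  have spT: "space (T j) = UNIV" by (simp only: space_density space_lborel space_borel)
  have spGT: "space (G \<Otimes>\<^sub>M T j) = UNIV" by (simp only: space_pair_measure spG spT UNIV_Times_UNIV)
  have "?L = msum 1 ?R1 1 ?R2"
  proof (rule measure_eqI)
    show "sets ?L = sets (msum 1 ?R1 1 ?R2)" by simp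
    fix A assume "A \<in> sets ?L"
    then have A [measurable]: "A \<in> sets borel" by simp
    have Aj: "A \<times> {j} \<in> sets \<nu>" unfolding sets_nu using A j by (intro pair_measureI) auto
    have "emeasure ?L A = (\<integral>\<^sup>+x. indicator A x \<partial>?L)" by simp
    also have "\<dots> = (\<integral>\<^sup>+x. ennreal (if snd x = j then 1 else 0) * indicator A (fst x) \<partial>\<nu>)"
      by (simp add: nn_integral_distr nn_integral_density del: nn_integral_indicator)
    also have "\<dots> = (\<integral>\<^sup>+x. indicator (A \<times> {j}) x \<partial>\<nu>)"
      by (intro nn_integral_cong) (auto simp: indicator_def)
    also have "\<dots> = emeasure \<nu> (A \<times> {j})" using Aj by simp
    also have "\<dots> = (\<integral>\<^sup>+x. step_prob D1 D2 G (fst x) (snd x) A j \<partial>\<nu>)"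
      using ss A j by (simp add: steady_state_def)
    also have "\<dots> = (\<integral>\<^sup>+x. ennreal (p (snd x) j * q1 (snd x) j) * emeasure (T j) {s \<in> space (T j). max 0 (fst x + - s) \<in> A}
       + ennreal (p (snd x) j * q2 (snd x) j) * emeasure (G \<Otimes>\<^sub>M T j) {s \<in> space (G \<Otimes>\<^sub>M T j). max 0 (fst x + (case s of (b, t) \<Rightarrow> b - t)) \<in> A} \<partial>\<nu>)"
    proof (intro nn_integral_cong)
      fix x assume x: "x \<in> space \<nu>"
      then have i: "snd x < N" unfolding space_nu by (simp only: mem_Times_iff lessThan_iff)
      have 1: "{t. max 0 (fst x - t) \<in> A} = {s \<in> space (T j). max 0 (fst x + - s) \<in> A}"
        unfolding spT by (simp only: diff_conv_add_uminus UNIV_I simp_thms)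
      have 2: "{(b, t). max 0 (fst x + b - t) \<in> A} = {s \<in> space (G \<Otimes>\<^sub>M T j). max 0 (fst x + (case s of (b, t) \<Rightarrow> b - t)) \<in> A}"
        unfolding spGT by (simp only: split_beta' UNIV_I simp_thms add_diff_eq)
      show "step_prob D1 D2 G (fst x) (snd x) A j = ennreal (p (snd x) j * q1 (snd x) j) * emeasure (T j) {s \<in> space (T j). max 0 (fst x + - s) \<in> A}
       + ennreal (p (snd x) j * q2 (snd x) j) * emeasure (G \<Otimes>\<^sub>M T j) {s \<in> space (G \<Otimes>\<^sub>M T j). max 0 (fst x + (case s of (b, t) \<Rightarrow> b - t)) \<in> A}"
        unfolding step_prob_def Let_def 1 2
        using p_nonneg[OF i j] q_nonneg[OF i j] by (simp only: distrib_left ennreal_mult mult.assoc)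
    qed
    also have "\<dots> = emeasure ?R1 A + emeasure ?R2 A"
    proof -
      have m1: "(\<lambda>x. ennreal (p (snd x) j * q1 (snd x) j) * emeasure (T j) {s \<in> space (T j). max 0 (fst x + - s) \<in> A}) \<in> borel_measurable \<nu>"
      proof -
        have "{y \<in> space (\<nu> \<Otimes>\<^sub>M T j). max 0 (fst (fst y) + - snd y) \<in> A} \<in> sets (\<nu> \<Otimes>\<^sub>M T j)"
          by measurable
        from T.measurable_emeasure_Pair[OF this]
        have "(\<lambda>x. emeasure (T j) (Pair x -` {y \<in> space (\<nu> \<Otimes>\<^sub>M T j). max 0 (fst (fst y) + - snd y) \<in> A})) \<in> borel_measurable \<nu>" .
        also have "?this \<longleftrightarrow> (\<lambda>x. emeasure (T j) {s \<in> space (T j). max 0 (fst x + - s) \<in> A}) \<in> borel_measurable \<nu>"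
          by (intro measurable_cong arg_cong[where f = "emeasure (T j)"]) (auto simp: space_pair_measure)
        finally show ?thesis by (intro borel_measurable_times_ennreal measurable_compose[OF J1.c_measurable measurable_ennreal])
      qed
      have m2: "(\<lambda>x. ennreal (p (snd x) j * q2 (snd x) j) * emeasure (G \<Otimes>\<^sub>M T j) {s \<in> space (G \<Otimes>\<^sub>M T j). max 0 (fst x + (case s of (b, t) \<Rightarrow> b - t)) \<in> A}) \<in> borel_measurable \<nu>"
      proof -
        have "{y \<in> space (\<nu> \<Otimes>\<^sub>M (G \<Otimes>\<^sub>M T j)). max 0 (fst (fst y) + (case snd y of (b, t) \<Rightarrow> b - t)) \<in> A} \<in> sets (\<nu> \<Otimes>\<^sub>M (G \<Otimes>\<^sub>M T j))"
          using measurable_sets[OF J2.step_measurable A] by (simp add: vimage_def Int_def conj_commute)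
        from GT.measurable_emeasure_Pair[OF this]
        have "(\<lambda>x. emeasure (G \<Otimes>\<^sub>M T j) (Pair x -` {y \<in> space (\<nu> \<Otimes>\<^sub>M (G \<Otimes>\<^sub>M T j)). max 0 (fst (fst y) + (case snd y of (b, t) \<Rightarrow> b - t)) \<in> A})) \<in> borel_measurable \<nu>" .
        also have "?this \<longleftrightarrow> (\<lambda>x. emeasure (G \<Otimes>\<^sub>M T j) {s \<in> space (G \<Otimes>\<^sub>M T j). max 0 (fst x + (case s of (b, t) \<Rightarrow> b - t)) \<in> A}) \<in> borel_measurable \<nu>"
          by (intro measurable_cong arg_cong[where f = "emeasure (G \<Otimes>\<^sub>M T j)"]) (auto simp: space_pair_measure)
        finally show ?thesis by (intro borel_measurable_times_ennreal measurable_compose[OF J2.c_measurable measurable_ennreal])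
      qed
      show ?thesis
        unfolding J1.emeasure_jump_law[OF A] J2.emeasure_jump_law[OF A] by (rule nn_integral_add[OF m1 m2])
    qed
    also have "\<dots> = emeasure (msum 1 ?R1 1 ?R2) A"
      using A by (subst emeasure_msum) (simp_all add: jump_law_def)
    finally show "emeasure ?L A = emeasure (msum 1 ?R1 1 ?R2) A" .
  qed
  moreover have "lst ?L \<zeta> = \<phi> \<zeta> j"
  proof -
    have "lst ?L \<zeta> = (\<integral>x. (if snd x = j then 1 else 0) *\<^sub>R exp (- \<zeta> * complex_of_real (fst x)) \<partial>\<nu>)"
      unfolding lst_def by (subst integral_distr) (measurable, subst integral_density, simp_all)
    also have "\<dots> = \<phi> \<zeta> j" unfolding \<phi>_def laplace_def by (intro Bochner_Integration.integral_cong) auto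
    finally show ?thesis .
  qed
  moreover have "lst (msum 1 ?R1 1 ?R2) \<zeta> = lst ?R1 \<zeta> + lst ?R2 \<zeta>"
  proof -
    let ?f = "\<lambda>v. exp (- \<zeta> * complex_of_real v)"
    have f: "?f \<in> borel_measurable borel" by measurable
    have b: "norm (?f v) \<le> 1" if "0 \<le> v" for v using norm_laplace_kernel_le[OF \<zeta> that, of 1] by simp
    show ?thesis
      unfolding lst_def
      by (subst integral_msum(1)[OF _ _ _ _ J1.integral_jump_law(1)[OF f b] J2.integral_jump_law(1)[OF f b]])
        (simp_all add: jump_law_def)
  qed
  ultimately show "\<phi> \<zeta> j = lst ?R1 \<zeta> + lst ?R2 \<zeta>" by simp
qed

lemma balance:
  assumes j: "j < N" and \<zeta>: "0 \<le> Re \<zeta>"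
  shows "(\<Sum>i<N. \<phi> \<zeta> i * E_mat2 D1 D2 \<zeta> (lst G \<zeta>) $$ (i, j)) = \<zeta> * u j"
proof -
  let ?l = "complex_of_real (lam j)"
  have l: "0 < lam j" using rate_pos[OF j] .
  interpret T: prob_space "T j" by (rule prob_T[OF j])
  interpret GT: pair_prob_space G "T j" ..
  have H1: "(?l - \<zeta>) * (\<integral>s. exp (- \<zeta> * complex_of_real (max 0 (v + - s))) \<partial>T j)
       = ?l * 1 * exp (- \<zeta> * complex_of_real v) - \<zeta> * 1 * exp (- ?l * complex_of_real v)" if "0 \<le> v" for v
    using exponential_reflected_transform[OF l that, of \<zeta>] by simp
  have H2: "(?l - \<zeta>) * (\<integral>s. exp (- \<zeta> * complex_of_real (max 0 (v + (case s of (b, t) \<Rightarrow> b - t)))) \<partial>(G \<Otimes>\<^sub>M T j))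
       = ?l * lst G \<zeta> * exp (- \<zeta> * complex_of_real v) - \<zeta> * lst G ?l * exp (- ?l * complex_of_real v)" if v: "0 \<le> v" for v
  proof -
    have m: "(\<lambda>(b, t). exp (- \<zeta> * complex_of_real (max 0 (v + (b - t))))) \<in> borel_measurable (G \<Otimes>\<^sub>M T j)"
    proof -
      have "(\<lambda>x :: real \<times> real. exp (- \<zeta> * complex_of_real (max 0 (v + (fst x - snd x))))) \<in> borel_measurable (borel \<Otimes>\<^sub>M borel)" by measurable
      moreover have s: "sets (G \<Otimes>\<^sub>M T j) = sets (borel \<Otimes>\<^sub>M borel)"
        by (intro sets_pair_measure_cong G.sets_F) simp
      ultimately show ?thesis unfolding split_beta' measurable_cong_sets[OF s refl] by blast
    qed
    have int: "integrable (G \<Otimes>\<^sub>M T j) (\<lambda>(b, t). exp (- \<zeta> * complex_of_real (max 0 (v + (b - t)))))"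
    proof (rule GT.integrable_const_bound[where B = 1])
      show "AE x in G \<Otimes>\<^sub>M T j. norm (case x of (b, t) \<Rightarrow> exp (- \<zeta> * complex_of_real (max 0 (v + (b - t))))) \<le> 1"
        using \<zeta> by (intro AE_I2) (auto simp: norm_exp_eq_Re split: prod.split)
    qed (rule m)
    have "(\<integral>s. exp (- \<zeta> * complex_of_real (max 0 (v + (case s of (b, t) \<Rightarrow> b - t)))) \<partial>(G \<Otimes>\<^sub>M T j))
      = (\<integral>s. (case s of (b, t) \<Rightarrow> exp (- \<zeta> * complex_of_real (max 0 (v + (b - t))))) \<partial>(G \<Otimes>\<^sub>M T j))"
      by (intro Bochner_Integration.integral_cong) (auto split: prod.split)
    also have "\<dots> = (\<integral>b. \<integral>t. exp (- \<zeta> * complex_of_real (max 0 (v + (b - t)))) \<partial>T j \<partial>G)"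
      by (rule GT.integral_fst[OF int, symmetric])
    finally have "(?l - \<zeta>) * (\<integral>s. exp (- \<zeta> * complex_of_real (max 0 (v + (case s of (b, t) \<Rightarrow> b - t)))) \<partial>(G \<Otimes>\<^sub>M T j))
       = (\<integral>b. (?l - \<zeta>) * (\<integral>t. exp (- \<zeta> * complex_of_real (max 0 (v + (b - t)))) \<partial>T j) \<partial>G)" by simp
    also have "\<dots> = (\<integral>b. ?l * exp (- \<zeta> * complex_of_real v) * exp (- \<zeta> * complex_of_real b)
        - \<zeta> * exp (- ?l * complex_of_real v) * exp (- ?l * complex_of_real b) \<partial>G)"
    proof (rule integral_cong_AE)
      show "(\<lambda>b. (?l - \<zeta>) * (\<integral>t. exp (- \<zeta> * complex_of_real (max 0 (v + (b - t)))) \<partial>T j)) \<in> borel_measurable G"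
        using GT.integrable_fst[OF int] by (intro borel_measurable_times borel_measurable_const) auto
      show "(\<lambda>b. ?l * exp (- \<zeta> * complex_of_real v) * exp (- \<zeta> * complex_of_real b)
        - \<zeta> * exp (- ?l * complex_of_real v) * exp (- ?l * complex_of_real b)) \<in> borel_measurable G"
        by (rule G.measurable_F) measurable
      show "AE b in G. (?l - \<zeta>) * (\<integral>t. exp (- \<zeta> * complex_of_real (max 0 (v + (b - t)))) \<partial>T j) =
         ?l * exp (- \<zeta> * complex_of_real v) * exp (- \<zeta> * complex_of_real b)
        - \<zeta> * exp (- ?l * complex_of_real v) * exp (- ?l * complex_of_real b)"
        using G.AE_nonneg
      proof eventually_elim
        case (elim b)
        then have "0 \<le> v + b" using v by simp
        from exponential_reflected_transform[OF l this, of \<zeta>]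
        have "(?l - \<zeta>) * (\<integral>t. exp (- \<zeta> * complex_of_real (max 0 (v + (b - t)))) \<partial>T j) =
          ?l * exp (- \<zeta> * complex_of_real (v + b)) - \<zeta> * exp (- ?l * complex_of_real (v + b))"
          by (simp only: add_diff_eq)
        moreover have "exp (- c * complex_of_real (v + b)) = exp (- c * complex_of_real v) * exp (- c * complex_of_real b)" for c
          unfolding mult_exp_exp by (simp add: algebra_simps)
        ultimately show ?case by (simp only: mult.assoc)
      qed
    qed
    also have "\<dots> = ?l * exp (- \<zeta> * complex_of_real v) * lst G \<zeta> - \<zeta> * exp (- ?l * complex_of_real v) * lst G ?l"
      unfolding lst_def integral_mult_right_zero[symmetric]
      by (intro Bochner_Integration.integral_diff integrable_mult_right G.lst_integrable) (use \<zeta> l in auto)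
    finally show ?thesis by (simp only: ac_simps)
  qed
  have t1: "(?l - \<zeta>) * lst (jump_law \<nu> (T j) (\<lambda>t. - t) (\<lambda>i. p i j * q1 i j)) \<zeta>
     = ?l * 1 * (\<Sum>i<N. complex_of_real (p i j * q1 i j) * \<phi> \<zeta> i) - \<zeta> * 1 * (\<Sum>i<N. complex_of_real (p i j * q1 i j) * \<phi> ?l i)"
    by (rule jump_transform[OF invariance(2)[OF j \<zeta>] \<zeta> l]) (rule H1)
  have t2: "(?l - \<zeta>) * lst (jump_law \<nu> (G \<Otimes>\<^sub>M T j) (\<lambda>(b, t). b - t) (\<lambda>i. p i j * q2 i j)) \<zeta>
     = ?l * lst G \<zeta> * (\<Sum>i<N. complex_of_real (p i j * q2 i j) * \<phi> \<zeta> i) - \<zeta> * lst G ?l * (\<Sum>i<N. complex_of_real (p i j * q2 i j) * \<phi> ?l i)"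
    by (rule jump_transform[OF invariance(3)[OF j \<zeta>] \<zeta> l]) (rule H2)
  have "(?l - \<zeta>) * \<phi> \<zeta> j = ?l * 1 * (\<Sum>i<N. complex_of_real (p i j * q1 i j) * \<phi> \<zeta> i)
       - \<zeta> * 1 * (\<Sum>i<N. complex_of_real (p i j * q1 i j) * \<phi> ?l i)
     + (?l * lst G \<zeta> * (\<Sum>i<N. complex_of_real (p i j * q2 i j) * \<phi> \<zeta> i)
       - \<zeta> * lst G ?l * (\<Sum>i<N. complex_of_real (p i j * q2 i j) * \<phi> ?l i))"
    unfolding invariance(1)[OF j \<zeta>] distrib_left t1 t2 ..
  also have "\<dots> = (\<Sum>i<N. \<phi> \<zeta> i * ((complex_of_real (q1 i j) + lst G \<zeta> * complex_of_real (q2 i j)) * complex_of_real (p i j * lam j))) - \<zeta> * u j"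
    unfolding u_def by (simp add: algebra_simps sum_distrib_left sum.distrib)
  finally have eq: "(?l - \<zeta>) * \<phi> \<zeta> j = (\<Sum>i<N. \<phi> \<zeta> i * ((complex_of_real (q1 i j) + lst G \<zeta> * complex_of_real (q2 i j)) * complex_of_real (p i j * lam j))) - \<zeta> * u j" .
  have "(\<Sum>i<N. \<phi> \<zeta> i * E_mat2 D1 D2 \<zeta> (lst G \<zeta>) $$ (i, j)) =
     (\<Sum>i<N. \<phi> \<zeta> i * ((complex_of_real (q1 i j) + lst G \<zeta> * complex_of_real (q2 i j)) * complex_of_real (p i j * lam j))
       + (if i = j then \<phi> \<zeta> i * (\<zeta> - complex_of_real (lam i)) else 0))"
    using j by (intro sum.cong) (auto simp: E_mat2_entry distrib_left)
  also have "\<dots> = (?l - \<zeta>) * \<phi> \<zeta> j + \<zeta> * u j + \<phi> \<zeta> j * (\<zeta> - ?l)"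
    using j eq by (simp add: sum.distrib)
  finally show ?thesis by (simp add: algebra_simps)
qed

lemma \<phi>_zero: "\<phi> 0 i = complex_of_real (measure \<nu> {x \<in> space \<nu>. snd x = i})"
proof -
  have "\<phi> 0 i = (\<integral>x. complex_of_real (indicator {x \<in> space \<nu>. snd x = i} x) \<partial>\<nu>)"
    unfolding \<phi>_def laplace_def by (intro Bochner_Integration.integral_cong) (auto simp: indicator_def)
  also have "\<dots> = complex_of_real (measure \<nu> ({x \<in> space \<nu>. snd x = i} \<inter> space \<nu>))"
    by (simp only: integral_complex_of_real Bochner_Integration.integral_indicator)
  also have "{x \<in> space \<nu>. snd x = i} \<inter> space \<nu> = {x \<in> space \<nu>. snd x = i}" by blast
  finally show ?thesis .
qed

text \<open>At \<open>\<zeta> = 0\<close> the balance equations say that the law of the tag is stationary for \<open>P\<close>.\<close>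

lemma \<phi>_zero_pi:
  assumes "j < N"
  shows "\<phi> 0 j = complex_of_real (\<pi> $ j)"
proof -
  define v where "v i = measure \<nu> {x \<in> space \<nu>. snd x = i}" for i
  have \<phi>: "\<phi> 0 i = complex_of_real (v i)" for i by (simp add: \<phi>_zero v_def)
  have lst0: "lst G 0 = 1" using GP.prob_space by (simp add: lst_def)
  have sum: "(\<Sum>i<N. v i) = 1"
  proof -
    have "(\<integral>x. complex_of_real 1 * exp (- 0 * complex_of_real (fst x)) \<partial>\<nu>) = (\<Sum>i<N. complex_of_real 1 * \<phi> 0 i)"
      by (rule integral_weighted(1)) simp
    then have "complex_of_real (\<Sum>i<N. v i) = 1" using nu.prob_space by (simp add: \<phi>)
    then show ?thesis by (simp only: of_real_eq_1_iff)
  qed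
  have st: "(\<Sum>i<N. v i * p i k) = v k" if k: "k < N" for k
  proof -
    have "0 = (\<Sum>i<N. \<phi> 0 i * E_mat2 D1 D2 0 1 $$ (i, k))" using balance[OF k, of 0] lst0 by simp
    also have "\<dots> = (\<Sum>i<N. complex_of_real (lam k * (v i * p i k) - (if i = k then v i * lam i else 0)))"
    proof (intro sum.cong refl)
      fix i assume "i \<in> {..<N}"
      then have i: "i < N" by simp
      have q: "(q1 i k + q2 i k) * (p i k * lam k) = p i k * lam k"
        using q_sum[OF i k] by (simp only: mult.assoc[symmetric])
      have "\<phi> 0 i * E_mat2 D1 D2 0 1 $$ (i, k) = complex_of_real (v i * ((q1 i k + q2 i k) * (p i k * lam k)) + (if i = k then - v i * lam i else 0))"
        unfolding E_mat2_entry[OF i k] \<phi> by (auto simp: algebra_simps)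
      then show "\<phi> 0 i * E_mat2 D1 D2 0 1 $$ (i, k) = complex_of_real (lam k * (v i * p i k) - (if i = k then v i * lam i else 0))"
        unfolding q by (auto simp: algebra_simps)
    qed
    also have "\<dots> = complex_of_real (lam k * (\<Sum>i<N. v i * p i k) - v k * lam k)"
      using k unfolding of_real_sum[symmetric] by (simp add: sum_subtractf sum_distrib_left)
    finally have "lam k * (\<Sum>i<N. v i * p i k) = lam k * v k" by (simp add: mult.commute flip: of_real_diff of_real_mult)
    then show ?thesis using rate_pos[OF k] by simp
  qed
  show ?thesis unfolding \<phi> using stationary_unique[OF st sum assms] by simp
qed

text \<open>Multiply the balance equations by \<open>\<Lambda>\<^sup>-\<^sup>1 e\<close>, divide by \<open>\<zeta>\<close>, and let \<open>\<zeta> \<rightarrow> 0\<close>. The function \<open>h\<close> is the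
  transform of the integrated tail, so \<open>\<mu>\<close> is the mean of \<open>G\<close>.\<close>

lemma normalization:
  assumes h: "\<And>\<zeta>. 0 \<le> Re \<zeta> \<Longrightarrow> lst G \<zeta> = 1 - \<zeta> * h \<zeta>" and cont: "continuous_on {\<zeta>. 0 \<le> Re \<zeta>} h"
    and h0: "h 0 = complex_of_real \<mu>"
  shows "(\<Sum>j<N. u j * complex_of_real (1 / lam j)) = complex_of_real (drift D1 D2 \<pi> \<mu>)"
proof -
  let ?r = "\<lambda>\<zeta>. \<Sum>i<N. \<phi> \<zeta> i * (complex_of_real (1 / lam i) - h \<zeta> * (\<Sum>j<N. complex_of_real (q2 i j * p i j)))"
  define e where "e n = complex_of_real (inverse (real (Suc n)))" for n
  have e0: "e \<longlonglongrightarrow> 0"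
    unfolding e_def using tendsto_of_real[OF LIMSEQ_inverse_real_of_nat] unfolding of_real_0 .
  have eRe: "0 < Re (e n)" for n by (simp add: e_def)
  have const: "?r \<zeta> = (\<Sum>j<N. u j * complex_of_real (1 / lam j))" if \<zeta>: "0 < Re \<zeta>" for \<zeta>
  proof -
    have "\<zeta> * (\<Sum>j<N. u j * complex_of_real (1 / lam j)) = (\<Sum>j<N. (\<Sum>i<N. \<phi> \<zeta> i * E_mat2 D1 D2 \<zeta> (lst G \<zeta>) $$ (i, j)) * complex_of_real (1 / lam j))"
      unfolding sum_distrib_left by (intro sum.cong refl) (use \<zeta> in \<open>simp add: balance\<close>)
    also have "\<dots> = (\<Sum>i<N. \<phi> \<zeta> i * (\<Sum>j<N. E_mat2 D1 D2 \<zeta> (lst G \<zeta>) $$ (i, j) * complex_of_real (1 / lam j)))"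
      unfolding sum_distrib_left sum_distrib_right by (subst sum.swap) (simp only: mult.assoc)
    also have "\<dots> = (\<Sum>i<N. \<phi> \<zeta> i * (\<zeta> * (complex_of_real (1 / lam i) - h \<zeta> * (\<Sum>j<N. complex_of_real (q2 i j * p i j)))))"
    proof (intro sum.cong refl)
      fix i assume "i \<in> {..<N}"
      then show "\<phi> \<zeta> i * (\<Sum>j<N. E_mat2 D1 D2 \<zeta> (lst G \<zeta>) $$ (i, j) * complex_of_real (1 / lam j)) =
        \<phi> \<zeta> i * (\<zeta> * (complex_of_real (1 / lam i) - h \<zeta> * (\<Sum>j<N. complex_of_real (q2 i j * p i j))))"
        using h[of \<zeta>] \<zeta> by (simp only: E_mat2_row lessThan_iff) (simp add: algebra_simps)
    qed
    also have "\<dots> = \<zeta> * ?r \<zeta>" by (simp only: sum_distrib_left mult.left_commute)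
    finally show ?thesis using \<zeta> by auto
  qed
  have contr: "continuous_on {\<zeta>. 0 \<le> Re \<zeta>} ?r"
    unfolding \<phi>_def by (intro continuous_intros L.laplace_continuous cont)
  have "(\<lambda>n. ?r (e n)) \<longlonglongrightarrow> ?r 0"
    by (rule continuous_on_tendsto_compose[OF contr e0]) (use eRe in \<open>auto intro!: always_eventually less_imp_le\<close>)
  then have "(\<Sum>j<N. u j * complex_of_real (1 / lam j)) = ?r 0"
    unfolding const[OF eRe] by (simp only: LIMSEQ_const_iff)
  also have "\<dots> = (\<Sum>i<N. complex_of_real (\<pi> $ i) * (complex_of_real (1 / lam i) - complex_of_real \<mu> * (\<Sum>j<N. complex_of_real (q2 i j * p i j))))"
    by (intro sum.cong refl) (simp add: \<phi>_zero_pi h0)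
  also have "\<dots> = complex_of_real (drift D1 D2 \<pi> \<mu>)"
    unfolding drift_eq by simp
  finally show ?thesis .
qed

end

section \<open>The residue of the first-order term\<close>

text \<open>The value of \<open>f\<close> at the root is not determined by the linear system there, since \<open>det E\<close> vanishes.
  Differentiating Cramer's rule in \<open>\<zeta>\<close> yields the component \<open>f s m\<close>, and the adjugate identity differentiated in
  direction \<open>K\<close> reduces the left-hand side to this component.\<close>

lemma first_order_at_root:
  fixes E :: "complex \<Rightarrow> complex mat"
  assumes E: "\<And>\<zeta>. E \<zeta> \<in> carrier_mat n n" and E': "E' \<in> carrier_mat n n" and K: "K \<in> carrier_mat n n"
    and dE: "\<And>i j. i < n \<Longrightarrow> j < n \<Longrightarrow> ((\<lambda>\<zeta>. E \<zeta> $$ (i, j)) has_field_derivative E' $$ (i, j)) (at s)"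
    and m: "m < n" and df: "((\<lambda>\<zeta>. f \<zeta> m) has_field_derivative F) (at s)"
    and open_S: "open S" "s \<in> S"
    and balance: "\<And>\<zeta> j. \<zeta> \<in> S \<Longrightarrow> j < n \<Longrightarrow> (\<Sum>i<n. f \<zeta> i * E \<zeta> $$ (i, j)) = \<zeta> * u j"
    and root: "det (E s) = 0" and simple: "col_replace_sum (E s) E' \<noteq> 0" and s: "s \<noteq> 0"
  shows "(\<Sum>i<n. \<Sum>j<n. f s i * K $$ (i, j) * adj_mat (E s) $$ (j, m)) =
    s * (\<Sum>i<n. u i * (col_replace_sum (E s) K / col_replace_sum (E s) E' * adj_derivative (E s) E' $$ (i, m)
        - adj_derivative (E s) K $$ (i, m)))"
proof -
  have cramer: "det (E \<zeta>) * f \<zeta> m = \<zeta> * (\<Sum>k<n. u k * adj_mat (E \<zeta>) $$ (k, m))" if "\<zeta> \<in> S" for \<zeta>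
    using perturbed_cramer[OF E[of \<zeta>] m, of "f \<zeta>" "\<lambda>_ _. 0" "\<lambda>k. \<zeta> * u k"] balance[OF that]
    by (simp add: sum_distrib_left mult.assoc)
  have u0: "(\<Sum>k<n. u k * adj_mat (E s) $$ (k, m)) = 0"
    using cramer[OF open_S(2)] root s by simp
  have h1: "((\<lambda>\<zeta>. det (E \<zeta>) * f \<zeta> m) has_field_derivative col_replace_sum (E s) E' * f s m) (at s)"
    using DERIV_mult[OF det_has_field_derivative[OF E E' dE] df] root by (simp add: mult.commute)
  have h2: "((\<lambda>\<zeta>. \<zeta> * (\<Sum>k<n. u k * adj_mat (E \<zeta>) $$ (k, m))) has_field_derivative
     s * (\<Sum>k<n. u k * adj_derivative (E s) E' $$ (k, m))) (at s)"
  proof -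
    have "((\<lambda>\<zeta>. \<Sum>k<n. u k * adj_mat (E \<zeta>) $$ (k, m)) has_field_derivative (\<Sum>k<n. u k * adj_derivative (E s) E' $$ (k, m))) (at s)"
      by (intro DERIV_sum DERIV_cmult adj_mat_has_field_derivative[OF E E' dE]) (use m in auto)
    from DERIV_mult[OF DERIV_ident this] show ?thesis using u0 by (simp add: mult.commute)
  qed
  have h3: "\<And>\<zeta>. \<zeta> \<in> S \<Longrightarrow> \<zeta> * (\<Sum>k<n. u k * adj_mat (E \<zeta>) $$ (k, m)) = det (E \<zeta>) * f \<zeta> m"
    using cramer by simp
  have d: "col_replace_sum (E s) E' * f s m = s * (\<Sum>k<n. u k * adj_derivative (E s) E' $$ (k, m))"
    by (rule DERIV_unique[OF h1 has_field_derivative_transform_within_open[OF h2 open_S h3]])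
  have "(\<Sum>i<n. f s i * ((\<Sum>k<n. K $$ (i, k) * adj_mat (E s) $$ (k, m)) + (\<Sum>k<n. E s $$ (i, k) * adj_derivative (E s) K $$ (k, m))))
     = (\<Sum>i<n. if i = m then f s i * col_replace_sum (E s) K else 0)"
    by (intro sum.cong refl) (simp add: adj_derivative_product_rule[OF E K _ m])
  also have "\<dots> = f s m * col_replace_sum (E s) K" using m by simp
  finally have "(\<Sum>i<n. \<Sum>j<n. f s i * K $$ (i, j) * adj_mat (E s) $$ (j, m)) +
     (\<Sum>i<n. \<Sum>k<n. f s i * E s $$ (i, k) * adj_derivative (E s) K $$ (k, m)) = f s m * col_replace_sum (E s) K"
    by (simp add: distrib_left sum.distrib sum_distrib_left mult.assoc)
  moreover have "(\<Sum>i<n. \<Sum>k<n. f s i * E s $$ (i, k) * adj_derivative (E s) K $$ (k, m))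
     = s * (\<Sum>k<n. u k * adj_derivative (E s) K $$ (k, m))"
  proof -
    have "(\<Sum>i<n. \<Sum>k<n. f s i * E s $$ (i, k) * adj_derivative (E s) K $$ (k, m))
      = (\<Sum>k<n. (\<Sum>i<n. f s i * E s $$ (i, k)) * adj_derivative (E s) K $$ (k, m))"
      by (subst sum.swap) (simp add: sum_distrib_right)
    also have "\<dots> = (\<Sum>k<n. s * u k * adj_derivative (E s) K $$ (k, m))"
      by (intro sum.cong refl) (simp add: balance[OF open_S(2)])
    finally show ?thesis by (simp add: sum_distrib_left mult.assoc)
  qed
  ultimately have "(\<Sum>i<n. \<Sum>j<n. f s i * K $$ (i, j) * adj_mat (E s) $$ (j, m))
     = f s m * col_replace_sum (E s) K - s * (\<Sum>k<n. u k * adj_derivative (E s) K $$ (k, m))"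
    by (simp add: algebra_simps)
  also have "f s m * col_replace_sum (E s) K = col_replace_sum (E s) K / col_replace_sum (E s) E' * (s * (\<Sum>k<n. u k * adj_derivative (E s) E' $$ (k, m)))"
    using simple by (simp flip: d)
  finally show ?thesis
    by (simp add: right_diff_distrib sum_subtractf sum_distrib_left ac_simps)
qed

section \<open>The two models\<close>

lemma excess_nonneg_finite:
  assumes F: "nonneg_dist F" and P: "prob_space (excess F)"
  shows "nonneg_finite_measure (excess F)"
proof (rule nonneg_finite_measure.intro)
  show "finite_measure (excess F)" using P by (rule prob_space.finite_measure)
  show "sets (excess F) = sets borel" by (simp add: excess_def)
  have m: "(\<lambda>x. ennreal (if 0 \<le> x then measure F {x<..} / mean F else 0)) \<in> borel_measurable lborel"
    using measurable_compose[OF excess_density_measurable[OF F] measurable_ennreal] by (simp only: measurable_lborel2)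
  have "emeasure (excess F) {..<0} = (\<integral>\<^sup>+x. 0 \<partial>(lborel :: real measure))"
    unfolding excess_def
    by (subst emeasure_density[OF m], simp, intro nn_integral_cong) (simp add: indicator_def)
  then show "measure (excess F) {..<0} = 0" by (simp add: measure_def)
qed

text \<open>With mean \<open>0\<close> the density of the excess law would be a quotient by \<open>0\<close>, hence identically \<open>0\<close>.\<close>

lemma mean_nonzero:
  assumes P: "prob_space (excess F)"
  shows "mean F \<noteq> 0"
proof
  assume "mean F = 0"
  then have "(\<lambda>x. ennreal (if 0 \<le> x then measure F {x<..} / mean F else 0)) = (\<lambda>_. 0)"
    by (simp add: fun_eq_iff)
  then have "excess F = density lborel (\<lambda>_. 0)" unfolding excess_def by (rule arg_cong)
  then have "emeasure (excess F) (space (excess F)) = 0" by (simp add: emeasure_density)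
  then show False using prob_space.emeasure_space_1[OF P] by simp
qed

lemma mixture_eq_msum: "mixture \<epsilon> F G = msum (1 - \<epsilon>) F \<epsilon> G"
  by (simp add: mixture_def msum_def)

lemma nonneg_dist_mixture:
  assumes F: "nonneg_dist F" and G: "nonneg_dist G" and \<epsilon>: "0 \<le> \<epsilon>" "\<epsilon> \<le> 1"
  shows "nonneg_dist (mixture \<epsilon> F G)"
    and "0 \<le> Re \<zeta> \<Longrightarrow> lst (mixture \<epsilon> F G) \<zeta> = complex_of_real (1 - \<epsilon>) * lst F \<zeta> + complex_of_real \<epsilon> * lst G \<zeta>"
proof -
  have e: "0 \<le> 1 - \<epsilon>" "0 \<le> \<epsilon>" using \<epsilon> by auto
  note m = nonneg_finite_measure_msum[OF nonneg_finite_measureI_dist[OF F] nonneg_finite_measureI_dist[OF G] e]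
  interpret F: real_distribution F using F by (simp add: nonneg_dist_def)
  interpret G: real_distribution G using G by (simp add: nonneg_dist_def)
  have "measure (msum (1 - \<epsilon>) F \<epsilon> G) UNIV = 1"
    using m(2)[of UNIV] F.prob_space G.prob_space by simp
  then have "prob_space (msum (1 - \<epsilon>) F \<epsilon> G)"
    using nonneg_finite_measure.fin[OF m(1)]
    by (intro prob_spaceI) (simp add: finite_measure.emeasure_eq_measure)
  then show "nonneg_dist (mixture \<epsilon> F G)"
    unfolding mixture_eq_msum nonneg_dist_def real_distribution_def real_distribution_axioms_def
    using nonneg_finite_measure.null_neg[OF m(1)] by simp
  show "0 \<le> Re \<zeta> \<Longrightarrow> lst (mixture \<epsilon> F G) \<zeta> = complex_of_real (1 - \<epsilon>) * lst F \<zeta> + complex_of_real \<epsilon> * lst G \<zeta>"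
    unfolding mixture_eq_msum by (simp add: m(3))
qed

lemma vec_mult_mat_index:
  fixes v :: "'a :: comm_semiring_0 vec"
  assumes "v \<in> carrier_vec n" "X \<in> carrier_mat n k" "j < k"
  shows "(v \<^sub>v* X) $ j = (\<Sum>i<n. v $ i * X $$ (i, j))"
  using assms
  by (auto simp: vec_mult_mat_def scalar_prod_def lessThan_atLeast0 mult.commute intro!: sum.cong)

lemma vec_mult_mat_carrier: "X \<in> carrier_mat n k \<Longrightarrow> v \<^sub>v* X \<in> carrier_vec k"
  by (intro carrier_vecI) (simp add: vec_mult_mat_def)

locale model = arrivals N D1 D2 \<pi> for N D1 D2 \<pi> +
  fixes Fp Fh :: "real measure" and q pp :: "complex poly" and \<nu> :: "(real \<times> nat) measure"
    and \<nu>mix :: "real \<Rightarrow> (real \<times> nat) measure" and s :: "nat \<Rightarrow> real" and m :: "nat \<Rightarrow> nat"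
    and u z :: "complex vec"
  assumes Fp: "nonneg_dist Fp" and Fp_int: "integrable Fp (\<lambda>t. t)" and Fp_e: "prob_space (excess Fp)"
    and Fh: "nonneg_dist Fh" and Fh_int: "integrable Fh (\<lambda>t. t)" and Fh_e: "prob_space (excess Fh)"
    and pp_nz: "pp \<noteq> 0" and no_common_root: "\<And>\<zeta>. \<not> (poly pp \<zeta> = 0 \<and> poly q \<zeta> = 0)"
    and lst_Fp: "\<And>\<zeta>. 0 \<le> Re \<zeta> \<Longrightarrow> lst Fp \<zeta> = poly q \<zeta> / poly pp \<zeta>"
    and stable: "0 < drift D1 D2 \<pi> (mean Fp)" and ss: "steady_state D1 D2 Fp \<nu>"
    and ss_mix: "\<And>\<epsilon>. 0 < \<epsilon> \<Longrightarrow> \<epsilon> \<le> 1 \<Longrightarrow> 0 < drift D1 D2 \<pi> (mean Fp + \<epsilon> * (mean Fh - mean Fp)) \<Longrightarrow>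
        steady_state D1 D2 (mixture \<epsilon> Fp Fh) (\<nu>mix \<epsilon>)"
    and s_zero: "s 0 = 0" and s_pos: "\<And>k. k \<in> {1..<N} \<Longrightarrow> 0 < s k"
    and roots: "{\<zeta>. 0 \<le> Re \<zeta> \<and> det (E_mat D1 D2 q pp \<zeta>) = 0} = (\<lambda>k. complex_of_real (s k)) ` {0..<N}"
    and simple: "\<And>k. k \<in> {1..<N} \<Longrightarrow> deriv (\<lambda>\<zeta>. det (E_mat D1 D2 q pp \<zeta>)) (complex_of_real (s k)) \<noteq> 0"
    and m_less: "\<And>k. k \<in> {1..<N} \<Longrightarrow> m k < N"
    and u: "\<And>v. v \<in> carrier_vec N \<and>
             v \<bullet> map_vec complex_of_real (Lam_inv D1 D2 *\<^sub>v ones N) = complex_of_real (drift D1 D2 \<pi> (mean Fp)) \<and>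
             (\<forall>k\<in>{1..<N}. v \<bullet> a_col (E_mat D1 D2 q pp) (complex_of_real (s k)) (m k) = 0) \<longleftrightarrow> v = u"
    and z: "z = (c_vec D1 D2 \<pi> Fp \<^sub>v* inv_mat (A_mat D1 D2 (E_mat D1 D2 q pp) s m)
                   \<^sub>v* B_mat N (E_mat D1 D2 q pp) (K_mat D1 D2 Fp Fh) s m
                + d_vec D1 D2 \<pi> Fp Fh) \<^sub>v* inv_mat (A_mat D1 D2 (E_mat D1 D2 q pp) s m)"
begin

abbreviation E where "E \<equiv> E_mat D1 D2 q pp"
abbreviation K where "K \<equiv> K_mat D1 D2 Fp Fh"
abbreviation D where "D \<equiv> excess_diff Fp Fh"
abbreviation Q where "Q \<equiv> QP2Lam D1 D2"

sublocale Fp: nonneg_finite_measure Fp using Fp by (rule nonneg_finite_measureI_dist)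
sublocale Fh: nonneg_finite_measure Fh using Fh by (rule nonneg_finite_measureI_dist)

sublocale Fpe: nonneg_finite_measure "excess Fp" by (rule excess_nonneg_finite[OF Fp Fp_e])
sublocale Fhe: nonneg_finite_measure "excess Fh" by (rule excess_nonneg_finite[OF Fh Fh_e])

lemma D_cont: "continuous_on {\<zeta>. 0 \<le> Re \<zeta>} D"
  unfolding excess_diff_def by (intro continuous_intros Fpe.lst_continuous Fhe.lst_continuous)

lemma lst_excess_zero:
  assumes "prob_space (excess F)"
  shows "lst (excess F) 0 = 1"
  unfolding lst_def using prob_space.prob_space[OF assms] by simp

lemma lst_expand:
  assumes "0 \<le> Re \<zeta>"
  shows "lst Fp \<zeta> = 1 - \<zeta> * (mean Fp * lst (excess Fp) \<zeta>)" "lst Fh \<zeta> = 1 - \<zeta> * (mean Fh * lst (excess Fh) \<zeta>)"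
  using lst_excess[OF Fp Fp_int mean_nonzero[OF Fp_e] assms] lst_excess[OF Fh Fh_int mean_nonzero[OF Fh_e] assms]
  by (simp_all add: algebra_simps)

lemma lst_diff: "0 \<le> Re \<zeta> \<Longrightarrow> lst Fh \<zeta> - lst Fp \<zeta> = \<zeta> * D \<zeta>"
  by (simp add: lst_expand excess_diff_def algebra_simps)

lemma lst_mixture:
  assumes "0 \<le> \<epsilon>" "\<epsilon> \<le> 1" "0 \<le> Re \<zeta>"
  shows "lst (mixture \<epsilon> Fp Fh) \<zeta> = poly q \<zeta> / poly pp \<zeta> + \<epsilon> * (\<zeta> * D \<zeta>)"
  unfolding nonneg_dist_mixture(2)[OF Fp Fh assms] lst_diff[OF assms(3), symmetric] lst_Fp[OF assms(3), symmetric]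
  by (simp add: algebra_simps)

text \<open>By continuity \<open>p(\<zeta>)\<close> times the transform of \<open>F\<^sub>p\<close> equals \<open>q(\<zeta>)\<close> also at a zero of \<open>p\<close> in the closed right half-plane, which would thus
  be a common zero. The formula \<open>q / p\<close> alone says nothing there, as division by \<open>0\<close> gives \<open>0\<close>.\<close>

lemma pp_nonzero:
  assumes z: "0 \<le> Re \<zeta>"
  shows "poly pp \<zeta> \<noteq> 0"
proof
  assume 0: "poly pp \<zeta> = 0"
  define e where "e n = complex_of_real (inverse (real (Suc n)))" for n
  have e0: "e \<longlonglongrightarrow> 0"
    unfolding e_def using tendsto_of_real[OF LIMSEQ_inverse_real_of_nat] unfolding of_real_0 .
  have lim: "(\<lambda>n. \<zeta> + e n) \<longlonglongrightarrow> \<zeta>" using tendsto_add[OF tendsto_const e0, of \<zeta>] by simp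
  have eRe: "0 < Re (\<zeta> + e n)" for n using z by (simp add: e_def add_nonneg_pos)
  have enz: "e n \<noteq> 0" for n unfolding e_def of_real_eq_0_iff by simp
  have fin: "finite {\<zeta>. poly pp \<zeta> = 0}" using pp_nz by (rule poly_roots_finite)
  have "eventually (\<lambda>w. w \<notin> {\<zeta>. poly pp \<zeta> = 0}) (at \<zeta>)"
    using fin by (rule islimpt_finite[unfolded islimpt_iff_eventually not_not])
  moreover have "filterlim (\<lambda>n. \<zeta> + e n) (at \<zeta>) sequentially"
    using lim enz by (simp add: filterlim_at)
  ultimately have ev: "eventually (\<lambda>n. poly pp (\<zeta> + e n) \<noteq> 0) sequentially"
    by (auto dest: eventually_compose_filterlim)
  have a: "(\<lambda>n. poly pp (\<zeta> + e n) * lst Fp (\<zeta> + e n)) \<longlonglongrightarrow> poly pp \<zeta> * lst Fp \<zeta>"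
    by (intro tendsto_mult continuous_on_tendsto_compose[OF Fp.lst_continuous lim] isCont_tendsto_compose[OF poly_isCont lim])
      (use z eRe in \<open>auto intro!: always_eventually less_imp_le\<close>)
  have b: "(\<lambda>n. poly q (\<zeta> + e n)) \<longlonglongrightarrow> poly q \<zeta>"
    by (rule isCont_tendsto_compose[OF poly_isCont lim])
  have c: "eventually (\<lambda>n. poly pp (\<zeta> + e n) * lst Fp (\<zeta> + e n) = poly q (\<zeta> + e n)) sequentially"
    using ev by eventually_elim (use eRe in \<open>simp add: lst_Fp less_imp_le\<close>)
  have "poly pp \<zeta> * lst Fp \<zeta> = poly q \<zeta>"
    by (rule LIMSEQ_unique[OF Lim_transform_eventually[OF a c] b])
  then show False using 0 no_common_root[of \<zeta>] by simp
qed

lemma E_entry: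
  assumes "i < N" "j < N"
  shows "E \<zeta> $$ (i, j) = (complex_of_real (q1 i j) + poly q \<zeta> / poly pp \<zeta> * complex_of_real (q2 i j)) * complex_of_real (p i j * lam j)
      + (if i = j then \<zeta> - complex_of_real (lam i) else 0)"
  unfolding E_mat_def by (rule E_mat2_entry[OF assms])

lemma E_carrier: "E \<zeta> \<in> carrier_mat N N"
  unfolding E_mat_def by (rule E_mat2_carrier)

lemma E_eq: "0 \<le> Re \<zeta> \<Longrightarrow> E \<zeta> = E_mat2 D1 D2 \<zeta> (lst Fp \<zeta>)"
  by (simp add: E_mat_def lst_Fp)

lemma K_entry: "i < N \<Longrightarrow> j < N \<Longrightarrow> K \<zeta> $$ (i, j) = \<zeta> * D \<zeta> * Q $$ (i, j)"
  using QP2Lam_carrier by (simp add: K_mat_def)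

lemma K_carrier: "K \<zeta> \<in> carrier_mat N N"
  using QP2Lam_carrier by (simp add: K_mat_def)

text \<open>The identity \<open>F\<^sub>h - F\<^sub>p = \<zeta> (\<mu>\<^sub>p F\<^sub>p\<^sup>e - \<mu>\<^sub>h F\<^sub>h\<^sup>e)\<close> of transforms identifies the perturbation with \<open>\<epsilon> K\<close>.\<close>

lemma E_mix:
  assumes "0 \<le> \<epsilon>" "\<epsilon> \<le> 1" "0 \<le> Re \<zeta>" "i < N" "j < N"
  shows "E_mat2 D1 D2 \<zeta> (lst (mixture \<epsilon> Fp Fh) \<zeta>) $$ (i, j) = E \<zeta> $$ (i, j) + \<epsilon> * K \<zeta> $$ (i, j)"
  unfolding lst_mixture[OF assms(1-3)] E_mat2_line
  using E_mat2_carrier QP2Lam_carrier assms by (simp add: E_mat_def K_entry)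

lemma E_deriv:
  assumes ij: "i < N" "j < N" and \<zeta>: "0 \<le> Re \<zeta>"
  shows "((\<lambda>\<zeta>. E \<zeta> $$ (i, j)) has_field_derivative mat_deriv E \<zeta> $$ (i, j)) (at \<zeta>)"
proof -
  have "(\<lambda>\<zeta>. E \<zeta> $$ (i, j)) = (\<lambda>\<zeta>. (complex_of_real (q1 i j) + poly q \<zeta> / poly pp \<zeta> * complex_of_real (q2 i j)) * complex_of_real (p i j * lam j)
      + (if i = j then \<zeta> - complex_of_real (lam i) else 0))"
    by (simp add: E_entry[OF ij])
  moreover have fd: "poly f field_differentiable (at \<zeta>)" for f :: "complex poly"
    unfolding field_differentiable_def using poly_DERIV by blast
  have "(\<lambda>\<zeta>. (complex_of_real (q1 i j) + poly q \<zeta> / poly pp \<zeta> * complex_of_real (q2 i j)) * complex_of_real (p i j * lam j)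
      + (if i = j then \<zeta> - complex_of_real (lam i) else 0)) field_differentiable (at \<zeta>)"
    using pp_nonzero[OF \<zeta>]
    by (cases "i = j") (simp_all only: if_True if_False simp_thms, (intro field_differentiable_add field_differentiable_mult
        field_differentiable_divide field_differentiable_const field_differentiable_diff field_differentiable_ident fd; simp)+)
  ultimately have "(\<lambda>\<zeta>. E \<zeta> $$ (i, j)) field_differentiable (at \<zeta>)" by (simp only:)
  then show ?thesis
    using ij carrier_matD[OF E_carrier[of \<zeta>]] by (simp add: mat_deriv_def field_differentiable_derivI)
qed

lemma mat_deriv_carrier: "mat_deriv E \<zeta> \<in> carrier_mat N N"
  using carrier_matD[OF E_carrier[of \<zeta>]] by (simp add: mat_deriv_def)

sublocale B: steady N D1 D2 \<pi> Fp \<nu>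
  by (intro steady.intro arrivals_axioms steady_axioms.intro ss Fp)

lemma steady_mix:
  assumes "0 < \<epsilon>" "\<epsilon> \<le> 1" "0 < drift D1 D2 \<pi> (mean Fp + \<epsilon> * (mean Fh - mean Fp))"
  shows "steady N D1 D2 \<pi> (mixture \<epsilon> Fp Fh) (\<nu>mix \<epsilon>)"
  by (intro steady.intro arrivals_axioms steady_axioms.intro ss_mix nonneg_dist_mixture(1) Fp Fh) (use assms in auto)

text \<open>The mixture is stable for small \<open>\<epsilon>\<close>, the drift being affine in the mean service time.\<close>

lemma eventually_stable:
  "\<forall>\<^sub>F \<epsilon> in at_right 0. 0 < \<epsilon> \<and> \<epsilon> \<le> 1 \<and> 0 < drift D1 D2 \<pi> (mean Fp + \<epsilon> * (mean Fh - mean Fp))"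
proof -
  have "((\<lambda>\<epsilon>. drift D1 D2 \<pi> (mean Fp + \<epsilon> * (mean Fh - mean Fp))) \<longlongrightarrow> drift D1 D2 \<pi> (mean Fp + 0 * (mean Fh - mean Fp))) (at_right 0)"
    unfolding drift_eq by (intro tendsto_intros)
  then have "\<forall>\<^sub>F \<epsilon> in at_right 0. 0 < drift D1 D2 \<pi> (mean Fp + \<epsilon> * (mean Fh - mean Fp))"
    using stable by (intro order_tendstoD(1)) auto
  moreover have "\<forall>\<^sub>F \<epsilon> in at_right (0::real). 0 < \<epsilon>" by (rule eventually_at_right_less)
  moreover have "\<forall>\<^sub>F \<epsilon> in at_right (0::real). \<epsilon> < 1" by (intro order_tendstoD(2)[OF tendsto_ident_at]) simp
  ultimately show ?thesis by eventually_elim auto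
qed

text \<open>The transform of the mixture model, written without reference to the locale of steady states, because
  \<open>\<nu>mix \<epsilon>\<close> is known to be a steady state only for small positive \<open>\<epsilon>\<close>.\<close>

definition fe :: "real \<Rightarrow> complex \<Rightarrow> nat \<Rightarrow> complex" where
  "fe \<epsilon> \<zeta> i = laplace (\<nu>mix \<epsilon>) (\<lambda>x. if snd x = i then 1 else 0) fst \<zeta>"

definition ue :: "real \<Rightarrow> nat \<Rightarrow> complex" where
  "ue \<epsilon> = steady.u N D1 D2 (mixture \<epsilon> Fp Fh) (\<nu>mix \<epsilon>)"

text \<open>The derivative of the drift with respect to \<open>\<epsilon>\<close>.\<close>

definition c1 :: complex where
  "c1 = complex_of_real ((mean Fp - mean Fh) * (\<Sum>i<N. \<pi> $ i * (\<Sum>j<N. q2 i j * p i j)))"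

lemma det_root:
  assumes "k < N"
  shows "det (E (complex_of_real (s k))) = 0"
proof -
  have "complex_of_real (s k) \<in> (\<lambda>k. complex_of_real (s k)) ` {0..<N}" using assms by simp
  then show ?thesis unfolding roots[symmetric] by (simp only: mem_Collect_eq)
qed

lemma det_nonzero:
  assumes "0 \<le> Re \<zeta>" and ne: "\<And>k. k < N \<Longrightarrow> \<zeta> \<noteq> complex_of_real (s k)"
  shows "det (E \<zeta>) \<noteq> 0"
proof
  assume "det (E \<zeta>) = 0"
  then have "\<zeta> \<in> {\<zeta>. 0 \<le> Re \<zeta> \<and> det (E \<zeta>) = 0}" using assms(1) by (simp only: mem_Collect_eq simp_thms)
  then show False unfolding roots using ne by (metis atLeastLessThan_iff imageE)
qed

lemma eventually_det_nonzero:
  assumes "0 < Re \<zeta>"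
  shows "\<forall>\<^sub>F w in at \<zeta>. 0 < Re w \<and> det (E w) \<noteq> 0 \<and> (\<forall>k<N. w \<noteq> complex_of_real (s k))"
proof -
  have fin: "finite ((\<lambda>k. complex_of_real (s k)) ` {0..<N})" by simp
  have "eventually (\<lambda>w. w \<notin> (\<lambda>k. complex_of_real (s k)) ` {0..<N}) (at \<zeta>)"
    using fin by (rule islimpt_finite[unfolded islimpt_iff_eventually not_not])
  moreover have "eventually (\<lambda>w. w \<in> {\<zeta>. 0 < Re \<zeta>}) (at \<zeta>)"
    using assms by (intro eventually_at_in_open' open_halfspace_Re_gt) simp
  ultimately show ?thesis
  proof eventually_elim
    case (elim w)
    then have "\<forall>k<N. w \<noteq> complex_of_real (s k)" by auto
    with elim show ?case using det_nonzero[of w] by auto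
  qed
qed

lemma dim_Lam_inv: "dim_row (Lam_inv D1 D2) = N"
  by (simp add: Lam_inv_def)

lemma A_carrier: "A_mat D1 D2 E s m \<in> carrier_mat N N"
  by (simp add: A_mat_def mat_of_cols_def)

lemma A_entry0: "i < N \<Longrightarrow> A_mat D1 D2 E s m $$ (i, 0) = complex_of_real (1 / lam i)"
  unfolding A_mat_def by (subst mat_of_cols_index) (auto simp: Lam_inv_ones dim_Lam_inv simp del: index_mult_mat_vec)

lemma A_entry:
  assumes "i < N" "k \<in> {1..<N}"
  shows "A_mat D1 D2 E s m $$ (i, k) = adj_mat (E (complex_of_real (s k))) $$ (i, m k)"
proof -
  have "A_mat D1 D2 E s m $$ (i, k) = a_col E (complex_of_real (s k)) (m k) $ i"
    using assms unfolding A_mat_def by (subst mat_of_cols_index) (auto simp: nth_Cons')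
  then show ?thesis
    using assms m_less[OF assms(2)] adj_mat(1)[OF E_carrier, of "complex_of_real (s k)"] by (simp add: a_col_def)
qed

lemma a_col_product:
  assumes "v \<in> carrier_vec N" "k \<in> {1..<N}"
  shows "v \<bullet> a_col E (complex_of_real (s k)) (m k) = (\<Sum>i<N. v $ i * adj_mat (E (complex_of_real (s k))) $$ (i, m k))"
  using assms m_less[OF assms(2)] adj_mat(1)[OF E_carrier, of "complex_of_real (s k)"]
  by (simp add: a_col_def scalar_prod_def lessThan_atLeast0)

lemma l0_product:
  assumes "v \<in> carrier_vec N"
  shows "v \<bullet> map_vec complex_of_real (Lam_inv D1 D2 *\<^sub>v ones N) = (\<Sum>i<N. v $ i * complex_of_real (1 / lam i))"
  using assms Lam_inv_ones by (simp add: scalar_prod_def lessThan_atLeast0 dim_Lam_inv del: index_mult_mat_vec)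

lemma u_carrier: "u \<in> carrier_vec N"
  and u_norm: "(\<Sum>i<N. u $ i * complex_of_real (1 / lam i)) = complex_of_real (drift D1 D2 \<pi> (mean Fp))"
  and u_root: "k \<in> {1..<N} \<Longrightarrow> (\<Sum>i<N. u $ i * adj_mat (E (complex_of_real (s k))) $$ (i, m k)) = 0"
proof -
  have *: "u \<in> carrier_vec N \<and>
             u \<bullet> map_vec complex_of_real (Lam_inv D1 D2 *\<^sub>v ones N) = complex_of_real (drift D1 D2 \<pi> (mean Fp)) \<and>
             (\<forall>k\<in>{1..<N}. u \<bullet> a_col E (complex_of_real (s k)) (m k) = 0)"
    unfolding u ..
  then show c: "u \<in> carrier_vec N" by (rule conjunct1)
  show "(\<Sum>i<N. u $ i * complex_of_real (1 / lam i)) = complex_of_real (drift D1 D2 \<pi> (mean Fp))"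
    using * unfolding l0_product[OF c, symmetric] by (elim conjE)
  show "(\<Sum>i<N. u $ i * adj_mat (E (complex_of_real (s k))) $$ (i, m k)) = 0" if "k \<in> {1..<N}"
    using * that unfolding a_col_product[OF c that, symmetric] by blast
qed

lemma u_unique:
  fixes v :: "complex vec"
  assumes v: "v \<in> carrier_vec N"
    and 1: "(\<Sum>i<N. v $ i * complex_of_real (1 / lam i)) = complex_of_real (drift D1 D2 \<pi> (mean Fp))"
    and 2: "\<And>k. k \<in> {1..<N} \<Longrightarrow> (\<Sum>i<N. v $ i * adj_mat (E (complex_of_real (s k))) $$ (i, m k)) = 0"
  shows "v = u"
proof -
  have "v \<in> carrier_vec N \<and>
             v \<bullet> map_vec complex_of_real (Lam_inv D1 D2 *\<^sub>v ones N) = complex_of_real (drift D1 D2 \<pi> (mean Fp)) \<and>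
             (\<forall>k\<in>{1..<N}. v \<bullet> a_col E (complex_of_real (s k)) (m k) = 0)"
  proof (intro conjI ballI)
    fix k assume k: "k \<in> {1..<N}"
    show "v \<bullet> a_col E (complex_of_real (s k)) (m k) = 0" unfolding a_col_product[OF v k] by (rule 2[OF k])
  qed (use v 1 in \<open>simp_all only: l0_product\<close>)
  then show ?thesis unfolding u .
qed

text \<open>The conditions on \<open>u\<close> determine it uniquely, so their matrix is invertible.\<close>

lemma A_inverse:
  "inv_mat (A_mat D1 D2 E s m) \<in> carrier_mat N N"
  "A_mat D1 D2 E s m * inv_mat (A_mat D1 D2 E s m) = 1\<^sub>m N"
  "inv_mat (A_mat D1 D2 E s m) * A_mat D1 D2 E s m = 1\<^sub>m N"
proof -
  let ?A = "A_mat D1 D2 E s m"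
  have "det ?A \<noteq> 0"
  proof
    assume "det ?A = 0"
    then have "det (transpose_mat ?A) = 0" using det_transpose[OF A_carrier] by simp
    then obtain w where w: "w \<in> carrier_vec N" "w \<noteq> 0\<^sub>v N" "transpose_mat ?A *\<^sub>v w = 0\<^sub>v N"
      using det_0_iff_vec_prod_zero[of "transpose_mat ?A" N] A_carrier by auto
    have 0: "(\<Sum>i<N. w $ i * ?A $$ (i, k)) = 0" if k: "k < N" for k
    proof -
      have "0 = (transpose_mat ?A *\<^sub>v w) $ k" using w(3) k by simp
      also have "\<dots> = (\<Sum>i<N. w $ i * ?A $$ (i, k))"
        using k w(1) A_carrier by (simp add: scalar_prod_def lessThan_atLeast0 mult.commute)
      finally show ?thesis by simp
    qed
    have "u + w = u"
    proof (rule u_unique)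
      have e: "(u + w) $ i = u $ i + w $ i" if "i < N" for i using that u_carrier w(1) by simp
      have w0: "(\<Sum>i<N. w $ i * complex_of_real (1 / lam i)) = 0"
        using 0[of 0] by (simp add: A_entry0)
      have wk: "(\<Sum>i<N. w $ i * adj_mat (E (complex_of_real (s k))) $$ (i, m k)) = 0" if "k \<in> {1..<N}" for k
        using 0[of k] that by (simp add: A_entry)
      show "u + w \<in> carrier_vec N" using u_carrier w(1) by simp
      show "(\<Sum>i<N. (u + w) $ i * complex_of_real (1 / lam i)) = complex_of_real (drift D1 D2 \<pi> (mean Fp))"
        using u_norm w0 by (simp add: e distrib_right add_divide_distrib sum.distrib)
      show "(\<Sum>i<N. (u + w) $ i * adj_mat (E (complex_of_real (s k))) $$ (i, m k)) = 0" if "k \<in> {1..<N}" for k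
        using u_root[OF that] wk[OF that] by (simp add: e distrib_right sum.distrib)
    qed
    then have "w $ i = 0" if "i < N" for i
    proof -
      have "(u + w) $ i = u $ i" using \<open>u + w = u\<close> by simp
      then show ?thesis using that u_carrier w(1) by simp
    qed
    then have "w = 0\<^sub>v N" using w(1) by (intro eq_vecI) auto
    then show False using w(2) by contradiction
  qed
  then have "?A \<in> Units (ring_mat TYPE(complex) N ())" by (rule det_non_zero_imp_unit[OF A_carrier])
  then have "mat_inverse ?A \<noteq> None" using mat_inverse(1)[OF A_carrier, where b = "()"] by blast
  then obtain B where B: "mat_inverse ?A = Some B" by blast
  from B mat_inverse(2)[OF A_carrier B]
  show "inv_mat ?A \<in> carrier_mat N N" "?A * inv_mat ?A = 1\<^sub>m N" "inv_mat ?A * ?A = 1\<^sub>m N"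
    by (simp_all add: inv_mat_def)
qed

definition Ainv :: "nat \<Rightarrow> nat \<Rightarrow> complex" where
  "Ainv k j = inv_mat (A_mat D1 D2 E s m) $$ (k, j)"

lemma A_Ainv: "i < N \<Longrightarrow> j < N \<Longrightarrow> (\<Sum>k<N. A_mat D1 D2 E s m $$ (i, k) * Ainv k j) = (if i = j then 1 else 0)"
  and Ainv_A: "i < N \<Longrightarrow> j < N \<Longrightarrow> (\<Sum>k<N. Ainv i k * A_mat D1 D2 E s m $$ (k, j)) = (if i = j then 1 else 0)"
proof -
  assume ij: "i < N" "j < N"
  have "(A_mat D1 D2 E s m * inv_mat (A_mat D1 D2 E s m)) $$ (i, j) = (\<Sum>k<N. A_mat D1 D2 E s m $$ (i, k) * Ainv k j)"
    using ij A_carrier A_inverse(1) by (simp add: scalar_prod_def lessThan_atLeast0 Ainv_def)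
  then show "(\<Sum>k<N. A_mat D1 D2 E s m $$ (i, k) * Ainv k j) = (if i = j then 1 else 0)"
    unfolding A_inverse(2) using ij by simp
  have "(inv_mat (A_mat D1 D2 E s m) * A_mat D1 D2 E s m) $$ (i, j) = (\<Sum>k<N. Ainv i k * A_mat D1 D2 E s m $$ (k, j))"
    using ij A_carrier A_inverse(1) by (simp add: scalar_prod_def lessThan_atLeast0 Ainv_def)
  then show "(\<Sum>k<N. Ainv i k * A_mat D1 D2 E s m $$ (k, j)) = (if i = j then 1 else 0)"
    unfolding A_inverse(3) using ij by simp
qed

lemma sum_split_first: "(\<Sum>k<N. f k) = f 0 + (\<Sum>k\<in>{1..<N}. f k)" for f :: "nat \<Rightarrow> complex"
  using sum.atLeast_Suc_lessThan[of 0 N f] by (simp add: lessThan_atLeast0)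

lemma A_expand:
  fixes v :: "nat \<Rightarrow> complex"
  assumes j: "j < N"
  shows "v j = (\<Sum>i<N. v i * complex_of_real (1 / lam i)) * Ainv 0 j
     + (\<Sum>k\<in>{1..<N}. (\<Sum>i<N. v i * adj_mat (E (complex_of_real (s k))) $$ (i, m k)) * Ainv k j)"
proof -
  have "v j = (\<Sum>i<N. v i * (\<Sum>k<N. A_mat D1 D2 E s m $$ (i, k) * Ainv k j))"
  proof -
    have "(\<Sum>i<N. v i * (\<Sum>k<N. A_mat D1 D2 E s m $$ (i, k) * Ainv k j)) = (\<Sum>i<N. if i = j then v i else 0)"
      by (intro sum.cong refl) (simp add: A_Ainv j)
    then show ?thesis using j by simp
  qed
  also have "\<dots> = (\<Sum>k<N. (\<Sum>i<N. v i * A_mat D1 D2 E s m $$ (i, k)) * Ainv k j)"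
    by (simp only: sum_distrib_left sum_distrib_right mult.assoc) (rule sum.swap)
  also have "\<dots> = (\<Sum>i<N. v i * A_mat D1 D2 E s m $$ (i, 0)) * Ainv 0 j
     + (\<Sum>k\<in>{1..<N}. (\<Sum>i<N. v i * A_mat D1 D2 E s m $$ (i, k)) * Ainv k j)"
    by (rule sum_split_first)
  also have "(\<Sum>i<N. v i * A_mat D1 D2 E s m $$ (i, 0)) = (\<Sum>i<N. v i * complex_of_real (1 / lam i))"
    by (intro sum.cong refl) (simp add: A_entry0)
  also have "(\<Sum>k\<in>{1..<N}. (\<Sum>i<N. v i * A_mat D1 D2 E s m $$ (i, k)) * Ainv k j)
     = (\<Sum>k\<in>{1..<N}. (\<Sum>i<N. v i * adj_mat (E (complex_of_real (s k))) $$ (i, m k)) * Ainv k j)"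
    by (intro sum.cong refl arg_cong2[where f = "(*)"]) (simp add: A_entry)
  finally show ?thesis .
qed

text \<open>The vector from the balance equations satisfies the conditions that define the vector \<open>u\<close> of the theorem.\<close>

lemma base_u: "j < N \<Longrightarrow> B.u j = u $ j"
proof -
  have "vec N B.u = u"
  proof (rule u_unique)
    have "(\<Sum>j<N. B.u j * complex_of_real (1 / lam j)) = complex_of_real (drift D1 D2 \<pi> (mean Fp))"
      by (rule B.normalization[where h = "\<lambda>\<zeta>. mean Fp * lst (excess Fp) \<zeta>"])
        (simp_all only: lst_expand lst_excess_zero[OF Fp_e] mult_1_right continuous_on_mult[OF continuous_on_const Fpe.lst_continuous])
    then show "(\<Sum>i<N. vec N B.u $ i * complex_of_real (1 / lam i)) = complex_of_real (drift D1 D2 \<pi> (mean Fp))" by simp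
    fix k assume k: "k \<in> {1..<N}"
    let ?s = "complex_of_real (s k)"
    have s: "0 \<le> Re ?s" "?s \<noteq> 0" using s_pos[OF k] by auto
    have "det (E ?s) * B.\<phi> ?s (m k) = (\<Sum>i<N. ?s * B.u i * adj_mat (E ?s) $$ (i, m k)) - (\<Sum>i<N. \<Sum>j<N. B.\<phi> ?s i * 0 * adj_mat (E ?s) $$ (j, m k))"
      by (rule perturbed_cramer[OF E_carrier m_less[OF k]]) (use B.balance[OF _ s(1)] E_eq[OF s(1)] in simp)
    then have "?s * (\<Sum>i<N. B.u i * adj_mat (E ?s) $$ (i, m k)) = 0"
      using det_root[of k] k by (simp add: sum_distrib_left mult.assoc)
    then show "(\<Sum>i<N. vec N B.u $ i * adj_mat (E ?s) $$ (i, m k)) = 0" using s(2) by simp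
  qed simp
  then have "vec N B.u $ j = u $ j" by (rule arg_cong)
  then show "j < N \<Longrightarrow> B.u j = u $ j" by simp
qed

lemma base_balance:
  assumes "0 \<le> Re \<zeta>" "j < N"
  shows "(\<Sum>i<N. B.\<phi> \<zeta> i * E \<zeta> $$ (i, j)) = \<zeta> * u $ j"
  using B.balance[OF assms(2,1)] by (simp add: E_eq[OF assms(1)] base_u[OF assms(2)])

lemma z_carrier: "z \<in> carrier_vec N"
  unfolding z by (rule vec_mult_mat_carrier[OF A_inverse(1)])

lemma c_Ainv: "c_vec D1 D2 \<pi> Fp \<^sub>v* inv_mat (A_mat D1 D2 E s m) = u"
proof (rule eq_vecI)
  fix j assume "j < dim_vec u"
  then have j: "j < N" using u_carrier by simp
  have "(c_vec D1 D2 \<pi> Fp \<^sub>v* inv_mat (A_mat D1 D2 E s m)) $ j = (\<Sum>k<N. c_vec D1 D2 \<pi> Fp $ k * Ainv k j)"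
    unfolding Ainv_def by (rule vec_mult_mat_index[OF _ A_inverse(1) j]) (simp add: c_vec_def)
  also have "\<dots> = complex_of_real (drift D1 D2 \<pi> (mean Fp)) * Ainv 0 j"
    by (subst sum_split_first) (simp add: c_vec_def)
  also have "\<dots> = u $ j"
    unfolding A_expand[OF j, of "\<lambda>i. u $ i"] u_norm by (simp add: u_root)
  finally show "(c_vec D1 D2 \<pi> Fp \<^sub>v* inv_mat (A_mat D1 D2 E s m)) $ j = u $ j" .
next
  show "dim_vec (c_vec D1 D2 \<pi> Fp \<^sub>v* inv_mat (A_mat D1 D2 E s m)) = dim_vec u"
    using vec_mult_mat_carrier[OF A_inverse(1), of "c_vec D1 D2 \<pi> Fp"] u_carrier by simp
qed

lemma B_mat_carrier: "B_mat N E K s m \<in> carrier_mat N N"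
  by (simp add: B_mat_def mat_of_cols_def)

lemma z_product:
  assumes k: "k < N"
  shows "(\<Sum>i<N. z $ i * A_mat D1 D2 E s m $$ (i, k)) = (\<Sum>i<N. u $ i * B_mat N E K s m $$ (i, k)) + d_vec D1 D2 \<pi> Fp Fh $ k"
proof -
  define y where "y = u \<^sub>v* B_mat N E K s m + d_vec D1 D2 \<pi> Fp Fh"
  have y: "y \<in> carrier_vec N"
    unfolding y_def using vec_mult_mat_carrier[OF B_mat_carrier, of u] by (simp add: d_vec_def)
  have z': "z = y \<^sub>v* inv_mat (A_mat D1 D2 E s m)"
    unfolding z c_Ainv y_def ..
  have "(\<Sum>i<N. z $ i * A_mat D1 D2 E s m $$ (i, k)) = (\<Sum>i<N. (\<Sum>j<N. y $ j * Ainv j i) * A_mat D1 D2 E s m $$ (i, k))"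
    unfolding z' Ainv_def by (intro sum.cong refl arg_cong2[where f = "(*)"] vec_mult_mat_index[OF y A_inverse(1)]) simp
  also have "\<dots> = (\<Sum>j<N. y $ j * (\<Sum>i<N. Ainv j i * A_mat D1 D2 E s m $$ (i, k)))"
    by (simp only: sum_distrib_left sum_distrib_right mult.assoc) (rule sum.swap)
  also have "\<dots> = (\<Sum>j<N. if j = k then y $ j else 0)"
    by (intro sum.cong refl) (simp add: Ainv_A k)
  also have "\<dots> = y $ k" using k by simp
  also have "\<dots> = (u \<^sub>v* B_mat N E K s m) $ k + d_vec D1 D2 \<pi> Fp Fh $ k"
    unfolding y_def using k by (simp add: d_vec_def)
  also have "(u \<^sub>v* B_mat N E K s m) $ k = (\<Sum>i<N. u $ i * B_mat N E K s m $$ (i, k))"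
    by (rule vec_mult_mat_index[OF u_carrier B_mat_carrier k])
  finally show ?thesis .
qed

lemma z_zero: "(\<Sum>i<N. z $ i * complex_of_real (1 / lam i)) = c1"
proof -
  have q: "dim_row (Q2 D1 D2) = N" "dim_col (Q2 D1 D2) = N" by (simp_all add: Q2_def)
  have "(\<Sum>i<N. z $ i * complex_of_real (1 / lam i)) = (\<Sum>i<N. z $ i * A_mat D1 D2 E s m $$ (i, 0))"
    by (intro sum.cong refl) (simp add: A_entry0)
  also have "\<dots> = (\<Sum>i<N. u $ i * B_mat N E K s m $$ (i, 0)) + d_vec D1 D2 \<pi> Fp Fh $ 0"
    by (rule z_product) simp
  also have "(\<Sum>i<N. u $ i * B_mat N E K s m $$ (i, 0)) = 0"
    by (intro sum.neutral ballI) (simp add: B_mat_def mat_of_cols_index)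
  also have "0 + d_vec D1 D2 \<pi> Fp Fh $ 0 = c1"
  proof -
    have "(hadamard (Q2 D1 D2) (P_mat D1 D2) *\<^sub>v ones N) $ i = (\<Sum>j<N. q2 i j * p i j)" if "i < N" for i
      using that q by (simp add: hadamard_def ones_def scalar_prod_def lessThan_atLeast0)
    then have "\<pi> \<bullet> (hadamard (Q2 D1 D2) (P_mat D1 D2) *\<^sub>v ones N) = (\<Sum>i<N. \<pi> $ i * (\<Sum>j<N. q2 i j * p i j))"
      using q by (simp add: scalar_prod_def lessThan_atLeast0 hadamard_def)
    then show ?thesis by (simp add: d_vec_def c1_def)
  qed
  finally show ?thesis .
qed

text \<open>By its definition \<open>z a\<^sub>k = u (\<delta>\<^sub>k a\<^sub>k\<^sup>(\<^sup>1\<^sup>) - k\<^sub>k)\<close>, which \<open>first_order_at_root\<close> identifies.\<close>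

lemma z_root:
  assumes k: "k \<in> {1..<N}"
  shows "complex_of_real (s k) * (\<Sum>i<N. z $ i * adj_mat (E (complex_of_real (s k))) $$ (i, m k)) =
    (\<Sum>i<N. \<Sum>j<N. B.\<phi> (complex_of_real (s k)) i * K (complex_of_real (s k)) $$ (i, j) * adj_mat (E (complex_of_real (s k))) $$ (j, m k))"
proof -
  let ?s = "complex_of_real (s k)"
  have s: "0 < Re ?s" "0 \<le> Re ?s" "?s \<noteq> 0" using s_pos[OF k] by auto
  have dE: "((\<lambda>\<zeta>. E \<zeta> $$ (i, j)) has_field_derivative mat_deriv E ?s $$ (i, j)) (at ?s)" if "i < N" "j < N" for i j
    by (rule E_deriv[OF that s(2)])
  have nz: "col_replace_sum (E ?s) (mat_deriv E ?s) \<noteq> 0"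
    using simple[OF k] DERIV_imp_deriv[OF det_has_field_derivative[OF E_carrier mat_deriv_carrier dE]] by simp
  have hol: "(\<lambda>\<zeta>. B.\<phi> \<zeta> i) holomorphic_on {\<zeta>. 0 < Re \<zeta>}" for i
    unfolding B.\<phi>_def by (rule B.L.laplace_holomorphic)
  have df: "((\<lambda>\<zeta>. B.\<phi> \<zeta> (m k)) has_field_derivative deriv (\<lambda>\<zeta>. B.\<phi> \<zeta> (m k)) ?s) (at ?s)"
    by (rule holomorphic_derivI[OF hol open_halfspace_Re_gt]) (use s in simp)
  have entry: "B_mat N E K s m $$ (i, k) = col_replace_sum (E ?s) (K ?s) / col_replace_sum (E ?s) (mat_deriv E ?s) * adj_derivative (E ?s) (mat_deriv E ?s) $$ (i, m k)
        - adj_derivative (E ?s) (K ?s) $$ (i, m k)" if i: "i < N" for i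
  proof -
    have a: "a_col_deriv E ?s (m k) $ i = adj_derivative (E ?s) (mat_deriv E ?s) $$ (i, m k)"
      using i m_less[OF k] adj_mat(1)[OF E_carrier[of ?s]]
        DERIV_imp_deriv[OF adj_mat_has_field_derivative[OF E_carrier mat_deriv_carrier dE i m_less[OF k]]]
      by (simp add: a_col_deriv_def mat_deriv_def)
    have b: "k_col E K ?s (m k) $ i = adj_derivative (E ?s) (K ?s) $$ (i, m k)"
      using i m_less[OF k] carrier_matD[OF E_carrier[of ?s]] by (simp add: k_col_def adj_derivative_def)
    have "B_mat N E K s m $$ (i, k) = (delta E K ?s \<cdot>\<^sub>v a_col_deriv E ?s (m k) - k_col E K ?s (m k)) $ i"
      using i k unfolding B_mat_def by (subst mat_of_cols_index) (auto simp: nth_Cons')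
    also have "\<dots> = delta E K ?s * a_col_deriv E ?s (m k) $ i - k_col E K ?s (m k) $ i"
      using i carrier_matD[OF E_carrier[of ?s]] adj_mat(1)[OF E_carrier[of ?s]]
      by (simp add: k_col_def a_col_deriv_def mat_deriv_def)
    finally show ?thesis unfolding a b delta_def .
  qed
  have "(\<Sum>i<N. z $ i * adj_mat (E ?s) $$ (i, m k)) = (\<Sum>i<N. z $ i * A_mat D1 D2 E s m $$ (i, k))"
    by (intro sum.cong refl) (simp add: A_entry[OF _ k])
  also have "\<dots> = (\<Sum>i<N. u $ i * B_mat N E K s m $$ (i, k)) + d_vec D1 D2 \<pi> Fp Fh $ k"
    by (rule z_product) (use k in simp)
  also have "\<dots> = (\<Sum>i<N. u $ i * (col_replace_sum (E ?s) (K ?s) / col_replace_sum (E ?s) (mat_deriv E ?s) * adj_derivative (E ?s) (mat_deriv E ?s) $$ (i, m k)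
        - adj_derivative (E ?s) (K ?s) $$ (i, m k)))"
    using k by (simp add: entry d_vec_def)
  finally have e: "(\<Sum>i<N. z $ i * adj_mat (E ?s) $$ (i, m k)) = \<dots>" .
  show ?thesis
    unfolding e
  proof (rule first_order_at_root[where E = E and E' = "mat_deriv E ?s" and K = "K ?s" and s = ?s and f = "B.\<phi>"
        and m = "m k" and n = N and S = "{\<zeta>. 0 < Re \<zeta>}" and u = "\<lambda>i. u $ i", symmetric])
    show "((\<lambda>\<zeta>. B.\<phi> \<zeta> (m k)) has_field_derivative deriv (\<lambda>\<zeta>. B.\<phi> \<zeta> (m k)) ?s) (at ?s)" by (rule df)
    show "(\<Sum>i<N. B.\<phi> \<zeta> i * E \<zeta> $$ (i, j)) = \<zeta> * u $ j" if "\<zeta> \<in> {\<zeta>. 0 < Re \<zeta>}" "j < N" for \<zeta> j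
      by (rule base_balance) (use that in auto)
    show "det (E ?s) = 0" by (rule det_root) (use k in simp)
    show "?s \<in> {\<zeta>. 0 < Re \<zeta>}" using s(1) by (simp only: mem_Collect_eq)
  qed (rule E_carrier mat_deriv_carrier K_carrier dE m_less[OF k] open_halfspace_Re_gt nz s(3); assumption)+
qed

sublocale PB: perturbed_balance N E K B.\<phi> fe "\<lambda>i. u $ i" "\<lambda>i. z $ i" ue s m "\<lambda>i. complex_of_real (1 / lam i)"
  "complex_of_real (drift D1 D2 \<pi> (mean Fp))" c1 Ainv
proof
  fix i j :: nat assume ij: "i < N" "j < N"
  show "continuous_on {\<zeta>. 0 \<le> Re \<zeta>} (\<lambda>\<zeta>. E \<zeta> $$ (i, j))"
    unfolding continuous_on_eq_continuous_within
    using E_deriv[OF ij] by (auto intro: DERIV_isCont continuous_at_imp_continuous_at_within)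
  show "continuous_on {\<zeta>. 0 \<le> Re \<zeta>} (\<lambda>\<zeta>. K \<zeta> $$ (i, j))"
    unfolding K_entry[OF ij] by (intro continuous_on_mult continuous_on_id continuous_on_const D_cont)
next
  show "\<forall>\<^sub>F \<epsilon> in at_right 0. \<forall>i<N. (\<lambda>\<zeta>. fe \<epsilon> \<zeta> i) holomorphic_on {\<zeta>. 0 < Re \<zeta>}"
    using eventually_stable
  proof eventually_elim
    case (elim \<epsilon>)
    then interpret S: steady N D1 D2 \<pi> "mixture \<epsilon> Fp Fh" "\<nu>mix \<epsilon>" by (intro steady_mix) auto
    show ?case unfolding fe_def using S.L.laplace_holomorphic by blast
  qed
  show "\<forall>\<^sub>F \<epsilon> in at_right 0. \<forall>i<N. \<forall>\<zeta>. 0 \<le> Re \<zeta> \<longrightarrow> norm (fe \<epsilon> \<zeta> i) \<le> 1"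
    using eventually_stable
  proof eventually_elim
    case (elim \<epsilon>)
    then interpret S: steady N D1 D2 \<pi> "mixture \<epsilon> Fp Fh" "\<nu>mix \<epsilon>" by (intro steady_mix) auto
    show ?case unfolding fe_def using S.L.norm_laplace_le S.nu.prob_space by metis
  qed
  show "\<forall>\<^sub>F \<epsilon> in at_right 0. \<forall>\<zeta>. \<forall>j<N. 0 \<le> Re \<zeta> \<longrightarrow>
        (\<Sum>i<N. fe \<epsilon> \<zeta> i * (E \<zeta> $$ (i, j) + complex_of_real \<epsilon> * K \<zeta> $$ (i, j))) = \<zeta> * ue \<epsilon> j"
    using eventually_stable
  proof eventually_elim
    case (elim \<epsilon>)
    then interpret S: steady N D1 D2 \<pi> "mixture \<epsilon> Fp Fh" "\<nu>mix \<epsilon>" by (intro steady_mix) auto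
    show ?case
    proof (intro allI impI)
      fix \<zeta> j assume j: "j < N" and \<zeta>: "0 \<le> Re \<zeta>"
      have "(\<Sum>i<N. fe \<epsilon> \<zeta> i * (E \<zeta> $$ (i, j) + complex_of_real \<epsilon> * K \<zeta> $$ (i, j))) =
        (\<Sum>i<N. S.\<phi> \<zeta> i * E_mat2 D1 D2 \<zeta> (lst (mixture \<epsilon> Fp Fh) \<zeta>) $$ (i, j))"
        using elim \<zeta> j by (intro sum.cong refl) (simp add: E_mix fe_def S.\<phi>_def)
      then show "(\<Sum>i<N. fe \<epsilon> \<zeta> i * (E \<zeta> $$ (i, j) + complex_of_real \<epsilon> * K \<zeta> $$ (i, j))) = \<zeta> * ue \<epsilon> j"
        unfolding S.balance[OF j \<zeta>] ue_def .
    qed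
  qed
  show "\<forall>\<^sub>F \<epsilon> in at_right 0. (\<Sum>i<N. ue \<epsilon> i * complex_of_real (1 / lam i)) =
      complex_of_real (drift D1 D2 \<pi> (mean Fp)) + complex_of_real \<epsilon> * c1"
    using eventually_stable
  proof eventually_elim
    case (elim \<epsilon>)
    then interpret S: steady N D1 D2 \<pi> "mixture \<epsilon> Fp Fh" "\<nu>mix \<epsilon>" by (intro steady_mix) auto
    have "(\<Sum>i<N. ue \<epsilon> i * complex_of_real (1 / lam i)) = complex_of_real (drift D1 D2 \<pi> (mean Fp + \<epsilon> * (mean Fh - mean Fp)))"
      unfolding ue_def
    proof (rule S.normalization[where h = "\<lambda>\<zeta>. mean Fp * lst (excess Fp) \<zeta> - complex_of_real \<epsilon> * D \<zeta>"])
      show "lst (mixture \<epsilon> Fp Fh) \<zeta> = 1 - \<zeta> * (mean Fp * lst (excess Fp) \<zeta> - complex_of_real \<epsilon> * D \<zeta>)" if "0 \<le> Re \<zeta>" for \<zeta>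
        using elim that lst_mixture[of \<epsilon> \<zeta>] lst_Fp[OF that] lst_expand(1)[OF that] by (simp add: algebra_simps)
      show "continuous_on {\<zeta>. 0 \<le> Re \<zeta>} (\<lambda>\<zeta>. mean Fp * lst (excess Fp) \<zeta> - complex_of_real \<epsilon> * D \<zeta>)"
        by (intro continuous_on_diff continuous_on_mult continuous_on_const Fpe.lst_continuous D_cont)
      show "mean Fp * lst (excess Fp) 0 - complex_of_real \<epsilon> * D 0 = complex_of_real (mean Fp + \<epsilon> * (mean Fh - mean Fp))"
        by (simp add: excess_diff_def lst_excess_zero Fp_e Fh_e algebra_simps)
    qed
    also have "\<dots> = complex_of_real (drift D1 D2 \<pi> (mean Fp)) + complex_of_real \<epsilon> * c1"
      unfolding drift_eq c1_def
      by (simp add: algebra_simps sum.distrib sum_subtractf sum_distrib_left)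
    finally show ?case .
  qed
next
  fix k assume k: "k \<in> {1..<N}"
  have "\<forall>\<^sub>F w in at (complex_of_real (s k)). 0 < Re w \<and> det (E w) \<noteq> 0 \<and> (\<forall>k<N. w \<noteq> complex_of_real (s k))"
    by (rule eventually_det_nonzero) (use s_pos[OF k] in simp)
  then show "\<forall>\<^sub>F \<zeta> in at (complex_of_real (s k)). det (E \<zeta>) \<noteq> 0" by eventually_elim simp
  show "det (E (complex_of_real (s k))) = 0" by (rule det_root) (use k in simp)
next
  show "(\<lambda>\<zeta>. B.\<phi> \<zeta> i) holomorphic_on {\<zeta>. 0 < Re \<zeta>}" for i
    unfolding B.\<phi>_def by (rule B.L.laplace_holomorphic)
qed (use E_carrier s_pos m_less base_balance u_norm z_zero z_root A_expand in \<open>blast+\<close>)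

end

section \<open>Sums of independent families\<close>

context prob_space begin

lemma AE_nonneg_of_distr:
  assumes "random_variable borel X" "distr M borel X = F" "nonneg_finite_measure F"
  shows "AE x in M. 0 \<le> X x"
proof -
  have "AE x in distr M borel X. 0 \<le> x" unfolding assms(2) by (rule nonneg_finite_measure.AE_nonneg[OF assms(3)])
  then show ?thesis using assms(1) by (rule AE_distrD[rotated])
qed

lemma distr_of_distributed: "distributed M lborel X f \<Longrightarrow> distr M borel X = density lborel f"
  using distributed_distr_eq_density[of M lborel X f] distr_cong[of M M lborel borel X X] by simp

lemma family_tail:
  assumes ind: "indep_vars (\<lambda>_. borel) Z I" and J: "finite J" "J \<noteq> {}" "J \<subseteq> I"
    and nn: "\<And>j. j \<in> I \<Longrightarrow> AE x in M. 0 \<le> Z j x"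
  shows "complex_tail (\<lambda>\<zeta>. \<Prod>j\<in>J. LT (Z j) \<zeta>) (\<lambda>t. complex_of_real (\<P>(x in M. (\<Sum>j\<in>J. Z j x) > t)))"
proof -
  have rv: "random_variable borel (Z j)" if "j \<in> J" for j
    using ind that J(3) by (auto simp: indep_vars_def)
  have "AE x in M. \<forall>j\<in>J. 0 \<le> Z j x" using J nn by (subst AE_finite_all) auto
  then have "AE x in M. 0 \<le> (\<Sum>j\<in>J. Z j x)" by eventually_elim (simp add: sum_nonneg)
  then have "complex_tail (LT (\<lambda>x. \<Sum>j\<in>J. Z j x)) (\<lambda>t. complex_of_real (\<P>(x in M. (\<Sum>j\<in>J. Z j x) > t)))"
    by (intro complex_tail_real tail_random_variable borel_measurable_sum rv)
  then show ?thesis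
  proof (rule complex_tail_cong)
    fix \<zeta> :: complex assume "0 \<le> Re \<zeta>"
    then show "(\<Prod>j\<in>J. LT (Z j) \<zeta>) = LT (\<lambda>x. \<Sum>j\<in>J. Z j x) \<zeta>"
      by (intro LT_sum[symmetric] indep_vars_subset[OF ind J(3)] J(1,2) nn) (use J(3) in blast)
  qed simp
qed

lemma family_overshoot:
  assumes ind: "indep_vars (\<lambda>_. borel) Z I" and J: "finite J" "J \<noteq> {}" "J \<subseteq> I"
    and nn: "\<And>j. j \<in> I \<Longrightarrow> AE x in M. 0 \<le> Z j x"
    and e: "e \<in> I" "e \<notin> J" and l: "0 < l" and T: "distributed M lborel (Z e) (exponential_density l)"
  shows "complex_tail (overshoot (\<lambda>x. \<Sum>j\<in>J. Z j x) (Z e))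
      (\<lambda>t. complex_of_real (\<P>(x in M. t < (\<Sum>j\<in>J. Z j x) \<and> (\<Sum>j\<in>J. Z j x) < t + Z e x)))"
    and "\<And>\<zeta>. 0 \<le> Re \<zeta> \<Longrightarrow> (\<zeta> - complex_of_real l) * overshoot (\<lambda>x. \<Sum>j\<in>J. Z j x) (Z e) \<zeta> =
      \<zeta> * ((\<Prod>j\<in>J. LT (Z j) \<zeta>) - (\<Prod>j\<in>J. LT (Z j) (complex_of_real l)))"
proof -
  have "AE x in M. \<forall>j\<in>J. 0 \<le> Z j x" using J nn by (subst AE_finite_all) auto
  then have X: "AE x in M. 0 \<le> (\<Sum>j\<in>J. Z j x)" by eventually_elim (simp add: sum_nonneg)
  have i: "indep_var borel (Z e) borel (\<lambda>x. \<Sum>j\<in>J. Z j x)"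
    by (rule indep_vars_sum[OF J(1) e(2) indep_vars_subset[OF ind]]) (use e J in auto)
  have LT: "LT (\<lambda>x. \<Sum>j\<in>J. Z j x) \<zeta> = (\<Prod>j\<in>J. LT (Z j) \<zeta>)" if "0 \<le> Re \<zeta>" for \<zeta>
    by (rule LT_sum[OF indep_vars_subset[OF ind J(3)] J(1,2) _ that]) (use nn J(3) in auto)
  show "complex_tail (overshoot (\<lambda>x. \<Sum>j\<in>J. Z j x) (Z e))
      (\<lambda>t. complex_of_real (\<P>(x in M. t < (\<Sum>j\<in>J. Z j x) \<and> (\<Sum>j\<in>J. Z j x) < t + Z e x)))"
    by (rule overshoot_tail[OF i X l T])
  show "(\<zeta> - complex_of_real l) * overshoot (\<lambda>x. \<Sum>j\<in>J. Z j x) (Z e) \<zeta> =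
      \<zeta> * ((\<Prod>j\<in>J. LT (Z j) \<zeta>) - (\<Prod>j\<in>J. LT (Z j) (complex_of_real l)))" if "0 \<le> Re \<zeta>" for \<zeta>
    using overshoot_transform[OF i X l T that] LT[OF that] LT[of "complex_of_real l"] l by simp
qed

end

section \<open>The first-order term of the delay transform\<close>

lemma Phi_laplace: "i < n \<Longrightarrow> Phi n \<nu> \<zeta> $ i = laplace \<nu> (\<lambda>x. if snd x = i then 1 else 0) fst \<zeta>"
  unfolding Phi_def laplace_def by (simp, intro Bochner_Integration.integral_cong) auto

context model begin

definition om :: "nat \<Rightarrow> complex" where "om j = omega D1 D2 \<pi> $ j"

lemma omega_carrier: "omega D1 D2 \<pi> \<in> carrier_vec N"
  unfolding omega_def Let_def carrier_vec_def mem_Collect_eq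
  by (simp only: index_map_vec index_smult_vec dim_mult_mat_vec dim_Lam_inv)

lemma om_real: "j < N \<Longrightarrow> cnj (om j) = om j"
  unfolding om_def omega_def Let_def
  by (subst index_map_vec) (simp_all only: index_smult_vec dim_mult_mat_vec dim_Lam_inv index_map_vec complex_cnj_complex_of_real)

definition w :: "complex \<Rightarrow> complex" where "w \<zeta> = (\<Sum>j<N. B.\<phi> \<zeta> j * om j)"
definition wmix :: "real \<Rightarrow> complex \<Rightarrow> complex" where "wmix \<epsilon> \<zeta> = (\<Sum>j<N. fe \<epsilon> \<zeta> j * om j)"

lemma delay_w: "delay_transform D1 D2 \<pi> \<nu> \<zeta> = w \<zeta>"
  using omega_carrier unfolding delay_transform_def w_def om_def B.\<phi>_def
  by (simp add: scalar_prod_def lessThan_atLeast0 Phi_laplace)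

lemma delay_wmix: "delay_transform D1 D2 \<pi> (\<nu>mix \<epsilon>) \<zeta> = wmix \<epsilon> \<zeta>"
  using omega_carrier unfolding delay_transform_def wmix_def om_def fe_def
  by (simp add: scalar_prod_def lessThan_atLeast0 Phi_laplace)

lemma laplace_tag_cnj:
  fixes \<rho> :: "(real \<times> nat) measure"
  shows "laplace \<rho> (\<lambda>x. if snd x = i then 1 else 0) fst (cnj \<zeta>) = cnj (laplace \<rho> (\<lambda>x. if snd x = i then 1 else 0) fst \<zeta>)"
proof -
  have "(\<lambda>x. if snd x = i then 1 else 0) = (\<lambda>x :: real \<times> nat. complex_of_real (if snd x = i then 1 else 0))" by auto
  then show ?thesis by (simp only: laplace_cnj)
qed

lemma w_cnj: "w (cnj \<zeta>) = cnj (w \<zeta>)" "wmix \<epsilon> (cnj \<zeta>) = cnj (wmix \<epsilon> \<zeta>)"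
  unfolding w_def wmix_def B.\<phi>_def fe_def laplace_tag_cnj by (simp_all add: om_real)

definition ZA where "ZA \<zeta> = (\<Sum>i<N. \<Sum>j<N. z $ i * adj_mat (E \<zeta>) $$ (i, j) * om j)"
definition UA where "UA \<zeta> = (\<Sum>i<N. \<Sum>j<N. u $ i * adj_mat (E \<zeta>) $$ (i, j) * om j)"
text \<open>The derivative of \<open>u adj E(\<zeta>, g) \<omega>\<close> with respect to \<open>g\<close>; likewise \<open>dg\<close> below is that of \<open>det E(\<zeta>, g)\<close>.\<close>

definition UB where "UB \<zeta> = (\<Sum>i<N. \<Sum>j<N. u $ i * adj_derivative (E \<zeta>) Q $$ (i, j) * om j)"
definition QA where "QA \<zeta> = (\<Sum>i<N. \<Sum>k<N. \<Sum>j<N. B.\<phi> \<zeta> i * Q $$ (i, k) * adj_mat (E \<zeta>) $$ (k, j) * om j)"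
definition dg where "dg \<zeta> = col_replace_sum (E \<zeta>) Q"
text \<open>The first-order term of the scalar delay transform.\<close>

definition \<psi> where "\<psi> \<zeta> = (\<Sum>j<N. PB.\<Psi> \<zeta> j * om j)"

text \<open>Multiply the product rule for \<open>E adj E\<close> in direction \<open>Q\<close> by \<open>\<Phi>\<close> from the left and use the balance
  equations to replace \<open>\<Phi> E\<close> by \<open>\<zeta> u\<close>.\<close>

lemma QA_eq:
  assumes \<zeta>: "0 \<le> Re \<zeta>"
  shows "QA \<zeta> + \<zeta> * UB \<zeta> = dg \<zeta> * w \<zeta>"
proof -
  have "B.\<phi> \<zeta> j * dg \<zeta> = (\<Sum>i<N. \<Sum>k<N. B.\<phi> \<zeta> i * Q $$ (i, k) * adj_mat (E \<zeta>) $$ (k, j)) + \<zeta> * (\<Sum>k<N. u $ k * adj_derivative (E \<zeta>) Q $$ (k, j))"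
    if j: "j < N" for j
  proof -
    have "B.\<phi> \<zeta> j * dg \<zeta> = (\<Sum>i<N. if i = j then B.\<phi> \<zeta> i * dg \<zeta> else 0)" using j by simp
    also have "\<dots> = (\<Sum>i<N. B.\<phi> \<zeta> i * ((\<Sum>k<N. Q $$ (i, k) * adj_mat (E \<zeta>) $$ (k, j)) + (\<Sum>k<N. E \<zeta> $$ (i, k) * adj_derivative (E \<zeta>) Q $$ (k, j))))"
      by (intro sum.cong refl) (simp add: adj_derivative_product_rule[OF E_carrier QP2Lam_carrier _ j] dg_def)
    also have "\<dots> = (\<Sum>i<N. \<Sum>k<N. B.\<phi> \<zeta> i * Q $$ (i, k) * adj_mat (E \<zeta>) $$ (k, j)) + (\<Sum>i<N. \<Sum>k<N. B.\<phi> \<zeta> i * E \<zeta> $$ (i, k) * adj_derivative (E \<zeta>) Q $$ (k, j))"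
      by (simp only: distrib_left sum.distrib sum_distrib_left mult.assoc)
    also have "(\<Sum>i<N. \<Sum>k<N. B.\<phi> \<zeta> i * E \<zeta> $$ (i, k) * adj_derivative (E \<zeta>) Q $$ (k, j)) = (\<Sum>k<N. (\<Sum>i<N. B.\<phi> \<zeta> i * E \<zeta> $$ (i, k)) * adj_derivative (E \<zeta>) Q $$ (k, j))"
      by (subst sum.swap) (simp only: sum_distrib_right)
    also have "\<dots> = (\<Sum>k<N. \<zeta> * u $ k * adj_derivative (E \<zeta>) Q $$ (k, j))"
      by (intro sum.cong refl) (simp add: base_balance[OF \<zeta>])
    finally show ?thesis by (simp only: sum_distrib_left mult.assoc)
  qed
  then have "dg \<zeta> * w \<zeta> = (\<Sum>j<N. ((\<Sum>i<N. \<Sum>k<N. B.\<phi> \<zeta> i * Q $$ (i, k) * adj_mat (E \<zeta>) $$ (k, j)) + \<zeta> * (\<Sum>k<N. u $ k * adj_derivative (E \<zeta>) Q $$ (k, j))) * om j)"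
    unfolding w_def sum_distrib_left by (intro sum.cong refl) (simp add: mult.assoc[symmetric] mult.commute[of "dg \<zeta>"])
  also have "\<dots> = (\<Sum>j<N. \<Sum>i<N. \<Sum>k<N. B.\<phi> \<zeta> i * Q $$ (i, k) * adj_mat (E \<zeta>) $$ (k, j) * om j) + \<zeta> * (\<Sum>j<N. \<Sum>k<N. u $ k * adj_derivative (E \<zeta>) Q $$ (k, j) * om j)"
    by (simp only: distrib_right sum.distrib sum_distrib_left sum_distrib_right mult.assoc)
  also have "(\<Sum>j<N. \<Sum>k<N. u $ k * adj_derivative (E \<zeta>) Q $$ (k, j) * om j) = UB \<zeta>"
    unfolding UB_def by (rule sum.swap)
  also have "(\<Sum>j<N. \<Sum>i<N. \<Sum>k<N. B.\<phi> \<zeta> i * Q $$ (i, k) * adj_mat (E \<zeta>) $$ (k, j) * om j) = QA \<zeta>"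
    unfolding QA_def by (rule trans[OF sum.swap], rule sum.cong[OF refl], rule sum.swap)
  finally show ?thesis by simp
qed

lemma w_cramer:
  assumes \<zeta>: "0 \<le> Re \<zeta>"
  shows "det (E \<zeta>) * w \<zeta> = \<zeta> * UA \<zeta>"
proof -
  have "det (E \<zeta>) * w \<zeta> = (\<Sum>j<N. det (E \<zeta>) * B.\<phi> \<zeta> j * om j)"
    by (simp only: w_def sum_distrib_left mult.assoc)
  also have "\<dots> = (\<Sum>j<N. \<zeta> * (\<Sum>k<N. u $ k * adj_mat (E \<zeta>) $$ (k, j)) * om j)"
    by (intro sum.cong refl) (simp only: PB.cramer0[OF \<zeta>] lessThan_iff)
  also have "\<dots> = \<zeta> * (\<Sum>j<N. \<Sum>k<N. u $ k * adj_mat (E \<zeta>) $$ (k, j) * om j)"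
    by (simp only: sum_distrib_left sum_distrib_right mult.assoc)
  also have "(\<Sum>j<N. \<Sum>k<N. u $ k * adj_mat (E \<zeta>) $$ (k, j) * om j) = UA \<zeta>"
    unfolding UA_def by (rule sum.swap)
  finally show ?thesis .
qed

lemma \<psi>_eq:
  assumes \<zeta>: "0 \<le> Re \<zeta>"
  shows "\<psi> \<zeta> = \<zeta> * (ZA \<zeta> + D \<zeta> * (\<zeta> * UB \<zeta>) - D \<zeta> * w \<zeta> * dg \<zeta>) / det (E \<zeta>)"
proof -
  have "\<psi> \<zeta> = (\<zeta> * (\<Sum>j<N. \<Sum>i<N. z $ i * adj_mat (E \<zeta>) $$ (i, j) * om j)
      - (\<Sum>j<N. \<Sum>i<N. \<Sum>k<N. B.\<phi> \<zeta> i * K \<zeta> $$ (i, k) * adj_mat (E \<zeta>) $$ (k, j) * om j)) / det (E \<zeta>)"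
    unfolding \<psi>_def PB.\<Psi>_def
    by (simp only: sum_distrib_left sum_distrib_right sum_divide_distrib[symmetric] sum_subtractf[symmetric]
        left_diff_distrib mult.assoc times_divide_eq_left)
  also have "(\<Sum>j<N. \<Sum>i<N. z $ i * adj_mat (E \<zeta>) $$ (i, j) * om j) = ZA \<zeta>"
    unfolding ZA_def by (rule sum.swap)
  also have "(\<Sum>j<N. \<Sum>i<N. \<Sum>k<N. B.\<phi> \<zeta> i * K \<zeta> $$ (i, k) * adj_mat (E \<zeta>) $$ (k, j) * om j) = \<zeta> * D \<zeta> * QA \<zeta>"
  proof -
    have "(\<Sum>j<N. \<Sum>i<N. \<Sum>k<N. B.\<phi> \<zeta> i * K \<zeta> $$ (i, k) * adj_mat (E \<zeta>) $$ (k, j) * om j) =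
       (\<Sum>j<N. \<Sum>i<N. \<Sum>k<N. \<zeta> * D \<zeta> * (B.\<phi> \<zeta> i * Q $$ (i, k) * adj_mat (E \<zeta>) $$ (k, j) * om j))"
      by (intro sum.cong refl) (simp add: K_entry)
    also have "\<dots> = \<zeta> * D \<zeta> * (\<Sum>j<N. \<Sum>i<N. \<Sum>k<N. B.\<phi> \<zeta> i * Q $$ (i, k) * adj_mat (E \<zeta>) $$ (k, j) * om j)"
      by (simp only: sum_distrib_left)
    also have "(\<Sum>j<N. \<Sum>i<N. \<Sum>k<N. B.\<phi> \<zeta> i * Q $$ (i, k) * adj_mat (E \<zeta>) $$ (k, j) * om j) = QA \<zeta>"
      unfolding QA_def by (rule trans[OF sum.swap], rule sum.cong[OF refl], rule sum.swap)
    finally show ?thesis .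
  qed
  also have "QA \<zeta> = dg \<zeta> * w \<zeta> - \<zeta> * UB \<zeta>" using QA_eq[OF \<zeta>] by (simp add: algebra_simps)
  finally show ?thesis by (simp add: algebra_simps)
qed

text \<open>At \<open>0\<close> every column of \<open>adj E\<close> lies in the kernel of \<open>(P - I) \<Lambda>\<close>, which is spanned by
  \<open>\<Lambda>\<^sup>-\<^sup>1 e\<close>; hence only the normalizations of \<open>z\<close> and of the perturbation enter, and they cancel.\<close>

lemma first_order_zero: "ZA 0 - D 0 * w 0 * dg 0 = 0"
proof -
  have pos: "0 < N" by simp
  have lst0: "poly q 0 / poly pp 0 = 1"
    using lst_Fp[of 0] lst_expand(1)[of 0] by simp
  have col: "complex_of_real (lam k) * adj_mat (E 0) $$ (k, j) = complex_of_real (lam 0) * adj_mat (E 0) $$ (0, j)"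
    if kj: "k < N" "j < N" for k j
  proof (rule harmonic_const_complex[OF _ kj(1) pos])
    fix i assume i: "i < N"
    have "0 = (\<Sum>k<N. E 0 $$ (i, k) * adj_mat (E 0) $$ (k, j))"
      using mat_times_adj_entry(1)[OF E_carrier i kj(2), of 0] det_root[of 0] pos s_zero by simp
    also have "\<dots> = (\<Sum>k<N. complex_of_real (p i k) * (complex_of_real (lam k) * adj_mat (E 0) $$ (k, j))
        - (if i = k then complex_of_real (lam i) * adj_mat (E 0) $$ (i, j) else 0))"
    proof (intro sum.cong refl)
      fix k assume "k \<in> {..<N}"
      then have k: "k < N" by simp
      have qs: "(complex_of_real (q1 i k) + complex_of_real (q2 i k)) * complex_of_real (p i k) = complex_of_real (p i k)"
        using arg_cong[OF q_sum[OF i k], of complex_of_real] by simp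
      have e: "E 0 $$ (i, k) = (complex_of_real (q1 i k) + complex_of_real (q2 i k)) * complex_of_real (p i k) * complex_of_real (lam k)
           - (if i = k then complex_of_real (lam i) else 0)"
        unfolding E_entry[OF i k] lst0 by simp
      show "E 0 $$ (i, k) * adj_mat (E 0) $$ (k, j) = complex_of_real (p i k) * (complex_of_real (lam k) * adj_mat (E 0) $$ (k, j))
        - (if i = k then complex_of_real (lam i) * adj_mat (E 0) $$ (i, j) else 0)"
        unfolding e qs by (cases "i = k") (simp_all add: algebra_simps)
    qed
    also have "\<dots> = (\<Sum>k<N. complex_of_real (p i k) * (complex_of_real (lam k) * adj_mat (E 0) $$ (k, j))) - complex_of_real (lam i) * adj_mat (E 0) $$ (i, j)"
      using i by (simp add: sum_subtractf)
    finally show "(\<Sum>k<N. complex_of_real (p i k) * (complex_of_real (lam k) * adj_mat (E 0) $$ (k, j))) = complex_of_real (lam i) * adj_mat (E 0) $$ (i, j)"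
      by simp
  qed
  define b where "b = (\<Sum>j<N. complex_of_real (lam 0) * adj_mat (E 0) $$ (0, j) * om j)"
  have row: "(\<Sum>j<N. adj_mat (E 0) $$ (k, j) * om j) = complex_of_real (1 / lam k) * b" if k: "k < N" for k
  proof -
    have "complex_of_real (lam k) * (\<Sum>j<N. adj_mat (E 0) $$ (k, j) * om j) = b"
      unfolding b_def sum_distrib_left by (intro sum.cong refl) (simp add: col[OF k] mult.assoc[symmetric])
    moreover have "complex_of_real (lam k) \<noteq> 0" using rate_pos[OF k] by simp
    ultimately show ?thesis by (simp add: field_simps)
  qed
  have "ZA 0 = (\<Sum>i<N. z $ i * (\<Sum>j<N. adj_mat (E 0) $$ (i, j) * om j))"
    unfolding ZA_def by (simp only: sum_distrib_left mult.assoc)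
  also have "\<dots> = (\<Sum>i<N. z $ i * complex_of_real (1 / lam i)) * b"
    unfolding sum_distrib_right by (intro sum.cong refl) (simp add: row)
  also have "\<dots> = c1 * b" by (simp only: z_zero)
  finally have za: "ZA 0 = c1 * b" .
  have "QA 0 = (\<Sum>i<N. \<Sum>k<N. B.\<phi> 0 i * Q $$ (i, k) * (\<Sum>j<N. adj_mat (E 0) $$ (k, j) * om j))"
    unfolding QA_def by (simp only: sum_distrib_left mult.assoc)
  also have "\<dots> = (\<Sum>i<N. \<Sum>k<N. complex_of_real (\<pi> $ i * (q2 i k * p i k)) * b)"
  proof (intro sum.cong refl)
    fix i k assume "i \<in> {..<N}" "k \<in> {..<N}"
    then have ik: "i < N" "k < N" by auto
    have "complex_of_real (lam k) * complex_of_real (1 / lam k) = 1" using rate_pos[OF ik(2)] by simp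
    then have "complex_of_real (lam k) * (complex_of_real (1 / lam k) * b) = b" by (simp only: mult.assoc[symmetric] mult_1_left)
    then show "B.\<phi> 0 i * Q $$ (i, k) * (\<Sum>j<N. adj_mat (E 0) $$ (k, j) * om j) = complex_of_real (\<pi> $ i * (q2 i k * p i k)) * b"
      unfolding row[OF ik(2)] B.\<phi>_zero_pi[OF ik(1)] QP2Lam_entry[OF ik] of_real_mult by (simp only: mult.assoc)
  qed
  also have "\<dots> = complex_of_real (\<Sum>i<N. \<pi> $ i * (\<Sum>j<N. q2 i j * p i j)) * b"
    by (simp only: of_real_sum of_real_mult sum_distrib_left sum_distrib_right mult.assoc)
  finally have qa: "QA 0 = complex_of_real (\<Sum>i<N. \<pi> $ i * (\<Sum>j<N. q2 i j * p i j)) * b" .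
  have d0: "D 0 = complex_of_real (mean Fp - mean Fh)"
    by (simp add: excess_diff_def lst_excess_zero Fp_e Fh_e)
  have "D 0 * QA 0 = ZA 0"
    unfolding za qa d0 c1_def of_real_mult by (simp only: mult.assoc)
  moreover have "QA 0 = dg 0 * w 0" using QA_eq[of 0] by simp
  ultimately show ?thesis by (simp add: algebra_simps)
qed

lemma scalar_adj:
  assumes "v \<in> carrier_vec N" "X \<in> carrier_mat N N"
  shows "v \<bullet> (X *\<^sub>v omega D1 D2 \<pi>) = (\<Sum>i<N. \<Sum>j<N. v $ i * X $$ (i, j) * om j)"
  using assms omega_carrier
  by (simp add: scalar_prod_def lessThan_atLeast0 om_def sum_distrib_left mult.assoc)

lemma E_mat2_deriv:
  assumes "i < N" "j < N"
  shows "((\<lambda>g. E_mat2 D1 D2 \<zeta> g $$ (i, j)) has_field_derivative Q $$ (i, j)) (at g0)"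
  unfolding E_mat2_entry[OF assms] QP2Lam_entry[OF assms] by (auto intro!: derivative_eq_intros)

lemma X_identities:
  "z \<bullet> (adj_mat (E \<zeta>) *\<^sub>v omega D1 D2 \<pi>) = ZA \<zeta>"
  "u \<bullet> (adj_mat (E \<zeta>) *\<^sub>v omega D1 D2 \<pi>) = UA \<zeta>"
  "deriv (\<lambda>g. u \<bullet> (adj_mat (E_mat2 D1 D2 \<zeta> g) *\<^sub>v omega D1 D2 \<pi>)) (poly q \<zeta> / poly pp \<zeta>) = UB \<zeta>"
  "deriv (\<lambda>g. det (E_mat2 D1 D2 \<zeta> g)) (poly q \<zeta> / poly pp \<zeta>) = dg \<zeta>"
proof -
  show "z \<bullet> (adj_mat (E \<zeta>) *\<^sub>v omega D1 D2 \<pi>) = ZA \<zeta>"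
    unfolding ZA_def by (rule scalar_adj[OF z_carrier adj_mat(1)[OF E_carrier]])
  show "u \<bullet> (adj_mat (E \<zeta>) *\<^sub>v omega D1 D2 \<pi>) = UA \<zeta>"
    unfolding UA_def by (rule scalar_adj[OF u_carrier adj_mat(1)[OF E_carrier]])
  show "deriv (\<lambda>g. u \<bullet> (adj_mat (E_mat2 D1 D2 \<zeta> g) *\<^sub>v omega D1 D2 \<pi>)) (poly q \<zeta> / poly pp \<zeta>) = UB \<zeta>"
    unfolding scalar_adj[OF u_carrier adj_mat(1)[OF E_mat2_carrier]] UB_def E_mat_def
    by (intro DERIV_imp_deriv DERIV_sum DERIV_cmult DERIV_cmult_right
        adj_mat_has_field_derivative[OF E_mat2_carrier QP2Lam_carrier E_mat2_deriv]) auto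
  show "deriv (\<lambda>g. det (E_mat2 D1 D2 \<zeta> g)) (poly q \<zeta> / poly pp \<zeta>) = dg \<zeta>"
    unfolding dg_def E_mat_def
    by (intro DERIV_imp_deriv det_has_field_derivative[OF E_mat2_carrier QP2Lam_carrier E_mat2_deriv])
qed

lemma wmix_expansion:
  assumes \<zeta>: "0 \<le> Re \<zeta>" and nz: "det (E \<zeta>) \<noteq> 0"
  shows "(\<lambda>\<epsilon>. wmix \<epsilon> \<zeta> - w \<zeta> - complex_of_real \<epsilon> * \<psi> \<zeta>) \<in> O[at_right 0](\<lambda>\<epsilon>. complex_of_real \<epsilon> ^ 2)"
proof -
  have "(\<lambda>\<epsilon>. \<Sum>j<N. (fe \<epsilon> \<zeta> j - B.\<phi> \<zeta> j - complex_of_real \<epsilon> * PB.\<Psi> \<zeta> j) * om j) \<in> O[at_right 0](\<lambda>\<epsilon>. complex_of_real \<epsilon> ^ 2 * 1)"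
    by (intro big_sum_in_bigo landau_o.big.mult PB.expansion_pointwise \<zeta> nz) simp_all
  moreover have "(\<Sum>j<N. (fe \<epsilon> \<zeta> j - B.\<phi> \<zeta> j - complex_of_real \<epsilon> * PB.\<Psi> \<zeta> j) * om j) = wmix \<epsilon> \<zeta> - w \<zeta> - complex_of_real \<epsilon> * \<psi> \<zeta>" for \<epsilon>
    unfolding wmix_def w_def \<psi>_def by (simp add: left_diff_distrib sum_subtractf sum_distrib_left mult.assoc)
  ultimately show ?thesis by (simp only: mult_1_right)
qed

lemma wmix_expansion_root:
  assumes "k \<in> {1..<N}" "\<theta> holomorphic_on {\<zeta>. 0 < Re \<zeta>}"
    and "\<And>\<zeta>. 0 < Re \<zeta> \<Longrightarrow> det (E \<zeta>) \<noteq> 0 \<Longrightarrow> \<theta> \<zeta> = \<psi> \<zeta>"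
  shows "(\<lambda>\<epsilon>. wmix \<epsilon> (complex_of_real (s k)) - w (complex_of_real (s k)) - complex_of_real \<epsilon> * \<theta> (complex_of_real (s k))) \<in> O[at_right 0](\<lambda>\<epsilon>. complex_of_real \<epsilon> ^ 2)"
  unfolding wmix_def w_def by (rule PB.expansion_at_root[OF assms(1,2)]) (simp add: assms(3) \<psi>_def)

text \<open>Both are \<open>\<pi> \<omega>\<close>.\<close>

lemma wmix_zero: "\<forall>\<^sub>F \<epsilon> in at_right 0. wmix \<epsilon> 0 = w 0"
  using eventually_stable
proof eventually_elim
  case (elim \<epsilon>)
  then interpret S: steady N D1 D2 \<pi> "mixture \<epsilon> Fp Fh" "\<nu>mix \<epsilon>" by (intro steady_mix) auto
  have "fe \<epsilon> 0 j = S.\<phi> 0 j" for j by (simp only: fe_def S.\<phi>_def)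
  then show ?case unfolding wmix_def w_def by (intro sum.cong refl) (simp add: S.\<phi>_zero_pi B.\<phi>_zero_pi)
qed

lemma \<psi>_bounded:
  assumes k: "k \<in> {1..<N}"
  shows "\<exists>C. \<forall>\<^sub>F \<zeta> in at (complex_of_real (s k)). norm (\<psi> \<zeta>) \<le> C"
proof -
  obtain C where C: "\<And>j. j < N \<Longrightarrow> \<forall>\<^sub>F \<zeta> in at (complex_of_real (s k)). norm (PB.\<Psi> \<zeta> j) \<le> C j"
    using PB.\<Psi>_bounded_near_root[OF k] by metis
  have "\<forall>\<^sub>F \<zeta> in at (complex_of_real (s k)). \<forall>j\<in>{..<N}. norm (PB.\<Psi> \<zeta> j) \<le> C j"
    by (rule eventually_ball_finite) (use C in auto)
  then have "\<forall>\<^sub>F \<zeta> in at (complex_of_real (s k)). norm (\<psi> \<zeta>) \<le> (\<Sum>j<N. C j * norm (om j))"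
  proof eventually_elim
    case (elim \<zeta>)
    have "norm (\<psi> \<zeta>) \<le> (\<Sum>j<N. norm (PB.\<Psi> \<zeta> j * om j))" unfolding \<psi>_def by (rule norm_sum)
    also have "\<dots> \<le> (\<Sum>j<N. C j * norm (om j))"
      using elim by (intro sum_mono) (auto simp: norm_mult intro!: mult_right_mono)
    finally show ?case .
  qed
  then show ?thesis ..
qed

lemma w_continuous: "continuous_on {\<zeta>. 0 \<le> Re \<zeta>} w"
  unfolding w_def B.\<phi>_def by (intro continuous_on_sum continuous_on_mult continuous_on_const B.L.laplace_continuous)

end

section \<open>Partial fractions\<close>

definition partial_fractions ::
    "nat \<Rightarrow> (nat \<Rightarrow> real) \<Rightarrow> nat \<Rightarrow> (nat \<Rightarrow> real) \<Rightarrow> (nat \<Rightarrow> nat) \<Rightarrow> complex \<Rightarrow> (nat \<Rightarrow> complex) \<Rightarrow> (nat \<Rightarrow> nat \<Rightarrow> complex) \<Rightarrow> complex \<Rightarrow> complex"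
  where
  "partial_fractions n s \<sigma> y mu c a b \<zeta> = c + (\<Sum>k=1..<n. a k / (\<zeta> - complex_of_real (s k))) +
     (\<Sum>j=1..\<sigma>. \<Sum>l=1..mu j.
        b j l * complex_of_real (y j) ^ (mu j - l + 1) / (\<zeta> + complex_of_real (y j)) ^ (mu j - l + 1))"

lemma partial_fractions_residue:
  fixes s y :: "nat \<Rightarrow> real" and mu :: "nat \<Rightarrow> nat" and a :: "nat \<Rightarrow> complex" and b :: "nat \<Rightarrow> nat \<Rightarrow> complex" and c :: complex
  assumes k: "k \<in> {1..<n}" and inj: "inj_on s {1..<n}" and y: "\<And>j. j \<in> {1..\<sigma>} \<Longrightarrow> 0 < y j" and s: "0 < s k"
  shows "((\<lambda>\<zeta>. (\<zeta> - complex_of_real (s k)) * partial_fractions n s \<sigma> y mu c a b \<zeta>) \<longlongrightarrow> a k) (at (complex_of_real (s k)))"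
proof -
  let ?s = "complex_of_real (s k)"
  let ?r = "\<lambda>\<zeta>. c + (\<Sum>i\<in>{1..<n} - {k}. a i / (\<zeta> - complex_of_real (s i))) +
     (\<Sum>j=1..\<sigma>. \<Sum>l=1..mu j.
        b j l * complex_of_real (y j) ^ (mu j - l + 1) / (\<zeta> + complex_of_real (y j)) ^ (mu j - l + 1))"
  have nz: "?s - complex_of_real (s i) \<noteq> 0" if "i \<in> {1..<n} - {k}" for i
    using that inj k by (auto simp: inj_on_def)
  have nz': "(?s + complex_of_real (y j)) ^ d \<noteq> 0" if "j \<in> {1..\<sigma>}" for j d
  proof -
    have "?s + complex_of_real (y j) = complex_of_real (s k + y j)" by simp
    moreover have "s k + y j \<noteq> 0" using y[OF that] s by simp
    ultimately show ?thesis by (simp only: power_eq_0_iff of_real_eq_0_iff simp_thms)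
  qed
  have "(?r \<longlongrightarrow> ?r ?s) (at ?s)"
    by (intro tendsto_add tendsto_const tendsto_sum tendsto_divide tendsto_diff tendsto_ident_at tendsto_power nz nz')
  from tendsto_add[OF tendsto_const[of "a k"] tendsto_mult[OF tendsto_diff[OF tendsto_ident_at tendsto_const[of ?s]] this]]
  have lim: "((\<lambda>\<zeta>. a k + (\<zeta> - ?s) * ?r \<zeta>) \<longlongrightarrow> a k) (at ?s)"
    unfolding diff_self mult_zero_left add_0_right .
  have "\<forall>\<^sub>F \<zeta> in at ?s. a k + (\<zeta> - ?s) * ?r \<zeta> = (\<zeta> - ?s) * partial_fractions n s \<sigma> y mu c a b \<zeta>"
    unfolding eventually_at_filter
  proof (rule always_eventually, intro allI impI)
    fix \<zeta> assume "\<zeta> \<noteq> ?s"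
    then have "(\<zeta> - ?s) * (a k / (\<zeta> - ?s)) = a k" by simp
    moreover have "(\<Sum>i=1..<n. a i / (\<zeta> - complex_of_real (s i))) = a k / (\<zeta> - ?s) + (\<Sum>i\<in>{1..<n} - {k}. a i / (\<zeta> - complex_of_real (s i)))"
      using k by (intro sum.remove) auto
    ultimately show "a k + (\<zeta> - ?s) * ?r \<zeta> = (\<zeta> - ?s) * partial_fractions n s \<sigma> y mu c a b \<zeta>"
      unfolding partial_fractions_def by (simp only: distrib_left add.assoc add.left_commute)
  qed
  then show ?thesis by (rule Lim_transform_eventually[OF lim])
qed

text \<open>\<open>A\<close>, \<open>B\<close>, \<open>C\<close> are transforms at \<open>\<zeta>\<close> and \<open>A'\<close>, \<open>B'\<close>, \<open>C'\<close> their values at \<open>s\<close>. The values at \<open>s\<close> enter the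
  overshoot transforms only in the combination that the residue condition annihilates.\<close>

lemma overshoot_partial_fraction:
  fixes s \<zeta> :: complex
  assumes s: "s \<noteq> 0" and ne: "\<zeta> \<noteq> s"
    and O: "(\<zeta> - s) * O1 = \<zeta> * (A - A')" "(\<zeta> - s) * O2 = \<zeta> * (B - B')" "(\<zeta> - s) * O3 = \<zeta> * (C - C')"
    and R: "\<alpha> * A' + \<beta> * B' - \<gamma> * C' = 0"
  shows "1 / s * (\<gamma> * O3 - \<beta> * O2 - \<alpha> * O1) = - (\<alpha> / (\<zeta> - s) * A + \<beta> / (\<zeta> - s) * B - \<gamma> / (\<zeta> - s) * C)
      - (\<alpha> / s * A + \<beta> / s * B - \<gamma> / s * C)"
proof -
  have d: "\<zeta> - s \<noteq> 0" using ne by simp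
  have "(\<zeta> - s) * (\<gamma> * O3 - \<beta> * O2 - \<alpha> * O1) = \<gamma> * ((\<zeta> - s) * O3) - \<beta> * ((\<zeta> - s) * O2) - \<alpha> * ((\<zeta> - s) * O1)"
    by (simp add: algebra_simps)
  also have "\<dots> = - \<zeta> * (\<alpha> * A + \<beta> * B - \<gamma> * C) + \<zeta> * (\<alpha> * A' + \<beta> * B' - \<gamma> * C')"
    unfolding O by (simp add: algebra_simps)
  finally have e: "(\<zeta> - s) * (\<gamma> * O3 - \<beta> * O2 - \<alpha> * O1) = - \<zeta> * (\<alpha> * A + \<beta> * B - \<gamma> * C)"
    unfolding R by simp
  have v: "\<gamma> * O3 - \<beta> * O2 - \<alpha> * O1 = - \<zeta> * (\<alpha> * A + \<beta> * B - \<gamma> * C) / (\<zeta> - s)"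
    unfolding nonzero_eq_divide_eq[OF d] e[symmetric] by (rule mult.commute)
  have g: "1 / s * (- \<zeta> * Y / (\<zeta> - s)) = - Y * (1 / (\<zeta> - s) + 1 / s)" for Y
    using s d by (simp add: field_simps)
  show ?thesis unfolding v g by (simp add: algebra_simps)
qed

text \<open>The left-hand side is the summandwise transform of \<open>\<Theta>\<^sub>1 + \<Theta>\<^sub>2\<close>; the terms with \<open>1 / s\<^sub>k\<close> in its first
  part compensate the ones that the overshoots produce besides \<open>1 / (\<zeta> - s\<^sub>k)\<close>.\<close>

lemma tail_transform_eq:
  fixes s y :: "nat \<Rightarrow> real" and mu :: "nat \<Rightarrow> nat" and \<alpha> \<beta> \<gamma> O1 O2 O3 A' B' C' :: "nat \<Rightarrow> complex"
    and \<alpha>2 \<beta>2 \<gamma>2 e :: "nat \<Rightarrow> nat \<Rightarrow> complex" and A D \<zeta> a0 \<beta>0 \<gamma>0 :: complex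
  assumes s: "\<And>k. k \<in> {1..<n} \<Longrightarrow> 0 < s k" and ne: "\<And>k. k \<in> {1..<n} \<Longrightarrow> \<zeta> \<noteq> complex_of_real (s k)"
    and O: "\<And>k. k \<in> {1..<n} \<Longrightarrow> (\<zeta> - complex_of_real (s k)) * O1 k = \<zeta> * (A - A' k)"
      "\<And>k. k \<in> {1..<n} \<Longrightarrow> (\<zeta> - complex_of_real (s k)) * O2 k = \<zeta> * (D * A - B' k)"
      "\<And>k. k \<in> {1..<n} \<Longrightarrow> (\<zeta> - complex_of_real (s k)) * O3 k = \<zeta> * (D * A * A - C' k)"
    and R: "\<And>k. k \<in> {1..<n} \<Longrightarrow> \<alpha> k * A' k + \<beta> k * B' k - \<gamma> k * C' k = 0"
    and e: "\<And>j l. e j l = complex_of_real (y j) ^ (mu j - l + 1) / (\<zeta> + complex_of_real (y j)) ^ (mu j - l + 1)"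
  shows "((a0 - (\<Sum>k=1..<n. \<alpha> k / complex_of_real (s k))) * A + (\<beta>0 - (\<Sum>k=1..<n. \<beta> k / complex_of_real (s k))) * (D * A)
      - (\<gamma>0 - (\<Sum>k=1..<n. \<gamma> k / complex_of_real (s k))) * (D * A * A)
      - (\<Sum>j=1..\<sigma>. \<Sum>l=1..mu j. \<gamma>2 j l * (D * A * A * e j l) - \<beta>2 j l * (D * A * e j l) - \<alpha>2 j l * (A * e j l)))
    + - (\<Sum>k=1..<n. 1 / complex_of_real (s k) * (\<gamma> k * O3 k - \<beta> k * O2 k - \<alpha> k * O1 k))
    = A * (partial_fractions n s \<sigma> y mu a0 \<alpha> \<alpha>2 \<zeta> + D * partial_fractions n s \<sigma> y mu \<beta>0 \<beta> \<beta>2 \<zeta>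
        - D * A * partial_fractions n s \<sigma> y mu \<gamma>0 \<gamma> \<gamma>2 \<zeta>)"
proof -
  have k: "1 / complex_of_real (s k) * (\<gamma> k * O3 k - \<beta> k * O2 k - \<alpha> k * O1 k) =
      - (\<alpha> k / (\<zeta> - complex_of_real (s k)) * A + \<beta> k / (\<zeta> - complex_of_real (s k)) * (D * A) - \<gamma> k / (\<zeta> - complex_of_real (s k)) * (D * A * A))
      - (\<alpha> k / complex_of_real (s k) * A + \<beta> k / complex_of_real (s k) * (D * A) - \<gamma> k / complex_of_real (s k) * (D * A * A))"
    if "k \<in> {1..<n}" for k
    using overshoot_partial_fraction[OF _ ne[OF that] O[OF that] R[OF that]] s[OF that] by simp
  have neg: "- (- (a + b - c) - (d + e - f)) = a + b - c + d + e - f" for a b c d e f :: complex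
    by (simp add: algebra_simps)
  have K: "- (\<Sum>k=1..<n. 1 / complex_of_real (s k) * (\<gamma> k * O3 k - \<beta> k * O2 k - \<alpha> k * O1 k)) =
      (\<Sum>k=1..<n. \<alpha> k / (\<zeta> - complex_of_real (s k))) * A + (\<Sum>k=1..<n. \<beta> k / (\<zeta> - complex_of_real (s k))) * (D * A)
      - (\<Sum>k=1..<n. \<gamma> k / (\<zeta> - complex_of_real (s k))) * (D * A * A)
      + (\<Sum>k=1..<n. \<alpha> k / complex_of_real (s k)) * A + (\<Sum>k=1..<n. \<beta> k / complex_of_real (s k)) * (D * A)
      - (\<Sum>k=1..<n. \<gamma> k / complex_of_real (s k)) * (D * A * A)"
    unfolding sum_distrib_right sum_negf[symmetric] sum.distrib[symmetric] sum_subtractf[symmetric]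
    by (intro sum.cong refl, subst k, assumption, rule neg)
  let ?f = "\<lambda>b :: nat \<Rightarrow> nat \<Rightarrow> complex. \<Sum>j=1..\<sigma>. \<Sum>l=1..mu j. b j l * e j l"
  have L: "(\<Sum>j=1..\<sigma>. \<Sum>l=1..mu j. \<gamma>2 j l * (D * A * A * e j l) - \<beta>2 j l * (D * A * e j l) - \<alpha>2 j l * (A * e j l))
      = ?f \<gamma>2 * (D * A * A) - ?f \<beta>2 * (D * A) - ?f \<alpha>2 * A"
    unfolding sum_distrib_right sum_subtractf[symmetric] by (intro sum.cong refl) (simp only: mult_ac)
  have P: "partial_fractions n s \<sigma> y mu c a b \<zeta> = c + (\<Sum>k=1..<n. a k / (\<zeta> - complex_of_real (s k))) + ?f b" for c a b
    by (simp add: partial_fractions_def e)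
  have alg: "(a0 - sa) * A + (b0 - sb) * (D * A) - (g0 - sg) * (D * A * A) - (G * (D * A * A) - B * (D * A) - F * A)
      + (pa * A + pb * (D * A) - pg * (D * A * A) + sa * A + sb * (D * A) - sg * (D * A * A))
    = A * (a0 + pa + F + D * (b0 + pb + B) - D * A * (g0 + pg + G))" for a0 b0 g0 sa sb sg pa pb pg F B G :: complex
    by (simp add: algebra_simps)
  show ?thesis unfolding K L P by (rule alg)
qed

section \<open>The first-order term as a signed measure\<close>

lemma isCont_right_half_plane:
  fixes f :: "complex \<Rightarrow> complex"
  assumes "continuous_on {\<zeta>. 0 \<le> Re \<zeta>} f" "0 < Re c"
  shows "isCont f c"
proof -
  have "continuous_on {\<zeta>. 0 < Re \<zeta>} f" by (rule continuous_on_subset[OF assms(1)]) auto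
  from continuous_on_eq_continuous_at[OF open_halfspace_Re_gt, THEN iffD1, OF this]
  show ?thesis by (rule bspec) (simp add: assms(2))
qed

context model begin

text \<open>\<open>\<theta>\<close> is a transform that has the form of the bracket off the roots, as soon as the residue condition at
  the roots holds. The residue condition follows from boundedness of \<open>\<psi>\<close>, and then \<open>\<theta>\<close> and \<open>\<psi>\<close> agree.\<close>

lemma first_order_tail:
  fixes r \<sigma> :: nat and y :: "nat \<Rightarrow> real" and mu :: "nat \<Rightarrow> nat" and uo a0 \<beta>0 \<gamma>0 :: complex
    and \<alpha> \<beta> \<gamma> :: "nat \<Rightarrow> complex" and \<alpha>2 \<beta>2 \<gamma>2 :: "nat \<Rightarrow> nat \<Rightarrow> complex" and \<Delta> \<theta> :: "complex \<Rightarrow> complex" and T :: "real \<Rightarrow> complex"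
  assumes w0: "w 0 = 1" and inj: "inj_on s {1..<N}" and y: "\<And>j. j \<in> {1..\<sigma>} \<Longrightarrow> 0 < y j"
    and \<Delta>: "\<And>\<zeta>. \<Delta> \<zeta> = (\<Prod>k=1..<N. \<zeta> - complex_of_real (s k)) * (\<Prod>j=1..\<sigma>. (\<zeta> + complex_of_real (y j)) ^ mu j)"
    and factor: "\<And>\<zeta>. poly pp \<zeta> \<noteq> 0 \<Longrightarrow> poly pp \<zeta> ^ r * (\<zeta> * UA \<zeta>) = uo * \<zeta> * \<Delta> \<zeta>"
    and pfA: "\<And>\<zeta>. poly pp \<zeta> \<noteq> 0 \<Longrightarrow> \<Delta> \<zeta> \<noteq> 0 \<Longrightarrow> poly pp \<zeta> ^ r * ZA \<zeta> / \<Delta> \<zeta> = partial_fractions N s \<sigma> y mu a0 \<alpha> \<alpha>2 \<zeta>"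
    and pfB: "\<And>\<zeta>. poly pp \<zeta> \<noteq> 0 \<Longrightarrow> \<Delta> \<zeta> \<noteq> 0 \<Longrightarrow> \<zeta> * poly pp \<zeta> ^ r * UB \<zeta> / \<Delta> \<zeta> = partial_fractions N s \<sigma> y mu \<beta>0 \<beta> \<beta>2 \<zeta>"
    and pfC: "\<And>\<zeta>. poly pp \<zeta> \<noteq> 0 \<Longrightarrow> \<Delta> \<zeta> \<noteq> 0 \<Longrightarrow> poly pp \<zeta> ^ r * dg \<zeta> / \<Delta> \<zeta> = partial_fractions N s \<sigma> y mu \<gamma>0 \<gamma> \<gamma>2 \<zeta>"
    and tail: "complex_tail \<theta> T"
    and \<theta>: "\<And>\<zeta>. 0 \<le> Re \<zeta> \<Longrightarrow> (\<And>k. k \<in> {1..<N} \<Longrightarrow> \<zeta> \<noteq> complex_of_real (s k)) \<Longrightarrow>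
        (\<And>k. k \<in> {1..<N} \<Longrightarrow> \<alpha> k * w (complex_of_real (s k)) + \<beta> k * (D (complex_of_real (s k)) * w (complex_of_real (s k)))
            - \<gamma> k * (D (complex_of_real (s k)) * w (complex_of_real (s k)) * w (complex_of_real (s k))) = 0) \<Longrightarrow>
        \<theta> \<zeta> = w \<zeta> / uo * (partial_fractions N s \<sigma> y mu a0 \<alpha> \<alpha>2 \<zeta> + D \<zeta> * partial_fractions N s \<sigma> y mu \<beta>0 \<beta> \<beta>2 \<zeta>
          - D \<zeta> * w \<zeta> * partial_fractions N s \<sigma> y mu \<gamma>0 \<gamma> \<gamma>2 \<zeta>)"
  shows "\<And>\<zeta>. 0 \<le> Re \<zeta> \<Longrightarrow> (\<lambda>\<epsilon>. wmix \<epsilon> \<zeta> - w \<zeta> - complex_of_real \<epsilon> * \<theta> \<zeta>) \<in> O[at_right 0](\<lambda>\<epsilon>. complex_of_real \<epsilon> ^ 2)"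
    and "\<And>\<zeta>. 0 \<le> Re \<zeta> \<Longrightarrow> \<Delta> \<zeta> \<noteq> 0 \<Longrightarrow> \<theta> \<zeta> = w \<zeta> / uo * (poly pp \<zeta> ^ r * ZA \<zeta> / \<Delta> \<zeta> + D \<zeta> * (\<zeta> * poly pp \<zeta> ^ r * UB \<zeta> / \<Delta> \<zeta>)
          - D \<zeta> * w \<zeta> * (poly pp \<zeta> ^ r * dg \<zeta> / \<Delta> \<zeta>))"
    and "laplace_inversion_tail \<theta> T"
proof -
  define b where "b \<zeta> = w \<zeta> / uo * (poly pp \<zeta> ^ r * ZA \<zeta> / \<Delta> \<zeta> + D \<zeta> * (\<zeta> * poly pp \<zeta> ^ r * UB \<zeta> / \<Delta> \<zeta>)
          - D \<zeta> * w \<zeta> * (poly pp \<zeta> ^ r * dg \<zeta> / \<Delta> \<zeta>))" for \<zeta>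
  have \<Delta>_nz: "\<Delta> \<zeta> \<noteq> 0 \<longleftrightarrow> (\<forall>k\<in>{1..<N}. \<zeta> \<noteq> complex_of_real (s k))" if \<zeta>: "0 \<le> Re \<zeta>" for \<zeta>
  proof -
    have "\<zeta> + complex_of_real (y j) \<noteq> 0" if "j \<in> {1..\<sigma>}" for j
    proof
      assume "\<zeta> + complex_of_real (y j) = 0"
      from arg_cong[OF this, of Re] have "Re \<zeta> + y j = 0" by simp
      then show False using \<zeta> y[OF that] by simp
    qed
    then show ?thesis by (auto simp: \<Delta>)
  qed
  have det_nz: "det (E \<zeta>) \<noteq> 0" if "0 \<le> Re \<zeta>" "\<Delta> \<zeta> \<noteq> 0" "\<zeta> \<noteq> 0" for \<zeta>
  proof (rule det_nonzero[OF that(1)])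
    fix k assume k: "k < N"
    show "\<zeta> \<noteq> complex_of_real (s k)"
    proof (cases "k = 0")
      case True
      then show ?thesis using that(3) s_zero by simp
    next
      case False
      then have "k \<in> {1..<N}" using k by simp
      then show ?thesis using that(2) unfolding \<Delta>_nz[OF that(1)] by blast
    qed
  qed
  have \<Delta>_of_det: "\<Delta> \<zeta> \<noteq> 0" if "0 \<le> Re \<zeta>" "det (E \<zeta>) \<noteq> 0" for \<zeta>
    unfolding \<Delta>_nz[OF that(1)]
  proof
    fix k assume "k \<in> {1..<N}"
    then show "\<zeta> \<noteq> complex_of_real (s k)" using that(2) det_root[of k] by auto
  qed
  have uo: "uo \<noteq> 0"
  proof
    assume 0: "uo = 0"
    \<comment> \<open>Otherwise \<open>w\<close> would vanish off the roots, and by continuity also at \<open>0\<close>.\<close>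
    define e where "e n = complex_of_real (inverse (real (Suc n)))" for n
    have e0: "e \<longlonglongrightarrow> 0"
      unfolding e_def using tendsto_of_real[OF LIMSEQ_inverse_real_of_nat] unfolding of_real_0 .
    have eRe: "0 < Re (e n)" for n unfolding e_def Re_complex_of_real by simp
    have fin: "finite ((\<lambda>k. complex_of_real (s k)) ` {0..<N})" by simp
    have "eventually (\<lambda>v. v \<notin> (\<lambda>k. complex_of_real (s k)) ` {0..<N}) (at 0)"
      using fin by (rule islimpt_finite[unfolded islimpt_iff_eventually not_not])
    moreover have "filterlim e (at 0) sequentially"
    proof -
      have "e n \<noteq> 0" for n
        unfolding e_def of_real_eq_0_iff inverse_nonzero_iff_nonzero by simp
      then show ?thesis using e0 by (simp only: filterlim_at UNIV_I simp_thms eventually_True)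
    qed
    ultimately have ev: "eventually (\<lambda>n. e n \<notin> (\<lambda>k. complex_of_real (s k)) ` {0..<N}) sequentially"
      by (rule eventually_compose_filterlim)
    have z: "eventually (\<lambda>n. w (e n) = 0) sequentially"
      using ev
    proof eventually_elim
      case (elim n)
      have re: "0 \<le> Re (e n)" using eRe[of n] by simp
      have "det (E (e n)) \<noteq> 0" by (rule det_nonzero[OF re]) (use elim in auto)
      moreover have "e n * UA (e n) = 0"
        using factor[OF pp_nonzero[OF re]] pp_nonzero[OF re] unfolding 0 by auto
      ultimately show ?case using w_cramer[OF re] by auto
    qed
    have "(\<lambda>n. w (e n)) \<longlonglongrightarrow> w 0"
      by (rule continuous_on_tendsto_compose[OF w_continuous e0]) (use eRe in \<open>auto intro!: always_eventually less_imp_le\<close>)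
    moreover have "(\<lambda>n. w (e n)) \<longlonglongrightarrow> 0"
      using z by (rule tendsto_eventually)
    ultimately have "w 0 = 0" by (rule LIMSEQ_unique)
    then show False using w0 by simp
  qed
  have b\<psi>: "b \<zeta> = \<psi> \<zeta>" if \<zeta>: "0 \<le> Re \<zeta>" "det (E \<zeta>) \<noteq> 0" for \<zeta>
  proof -
    note nz = \<Delta>_of_det[OF \<zeta>] pp_nonzero[OF \<zeta>(1)] uo \<zeta>(2)
    have "w \<zeta> * poly pp \<zeta> ^ r * det (E \<zeta>) = poly pp \<zeta> ^ r * (det (E \<zeta>) * w \<zeta>)" by (simp only: ac_simps)
    also have "\<dots> = uo * \<zeta> * \<Delta> \<zeta>"
      unfolding w_cramer[OF \<zeta>(1)] by (rule factor[OF nz(2)])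
    finally have "w \<zeta> * poly pp \<zeta> ^ r / (uo * \<Delta> \<zeta>) = \<zeta> / det (E \<zeta>)"
      using nz by (simp add: field_simps)
    moreover have "b \<zeta> = w \<zeta> * poly pp \<zeta> ^ r / (uo * \<Delta> \<zeta>) * (ZA \<zeta> + D \<zeta> * (\<zeta> * UB \<zeta>) - D \<zeta> * w \<zeta> * dg \<zeta>)"
      unfolding b_def using nz by (simp add: field_simps)
    ultimately show ?thesis unfolding \<psi>_eq[OF \<zeta>(1)] by simp
  qed
  have b_pf: "b \<zeta> = w \<zeta> / uo * (partial_fractions N s \<sigma> y mu a0 \<alpha> \<alpha>2 \<zeta> + D \<zeta> * partial_fractions N s \<sigma> y mu \<beta>0 \<beta> \<beta>2 \<zeta>
          - D \<zeta> * w \<zeta> * partial_fractions N s \<sigma> y mu \<gamma>0 \<gamma> \<gamma>2 \<zeta>)" if "0 \<le> Re \<zeta>" "\<Delta> \<zeta> \<noteq> 0" for \<zeta>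
    unfolding b_def by (simp only: pfA[OF pp_nonzero[OF that(1)] that(2)] pfB[OF pp_nonzero[OF that(1)] that(2)] pfC[OF pp_nonzero[OF that(1)] that(2)])
  have residue: "\<alpha> k * w (complex_of_real (s k)) + \<beta> k * (D (complex_of_real (s k)) * w (complex_of_real (s k)))
            - \<gamma> k * (D (complex_of_real (s k)) * w (complex_of_real (s k)) * w (complex_of_real (s k))) = 0" if k: "k \<in> {1..<N}" for k
  proof -
    let ?s = "complex_of_real (s k)"
    have s: "0 < Re ?s" using s_pos[OF k] by simp
    have sk: "0 < s k" by (rule s_pos[OF k])
    note ev = eventually_det_nonzero[OF s]
    obtain C where C: "\<forall>\<^sub>F \<zeta> in at ?s. norm (\<psi> \<zeta>) \<le> C" using \<psi>_bounded[OF k] by blast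
    have wc: "(w \<longlongrightarrow> w ?s) (at ?s)" using isCont_right_half_plane[OF w_continuous s] by (simp only: isCont_def)
    have Dc: "(D \<longlongrightarrow> D ?s) (at ?s)" using isCont_right_half_plane[OF D_cont s] by (simp only: isCont_def)
    note res = partial_fractions_residue[OF k inj y sk]
    have l1: "((\<lambda>\<zeta>. w \<zeta> / uo * ((\<zeta> - ?s) * partial_fractions N s \<sigma> y mu a0 \<alpha> \<alpha>2 \<zeta> + D \<zeta> * ((\<zeta> - ?s) * partial_fractions N s \<sigma> y mu \<beta>0 \<beta> \<beta>2 \<zeta>)
          - D \<zeta> * w \<zeta> * ((\<zeta> - ?s) * partial_fractions N s \<sigma> y mu \<gamma>0 \<gamma> \<gamma>2 \<zeta>))) \<longlongrightarrow>
         w ?s / uo * (\<alpha> k + D ?s * \<beta> k - D ?s * w ?s * \<gamma> k)) (at ?s)"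
      by (intro tendsto_mult tendsto_diff tendsto_add tendsto_divide tendsto_const wc Dc res uo)
    have e: "\<forall>\<^sub>F \<zeta> in at ?s. w \<zeta> / uo * ((\<zeta> - ?s) * partial_fractions N s \<sigma> y mu a0 \<alpha> \<alpha>2 \<zeta> + D \<zeta> * ((\<zeta> - ?s) * partial_fractions N s \<sigma> y mu \<beta>0 \<beta> \<beta>2 \<zeta>)
          - D \<zeta> * w \<zeta> * ((\<zeta> - ?s) * partial_fractions N s \<sigma> y mu \<gamma>0 \<gamma> \<gamma>2 \<zeta>)) = (\<zeta> - ?s) * \<psi> \<zeta>"
      using ev
    proof eventually_elim
      case (elim \<zeta>)
      then have r: "0 \<le> Re \<zeta>" "det (E \<zeta>) \<noteq> 0" by auto
      show ?case unfolding b\<psi>[OF r, symmetric] b_pf[OF r(1) \<Delta>_of_det[OF r]] by (simp only: algebra_simps)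
    qed
    have l2: "((\<lambda>\<zeta>. (\<zeta> - ?s) * \<psi> \<zeta>) \<longlongrightarrow> 0) (at ?s)"
    proof (rule Lim_null_comparison)
      show "\<forall>\<^sub>F \<zeta> in at ?s. norm ((\<zeta> - ?s) * \<psi> \<zeta>) \<le> norm (\<zeta> - ?s) * C"
        using C by eventually_elim (simp add: norm_mult mult_left_mono)
      have "((\<lambda>\<zeta>. norm (\<zeta> - ?s) * C) \<longlongrightarrow> norm (?s - ?s) * C) (at ?s)"
        by (intro tendsto_mult tendsto_norm tendsto_diff tendsto_ident_at tendsto_const)
      then show "((\<lambda>\<zeta>. norm (\<zeta> - ?s) * C) \<longlongrightarrow> 0) (at ?s)" by simp
    qed
    have "w ?s / uo * (\<alpha> k + D ?s * \<beta> k - D ?s * w ?s * \<gamma> k) = 0"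
      by (rule tendsto_unique[OF _ Lim_transform_eventually[OF l1 e] l2]) simp
    then have "w ?s * (\<alpha> k + D ?s * \<beta> k - D ?s * w ?s * \<gamma> k) = 0" using uo by simp
    then show ?thesis by (simp add: algebra_simps)
  qed
  have \<theta>b: "\<theta> \<zeta> = b \<zeta>" if \<zeta>: "0 \<le> Re \<zeta>" "\<Delta> \<zeta> \<noteq> 0" for \<zeta>
    unfolding b_pf[OF \<zeta>] by (rule \<theta>[OF \<zeta>(1) _ residue]) (use \<zeta>(2) \<Delta>_nz[OF \<zeta>(1)] in auto)
  show "\<theta> \<zeta> = w \<zeta> / uo * (poly pp \<zeta> ^ r * ZA \<zeta> / \<Delta> \<zeta> + D \<zeta> * (\<zeta> * poly pp \<zeta> ^ r * UB \<zeta> / \<Delta> \<zeta>)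
          - D \<zeta> * w \<zeta> * (poly pp \<zeta> ^ r * dg \<zeta> / \<Delta> \<zeta>))" if \<zeta>: "0 \<le> Re \<zeta>" "\<Delta> \<zeta> \<noteq> 0" for \<zeta>
    using \<theta>b[OF \<zeta>] by (simp only: b_def)
  have \<theta>0: "\<theta> 0 = 0"
  proof -
    have "\<Delta> 0 \<noteq> 0" using \<Delta>_nz[of 0] s_pos by force
    then have "\<theta> 0 = b 0" by (intro \<theta>b) simp_all
    also have "b 0 = w 0 / uo * (poly pp 0 ^ r / \<Delta> 0) * (ZA 0 - D 0 * w 0 * dg 0)"
      unfolding b_def by (simp add: algebra_simps diff_divide_distrib)
    finally show ?thesis unfolding first_order_zero by simp
  qed
  have \<theta>\<psi>: "\<theta> \<zeta> = \<psi> \<zeta>" if "0 \<le> Re \<zeta>" "det (E \<zeta>) \<noteq> 0" for \<zeta>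
    using \<theta>b[OF that(1) \<Delta>_of_det[OF that]] b\<psi>[OF that] by (simp only:)
  show expansion: "(\<lambda>\<epsilon>. wmix \<epsilon> \<zeta> - w \<zeta> - complex_of_real \<epsilon> * \<theta> \<zeta>) \<in> O[at_right 0](\<lambda>\<epsilon>. complex_of_real \<epsilon> ^ 2)" if \<zeta>: "0 \<le> Re \<zeta>" for \<zeta>
  proof (cases "det (E \<zeta>) = 0")
    case False
    show ?thesis unfolding \<theta>\<psi>[OF \<zeta> False] by (rule wmix_expansion[OF \<zeta> False])
  next
    case True
    then obtain k where k: "k < N" "\<zeta> = complex_of_real (s k)" using det_nonzero[OF \<zeta>] by blast
    show ?thesis
    proof (cases "k = 0")
      case True
      then have "\<zeta> = 0" using k s_zero by simp
      moreover have "(\<lambda>\<epsilon>. wmix \<epsilon> 0 - w 0 - complex_of_real \<epsilon> * \<theta> 0) \<in> O[at_right 0](\<lambda>\<epsilon>. complex_of_real \<epsilon> ^ 2)"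
      proof (rule bigoI[of _ 1])
        show "\<forall>\<^sub>F \<epsilon> in at_right 0. norm (wmix \<epsilon> 0 - w 0 - complex_of_real \<epsilon> * \<theta> 0) \<le> 1 * norm (complex_of_real \<epsilon> ^ 2)"
          using wmix_zero by eventually_elim (simp add: \<theta>0)
      qed
      ultimately show ?thesis by (simp only:)
    next
      case False
      then have "k \<in> {1..<N}" using k by simp
      then show ?thesis unfolding k(2)
        by (rule wmix_expansion_root[OF _ complex_tail_holomorphic[OF tail]]) (simp add: \<theta>\<psi> less_imp_le)
    qed
  qed
  show "laplace_inversion_tail \<theta> T"
  proof (rule complex_tail_hermitian[OF tail])
    fix \<zeta> assume \<zeta>: "0 \<le> Re \<zeta>"
    have lim: "((\<lambda>\<epsilon>. (wmix \<epsilon> \<xi> - w \<xi>) / complex_of_real \<epsilon>) \<longlongrightarrow> \<theta> \<xi>) (at_right 0)" if "0 \<le> Re \<xi>" for \<xi>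
      by (rule bigo_square_tendsto[OF expansion[OF that]])
    have "((\<lambda>\<epsilon>. cnj ((wmix \<epsilon> \<zeta> - w \<zeta>) / complex_of_real \<epsilon>)) \<longlongrightarrow> cnj (\<theta> \<zeta>)) (at_right 0)"
      by (rule tendsto_cnj[OF lim[OF \<zeta>]])
    moreover have "((\<lambda>\<epsilon>. cnj ((wmix \<epsilon> \<zeta> - w \<zeta>) / complex_of_real \<epsilon>)) \<longlongrightarrow> \<theta> (cnj \<zeta>)) (at_right 0)"
      using lim[of "cnj \<zeta>"] \<zeta> by (simp add: w_cnj)
    ultimately show "\<theta> (cnj \<zeta>) = cnj (\<theta> \<zeta>)"
      by (intro tendsto_unique[OF trivial_limit_at_right_real])
  qed
qed

end

section \<open>The tail of the first-order term\<close>

theorem theorem3p7: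
  fixes N :: nat and D1 D2 :: "real mat" and \<pi> :: "real vec"
    and Fp Fh :: "real measure" and q p :: "complex poly"
    and E K :: "complex \<Rightarrow> complex mat" and s :: "nat \<Rightarrow> real" and m :: "nat \<Rightarrow> nat"
    and a :: "nat \<Rightarrow> complex vec" and u z \<omega> :: "complex vec"
    and r \<sigma> :: nat and x :: "nat \<Rightarrow> complex" and y :: "nat \<Rightarrow> real" and mult :: "nat \<Rightarrow> nat"
    and \<Delta> XA XB XC :: "complex \<Rightarrow> complex"
    and \<alpha> \<beta> \<gamma> :: "nat \<Rightarrow> complex" and \<beta>0 \<gamma>0 :: complex
    and \<alpha>2 \<beta>2 \<gamma>2 :: "nat \<Rightarrow> nat \<Rightarrow> complex"
    and \<nu> :: "(real \<times> nat) measure" and \<nu>mix :: "real \<Rightarrow> (real \<times> nat) measure"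
    and w :: "complex \<Rightarrow> complex" and wmix :: "real \<Rightarrow> complex \<Rightarrow> complex"
    and M :: "'a measure" and W W' Be Ce :: "'a \<Rightarrow> real"
    and Er :: "nat \<Rightarrow> nat \<Rightarrow> 'a \<Rightarrow> real" and Ex :: "nat \<Rightarrow> 'a \<Rightarrow> real"
    and \<mu>p \<mu>h :: real and \<Theta>1 \<Theta>2 :: "real \<Rightarrow> complex"
  \<comment> \<open>arrivals and services\<close>
  assumes "arrival_rates N D1 D2" and "\<And>i. i < N \<Longrightarrow> 0 < rate D1 D2 i"
    and "irreducible_mat (P_mat D1 D2)" and "stationary_vec (P_mat D1 D2) \<pi>"
    and "phase_type Fp" and "integrable Fp (\<lambda>t. t)" and "\<mu>p = mean Fp"
    and "heavy_tailed Fh" and "integrable Fh (\<lambda>t. t)" and "\<mu>h = mean Fh"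
    and "lead_coeff p = 1" and "degree q < degree p"
    and "\<And>\<zeta> :: complex. \<not> (poly p \<zeta> = 0 \<and> poly q \<zeta> = 0)"
    and "\<And>\<zeta> :: complex. 0 \<le> Re \<zeta> \<Longrightarrow> lst Fp \<zeta> = poly q \<zeta> / poly p \<zeta>"
  \<comment> \<open>stability and steady-state delay transforms\<close>
    and "0 < drift D1 D2 \<pi> \<mu>p" and "steady_state D1 D2 Fp \<nu>"
    and "\<And>\<epsilon>. 0 < \<epsilon> \<Longrightarrow> \<epsilon> \<le> 1 \<Longrightarrow> 0 < drift D1 D2 \<pi> (\<mu>p + \<epsilon> * (\<mu>h - \<mu>p)) \<Longrightarrow>
           steady_state D1 D2 (mixture \<epsilon> Fp Fh) (\<nu>mix \<epsilon>)"
    and "w = delay_transform D1 D2 \<pi> \<nu>"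
    and "wmix = (\<lambda>\<epsilon>. delay_transform D1 D2 \<pi> (\<nu>mix \<epsilon>))"
    and "\<omega> = omega D1 D2 \<pi>"
  \<comment> \<open>roots of \<open>det E\<close> in the closed right half-plane\<close>
    and "E = E_mat D1 D2 q p" and "K = K_mat D1 D2 Fp Fh"
    and "s 0 = 0" and "\<And>k. k \<in> {1..<N} \<Longrightarrow> 0 < s k" and "inj_on s {0..<N}"
    and "{\<zeta>. 0 \<le> Re \<zeta> \<and> det (E \<zeta>) = 0} = (\<lambda>k. complex_of_real (s k)) ` {0..<N}"
    and "\<And>k. k \<in> {1..<N} \<Longrightarrow> deriv (\<lambda>\<zeta> :: complex. det (E \<zeta>)) (complex_of_real (s k)) \<noteq> 0"
  \<comment> \<open>the vectors \<open>u\<close> and \<open>z\<close>\<close>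
    and "\<And>k. k \<in> {1..<N} \<Longrightarrow> m k < N \<and> col (adj_mat (E (complex_of_real (s k)))) (m k) \<noteq> 0\<^sub>v N"
    and "\<And>k. a k = a_col E (complex_of_real (s k)) (m k)"
    and "\<And>v. v \<in> carrier_vec N \<and>
             v \<bullet> map_vec complex_of_real (Lam_inv D1 D2 *\<^sub>v ones N) = complex_of_real (drift D1 D2 \<pi> \<mu>p) \<and>
             (\<forall>k\<in>{1..<N}. v \<bullet> a k = 0) \<longleftrightarrow> v = u"
    and "z = (c_vec D1 D2 \<pi> Fp \<^sub>v* inv_mat (A_mat D1 D2 E s m) \<^sub>v* B_mat N E K s m
                + d_vec D1 D2 \<pi> Fp Fh) \<^sub>v* inv_mat (A_mat D1 D2 E s m)"
  \<comment> \<open>the numbers \<open>x\<^sub>j\<close>, \<open>y\<^sub>j\<close>; the distinct \<open>y\<^sub>j\<close> are listed with their multiplicities\<close>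
    and "r = p_power D1 D2"
    and "\<And>j. j \<in> {1..r * degree p} \<Longrightarrow> 0 < Re (x j)"
    and "\<And>\<zeta> :: complex. poly p \<zeta> \<noteq> 0 \<Longrightarrow> poly p \<zeta> ^ r * det (E \<zeta>) =
             \<zeta> * (\<Prod>k=1..<N. \<zeta> - complex_of_real (s k)) * (\<Prod>j=1..r * degree p. \<zeta> + x j)"
    and "inj_on y {1..\<sigma>}" and "\<And>j. j \<in> {1..\<sigma>} \<Longrightarrow> 0 < y j \<and> 0 < mult j"
    and "(\<Sum>j=1..\<sigma>. mult j) = r * degree p"
    and "\<And>\<zeta> :: complex. poly p \<zeta> \<noteq> 0 \<Longrightarrow> poly p \<zeta> ^ r * (\<zeta> * (u \<bullet> (adj_mat (E \<zeta>) *\<^sub>v \<omega>))) =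
             (u \<bullet> \<omega>) * \<zeta> * (\<Prod>k=1..<N. \<zeta> - complex_of_real (s k)) * (\<Prod>j=1..\<sigma>. (\<zeta> + complex_of_real (y j)) ^ mult j)"
  \<comment> \<open>partial fraction coefficients\<close>
    and "\<Delta> = (\<lambda>\<zeta> :: complex. (\<Prod>k=1..<N. \<zeta> - complex_of_real (s k)) * (\<Prod>j=1..\<sigma>. (\<zeta> + complex_of_real (y j)) ^ mult j))"
    and "XA = (\<lambda>\<zeta> :: complex. poly p \<zeta> ^ r * (z \<bullet> (adj_mat (E \<zeta>) *\<^sub>v \<omega>)))"
    and "XB = (\<lambda>\<zeta> :: complex. \<zeta> * poly p \<zeta> ^ r *
             deriv (\<lambda>g. u \<bullet> (adj_mat (E_mat2 D1 D2 \<zeta> g) *\<^sub>v \<omega>)) (poly q \<zeta> / poly p \<zeta>))"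
    and "XC = (\<lambda>\<zeta> :: complex. poly p \<zeta> ^ r * deriv (\<lambda>g. det (E_mat2 D1 D2 \<zeta> g)) (poly q \<zeta> / poly p \<zeta>))"
    and "\<And>\<zeta> :: complex. poly p \<zeta> \<noteq> 0 \<Longrightarrow> \<Delta> \<zeta> \<noteq> 0 \<Longrightarrow> XA \<zeta> / \<Delta> \<zeta> = z \<bullet> \<omega> + (\<Sum>k=1..<N. \<alpha> k / (\<zeta> - complex_of_real (s k))) +
             (\<Sum>j=1..\<sigma>. \<Sum>l=1..mult j.
                \<alpha>2 j l * complex_of_real (y j) ^ (mult j - l + 1) / (\<zeta> + complex_of_real (y j)) ^ (mult j - l + 1))"
    and "\<And>\<zeta> :: complex. poly p \<zeta> \<noteq> 0 \<Longrightarrow> \<Delta> \<zeta> \<noteq> 0 \<Longrightarrow> XB \<zeta> / \<Delta> \<zeta> = \<beta>0 + (\<Sum>k=1..<N. \<beta> k / (\<zeta> - complex_of_real (s k))) +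
             (\<Sum>j=1..\<sigma>. \<Sum>l=1..mult j.
                \<beta>2 j l * complex_of_real (y j) ^ (mult j - l + 1) / (\<zeta> + complex_of_real (y j)) ^ (mult j - l + 1))"
    and "\<And>\<zeta> :: complex. poly p \<zeta> \<noteq> 0 \<Longrightarrow> \<Delta> \<zeta> \<noteq> 0 \<Longrightarrow> XC \<zeta> / \<Delta> \<zeta> = \<gamma>0 + (\<Sum>k=1..<N. \<gamma> k / (\<zeta> - complex_of_real (s k))) +
             (\<Sum>j=1..\<sigma>. \<Sum>l=1..mult j.
                \<gamma>2 j l * complex_of_real (y j) ^ (mult j - l + 1) / (\<zeta> + complex_of_real (y j)) ^ (mult j - l + 1))"
  \<comment> \<open>independent random variables; note that \<open>erlang_density k\<close> has \<open>k + 1\<close> phases\<close>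
    and "prob_space M"
    and "prob_space.indep_vars M (\<lambda>_. borel) (case_rv W W' Be Ce Er Ex)
           ({Delay, Delay', ExcessP, ExcessH} \<union> {Erl j l |j l. j \<in> {1..\<sigma>} \<and> l \<in> {1..mult j}}
              \<union> Expo ` {1..<N})"
    and "AE \<eta> in M. 0 \<le> W \<eta>" and "\<And>\<zeta> :: complex. 0 \<le> Re \<zeta> \<Longrightarrow> lst (distr M borel W) \<zeta> = w \<zeta>"
    and "distr M borel W' = distr M borel W"
    and "distr M borel Be = excess Fp" and "distr M borel Ce = excess Fh"
    and "\<And>j l. j \<in> {1..\<sigma>} \<Longrightarrow> l \<in> {1..mult j} \<Longrightarrow>
           distributed M lborel (Er j l) (erlang_density (mult j - l) (y j))"
    and "\<And>k. k \<in> {1..<N} \<Longrightarrow> distributed M lborel (Ex k) (exponential_density (s k))"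
  \<comment> \<open>the two parts of the tail\<close>
    and "\<Theta>1 = (\<lambda>t.
        (z \<bullet> \<omega> - (\<Sum>k=1..<N. \<alpha> k / complex_of_real (s k))) * complex_of_real (\<P>(\<eta> in M. W \<eta> > t))
      + (\<beta>0 - (\<Sum>k=1..<N. \<beta> k / complex_of_real (s k))) *
          complex_of_real (\<mu>p * \<P>(\<eta> in M. W \<eta> + Be \<eta> > t) - \<mu>h * \<P>(\<eta> in M. W \<eta> + Ce \<eta> > t))
      - (\<gamma>0 - (\<Sum>k=1..<N. \<gamma> k / complex_of_real (s k))) *
          complex_of_real (\<mu>p * \<P>(\<eta> in M. W \<eta> + W' \<eta> + Be \<eta> > t) - \<mu>h * \<P>(\<eta> in M. W \<eta> + W' \<eta> + Ce \<eta> > t))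
      - (\<Sum>j=1..\<sigma>. \<Sum>l=1..mult j.
            \<gamma>2 j l * complex_of_real (\<mu>p * \<P>(\<eta> in M. W \<eta> + W' \<eta> + Be \<eta> + Er j l \<eta> > t)
                      - \<mu>h * \<P>(\<eta> in M. W \<eta> + W' \<eta> + Ce \<eta> + Er j l \<eta> > t))
          - \<beta>2 j l * complex_of_real (\<mu>p * \<P>(\<eta> in M. W \<eta> + Be \<eta> + Er j l \<eta> > t)
                      - \<mu>h * \<P>(\<eta> in M. W \<eta> + Ce \<eta> + Er j l \<eta> > t))
          - \<alpha>2 j l * complex_of_real (\<P>(\<eta> in M. W \<eta> + Er j l \<eta> > t))))"
    and "\<Theta>2 = (\<lambda>t. - (\<Sum>k=1..<N. 1 / complex_of_real (s k) * (
            \<gamma> k * complex_of_real (\<mu>p * \<P>(\<eta> in M. t < W \<eta> + W' \<eta> + Be \<eta> \<and> W \<eta> + W' \<eta> + Be \<eta> < t + Ex k \<eta>)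
                    - \<mu>h * \<P>(\<eta> in M. t < W \<eta> + W' \<eta> + Ce \<eta> \<and> W \<eta> + W' \<eta> + Ce \<eta> < t + Ex k \<eta>))
          - \<beta> k * complex_of_real (\<mu>p * \<P>(\<eta> in M. t < W \<eta> + Be \<eta> \<and> W \<eta> + Be \<eta> < t + Ex k \<eta>)
                    - \<mu>h * \<P>(\<eta> in M. t < W \<eta> + Ce \<eta> \<and> W \<eta> + Ce \<eta> < t + Ex k \<eta>))
          - \<alpha> k * complex_of_real (\<P>(\<eta> in M. t < W \<eta> \<and> W \<eta> < t + Ex k \<eta>)))))"
  shows "\<exists>\<theta> :: complex \<Rightarrow> complex.
      (\<forall>\<zeta>. 0 \<le> Re \<zeta> \<longrightarrow>
         (\<lambda>\<epsilon>. wmix \<epsilon> \<zeta> - w \<zeta> - complex_of_real \<epsilon> * \<theta> \<zeta>)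
           \<in> O[at_right 0](\<lambda>\<epsilon>. complex_of_real (\<epsilon>\<^sup>2))) \<and>
      (\<forall>\<zeta>. 0 \<le> Re \<zeta> \<and> \<Delta> \<zeta> \<noteq> 0 \<longrightarrow>
         \<theta> \<zeta> = w \<zeta> / (u \<bullet> \<omega>) * (XA \<zeta> / \<Delta> \<zeta> + excess_diff Fp Fh \<zeta> * (XB \<zeta> / \<Delta> \<zeta>)
                    - excess_diff Fp Fh \<zeta> * w \<zeta> * (XC \<zeta> / \<Delta> \<zeta>))) \<and>
      laplace_inversion_tail \<theta> (\<lambda>t. 1 / (u \<bullet> \<omega>) * (\<Theta>1 t + \<Theta>2 t))"
proof -
  interpret prob_space M by (rule assms(46))
  define Z where "Z = case_rv W W' Be Ce Er Ex"
  define I where "I = {Delay, Delay', ExcessP, ExcessH} \<union> {Erl j l |j l. j \<in> {1..\<sigma>} \<and> l \<in> {1..mult j}} \<union> Expo ` {1..<N}"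
  have Z: "Z Delay = W" "Z Delay' = W'" "Z ExcessP = Be" "Z ExcessH = Ce" "Z (Erl j l) = Er j l" "Z (Expo k) = Ex k" for j l k
    by (simp_all add: Z_def)
  have I: "Delay \<in> I" "Delay' \<in> I" "ExcessP \<in> I" "ExcessH \<in> I"
    by (simp_all add: I_def)
  have IE: "Erl j l \<in> I" if "j \<in> {1..\<sigma>}" "l \<in> {1..mult j}" for j l
    using that unfolding I_def by blast
  have IX: "Expo k \<in> I" if "k \<in> {1..<N}" for k
    using that unfolding I_def by blast
  have ind: "indep_vars (\<lambda>_. borel) Z I"
    unfolding Z_def I_def by (rule assms(47))
  have rv: "random_variable borel (Z i)" if "i \<in> I" for i
    using ind that by (auto simp: indep_vars_def)
  have rvW: "random_variable borel W" "random_variable borel W'" "random_variable borel Be" "random_variable borel Ce"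
    using rv[OF I(1)] rv[OF I(2)] rv[OF I(3)] rv[OF I(4)] by (simp_all only: Z)
  have Fp: "nonneg_dist Fp" using assms(5) by (simp only: phase_type_def)
  have Fh: "nonneg_dist Fh" using assms(8) by (simp only: heavy_tailed_def)
  have Pe: "prob_space (excess Fp)" "prob_space (excess Fh)"
    using prob_space_distr[OF rvW(3)] prob_space_distr[OF rvW(4)] by (simp_all only: assms(51,52))
  have arr: "arrivals N D1 D2 \<pi>"
    by (intro arrivals.intro assms(1-4))
  interpret md: model N D1 D2 \<pi> Fp Fh q p \<nu> \<nu>mix s m u z
  proof (rule model.intro[OF arr], rule model_axioms.intro)
    show "p \<noteq> 0" using assms(11) by auto
    show "0 < drift D1 D2 \<pi> (mean Fp)" using assms(15) unfolding assms(7) .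
    show "steady_state D1 D2 (mixture \<epsilon> Fp Fh) (\<nu>mix \<epsilon>)"
      if "0 < \<epsilon>" "\<epsilon> \<le> 1" "0 < drift D1 D2 \<pi> (mean Fp + \<epsilon> * (mean Fh - mean Fp))" for \<epsilon>
      using assms(17)[OF that(1,2)] that(3) unfolding assms(7,10) by blast
    show "{\<zeta>. 0 \<le> Re \<zeta> \<and> det (E_mat D1 D2 q p \<zeta>) = 0} = (\<lambda>k. complex_of_real (s k)) ` {0..<N}"
      using assms(26) unfolding assms(21) .
    show "deriv (\<lambda>\<zeta>. det (E_mat D1 D2 q p \<zeta>)) (complex_of_real (s k)) \<noteq> 0" if "k \<in> {1..<N}" for k
      using assms(27)[OF that] unfolding assms(21) .
    show "m k < N" if "k \<in> {1..<N}" for k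
      using assms(28)[OF that] by (rule conjunct1)
    show "v \<in> carrier_vec N \<and>
             v \<bullet> map_vec complex_of_real (Lam_inv D1 D2 *\<^sub>v ones N) = complex_of_real (drift D1 D2 \<pi> (mean Fp)) \<and>
             (\<forall>k\<in>{1..<N}. v \<bullet> a_col (E_mat D1 D2 q p) (complex_of_real (s k)) (m k) = 0) \<longleftrightarrow> v = u" for v
      using assms(30)[of v] unfolding assms(29) assms(7,21) .
    show "z = (c_vec D1 D2 \<pi> Fp \<^sub>v* inv_mat (A_mat D1 D2 (E_mat D1 D2 q p) s m)
                   \<^sub>v* B_mat N (E_mat D1 D2 q p) (K_mat D1 D2 Fp Fh) s m
                + d_vec D1 D2 \<pi> Fp Fh) \<^sub>v* inv_mat (A_mat D1 D2 (E_mat D1 D2 q p) s m)"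
      using assms(31) unfolding assms(21,22) .
  qed (fact Fp assms(6) Pe Fh assms(9) assms(13) assms(14) assms(16) assms(23) assms(24))+
  let ?D = "excess_diff Fp Fh" and ?s = "\<lambda>k. complex_of_real (s k)" and ?uo = "u \<bullet> \<omega>"
  have w: "w = md.w" unfolding assms(18) by (rule ext) (rule md.delay_w)
  have wmix: "wmix = md.wmix" unfolding assms(19) by (intro ext) (rule md.delay_wmix)
  have XA: "XA \<zeta> = poly p \<zeta> ^ r * md.ZA \<zeta>" and XB: "XB \<zeta> = \<zeta> * poly p \<zeta> ^ r * md.UB \<zeta>"
    and XC: "XC \<zeta> = poly p \<zeta> ^ r * md.dg \<zeta>" for \<zeta>
    unfolding assms(20,21,40,41,42) by (simp_all only: md.X_identities)

  have ex_nn: "nonneg_finite_measure (excess Fp)" "nonneg_finite_measure (excess Fh)"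
    by (rule md.Fpe.nonneg_finite_measure_axioms md.Fhe.nonneg_finite_measure_axioms)+
  have nn: "AE \<eta> in M. 0 \<le> Z i \<eta>" if i: "i \<in> I" for i
  proof (cases i)
    case Delay
    show ?thesis unfolding Delay Z by (rule assms(48))
  next
    case Delay'
    show ?thesis unfolding Delay' Z
      by (rule AE_nonneg_of_distr[OF rvW(2) assms(50) nonneg_distr[OF rvW(1) assms(48)]])
  next
    case ExcessP
    show ?thesis unfolding ExcessP Z by (rule AE_nonneg_of_distr[OF rvW(3) assms(51) ex_nn(1)])
  next
    case ExcessH
    show ?thesis unfolding ExcessH Z by (rule AE_nonneg_of_distr[OF rvW(4) assms(52) ex_nn(2)])
  next
    case (Erl j l)
    then have jl: "j \<in> {1..\<sigma>}" "l \<in> {1..mult j}" using i by (auto simp: I_def)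
    show ?thesis using rv[OF IE[OF jl]] unfolding Erl Z
      by (rule AE_nonneg_of_distr[OF _ distr_of_distributed[OF assms(53)[OF jl]] nonneg_finite_measure_erlang])
        (use assms(36)[OF jl(1)] in blast)
  next
    case (Expo k)
    then have k: "k \<in> {1..<N}" using i by (auto simp: I_def)
    show ?thesis using rv[OF IX[OF k]] unfolding Expo Z
      by (rule AE_nonneg_of_distr[OF _ distr_of_distributed[OF assms(54)[OF k]] nonneg_finite_measure_erlang[OF assms(24)[OF k]]])
  qed

  define e where "e \<zeta> j l = complex_of_real (y j) ^ (mult j - l + 1) / (\<zeta> + complex_of_real (y j)) ^ (mult j - l + 1)" for \<zeta> j l
  have LT: "LT W \<zeta> = w \<zeta>" "LT W' \<zeta> = w \<zeta>" "LT Be \<zeta> = lst (excess Fp) \<zeta>" "LT Ce \<zeta> = lst (excess Fh) \<zeta>"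
    if "0 \<le> Re \<zeta>" for \<zeta>
    unfolding LT_def assms(50,51,52) by (simp_all only: assms(49)[OF that])
  have LTe: "LT (Er j l) \<zeta> = e \<zeta> j l" if "0 \<le> Re \<zeta>" "j \<in> {1..\<sigma>}" "l \<in> {1..mult j}" for \<zeta> j l
    unfolding LT_def distr_of_distributed[OF assms(53)[OF that(2,3)]] e_def
    using assms(36)[OF that(2)] that(1) by (intro lst_erlang) simp_all
  have w0: "w 0 = 1"
    using LT(1)[of 0] LT_eq[OF rvW(1), of 0] by (simp add: prob_space)

  have tail: "complex_tail (\<lambda>\<zeta>. \<Prod>j\<in>J. LT (Z j) \<zeta>) (\<lambda>t. complex_of_real (\<P>(\<eta> in M. (\<Sum>j\<in>J. Z j \<eta>) > t)))"
    if "finite J" "J \<noteq> {}" "J \<subseteq> I" for J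
    by (rule family_tail[OF ind that nn])
  have tail_excess: "complex_tail (\<lambda>\<zeta>. ?D \<zeta> * (\<Prod>j\<in>J. LT (Z j) \<zeta>))
      (\<lambda>t. complex_of_real (\<mu>p * \<P>(\<eta> in M. (\<Sum>j\<in>J. Z j \<eta>) + Be \<eta> > t) - \<mu>h * \<P>(\<eta> in M. (\<Sum>j\<in>J. Z j \<eta>) + Ce \<eta> > t)))"
    if J: "finite J" "J \<subseteq> I" "ExcessP \<notin> J" "ExcessH \<notin> J" for J
  proof (rule complex_tail_cong)
    have s: "insert ExcessP J \<subseteq> I" "insert ExcessH J \<subseteq> I" using J(2) I by blast+
    show "complex_tail (\<lambda>\<zeta>. complex_of_real \<mu>p * (\<Prod>j\<in>insert ExcessP J. LT (Z j) \<zeta>) - complex_of_real \<mu>h * (\<Prod>j\<in>insert ExcessH J. LT (Z j) \<zeta>))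
      (\<lambda>t. complex_of_real \<mu>p * complex_of_real (\<P>(\<eta> in M. (\<Sum>j\<in>insert ExcessP J. Z j \<eta>) > t))
         - complex_of_real \<mu>h * complex_of_real (\<P>(\<eta> in M. (\<Sum>j\<in>insert ExcessH J. Z j \<eta>) > t)))"
      by (intro complex_tail_diff complex_tail_scale tail finite.insertI J(1) insert_not_empty s)
    show "?D \<zeta> * (\<Prod>j\<in>J. LT (Z j) \<zeta>) =
        complex_of_real \<mu>p * (\<Prod>j\<in>insert ExcessP J. LT (Z j) \<zeta>) - complex_of_real \<mu>h * (\<Prod>j\<in>insert ExcessH J. LT (Z j) \<zeta>)"
      if "0 \<le> Re \<zeta>" for \<zeta>
      by (simp only: prod.insert[OF J(1,3)] prod.insert[OF J(1,4)] Z LT[OF that] excess_diff_def assms(7,10) left_diff_distrib mult.assoc)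
    show "complex_of_real (\<mu>p * \<P>(\<eta> in M. (\<Sum>j\<in>J. Z j \<eta>) + Be \<eta> > t) - \<mu>h * \<P>(\<eta> in M. (\<Sum>j\<in>J. Z j \<eta>) + Ce \<eta> > t)) =
        complex_of_real \<mu>p * complex_of_real (\<P>(\<eta> in M. (\<Sum>j\<in>insert ExcessP J. Z j \<eta>) > t))
         - complex_of_real \<mu>h * complex_of_real (\<P>(\<eta> in M. (\<Sum>j\<in>insert ExcessH J. Z j \<eta>) > t))" for t
      by (simp only: sum.insert[OF J(1,3)] sum.insert[OF J(1,4)] Z of_real_diff of_real_mult add.commute[of "sum _ _"])
  qed
  \<comment> \<open>\<open>os\<close> and \<open>os_excess\<close> are overshoots over an exponential variable, of a sum over \<open>J\<close> and of the signed
      combination of the same sum with the two excess variables added.\<close>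
  define os where "os J k = overshoot (\<lambda>\<eta>. \<Sum>j\<in>J. Z j \<eta>) (Ex k)" for J k
  have os: "complex_tail (os J k) (\<lambda>t. complex_of_real (\<P>(\<eta> in M. t < (\<Sum>j\<in>J. Z j \<eta>) \<and> (\<Sum>j\<in>J. Z j \<eta>) < t + Ex k \<eta>)))"
    and os_eq: "0 \<le> Re \<zeta> \<Longrightarrow> (\<zeta> - ?s k) * os J k \<zeta> = \<zeta> * ((\<Prod>j\<in>J. LT (Z j) \<zeta>) - (\<Prod>j\<in>J. LT (Z j) (?s k)))"
    if J: "finite J" "J \<noteq> {}" "J \<subseteq> I" "Expo k \<notin> J" and k: "k \<in> {1..<N}" for J k \<zeta>
    using family_overshoot[OF ind J(1-3) nn IX[OF k] J(4) assms(24)[OF k]] assms(54)[OF k] unfolding os_def Z by blast+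
  define os_excess where "os_excess J k \<zeta> = complex_of_real \<mu>p * os (insert ExcessP J) k \<zeta> - complex_of_real \<mu>h * os (insert ExcessH J) k \<zeta>" for J k \<zeta>
  have os_excess: "complex_tail (os_excess J k)
      (\<lambda>t. complex_of_real (\<mu>p * \<P>(\<eta> in M. t < (\<Sum>j\<in>J. Z j \<eta>) + Be \<eta> \<and> (\<Sum>j\<in>J. Z j \<eta>) + Be \<eta> < t + Ex k \<eta>)
         - \<mu>h * \<P>(\<eta> in M. t < (\<Sum>j\<in>J. Z j \<eta>) + Ce \<eta> \<and> (\<Sum>j\<in>J. Z j \<eta>) + Ce \<eta> < t + Ex k \<eta>)))" (is ?tail)
    and os_excess_eq: "0 \<le> Re \<zeta> \<Longrightarrow> (\<zeta> - ?s k) * os_excess J k \<zeta> =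
      \<zeta> * (?D \<zeta> * (\<Prod>j\<in>J. LT (Z j) \<zeta>) - ?D (?s k) * (\<Prod>j\<in>J. LT (Z j) (?s k)))" (is "_ \<Longrightarrow> ?eq")
    if J: "finite J" "J \<subseteq> I" "ExcessP \<notin> J" "ExcessH \<notin> J" "Expo k \<notin> J" and k: "k \<in> {1..<N}" for J k \<zeta>
  proof -
    have s: "insert ExcessP J \<subseteq> I" "insert ExcessH J \<subseteq> I" "Expo k \<notin> insert ExcessP J" "Expo k \<notin> insert ExcessH J"
      using J(2,5) I by auto
    show ?tail
    proof (rule complex_tail_cong)
      show "complex_tail (\<lambda>\<zeta>. complex_of_real \<mu>p * os (insert ExcessP J) k \<zeta> - complex_of_real \<mu>h * os (insert ExcessH J) k \<zeta>)
        (\<lambda>t. complex_of_real \<mu>p * complex_of_real (\<P>(\<eta> in M. t < (\<Sum>j\<in>insert ExcessP J. Z j \<eta>) \<and> (\<Sum>j\<in>insert ExcessP J. Z j \<eta>) < t + Ex k \<eta>))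
           - complex_of_real \<mu>h * complex_of_real (\<P>(\<eta> in M. t < (\<Sum>j\<in>insert ExcessH J. Z j \<eta>) \<and> (\<Sum>j\<in>insert ExcessH J. Z j \<eta>) < t + Ex k \<eta>)))"
        by (intro complex_tail_diff complex_tail_scale os finite.insertI J(1) insert_not_empty s k)
      show "complex_of_real (\<mu>p * \<P>(\<eta> in M. t < (\<Sum>j\<in>J. Z j \<eta>) + Be \<eta> \<and> (\<Sum>j\<in>J. Z j \<eta>) + Be \<eta> < t + Ex k \<eta>)
         - \<mu>h * \<P>(\<eta> in M. t < (\<Sum>j\<in>J. Z j \<eta>) + Ce \<eta> \<and> (\<Sum>j\<in>J. Z j \<eta>) + Ce \<eta> < t + Ex k \<eta>)) =
        complex_of_real \<mu>p * complex_of_real (\<P>(\<eta> in M. t < (\<Sum>j\<in>insert ExcessP J. Z j \<eta>) \<and> (\<Sum>j\<in>insert ExcessP J. Z j \<eta>) < t + Ex k \<eta>))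
           - complex_of_real \<mu>h * complex_of_real (\<P>(\<eta> in M. t < (\<Sum>j\<in>insert ExcessH J. Z j \<eta>) \<and> (\<Sum>j\<in>insert ExcessH J. Z j \<eta>) < t + Ex k \<eta>))" for t
        by (simp only: sum.insert[OF J(1,3)] sum.insert[OF J(1,4)] Z of_real_diff of_real_mult add.commute[of "sum _ _"])
    qed (simp only: os_excess_def)
    assume \<zeta>: "0 \<le> Re \<zeta>"
    have sk: "0 \<le> Re (?s k)" using assms(24)[OF k] by simp
    have "(\<zeta> - ?s k) * os_excess J k \<zeta> =
        complex_of_real \<mu>p * ((\<zeta> - ?s k) * os (insert ExcessP J) k \<zeta>) - complex_of_real \<mu>h * ((\<zeta> - ?s k) * os (insert ExcessH J) k \<zeta>)"
      by (simp only: os_excess_def right_diff_distrib mult.left_commute)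
    also have "\<dots> = complex_of_real \<mu>p * (\<zeta> * ((\<Prod>j\<in>insert ExcessP J. LT (Z j) \<zeta>) - (\<Prod>j\<in>insert ExcessP J. LT (Z j) (?s k))))
        - complex_of_real \<mu>h * (\<zeta> * ((\<Prod>j\<in>insert ExcessH J. LT (Z j) \<zeta>) - (\<Prod>j\<in>insert ExcessH J. LT (Z j) (?s k))))"
      by (simp only: os_eq[OF finite.insertI[OF J(1)] insert_not_empty s(1,3) k \<zeta>] os_eq[OF finite.insertI[OF J(1)] insert_not_empty s(2,4) k \<zeta>])
    also have "\<dots> = \<zeta> * (?D \<zeta> * (\<Prod>j\<in>J. LT (Z j) \<zeta>) - ?D (?s k) * (\<Prod>j\<in>J. LT (Z j) (?s k)))"
      by (simp only: prod.insert[OF J(1,3)] prod.insert[OF J(1,4)] Z LT[OF \<zeta>] LT[OF sk] excess_diff_def assms(7,10) algebra_simps)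
    finally show ?eq .
  qed

  \<comment> \<open>The atoms: one pair of a transform and a tail for each probability in the statement.\<close>
  let ?J2 = "{Delay}" and ?J3 = "{Delay, Delay'}"
  have atomW: "complex_tail w (\<lambda>t. complex_of_real (\<P>(\<eta> in M. W \<eta> > t)))"
    by (rule complex_tail_cong[OF tail[of ?J2]]) (simp_all add: I Z LT)
  have atomB: "complex_tail (\<lambda>\<zeta>. ?D \<zeta> * w \<zeta>) (\<lambda>t. complex_of_real (\<mu>p * \<P>(\<eta> in M. W \<eta> + Be \<eta> > t) - \<mu>h * \<P>(\<eta> in M. W \<eta> + Ce \<eta> > t)))"
    by (rule complex_tail_cong[OF tail_excess[of ?J2]]) (simp_all add: I Z LT)
  have atomC: "complex_tail (\<lambda>\<zeta>. ?D \<zeta> * w \<zeta> * w \<zeta>)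
      (\<lambda>t. complex_of_real (\<mu>p * \<P>(\<eta> in M. W \<eta> + W' \<eta> + Be \<eta> > t) - \<mu>h * \<P>(\<eta> in M. W \<eta> + W' \<eta> + Ce \<eta> > t)))"
    by (rule complex_tail_cong[OF tail_excess[of ?J3]]) (simp_all add: I Z LT)
  have erlW: "complex_tail (\<lambda>\<zeta>. w \<zeta> * e \<zeta> j l) (\<lambda>t. complex_of_real (\<P>(\<eta> in M. W \<eta> + Er j l \<eta> > t)))"
    if jl: "j \<in> {1..\<sigma>}" "l \<in> {1..mult j}" for j l
    by (rule complex_tail_cong[OF tail[of "{Delay, Erl j l}"]]) (simp_all add: I IE[OF jl] Z LT LTe[OF _ jl])
  have erlB: "complex_tail (\<lambda>\<zeta>. ?D \<zeta> * w \<zeta> * e \<zeta> j l)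
      (\<lambda>t. complex_of_real (\<mu>p * \<P>(\<eta> in M. W \<eta> + Be \<eta> + Er j l \<eta> > t) - \<mu>h * \<P>(\<eta> in M. W \<eta> + Ce \<eta> + Er j l \<eta> > t)))"
    if jl: "j \<in> {1..\<sigma>}" "l \<in> {1..mult j}" for j l
    by (rule complex_tail_cong[OF tail_excess[of "{Delay, Erl j l}"]]) (simp_all add: I IE[OF jl] Z LT LTe[OF _ jl] add_ac)
  have erlC: "complex_tail (\<lambda>\<zeta>. ?D \<zeta> * w \<zeta> * w \<zeta> * e \<zeta> j l)
      (\<lambda>t. complex_of_real (\<mu>p * \<P>(\<eta> in M. W \<eta> + W' \<eta> + Be \<eta> + Er j l \<eta> > t) - \<mu>h * \<P>(\<eta> in M. W \<eta> + W' \<eta> + Ce \<eta> + Er j l \<eta> > t)))"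
    if jl: "j \<in> {1..\<sigma>}" "l \<in> {1..mult j}" for j l
    by (rule complex_tail_cong[OF tail_excess[of "{Delay, Delay', Erl j l}"]]) (simp_all add: I IE[OF jl] Z LT LTe[OF _ jl] add_ac)
  have osW: "complex_tail (os ?J2 k) (\<lambda>t. complex_of_real (\<P>(\<eta> in M. t < W \<eta> \<and> W \<eta> < t + Ex k \<eta>)))" if k: "k \<in> {1..<N}" for k
    by (rule complex_tail_cong[OF os[OF _ _ _ _ k, of ?J2]]) (simp_all add: I Z)
  have osB: "complex_tail (os_excess ?J2 k) (\<lambda>t. complex_of_real (\<mu>p * \<P>(\<eta> in M. t < W \<eta> + Be \<eta> \<and> W \<eta> + Be \<eta> < t + Ex k \<eta>)
         - \<mu>h * \<P>(\<eta> in M. t < W \<eta> + Ce \<eta> \<and> W \<eta> + Ce \<eta> < t + Ex k \<eta>)))" if k: "k \<in> {1..<N}" for k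
    by (rule complex_tail_cong[OF os_excess[OF _ _ _ _ _ k, of ?J2]]) (simp_all add: I Z)
  have osC: "complex_tail (os_excess ?J3 k) (\<lambda>t. complex_of_real (\<mu>p * \<P>(\<eta> in M. t < W \<eta> + W' \<eta> + Be \<eta> \<and> W \<eta> + W' \<eta> + Be \<eta> < t + Ex k \<eta>)
         - \<mu>h * \<P>(\<eta> in M. t < W \<eta> + W' \<eta> + Ce \<eta> \<and> W \<eta> + W' \<eta> + Ce \<eta> < t + Ex k \<eta>)))" if k: "k \<in> {1..<N}" for k
    by (rule complex_tail_cong[OF os_excess[OF _ _ _ _ _ k, of ?J3]]) (simp_all add: I Z)
  have sk: "0 \<le> Re (?s k)" if "k \<in> {1..<N}" for k using assms(24)[OF that] by simp
  have osW_eq: "(\<zeta> - ?s k) * os ?J2 k \<zeta> = \<zeta> * (w \<zeta> - w (?s k))" if k: "k \<in> {1..<N}" and \<zeta>: "0 \<le> Re \<zeta>" for k \<zeta>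
    using os_eq[OF _ _ _ _ k \<zeta>, of ?J2] by (simp add: I Z LT[OF \<zeta>] LT[OF sk[OF k]])
  have osB_eq: "(\<zeta> - ?s k) * os_excess ?J2 k \<zeta> = \<zeta> * (?D \<zeta> * w \<zeta> - ?D (?s k) * w (?s k))" if k: "k \<in> {1..<N}" and \<zeta>: "0 \<le> Re \<zeta>" for k \<zeta>
    using os_excess_eq[OF _ _ _ _ _ k \<zeta>, of ?J2] by (simp add: I Z LT[OF \<zeta>] LT[OF sk[OF k]])
  have osC_eq: "(\<zeta> - ?s k) * os_excess ?J3 k \<zeta> = \<zeta> * (?D \<zeta> * w \<zeta> * w \<zeta> - ?D (?s k) * w (?s k) * w (?s k))"
    if k: "k \<in> {1..<N}" and \<zeta>: "0 \<le> Re \<zeta>" for k \<zeta>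
    using os_excess_eq[OF _ _ _ _ _ k \<zeta>, of ?J3] by (simp add: I Z LT[OF \<zeta>] LT[OF sk[OF k]])

  define \<theta> where "\<theta> = (\<lambda>\<zeta>. 1 / ?uo * (
      ((z \<bullet> \<omega> - (\<Sum>k=1..<N. \<alpha> k / ?s k)) * w \<zeta> + (\<beta>0 - (\<Sum>k=1..<N. \<beta> k / ?s k)) * (?D \<zeta> * w \<zeta>)
        - (\<gamma>0 - (\<Sum>k=1..<N. \<gamma> k / ?s k)) * (?D \<zeta> * w \<zeta> * w \<zeta>)
        - (\<Sum>j=1..\<sigma>. \<Sum>l=1..mult j. \<gamma>2 j l * (?D \<zeta> * w \<zeta> * w \<zeta> * e \<zeta> j l) - \<beta>2 j l * (?D \<zeta> * w \<zeta> * e \<zeta> j l) - \<alpha>2 j l * (w \<zeta> * e \<zeta> j l)))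
      + - (\<Sum>k=1..<N. 1 / ?s k * (\<gamma> k * os_excess ?J3 k \<zeta> - \<beta> k * os_excess ?J2 k \<zeta> - \<alpha> k * os ?J2 k \<zeta>))))"
  have \<theta>_tail: "complex_tail \<theta> (\<lambda>t. 1 / ?uo * (\<Theta>1 t + \<Theta>2 t))"
    unfolding \<theta>_def assms(55,56)
    by (intro complex_tail_scale complex_tail_add complex_tail_diff complex_tail_uminus complex_tail_sum[OF _ atomW]
        finite_atLeastAtMost finite_atLeastLessThan atomW atomB atomC erlW erlB erlC osW osB osC)
  have \<theta>_eq: "\<theta> \<zeta> = md.w \<zeta> / ?uo * (partial_fractions N s \<sigma> y mult (z \<bullet> \<omega>) \<alpha> \<alpha>2 \<zeta> + ?D \<zeta> * partial_fractions N s \<sigma> y mult \<beta>0 \<beta> \<beta>2 \<zeta>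
          - ?D \<zeta> * md.w \<zeta> * partial_fractions N s \<sigma> y mult \<gamma>0 \<gamma> \<gamma>2 \<zeta>)"
    if \<zeta>: "0 \<le> Re \<zeta>" and ne: "\<And>k. k \<in> {1..<N} \<Longrightarrow> \<zeta> \<noteq> ?s k"
      and R: "\<And>k. k \<in> {1..<N} \<Longrightarrow> \<alpha> k * md.w (?s k) + \<beta> k * (?D (?s k) * md.w (?s k)) - \<gamma> k * (?D (?s k) * md.w (?s k) * md.w (?s k)) = 0" for \<zeta>
    unfolding \<theta>_def w[symmetric]
    by (subst tail_transform_eq[OF assms(24) ne osW_eq[OF _ \<zeta>] osB_eq[OF _ \<zeta>] osC_eq[OF _ \<zeta>] R[folded w] e_def]) (assumption | simp)+

  have \<Delta>: "\<Delta> \<zeta> = (\<Prod>k=1..<N. \<zeta> - ?s k) * (\<Prod>j=1..\<sigma>. (\<zeta> + complex_of_real (y j)) ^ mult j)" for \<zeta>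
    by (simp only: assms(39))
  have factor: "poly p \<zeta> ^ r * (\<zeta> * md.UA \<zeta>) = ?uo * \<zeta> * \<Delta> \<zeta>" if "poly p \<zeta> \<noteq> 0" for \<zeta>
    using assms(38)[OF that] unfolding \<Delta> assms(20,21) md.X_identities by (simp only: mult.assoc)
  have pfA: "poly p \<zeta> ^ r * md.ZA \<zeta> / \<Delta> \<zeta> = partial_fractions N s \<sigma> y mult (z \<bullet> \<omega>) \<alpha> \<alpha>2 \<zeta>"
    if "poly p \<zeta> \<noteq> 0" "\<Delta> \<zeta> \<noteq> 0" for \<zeta>
    using assms(43)[OF that] unfolding XA partial_fractions_def .
  have pfB: "\<zeta> * poly p \<zeta> ^ r * md.UB \<zeta> / \<Delta> \<zeta> = partial_fractions N s \<sigma> y mult \<beta>0 \<beta> \<beta>2 \<zeta>"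
    if "poly p \<zeta> \<noteq> 0" "\<Delta> \<zeta> \<noteq> 0" for \<zeta>
    using assms(44)[OF that] unfolding XB partial_fractions_def .
  have pfC: "poly p \<zeta> ^ r * md.dg \<zeta> / \<Delta> \<zeta> = partial_fractions N s \<sigma> y mult \<gamma>0 \<gamma> \<gamma>2 \<zeta>"
    if "poly p \<zeta> \<noteq> 0" "\<Delta> \<zeta> \<noteq> 0" for \<zeta>
    using assms(45)[OF that] unfolding XC partial_fractions_def .
  have inj: "inj_on s {1..<N}" by (rule inj_on_subset[OF assms(25)]) auto
  have y: "0 < y j" if "j \<in> {1..\<sigma>}" for j using assms(36)[OF that] by (rule conjunct1)
  note first_order = md.first_order_tail[OF w0[unfolded w] inj y \<Delta> factor pfA pfB pfC \<theta>_tail \<theta>_eq]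
  show ?thesis
  proof (intro exI[of _ \<theta>] conjI allI impI)
    show "(\<lambda>\<epsilon>. wmix \<epsilon> \<zeta> - w \<zeta> - complex_of_real \<epsilon> * \<theta> \<zeta>) \<in> O[at_right 0](\<lambda>\<epsilon>. complex_of_real (\<epsilon>\<^sup>2))" if "0 \<le> Re \<zeta>" for \<zeta>
      unfolding of_real_power w wmix by (rule first_order(1)) (assumption | rule that)+
    show "\<theta> \<zeta> = w \<zeta> / ?uo * (XA \<zeta> / \<Delta> \<zeta> + ?D \<zeta> * (XB \<zeta> / \<Delta> \<zeta>) - ?D \<zeta> * w \<zeta> * (XC \<zeta> / \<Delta> \<zeta>))"
      if "0 \<le> Re \<zeta> \<and> \<Delta> \<zeta> \<noteq> 0" for \<zeta>
      unfolding XA XB XC w by (rule first_order(2)) (assumption | rule conjunct1[OF that] conjunct2[OF that])+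
    show "laplace_inversion_tail \<theta> (\<lambda>t. 1 / ?uo * (\<Theta>1 t + \<Theta>2 t))"
      by (rule first_order(3)) assumption+
  qed
qed

end
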